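(* Let $R$ be a standard graded polynomial ring of dimension $n$ over a separably closed field of characteristic $p>0$, and let $\mathfrak{m}$ be its homogeneous maximal ideal. Then the $R$-module $H^n_{\mathfrak{m}}(R)$, with its natural $\mathcal{F}$-module structure, is an injective object in the category of graded $\mathcal{F}$-finite modules.
   Context: Let $R=\mathbb{F}[x_1,\dots,x_n]$ with $\mathbb{F}$ a field of characteristic $p>0$, $\deg x_i=1$. Graded modules are $\mathbb{Z}$-graded. Let $R'$ be the $R$-bimodule equal to $R$ as a left module, with right action $r'r=r^pr'$. Set $F(M)=R'\otimes_RM$, an $R$-module via the left structure of $R'$; if $M$ is graded, $F(M)$ is graded by $\deg(r'\otimes m)=\deg r'+p\deg m$. An $\mathcal{F}$-module is a pair $(\mathcal{M},\theta)$ with $\mathcal{M}$ an $R$-module and $\theta\colon\mathcal{M}\to F(\mathcal{M})$ an $R$-module isomorphism. A morphism $(\mathcal{M},\theta)\to(\mathcal{M}',\theta')$ is an $R$-linear map $\varphi$ with $\theta'\circ\varphi=F(\varphi)\circ\theta$. A graded $\mathcal{F}$-module is an $\mathcal{F}$-module with $\mathcal{M}$ graded and $\theta$ degree-preserving; morphisms of graded $\mathcal{F}$-modules are degree-preserving morphisms of $\mathcal{F}$-modules. A graded $\mathcal{F}$-module is graded $\mathcal{F}$-finite if it is the direct limit of $M\xrightarrow{\beta}F(M)\xrightarrow{F(\beta)}F^2(M)\to\cdots$ for a finitely generated graded $R$-module $M$ and a degree-preserving $R$-linear map $\beta$, with $\theta$ induced by the maps $F^e(\beta)\colon F^e(M)\to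 F^{e+1}(M)$. The natural $\mathcal{F}$-module structure on $H^n_{\mathfrak{m}}(R)$: if $f$ denotes the Frobenius action on $H^n_{\mathfrak{m}}(R)$ (induced by the Frobenius endomorphism of $R$), whose image generates $H^n_{\mathfrak{m}}(R)$ as an $R$-module, then the structure isomorphism is $H^n_{\mathfrak{m}}(R)\to R'\otimes_RH^n_{\mathfrak{m}}(R)$, $rf(\eta)\mapsto r\otimes\eta$. *)

theory Defs
  imports
    "HOL-Algebra.Module"
    "HOL-Algebra.AbelCoset"
    "HOL-Algebra.Free_Abelian_Groups"
    "HOL-Library.Poly_Mapping"
    "HOL-Computational_Algebra.Polynomial"
    "HOL-Computational_Algebra.Fraction_Field"
begin

section \<open>Graded rings and graded modules\<close>

record 'a graded_ring = "'a ring" +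
  rcomp :: "int \<Rightarrow> 'a set"

text \<open>The fields \<open>mult\<close> and \<open>one\<close> that module records inherit from ring records play no
  role; they are left \<open>undefined\<close> in the constructions below.\<close>

record ('a, 'b) graded_module = "('a, 'b) module" +
  hcomp :: "int \<Rightarrow> 'b set"

locale graded_module = Module.module R M
  for R :: "'a graded_ring" (structure) and M :: "('a, 'b, 'z) graded_module_scheme" (structure) +
  assumes hcomp_subgroup: "subgroup (hcomp M d) (add_monoid M)"
    and hcomp_smult:
      "a \<in> rcomp R i \<Longrightarrow> x \<in> hcomp M j \<Longrightarrow> a \<odot>\<^bsub>M\<^esub> x \<in> hcomp M (i + j)"
    and hcomp_direct_sum: "x \<in> carrier M \<Longrightarrow>
      \<exists>!c. (\<forall>d. c d \<in> hcomp M d) \<and> finite {d. c d \<noteq> \<zero>\<^bsub>M\<^esub>} \<and>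
           x = finsum M c {d. c d \<noteq> \<zero>\<^bsub>M\<^esub>}"

definition finitely_generated ::
  "('a, 'r) ring_scheme \<Rightarrow> ('a, 'b, 'z) module_scheme \<Rightarrow> bool" where
  "finitely_generated R M \<longleftrightarrow>
     (\<exists>S. finite S \<and> S \<subseteq> carrier M \<and>
       (\<forall>H. submodule H R M \<and> S \<subseteq> H \<longrightarrow> carrier M \<subseteq> H))"

definition mod_hom ::
  "('a, 'r) ring_scheme \<Rightarrow> ('a, 'b, 'y) module_scheme \<Rightarrow> ('a, 'c, 'z) module_scheme
    \<Rightarrow> ('b \<Rightarrow> 'c) set" where
  "mod_hom R M N = {h \<in> carrier M \<rightarrow> carrier N.
     (\<forall>x\<in>carrier M. \<forall>y\<in>carrier M. h (x \<oplus>\<^bsub>M\<^esub> y) = h x \<oplus>\<^bsub>N\<^esub> h y) \<and>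
     (\<forall>a\<in>carrier R. \<forall>x\<in>carrier M. h (a \<odot>\<^bsub>M\<^esub> x) = a \<odot>\<^bsub>N\<^esub> h x)}"

definition gmod_hom ::
  "('a, 'r) ring_scheme \<Rightarrow> ('a, 'b, 'y) graded_module_scheme
    \<Rightarrow> ('a, 'c, 'z) graded_module_scheme \<Rightarrow> ('b \<Rightarrow> 'c) set" where
  "gmod_hom R M N = {h \<in> mod_hom R M N. \<forall>d. h ` hcomp M d \<subseteq> hcomp N d}"

definition gmod_iso ::
  "('a, 'r) ring_scheme \<Rightarrow> ('a, 'b, 'y) graded_module_scheme
    \<Rightarrow> ('a, 'c, 'z) graded_module_scheme \<Rightarrow> ('b \<Rightarrow> 'c) set" where
  "gmod_iso R M N = {h \<in> gmod_hom R M N. bij_betw h (carrier M) (carrier N)}"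

definition quot_gmodule ::
  "('a, 'b, 'z) graded_module_scheme \<Rightarrow> 'b set \<Rightarrow> ('a, 'b set) graded_module" where
  "quot_gmodule M K =
    \<lparr> carrier = A_RCOSETS M K, monoid.mult = undefined, monoid.one = undefined,
      ring.zero = K, ring.add = set_add M,
      module.smult = (\<lambda>a X. K <+>\<^bsub>M\<^esub> ((\<lambda>x. a \<odot>\<^bsub>M\<^esub> x) ` X)),
      hcomp = (\<lambda>d. (\<lambda>x. K +>\<^bsub>M\<^esub> x) ` hcomp M d) \<rparr>"


section \<open>The Frobenius functor\<close>

text \<open>\<open>F(M) = R' \<otimes>\<^sub>R M\<close> is the free abelian group on \<open>R \<times> M\<close> modulo
  the tensor relations, where the right action on \<open>R'\<close> is \<open>r \<cdot> s = s\<^sup>p r\<close>. The generator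
  \<open>(r, m)\<close> has degree \<open>deg r + p deg m\<close>.\<close>

definition free_pairs ::
  "nat \<Rightarrow> 'a graded_ring \<Rightarrow> ('a, 'b, 'z) graded_module_scheme
    \<Rightarrow> ('a, ('a \<times> 'b) \<Rightarrow>\<^sub>0 int) graded_module" where
  "free_pairs p R M =
    \<lparr> carrier = carrier (free_Abelian_group (carrier R \<times> carrier M)),
      monoid.mult = undefined, monoid.one = undefined, ring.zero = 0, ring.add = (+),
      module.smult = (\<lambda>a. frag_extend (\<lambda>(r, m). frag_of (a \<otimes>\<^bsub>R\<^esub> r, m))),
      hcomp = (\<lambda>d. generate (free_Abelian_group (carrier R \<times> carrier M))
        {frag_of (r, m) | r m. \<exists>i j. r \<in> rcomp R i \<and> m \<in> hcomp M j \<and> i + int p * j = d}) \<rparr>"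

definition tensor_relations ::
  "nat \<Rightarrow> 'a graded_ring \<Rightarrow> ('a, 'b, 'z) graded_module_scheme
    \<Rightarrow> (('a \<times> 'b) \<Rightarrow>\<^sub>0 int) set" where
  "tensor_relations p R M = generate (free_Abelian_group (carrier R \<times> carrier M))
    ({frag_of (r \<oplus>\<^bsub>R\<^esub> s, m) - frag_of (r, m) - frag_of (s, m) | r s m.
        r \<in> carrier R \<and> s \<in> carrier R \<and> m \<in> carrier M} \<union>
     {frag_of (r, m \<oplus>\<^bsub>M\<^esub> m') - frag_of (r, m) - frag_of (r, m') | r m m'.
        r \<in> carrier R \<and> m \<in> carrier M \<and> m' \<in> carrier M} \<union>
     {frag_of (s [^]\<^bsub>R\<^esub> p \<otimes>\<^bsub>R\<^esub> r, m) - frag_of (r, s \<odot>\<^bsub>M\<^esub> m) | r s m.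
        r \<in> carrier R \<and> s \<in> carrier R \<and> m \<in> carrier M})"

definition frob ::
  "nat \<Rightarrow> 'a graded_ring \<Rightarrow> ('a, 'b, 'z) graded_module_scheme
    \<Rightarrow> ('a, (('a \<times> 'b) \<Rightarrow>\<^sub>0 int) set) graded_module" where
  "frob p R M = quot_gmodule (free_pairs p R M) (tensor_relations p R M)"

definition frob_tensor ::
  "nat \<Rightarrow> 'a graded_ring \<Rightarrow> ('a, 'b, 'z) graded_module_scheme \<Rightarrow> 'a \<Rightarrow> 'b
    \<Rightarrow> (('a \<times> 'b) \<Rightarrow>\<^sub>0 int) set" where
  "frob_tensor p R M r m = tensor_relations p R M +>\<^bsub>free_pairs p R M\<^esub> frag_of (r, m)"

text \<open>\<open>F(\<phi>)\<close> for \<open>\<phi>\<close> with target \<open>N\<close>; it sends \<open>r \<otimes> m\<close> to \<open>r \<otimes> \<phi>(m)\<close>.\<close>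

definition frob_map ::
  "nat \<Rightarrow> 'a graded_ring \<Rightarrow> ('a, 'c, 'z) graded_module_scheme \<Rightarrow> ('b \<Rightarrow> 'c)
    \<Rightarrow> (('a \<times> 'b) \<Rightarrow>\<^sub>0 int) set \<Rightarrow> (('a \<times> 'c) \<Rightarrow>\<^sub>0 int) set" where
  "frob_map p R N \<phi> X =
     tensor_relations p R N <+>\<^bsub>free_pairs p R N\<^esub>
       (frag_extend (\<lambda>(r, m). frag_of (r, \<phi> m)) ` X)"


section \<open>Graded F-modules\<close>

record ('a, 'b) F_module = "('a, 'b) graded_module" +
  struct :: "'b \<Rightarrow> (('a \<times> 'b) \<Rightarrow>\<^sub>0 int) set"

definition graded_F_module ::
  "nat \<Rightarrow> 'a graded_ring \<Rightarrow> ('a, 'b) F_module \<Rightarrow> bool" where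
  "graded_F_module p R A \<longleftrightarrow>
     graded_module R A \<and> struct A \<in> gmod_iso R A (frob p R A)"

definition F_hom ::
  "nat \<Rightarrow> 'a graded_ring \<Rightarrow> ('a, 'b) F_module \<Rightarrow> ('a, 'c) F_module \<Rightarrow> ('b \<Rightarrow> 'c) set" where
  "F_hom p R A B = {\<phi> \<in> gmod_hom R A B.
     \<forall>x\<in>carrier A. struct B (\<phi> x) = frob_map p R B \<phi> (struct A x)}"

text \<open>Direct limits of sequences \<open>N\<^sub>0 \<rightarrow> N\<^sub>1 \<rightarrow> \<dots>\<close> with transition maps \<open>t e\<close>.
  A cocone \<open>\<iota>\<close> of degree-preserving maps exhibits \<open>A\<close> as the limit if it identifies \<open>A\<close> with
  the disjoint union of the \<open>N e\<close> modulo eventual equality.\<close>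

primrec transition :: "(nat \<Rightarrow> 'b \<Rightarrow> 'b) \<Rightarrow> nat \<Rightarrow> nat \<Rightarrow> 'b \<Rightarrow> 'b" where
  "transition t e 0 x = x"
| "transition t e (Suc k) x = t (e + k) (transition t e k x)"

definition direct_limit ::
  "'a graded_ring \<Rightarrow> (nat \<Rightarrow> ('a, 'b, 'y) graded_module_scheme) \<Rightarrow> (nat \<Rightarrow> 'b \<Rightarrow> 'b)
    \<Rightarrow> ('a, 'c, 'z) graded_module_scheme \<Rightarrow> (nat \<Rightarrow> 'b \<Rightarrow> 'c) \<Rightarrow> bool" where
  "direct_limit R N t A \<iota> \<longleftrightarrow>
     (\<forall>e. \<iota> e \<in> gmod_hom R (N e) A) \<and>
     (\<forall>e. \<forall>x\<in>carrier (N e). \<iota> (Suc e) (t e x) = \<iota> e x) \<and>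
     carrier A = (\<Union>e. \<iota> e ` carrier (N e)) \<and>
     (\<forall>e f. \<forall>x\<in>carrier (N e). \<forall>y\<in>carrier (N f). \<iota> e x = \<iota> f y \<longrightarrow>
        (\<exists>k l. e + k = f + l \<and> transition t e k x = transition t f l y))"

text \<open>A sequence \<open>M, F(M), F\<^sup>2(M), \<dots>\<close> with the maps \<open>b e = F\<^sup>e(\<beta>) : F\<^sup>e(M) \<rightarrow> F\<^sup>e\<^sup>+\<^sup>1(M)\<close>
  induced by \<open>\<beta> = b 0\<close>.  Since \<open>frob\<close> changes the type of the elements, it cannot be
  iterated literally inside one type: \<open>N e\<close> is a copy of \<open>F\<^sup>e(M)\<close>, and \<open>N (e + 1)\<close> is
  identified with \<open>F (N e)\<close> along an isomorphism \<open>j e\<close>.\<close>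

definition frob_tower ::
  "nat \<Rightarrow> 'a graded_ring \<Rightarrow> (nat \<Rightarrow> ('a, 'b) graded_module)
    \<Rightarrow> (nat \<Rightarrow> 'b \<Rightarrow> (('a \<times> 'b) \<Rightarrow>\<^sub>0 int) set)
    \<Rightarrow> (nat \<Rightarrow> (('a \<times> 'b) \<Rightarrow>\<^sub>0 int) set \<Rightarrow> 'b) \<Rightarrow> bool" where
  "frob_tower p R N b j \<longleftrightarrow>
     (\<forall>e. graded_module R (N e)) \<and>
     (\<forall>e. b e \<in> gmod_hom R (N e) (frob p R (N e))) \<and>
     (\<forall>e. j e \<in> gmod_iso R (frob p R (N e)) (N (Suc e))) \<and>
     (\<forall>e. \<forall>y\<in>carrier (frob p R (N e)).
        b (Suc e) (j e y) =
          frob_map p R (N (Suc e)) (j e) (frob_map p R (frob p R (N e)) (b e) y))"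

text \<open>The elements of the modules \<open>N e\<close> are taken in the type \<open>(nat \<Rightarrow> 'a) set\<close>. This is no
  restriction: every \<open>F\<^sup>e(M)\<close> is finitely generated, hence isomorphic to a quotient of some
  \<open>R\<^sup>k\<close>, whose elements are cosets in \<open>R\<^sup>k\<close>.\<close>

definition graded_F_finite ::
  "nat \<Rightarrow> 'a graded_ring \<Rightarrow> ('a, 'b) F_module \<Rightarrow> bool" where
  "graded_F_finite p R A \<longleftrightarrow> graded_F_module p R A \<and>
     (\<exists>(N :: nat \<Rightarrow> ('a, (nat \<Rightarrow> 'a) set) graded_module) b j \<iota>.
        finitely_generated R (N 0) \<and> frob_tower p R N b j \<and>
        direct_limit R N (\<lambda>e x. j e (b e x)) A \<iota> \<and>
        (\<forall>e. \<forall>x\<in>carrier (N e). struct A (\<iota> e x) = frob_map p R A (\<iota> e) (b e x)))"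

text \<open>Monomorphisms in the category of graded F-finite modules.  The test objects \<open>C\<close> have
  their elements in the same type as the source \<open>A\<close>, so every submodule of \<open>A\<close> is a possible
  test object.\<close>

definition F_finite_mono ::
  "nat \<Rightarrow> 'a graded_ring \<Rightarrow> ('a, 'b) F_module \<Rightarrow> ('a, 'c) F_module \<Rightarrow> ('b \<Rightarrow> 'c) set" where
  "F_finite_mono p R A B = {i \<in> F_hom p R A B.
     \<forall>(C :: ('a, 'b) F_module) u v.
       graded_F_finite p R C \<and> u \<in> F_hom p R C A \<and> v \<in> F_hom p R C A \<and>
       (\<forall>x\<in>carrier C. i (u x) = i (v x)) \<longrightarrow> (\<forall>x\<in>carrier C. u x = v x)}"

text \<open>Injective objects of the category of graded F-finite modules, tested on objects \<open>A\<close> and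
  \<open>B\<close> with elements in the types \<open>'b\<close> and \<open>'c\<close>.\<close>

definition injective_graded_F_finite ::
  "nat \<Rightarrow> 'a graded_ring \<Rightarrow> 'b itself \<Rightarrow> 'c itself \<Rightarrow> ('a, 'd) F_module \<Rightarrow> bool" where
  "injective_graded_F_finite p R _ _ E \<longleftrightarrow> graded_F_finite p R E \<and>
     (\<forall>(A :: ('a, 'b) F_module) (B :: ('a, 'c) F_module) i g.
        graded_F_finite p R A \<and> graded_F_finite p R B \<and>
        i \<in> F_finite_mono p R A B \<and> g \<in> F_hom p R A E \<longrightarrow>
        (\<exists>h\<in>F_hom p R B E. \<forall>x\<in>carrier A. h (i x) = g x))"


section \<open>Polynomial rings\<close>

definition separably_closed :: "'k::field itself \<Rightarrow> bool" where
  "separably_closed _ \<longleftrightarrow>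
     (\<forall>f :: 'k poly. degree f > 0 \<and> coprime f (pderiv f) \<longrightarrow> (\<exists>x. poly f x = 0))"

text \<open>Polynomials with coefficients in \<open>'k\<close> and variables indexed by \<open>nat\<close>; the polynomial
  ring in \<open>n\<close> variables uses only the variables with indices \<open>0, \<dots>, n - 1\<close>.\<close>

type_synonym 'k mpol = "(nat \<Rightarrow>\<^sub>0 nat) \<Rightarrow>\<^sub>0 'k"

definition mvar :: "nat \<Rightarrow> 'k::field mpol" where
  "mvar i = Poly_Mapping.single (Poly_Mapping.single i 1) 1"

definition mdeg :: "(nat \<Rightarrow>\<^sub>0 nat) \<Rightarrow> nat" where
  "mdeg m = (\<Sum>i\<in>Poly_Mapping.keys m. Poly_Mapping.lookup m i)"

definition poly_ring :: "nat \<Rightarrow> 'k::field mpol graded_ring" where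
  "poly_ring n =
    (let P = {f. \<forall>m\<in>Poly_Mapping.keys f. Poly_Mapping.keys m \<subseteq> {..<n}} in
     \<lparr> carrier = P, monoid.mult = (*), monoid.one = 1, ring.zero = 0, ring.add = (+),
       rcomp = (\<lambda>d. {f \<in> P. \<forall>m\<in>Poly_Mapping.keys f. int (mdeg m) = d}) \<rparr>)"


section \<open>Local cohomology of the polynomial ring at its homogeneous maximal ideal\<close>

text \<open>\<open>H\<^sup>i\<^sub>\<mm>(R)\<close> is the \<open>i\<close>-th cohomology of the Cech complex on \<open>x\<^sub>0, \<dots>, x\<^sub>n\<^sub>-\<^sub>1\<close>. As
  \<open>R\<close> is a domain, its localization at \<open>x\<^sub>S = (\<Prod>i\<in>S. x\<^sub>i)\<close> is the subring of fractions
  \<open>a / x\<^sub>S\<^sup>k\<close>; such a fraction has degree \<open>deg a - k |S|\<close>.\<close>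

definition cech_loc :: "nat \<Rightarrow> nat set \<Rightarrow> 'k::field mpol fract set" where
  "cech_loc n S = {Fract a ((\<Prod>i\<in>S. mvar i) ^ k) | a k. a \<in> carrier (poly_ring n)}"

definition cech_loc_comp :: "nat \<Rightarrow> nat set \<Rightarrow> int \<Rightarrow> 'k::field mpol fract set" where
  "cech_loc_comp n S d =
     {Fract a ((\<Prod>i\<in>S. mvar i) ^ k) | a k. a \<in> rcomp (poly_ring n) (d + int (k * card S))}"

text \<open>Cochains of degree \<open>i\<close> are families indexed by the \<open>i\<close>-element subsets of \<open>{..<n}\<close>,
  extended by zero.\<close>

definition cech_cochains :: "nat \<Rightarrow> nat \<Rightarrow> (nat set \<Rightarrow> 'k::field mpol fract) set" where
  "cech_cochains n i =
     {c. \<forall>S. c S \<in> (if S \<subseteq> {..<n} \<and> card S = i then cech_loc n S else {0})}"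

definition cech_diff ::
  "nat \<Rightarrow> (nat set \<Rightarrow> 'k::field mpol fract) \<Rightarrow> nat set \<Rightarrow> 'k mpol fract" where
  "cech_diff n c T =
     (if T \<subseteq> {..<n} then \<Sum>j\<in>T. (- 1) ^ card {l \<in> T. l < j} * c (T - {j}) else 0)"

definition cech_cocycles ::
  "nat \<Rightarrow> nat \<Rightarrow> ('k::field mpol, nat set \<Rightarrow> 'k mpol fract) graded_module" where
  "cech_cocycles n i =
    (let Z = {c \<in> cech_cochains n i. cech_diff n c = (\<lambda>_. 0)} in
     \<lparr> carrier = Z, monoid.mult = undefined, monoid.one = undefined,
       ring.zero = (\<lambda>_. 0), ring.add = (\<lambda>c c' S. c S + c' S),
       module.smult = (\<lambda>a c S. Fract a 1 * c S),
       hcomp = (\<lambda>d. {c \<in> Z. \<forall>S. S \<subseteq> {..<n} \<and> card S = i \<longrightarrow> c S \<in> cech_loc_comp n S d}) \<rparr>)"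

text \<open>The zero cochain is added because in degree \<open>i = 0\<close> there are no cochains of degree
  \<open>i - 1\<close>.\<close>

definition cech_coboundaries :: "nat \<Rightarrow> nat \<Rightarrow> (nat set \<Rightarrow> 'k::field mpol fract) set" where
  "cech_coboundaries n i = {\<lambda>_. 0} \<union> {cech_diff n c | c j. c \<in> cech_cochains n j \<and> Suc j = i}"

definition local_cohomology ::
  "nat \<Rightarrow> nat \<Rightarrow> ('k::field mpol, (nat set \<Rightarrow> 'k mpol fract) set) graded_module" where
  "local_cohomology n i = quot_gmodule (cech_cocycles n i) (cech_coboundaries n i)"

text \<open>The Frobenius endomorphism of \<open>R\<close> induces the \<open>p\<close>-th power map on each localization,
  and hence on cohomology.\<close>

definition frob_action ::
  "nat \<Rightarrow> nat \<Rightarrow> nat \<Rightarrow> (nat set \<Rightarrow> 'k::field mpol fract) set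
    \<Rightarrow> (nat set \<Rightarrow> 'k mpol fract) set" where
  "frob_action p n i X =
     cech_coboundaries n i <+>\<^bsub>cech_cocycles n i\<^esub> ((\<lambda>c S. c S ^ p) ` X)"

definition top_structure ::
  "nat \<Rightarrow> nat \<Rightarrow> (nat set \<Rightarrow> 'k::field mpol fract) set
    \<Rightarrow> (('k mpol \<times> (nat set \<Rightarrow> 'k mpol fract) set) \<Rightarrow>\<^sub>0 int) set" where
  "top_structure p n =
    (let R = poly_ring n; H = local_cohomology n n in
     THE \<theta>. \<theta> \<in> mod_hom R H (frob p R H) \<and> \<theta> \<in> extensional (carrier H) \<and>
       (\<forall>r\<in>carrier R. \<forall>\<eta>\<in>carrier H.
          \<theta> (r \<odot>\<^bsub>H\<^esub> frob_action p n n \<eta>) = frob_tensor p R H r \<eta>))"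

definition top_local_cohomology ::
  "nat \<Rightarrow> nat \<Rightarrow> ('k::field mpol, (nat set \<Rightarrow> 'k mpol fract) set) F_module" where
  "top_local_cohomology p n =
    graded_module.extend (local_cohomology n n) (F_module.fields (top_structure p n))"

end

theory Submission imports Defs begin

text \<open>Top local cohomology \<open>E\<close> is identified with Macaulay's inverse system, the graded dual of \<open>R\<close>,
  which is injective among graded modules because linear functionals extend. A morphism from an
  F-finite module \<open>B\<close> to \<open>E\<close> is a graded homomorphism fixed by the \<open>p\<close>-linear operator \<open>\<Phi>\<close> that sends
  \<open>h\<close> to \<open>\<theta>\<^sub>E\<^sup>-\<^sup>1 \<circ> F(h) \<circ> \<theta>\<^sub>B\<close>. Extend \<open>g\<close> to a graded homomorphism \<open>\<mu>\<close> on \<open>B\<close>. The maps \<open>\<Phi>\<^sup>i(\<Phi> \<mu> - \<mu>)\<close>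
  vanish on the image of the submodule and, restricted to a finitely generated root of \<open>B\<close>, span a
  finite-dimensional space, so \<open>\<mu>\<close> can be corrected to a fixed point on the root by solving an additive
  equation \<open>t\<^sup>p + \<cdots> = t\<close>, which is separable. Iterating \<open>\<Phi>\<close> spreads the fixed point from the root
  to all of \<open>B\<close>.\<close>


section \<open>The Frobenius functor as a tensor product\<close>

text \<open>The field need not be perfect, so \<open>R'\<close> is free over \<open>R\<close> on a
  basis that may be infinite. Coordinate maps in this basis stand in for flatness of the Frobenius:
  they detect zero, they recognise F-submodules, and they roughly divide degrees by
  \<open>p\<close>. The last effect drives the treatment of monomorphisms, which are not known to be
  injective as maps, so that \<open>g\<close> must first be shown to vanish on the kernel. A
  homomorphism to \<open>E\<close> is determined by its effect in degree \<open>-n\<close>, and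
  coordinates of elements with degrees in \<open>-n, ..., 0\<close> have degrees in the same window,
  since a basis monomial has degree at most \<open>n (p - 1)\<close>. In this window the kernel
  inside a root is finite-dimensional, hence generates a graded F-finite subobject, which a
  monomorphism forces to vanish. The correction of \<open>\<mu>\<close> is sought as
  \<open>\<mu> + \<Sum> t_i \<Phi>^i (\<Phi> \<mu> - \<mu>)\<close>. Applying \<open>\<Phi>\<close>
  raises each \<open>t_i\<close> to the power \<open>p\<close> and shifts the index, and one linear
  relation among the maps closes the system. The resulting polynomial has derivative
  \<open>-1\<close>, which is why separable closure is enough.\<close>

lemma comm_group_record_cong:
  assumes "comm_group G" "carrier H = carrier G" "monoid.mult H = monoid.mult G" "one H = one G"
  shows "comm_group H"
proof -
  interpret G: comm_group G by fact
  show ?thesis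
  proof (rule comm_groupI)
    fix x assume "x \<in> carrier H"
    then show "\<exists>y\<in>carrier H. y \<otimes>\<^bsub>H\<^esub> x = \<one>\<^bsub>H\<^esub>"
      using assms(2-) G.l_inv[of x] G.inv_closed[of x] by metis
  qed (auto simp: assms(2-) intro: G.m_assoc G.m_comm)
qed

lemma subgroup_record_cong:
  assumes "carrier H = carrier G" "monoid.mult H = monoid.mult G" "one H = one G"
  shows "subgroup K H \<longleftrightarrow> subgroup K G"
  using assms by (simp add: subgroup_def m_inv_def)

lemma abelian_group_quot_gmodule:
  assumes "abelian_subgroup K M"
  shows "abelian_group (quot_gmodule M K)"
proof -
  interpret abelian_subgroup K M by fact
  have "comm_group (add_monoid (quot_gmodule M K))"
    by (rule comm_group_record_cong[OF a_factorgroup_is_comm_group])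
       (simp_all add: quot_gmodule_def A_FactGroup_def')
  then show ?thesis by (rule comm_group_abelian_groupI)
qed

lemma carrier_quot_gmodule: "carrier (quot_gmodule M K) = (\<lambda>x. K +>\<^bsub>M\<^esub> x) ` carrier M"
  by (auto simp: quot_gmodule_def A_RCOSETS_def')

lemma quot_gmodule_add:
  assumes "abelian_subgroup K M" "x \<in> carrier M" "y \<in> carrier M"
  shows "(K +>\<^bsub>M\<^esub> x) \<oplus>\<^bsub>quot_gmodule M K\<^esub> (K +>\<^bsub>M\<^esub> y) = K +>\<^bsub>M\<^esub> (x \<oplus>\<^bsub>M\<^esub> y)"
  using abelian_subgroup.a_rcos_sum[OF assms] by (simp add: quot_gmodule_def)

lemma coset_eq_iff:
  assumes "abelian_subgroup K M" "x \<in> carrier M" "y \<in> carrier M"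
  shows "K +>\<^bsub>M\<^esub> x = K +>\<^bsub>M\<^esub> y \<longleftrightarrow> x \<oplus>\<^bsub>M\<^esub> \<ominus>\<^bsub>M\<^esub> y \<in> K"
proof -
  interpret abelian_subgroup K M by fact
  have "K +>\<^bsub>M\<^esub> x = K +>\<^bsub>M\<^esub> y \<longleftrightarrow> x \<in> K +>\<^bsub>M\<^esub> y"
    using assms a_rcos_self a_repr_independence[OF _ _ a_subgroup] by metis
  also have "\<dots> \<longleftrightarrow> x \<oplus>\<^bsub>M\<^esub> \<ominus>\<^bsub>M\<^esub> y \<in> K"
    using a_rcos_module[OF assms(3,2)] .
  finally show ?thesis .
qed

text \<open>Scalar multiplication on quotients, \<open>frob_map\<close> and
  \<open>frob_action\<close> are all encoded as the subgroup plus the image of a coset. This one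
  computation evaluates each of them on a representative.\<close>

lemma coset_image:
  assumes K: "abelian_subgroup K M" and K': "abelian_subgroup K' M'"
    and h: "h \<in> carrier M' \<rightarrow> carrier M"
    and hadd: "\<And>x y. x \<in> carrier M' \<Longrightarrow> y \<in> carrier M' \<Longrightarrow> h (x \<oplus>\<^bsub>M'\<^esub> y) = h x \<oplus>\<^bsub>M\<^esub> h y"
    and hK: "h ` K' \<subseteq> K" and x: "x \<in> carrier M'"
  shows "K <+>\<^bsub>M\<^esub> h ` (K' +>\<^bsub>M'\<^esub> x) = K +>\<^bsub>M\<^esub> h x"
proof -
  interpret K: abelian_subgroup K M by fact
  interpret K': abelian_subgroup K' M' by fact
  have sub: "K \<subseteq> carrier M" "K' \<subseteq> carrier M'" by (rule K.a_subset K'.a_subset)+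
  have hx: "h x \<in> carrier M" using h x by auto
  show ?thesis
  proof (intro equalityI subsetI)
    fix z assume "z \<in> K <+>\<^bsub>M\<^esub> h ` (K' +>\<^bsub>M'\<^esub> x)"
    then obtain k k' where k: "k \<in> K" "k' \<in> K'" and z: "z = k \<oplus>\<^bsub>M\<^esub> h (k' \<oplus>\<^bsub>M'\<^esub> x)"
      by (auto simp: set_add_def' a_r_coset_def')
    have hk: "h k' \<in> K" using hK k by auto
    have "z = (k \<oplus>\<^bsub>M\<^esub> h k') \<oplus>\<^bsub>M\<^esub> h x"
      using k hk hx sub x by (simp add: z hadd subsetD K.a_assoc)
    moreover have "k \<oplus>\<^bsub>M\<^esub> h k' \<in> K" using k hk by simp
    ultimately show "z \<in> K +>\<^bsub>M\<^esub> h x" by (auto simp: a_r_coset_def')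
  next
    fix z assume "z \<in> K +>\<^bsub>M\<^esub> h x"
    then obtain k where k: "k \<in> K" "z = k \<oplus>\<^bsub>M\<^esub> h x"
      by (auto simp: a_r_coset_def')
    have "x \<in> K' +>\<^bsub>M'\<^esub> x" using x by (rule K'.a_rcos_self)
    then show "z \<in> K <+>\<^bsub>M\<^esub> h ` (K' +>\<^bsub>M'\<^esub> x)"
      using k by (auto simp: set_add_def')
  qed
qed

section \<open>The free abelian group on pairs and its tensor relations\<close>

lemma subgroup_free_pairs_iff:
  "subgroup K (add_monoid (free_pairs p R A)) \<longleftrightarrow>
    subgroup K (free_Abelian_group (carrier R \<times> carrier A))"
  by (rule subgroup_record_cong) (simp_all add: free_pairs_def free_Abelian_group_def)

lemma abelian_group_free_pairs: "abelian_group (free_pairs p R A)"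
  by (rule comm_group_abelian_groupI, rule comm_group_record_cong[OF abelian_free_Abelian_group])
     (auto simp: free_pairs_def free_Abelian_group_def)

lemma free_pairs_simps [simp]:
  "carrier (free_pairs p R A) = {c. Poly_Mapping.keys c \<subseteq> carrier R \<times> carrier A}"
  "x \<oplus>\<^bsub>free_pairs p R A\<^esub> y = x + y" "\<zero>\<^bsub>free_pairs p R A\<^esub> = 0"
  by (auto simp: free_pairs_def)

text \<open>The generators of \<open>tensor_relations\<close> are split off so that a homomorphism
  can be checked on the three kinds of relators by case analysis.\<close>

definition tensor_relators ::
  "nat \<Rightarrow> 'a graded_ring \<Rightarrow> ('a, 'b, 'z) graded_module_scheme \<Rightarrow> (('a \<times> 'b) \<Rightarrow>\<^sub>0 int) set" where
  "tensor_relators p R M =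
    {frag_of (r \<oplus>\<^bsub>R\<^esub> s, m) - frag_of (r, m) - frag_of (s, m) | r s m.
        r \<in> carrier R \<and> s \<in> carrier R \<and> m \<in> carrier M} \<union>
     {frag_of (r, m \<oplus>\<^bsub>M\<^esub> m') - frag_of (r, m) - frag_of (r, m') | r m m'.
        r \<in> carrier R \<and> m \<in> carrier M \<and> m' \<in> carrier M} \<union>
     {frag_of (s [^]\<^bsub>R\<^esub> p \<otimes>\<^bsub>R\<^esub> r, m) - frag_of (r, s \<odot>\<^bsub>M\<^esub> m) | r s m.
        r \<in> carrier R \<and> s \<in> carrier R \<and> m \<in> carrier M}"

lemma tensor_relatorsI:
  "\<lbrakk>r \<in> carrier R; s \<in> carrier R; m \<in> carrier M\<rbrakk> \<Longrightarrow>
    frag_of (r \<oplus>\<^bsub>R\<^esub> s, m) - frag_of (r, m) - frag_of (s, m) \<in> tensor_relators p R M"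
  "\<lbrakk>r \<in> carrier R; m \<in> carrier M; m' \<in> carrier M\<rbrakk> \<Longrightarrow>
    frag_of (r, m \<oplus>\<^bsub>M\<^esub> m') - frag_of (r, m) - frag_of (r, m') \<in> tensor_relators p R M"
  "\<lbrakk>r \<in> carrier R; s \<in> carrier R; m \<in> carrier M\<rbrakk> \<Longrightarrow>
    frag_of (s [^]\<^bsub>R\<^esub> p \<otimes>\<^bsub>R\<^esub> r, m) - frag_of (r, s \<odot>\<^bsub>M\<^esub> m) \<in> tensor_relators p R M"
  unfolding tensor_relators_def by blast+

lemma tensor_relatorsE [consumes 1, case_names add_left add_right balanced]:
  assumes "x \<in> tensor_relators p R M"
  obtains r s m where "r \<in> carrier R" "s \<in> carrier R" "m \<in> carrier M"
      "x = frag_of (r \<oplus>\<^bsub>R\<^esub> s, m) - frag_of (r, m) - frag_of (s, m)"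
  | r m m' where "r \<in> carrier R" "m \<in> carrier M" "m' \<in> carrier M"
      "x = frag_of (r, m \<oplus>\<^bsub>M\<^esub> m') - frag_of (r, m) - frag_of (r, m')"
  | r s m where "r \<in> carrier R" "s \<in> carrier R" "m \<in> carrier M"
      "x = frag_of (s [^]\<^bsub>R\<^esub> p \<otimes>\<^bsub>R\<^esub> r, m) - frag_of (r, s \<odot>\<^bsub>M\<^esub> m)"
  using assms unfolding tensor_relators_def by blast

lemma tensor_relations_eq: "tensor_relations p R M =
    generate (free_Abelian_group (carrier R \<times> carrier M)) (tensor_relators p R M)"
  by (simp add: tensor_relations_def tensor_relators_def)

lemma keys_diff_subset: "Poly_Mapping.keys a \<subseteq> S \<Longrightarrow> Poly_Mapping.keys b \<subseteq> S \<Longrightarrow>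
    Poly_Mapping.keys (a - b :: 'a \<Rightarrow>\<^sub>0 int) \<subseteq> S"
  using keys_diff[of a b] by auto

lemma generate_frag_image:
  assumes X: "X \<subseteq> carrier (free_Abelian_group S)"
    and G: "group G" and h: "h \<in> hom (free_Abelian_group S) G"
    and K: "subgroup K G" and hX: "h ` X \<subseteq> K"
  shows "h ` generate (free_Abelian_group S) X \<subseteq> K"
proof -
  interpret group_hom "free_Abelian_group S" G h
    using G h by (simp add: group_hom_def group_hom_axioms_def)
  have "h ` generate (free_Abelian_group S) X = generate G (h ` X)"
    using generate_img[OF X] by simp
  also have "\<dots> \<subseteq> K" using group.generate_subgroup_incl[OF G hX K] .
  finally show ?thesis .
qed

lemma frag_extend_hom:
  assumes "\<And>x. x \<in> S \<Longrightarrow> Poly_Mapping.keys (f x) \<subseteq> T"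
  shows "frag_extend f \<in> hom (free_Abelian_group S) (free_Abelian_group T)"
  using assms keys_frag_extend[of f] by (force intro!: homI simp: frag_extend_add)

text \<open>Assuming only a module lets the locale apply to \<open>frob p R A\<close> as well, which
  is shown to be a module (\<open>module_frob\<close>) but is not given a direct sum
  decomposition.\<close>

locale tensor = Module.module R A
  for R :: "'a graded_ring" (structure) and A :: "('a, 'b, 'z) graded_module_scheme" (structure) +
  fixes p :: nat
begin

lemma relators_carrier: "tensor_relators p R A \<subseteq> carrier (free_Abelian_group (carrier R \<times> carrier A))"
  by (rule subsetI, erule tensor_relatorsE)
     (simp_all add: keys_diff_subset keys_frag_of)

lemma subgroup_relations:
  "subgroup (tensor_relations p R A) (free_Abelian_group (carrier R \<times> carrier A))"
  unfolding tensor_relations_eq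
  by (rule group.generate_is_subgroup[OF _ relators_carrier]) simp

lemma abelian_subgroup_relations: "abelian_subgroup (tensor_relations p R A) (free_pairs p R A)"
  by (intro abelian_subgroupI3 additive_subgroupI abelian_group_free_pairs)
     (simp only: subgroup_free_pairs_iff subgroup_relations)

lemma abelian_group_frob: "abelian_group (frob p R A)"
  unfolding frob_def by (rule abelian_group_quot_gmodule[OF abelian_subgroup_relations])

abbreviation tens where "tens r m \<equiv> frob_tensor p R A r m"

abbreviation cs where "cs x \<equiv> tensor_relations p R A +>\<^bsub>free_pairs p R A\<^esub> x"

lemma cs_add: "x \<in> carrier (free_pairs p R A) \<Longrightarrow> y \<in> carrier (free_pairs p R A) \<Longrightarrow>
   cs x \<oplus>\<^bsub>frob p R A\<^esub> cs y = cs (x + y)"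
  using quot_gmodule_add[OF abelian_subgroup_relations, of x y] by (simp add: frob_def)

lemma carrier_frob: "carrier (frob p R A) = cs ` {c. Poly_Mapping.keys c \<subseteq> carrier R \<times> carrier A}"
  by (simp add: frob_def carrier_quot_gmodule)

lemma tensor_closed: "r \<in> carrier R \<Longrightarrow> m \<in> carrier A \<Longrightarrow> tens r m \<in> carrier (frob p R A)"
  by (auto simp: carrier_frob frob_tensor_def keys_frag_of)

lemma relator_zero:
  assumes "x - y - z \<in> tensor_relators p R A"
    "Poly_Mapping.keys x \<subseteq> carrier R \<times> carrier A" "Poly_Mapping.keys y \<subseteq> carrier R \<times> carrier A"
    "Poly_Mapping.keys z \<subseteq> carrier R \<times> carrier A"
  shows "cs x = cs (y + z)"
proof -
  have "x - y - z \<in> tensor_relations p R A"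
    unfolding tensor_relations_eq using assms(1) by (rule generate.incl)
  moreover have "x \<in> cs (y + z) \<longleftrightarrow> x - y - z \<in> tensor_relations p R A"
    by (auto simp: a_r_coset_def' diff_diff_add) (metis diff_add_cancel)
  ultimately have x: "x \<in> cs (y + z)" by simp
  have "subgroup (tensor_relations p R A) (add_monoid (free_pairs p R A))"
    by (simp only: subgroup_free_pairs_iff subgroup_relations)
  moreover have "y + z \<in> carrier (free_pairs p R A)"
    using assms(3,4) keys_add[of y z] by auto
  ultimately show ?thesis
    using abelian_group.a_repr_independence[OF abelian_group_free_pairs x] by simp
qed

lemma tensor_add_left:
  assumes "r \<in> carrier R" "s \<in> carrier R" "m \<in> carrier A"
  shows "tens (r \<oplus> s) m = tens r m \<oplus>\<^bsub>frob p R A\<^esub> tens s m"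
proof -
  have "cs (frag_of (r \<oplus> s, m)) = cs (frag_of (r, m) + frag_of (s, m))"
    by (rule relator_zero) (use assms in \<open>auto simp: keys_frag_of tensor_relatorsI\<close>)
  then show ?thesis using assms by (simp add: frob_tensor_def cs_add keys_frag_of)
qed

lemma tensor_add_right:
  assumes "r \<in> carrier R" "m \<in> carrier A" "m' \<in> carrier A"
  shows "tens r (m \<oplus>\<^bsub>A\<^esub> m') = tens r m \<oplus>\<^bsub>frob p R A\<^esub> tens r m'"
proof -
  have "cs (frag_of (r, m \<oplus>\<^bsub>A\<^esub> m')) = cs (frag_of (r, m) + frag_of (r, m'))"
    by (rule relator_zero) (use assms in \<open>auto simp: keys_frag_of tensor_relatorsI\<close>)
  then show ?thesis using assms by (simp add: frob_tensor_def cs_add keys_frag_of)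
qed

lemma tensor_balanced:
  assumes "r \<in> carrier R" "s \<in> carrier R" "m \<in> carrier A"
  shows "tens (s [^] p \<otimes> r) m = tens r (s \<odot>\<^bsub>A\<^esub> m)"
proof -
  \<comment> \<open>The trailing \<open>- 0\<close> fits the two-term relator into the three-term
    form that \<open>relator_zero\<close> expects.\<close>
  have "frag_of (s [^] p \<otimes> r, m) - frag_of (r, s \<odot>\<^bsub>A\<^esub> m) - 0 \<in> tensor_relators p R A"
    using assms by (simp add: tensor_relatorsI)
  from relator_zero[OF this] show ?thesis
    using assms by (simp add: frob_tensor_def keys_frag_of)
qed

lemma tensor_zero_right: "r \<in> carrier R \<Longrightarrow> tens r \<zero>\<^bsub>A\<^esub> = \<zero>\<^bsub>frob p R A\<^esub>"
  using tensor_add_right[of r "\<zero>\<^bsub>A\<^esub>" "\<zero>\<^bsub>A\<^esub>"] tensor_closed[of r "\<zero>\<^bsub>A\<^esub>"]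
    abelian_group.a_group[OF abelian_group_frob, THEN group.r_cancel_one'] 
  by simp

text \<open>Sums of tensors already form a group, because \<open>-(r \<otimes> m)\<close> is the
  tensor \<open>(-r) \<otimes> m\<close>.\<close>

lemma tensor_induct [consumes 1, case_names tensor add]:
  assumes z: "z \<in> carrier (frob p R A)"
    and t: "\<And>r m. r \<in> carrier R \<Longrightarrow> m \<in> carrier A \<Longrightarrow> P (tens r m)"
    and add: "\<And>x y. x \<in> carrier (frob p R A) \<Longrightarrow> y \<in> carrier (frob p R A) \<Longrightarrow> P x \<Longrightarrow> P y \<Longrightarrow>
      P (x \<oplus>\<^bsub>frob p R A\<^esub> y)"
  shows "P z"
proof -
  interpret F: abelian_group "frob p R A" by (rule abelian_group_frob)
  let ?S = "carrier R \<times> carrier A"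
  have neg: "tens (\<ominus> r) m \<oplus>\<^bsub>frob p R A\<^esub> tens r m = \<zero>\<^bsub>frob p R A\<^esub>"
    if "r \<in> carrier R" "m \<in> carrier A" for r m
  proof -
    have "tens \<zero> m \<oplus>\<^bsub>frob p R A\<^esub> tens \<zero> m = tens \<zero> m"
      using that tensor_add_left[of \<zero> \<zero> m] by simp
    then have "tens \<zero> m = \<zero>\<^bsub>frob p R A\<^esub>"
      using tensor_closed[of \<zero> m] that by simp
    then show ?thesis using tensor_add_left[of "\<ominus> r" r m] that by (simp add: R.l_neg)
  qed
  \<comment> \<open>Induction over a free abelian group builds up differences, so the claim is
    carried for \<open>c\<close> and \<open>- c\<close> together.\<close>
  have *: "P (cs c) \<and> P (cs (- c))" if "Poly_Mapping.keys c \<subseteq> ?S" for c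
  proof (rule free_Abelian_group_induct[OF that, where P = "\<lambda>c. P (cs c) \<and> P (cs (- c))"], goal_cases)
    case 1
    have "cs 0 = tens \<zero> \<zero>\<^bsub>A\<^esub>"
      using tensor_zero_right[of \<zero>] abelian_group.a_coset_add_zero[OF abelian_group_free_pairs[of p R A], of "tensor_relations p R A"]
        subgroup.subset[OF subgroup_relations]
      by (simp add: frob_def quot_gmodule_def free_Abelian_group_def)
    then show ?case using t[of \<zero> "\<zero>\<^bsub>A\<^esub>"] by simp
  next
    case (2 x y)
    have *: "cs x \<in> carrier (frob p R A)" "cs (-x) \<in> carrier (frob p R A)"
      "cs y \<in> carrier (frob p R A)" "cs (-y) \<in> carrier (frob p R A)"
      using 2 by (auto simp: carrier_frob)
    have "cs x \<oplus>\<^bsub>frob p R A\<^esub> cs (-y) = cs (x - y)" "cs (-x) \<oplus>\<^bsub>frob p R A\<^esub> cs y = cs (- (x - y))"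
      using 2(1,2) by (subst cs_add; simp)+
    then show ?case using add[OF *(1,4)] add[OF *(2,3)] 2(3,4) by simp
  next
    case (3 a)
    then obtain r m where a: "a = (r, m)" and rm: "r \<in> carrier R" "m \<in> carrier A" by auto
    have c: "cs (- frag_of a) \<in> carrier (frob p R A)" using 3 by (auto simp: carrier_frob keys_frag_of)
    have "cs (- frag_of a) \<oplus>\<^bsub>frob p R A\<^esub> cs (frag_of a) = cs 0"
      using 3 by (subst cs_add) (simp_all add: keys_frag_of)
    also have "cs 0 = \<zero>\<^bsub>frob p R A\<^esub>"
      using abelian_group.a_coset_add_zero[OF abelian_group_free_pairs[of p R A], of "tensor_relations p R A"]
        subgroup.subset[OF subgroup_relations]
      by (simp add: frob_def quot_gmodule_def free_Abelian_group_def)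
    finally have "cs (- frag_of a) = tens (\<ominus> r) m"
      using neg[OF rm] tensor_closed[OF _ rm(2)] rm c 
      by (metis F.minus_equality R.a_inv_closed a frob_tensor_def)
    then show ?case using t[of r m] t[of "\<ominus> r" m] rm by (simp add: a frob_tensor_def)
  qed
  then show ?thesis using z by (auto simp: carrier_frob)
qed

text \<open>Universal property of \<open>R' \<otimes> A\<close> for balanced biadditive maps: the
  homomorphism that freeness provides kills the relators, hence is constant on cosets.\<close>

lemma tensor_lift:
  assumes G: "abelian_group G"
    and \<tau>: "\<And>r m. r \<in> carrier R \<Longrightarrow> m \<in> carrier A \<Longrightarrow> \<tau> r m \<in> carrier G"
    and addl: "\<And>r s m. r \<in> carrier R \<Longrightarrow> s \<in> carrier R \<Longrightarrow> m \<in> carrier A \<Longrightarrow>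
        \<tau> (r \<oplus> s) m = \<tau> r m \<oplus>\<^bsub>G\<^esub> \<tau> s m"
    and addr: "\<And>r m m'. r \<in> carrier R \<Longrightarrow> m \<in> carrier A \<Longrightarrow> m' \<in> carrier A \<Longrightarrow>
        \<tau> r (m \<oplus>\<^bsub>A\<^esub> m') = \<tau> r m \<oplus>\<^bsub>G\<^esub> \<tau> r m'"
    and bal: "\<And>r s m. r \<in> carrier R \<Longrightarrow> s \<in> carrier R \<Longrightarrow> m \<in> carrier A \<Longrightarrow>
        \<tau> (s [^] p \<otimes> r) m = \<tau> r (s \<odot>\<^bsub>A\<^esub> m)"
  obtains \<phi> where "\<phi> \<in> carrier (frob p R A) \<rightarrow> carrier G"
    "\<And>x y. x \<in> carrier (frob p R A) \<Longrightarrow> y \<in> carrier (frob p R A) \<Longrightarrow>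
        \<phi> (x \<oplus>\<^bsub>frob p R A\<^esub> y) = \<phi> x \<oplus>\<^bsub>G\<^esub> \<phi> y"
    "\<And>r m. r \<in> carrier R \<Longrightarrow> m \<in> carrier A \<Longrightarrow> \<phi> (tens r m) = \<tau> r m"
proof -
  interpret G: abelian_group G by fact
  let ?S = "carrier R \<times> carrier A"
  have "(\<lambda>(r, m). \<tau> r m) ` ?S \<subseteq> carrier (add_monoid G)" using \<tau> by auto
  from comm_group.free_Abelian_group_universal[OF G.a_comm_group this]
  obtain h where h: "h \<in> hom (free_Abelian_group ?S) (add_monoid G)"
    and ht: "\<And>x. x \<in> ?S \<Longrightarrow> h (frag_of x) = (case x of (r, m) \<Rightarrow> \<tau> r m)" by metis
  have hcl: "h c \<in> carrier G" if "Poly_Mapping.keys c \<subseteq> ?S" for c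
    using h that by (auto simp: hom_def Pi_def)
  have hadd: "h (c + d) = h c \<oplus>\<^bsub>G\<^esub> h d"
    if "Poly_Mapping.keys c \<subseteq> ?S" "Poly_Mapping.keys d \<subseteq> ?S" for c d
    using h that by (auto simp: hom_def)
  have hdiff: "h (c - d) = h c \<ominus>\<^bsub>G\<^esub> h d"
    if "Poly_Mapping.keys c \<subseteq> ?S" "Poly_Mapping.keys d \<subseteq> ?S" for c d
  proof -
    have k: "Poly_Mapping.keys (c - d) \<subseteq> ?S" using that by (rule keys_diff_subset)
    have "h (c - d) \<oplus>\<^bsub>G\<^esub> h d = h c" using hadd[OF k that(2)] by simp
    then show ?thesis using hcl[OF k] hcl[OF that(1)] hcl[OF that(2)]
      by (metis G.add.inv_solve_right G.minus_eq)
  qed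
  have "subgroup {\<zero>\<^bsub>G\<^esub>} (add_monoid G)"
    by (rule G.add.subgroupI) auto
  moreover have "h ` tensor_relators p R A \<subseteq> {\<zero>\<^bsub>G\<^esub>}"
  proof -
    have 1: "h (frag_of (r, m)) = \<tau> r m" if "r \<in> carrier R" "m \<in> carrier A" for r m
      using ht[of "(r, m)"] that by simp
    have 3: "x \<ominus>\<^bsub>G\<^esub> y = \<zero>\<^bsub>G\<^esub>" if "x = y" "y \<in> carrier G" for x y
      using that by (simp add: G.minus_eq G.r_neg)
    have 4: "x \<oplus>\<^bsub>G\<^esub> y \<ominus>\<^bsub>G\<^esub> x \<ominus>\<^bsub>G\<^esub> y = \<zero>\<^bsub>G\<^esub>" if "x \<in> carrier G" "y \<in> carrier G" for x y
    proof -
      have "x \<oplus>\<^bsub>G\<^esub> y \<ominus>\<^bsub>G\<^esub> x \<ominus>\<^bsub>G\<^esub> y = (x \<oplus>\<^bsub>G\<^esub> y) \<oplus>\<^bsub>G\<^esub> \<ominus>\<^bsub>G\<^esub> (x \<oplus>\<^bsub>G\<^esub> y)"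
        using that by (simp add: G.minus_eq G.minus_add G.a_assoc)
      then show ?thesis using that by (simp add: G.r_neg)
    qed
    show ?thesis
    proof (intro image_subsetI, erule tensor_relatorsE)
      fix x r s m assume x: "x = frag_of (r \<oplus> s, m) - frag_of (r, m) - frag_of (s, m)"
        and c: "r \<in> carrier R" "s \<in> carrier R" "m \<in> carrier A"
      show "h x \<in> {\<zero>\<^bsub>G\<^esub>}"
        using c \<tau>[of r m] \<tau>[of s m]
        by (simp add: x hdiff keys_diff_subset keys_frag_of 1 addl 4)
    next
      fix x r m m' assume x: "x = frag_of (r, m \<oplus>\<^bsub>A\<^esub> m') - frag_of (r, m) - frag_of (r, m')"
        and c: "r \<in> carrier R" "m \<in> carrier A" "m' \<in> carrier A"
      show "h x \<in> {\<zero>\<^bsub>G\<^esub>}"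
        using c \<tau>[of r m] \<tau>[of r m']
        by (simp add: x hdiff keys_diff_subset keys_frag_of 1 addr 4)
    next
      fix x r s m assume x: "x = frag_of (s [^] p \<otimes> r, m) - frag_of (r, s \<odot>\<^bsub>A\<^esub> m)"
        and c: "r \<in> carrier R" "s \<in> carrier R" "m \<in> carrier A"
      show "h x \<in> {\<zero>\<^bsub>G\<^esub>}"
        using c \<tau>[of r "s \<odot>\<^bsub>A\<^esub> m"]
        by (simp add: x hdiff keys_frag_of 1 bal 3)
    qed
  qed
  ultimately have hK: "h ` tensor_relations p R A \<subseteq> {\<zero>\<^bsub>G\<^esub>}"
    unfolding tensor_relations_eq
    by (intro generate_frag_image[OF relators_carrier G.a_group h]) auto
  have sub: "tensor_relations p R A \<subseteq> {c. Poly_Mapping.keys c \<subseteq> ?S}"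
    using subgroup.subset[OF subgroup_relations] by (auto simp: free_Abelian_group_def)
  \<comment> \<open>Any representative may be chosen, since two of them differ by an element that
    \<open>h\<close> kills.\<close>
  define \<phi> where "\<phi> X = h (SOME c. c \<in> X)" for X
  have \<phi>: "\<phi> (cs c) = h c" if c: "Poly_Mapping.keys c \<subseteq> ?S" for c
  proof -
    have "c \<in> cs c"
      using abelian_subgroup.a_rcos_self[OF abelian_subgroup_relations, of c] c by simp
    then have "(SOME d. d \<in> cs c) \<in> cs c" by (rule someI)
    then obtain k where "k \<in> tensor_relations p R A" "(SOME d. d \<in> cs c) = k + c"
      by (auto simp: a_r_coset_def')
    moreover from this have "h k = \<zero>\<^bsub>G\<^esub>" "Poly_Mapping.keys k \<subseteq> ?S"
      using hK sub by blast+
    ultimately show ?thesis using c hcl[OF c] by (simp add: \<phi>_def hadd)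
  qed
  show thesis
  proof
    show "\<phi> \<in> carrier (frob p R A) \<rightarrow> carrier G" by (auto simp: carrier_frob \<phi> hcl)
    show "\<phi> (x \<oplus>\<^bsub>frob p R A\<^esub> y) = \<phi> x \<oplus>\<^bsub>G\<^esub> \<phi> y"
      if "x \<in> carrier (frob p R A)" "y \<in> carrier (frob p R A)" for x y
    proof -
      obtain c d where cd: "x = cs c" "y = cs d" "Poly_Mapping.keys c \<subseteq> ?S" "Poly_Mapping.keys d \<subseteq> ?S"
        using \<open>x \<in> _\<close> \<open>y \<in> _\<close> unfolding carrier_frob by auto
      then have "Poly_Mapping.keys (c + d) \<subseteq> ?S" using keys_add[of c d] by blast
      then show ?thesis using cd by (simp add: cs_add \<phi> hadd)
    qed
    show "\<phi> (tens r m) = \<tau> r m" if "r \<in> carrier R" "m \<in> carrier A" for r m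
      using that ht[of "(r, m)"] by (simp add: frob_tensor_def \<phi> keys_frag_of)
  qed
qed

text \<open>Common source of \<open>frob_map_cs\<close> and \<open>smult_cs\<close>: an additive map
  of free groups descends to the tensor products as soon as it sends relators to relations.\<close>

lemma coset_frag_extend:
  assumes T: "tensor R B"
    and k: "\<And>x. x \<in> carrier R \<times> carrier A \<Longrightarrow> Poly_Mapping.keys (f x) \<subseteq> carrier R \<times> carrier B"
    and rel: "frag_extend f ` tensor_relators p R A \<subseteq> tensor_relations p R B"
    and c: "Poly_Mapping.keys c \<subseteq> carrier R \<times> carrier A"
  shows "tensor_relations p R B <+>\<^bsub>free_pairs p R B\<^esub> frag_extend f ` cs c =
    tensor_relations p R B +>\<^bsub>free_pairs p R B\<^esub> frag_extend f c"
proof -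
  have hom: "frag_extend f \<in> hom (free_Abelian_group (carrier R \<times> carrier A))
      (free_Abelian_group (carrier R \<times> carrier B))"
    using k by (rule frag_extend_hom)
  show ?thesis
  proof (rule coset_image)
    show "abelian_subgroup (tensor_relations p R B) (free_pairs p R B)"
      by (rule tensor.abelian_subgroup_relations[OF T])
    show "abelian_subgroup (tensor_relations p R A) (free_pairs p R A)"
      by (rule abelian_subgroup_relations)
    show "frag_extend f \<in> carrier (free_pairs p R A) \<rightarrow> carrier (free_pairs p R B)"
      using hom by (auto simp: hom_def free_Abelian_group_def)
    show "frag_extend f ` tensor_relations p R A \<subseteq> tensor_relations p R B"
      unfolding tensor_relations_eq[of p R A]
      by (rule generate_frag_image[OF relators_carrier _ hom tensor.subgroup_relations[OF T] rel]) simp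
  qed (use c in \<open>auto simp: frag_extend_add\<close>)
qed

lemma frob_map_cs:
  assumes T: "tensor R B" and \<phi>: "\<phi> \<in> mod_hom R A B"
    and c: "Poly_Mapping.keys c \<subseteq> carrier R \<times> carrier A"
  shows "frob_map p R B \<phi> (cs c) = tensor_relations p R B +>\<^bsub>free_pairs p R B\<^esub>
      frag_extend (\<lambda>(r, m). frag_of (r, \<phi> m)) c"
  unfolding frob_map_def
proof (rule coset_frag_extend[OF T _ _ c])
  have \<phi>': "\<And>m. m \<in> carrier A \<Longrightarrow> \<phi> m \<in> carrier B"
    "\<And>m m'. m \<in> carrier A \<Longrightarrow> m' \<in> carrier A \<Longrightarrow> \<phi> (m \<oplus>\<^bsub>A\<^esub> m') = \<phi> m \<oplus>\<^bsub>B\<^esub> \<phi> m'"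
    "\<And>a m. a \<in> carrier R \<Longrightarrow> m \<in> carrier A \<Longrightarrow> \<phi> (a \<odot>\<^bsub>A\<^esub> m) = a \<odot>\<^bsub>B\<^esub> \<phi> m"
    using \<phi> by (auto simp: mod_hom_def)
  show "Poly_Mapping.keys (case x of (r, m) \<Rightarrow> frag_of (r, \<phi> m)) \<subseteq> carrier R \<times> carrier B"
    if "x \<in> carrier R \<times> carrier A" for x
    using that \<phi>'(1) by (auto simp: keys_frag_of)
  have "frag_extend (\<lambda>(r, m). frag_of (r, \<phi> m)) ` tensor_relators p R A \<subseteq> tensor_relators p R B"
    by (intro image_subsetI, erule tensor_relatorsE)
       (simp_all add: frag_extend_diff \<phi>' tensor_relatorsI)
  then show "frag_extend (\<lambda>(r, m). frag_of (r, \<phi> m)) ` tensor_relators p R A \<subseteq> tensor_relations p R B"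
    unfolding tensor_relations_eq by (blast intro: generate.incl)
qed

lemma frob_map_tensor:
  assumes T: "tensor R B" and \<phi>: "\<phi> \<in> mod_hom R A B" and r: "r \<in> carrier R" and m: "m \<in> carrier A"
  shows "frob_map p R B \<phi> (tens r m) = frob_tensor p R B r (\<phi> m)"
  using frob_map_cs[OF T \<phi>, of "frag_of (r, m)"] r m by (simp add: frob_tensor_def keys_frag_of)

lemma frob_map_add:
  assumes T: "tensor R B" and \<phi>: "\<phi> \<in> mod_hom R A B"
    and x: "x \<in> carrier (frob p R A)" and y: "y \<in> carrier (frob p R A)"
  shows "frob_map p R B \<phi> (x \<oplus>\<^bsub>frob p R A\<^esub> y) =
    frob_map p R B \<phi> x \<oplus>\<^bsub>frob p R B\<^esub> frob_map p R B \<phi> y"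
proof -
  interpret B: tensor R B p by fact
  let ?f = "frag_extend (\<lambda>(r, m). frag_of (r, \<phi> m))"
  have f: "?f \<in> hom (free_Abelian_group (carrier R \<times> carrier A))
      (free_Abelian_group (carrier R \<times> carrier B))"
    using \<phi> by (intro frag_extend_hom) (auto simp: mod_hom_def keys_frag_of)
  then have k: "Poly_Mapping.keys (?f c) \<subseteq> carrier R \<times> carrier B"
    if "Poly_Mapping.keys c \<subseteq> carrier R \<times> carrier A" for c
    using that by (auto simp: hom_def free_Abelian_group_def)
  from x y obtain c d where cd: "x = cs c" "y = cs d" "Poly_Mapping.keys c \<subseteq> carrier R \<times> carrier A"
    "Poly_Mapping.keys d \<subseteq> carrier R \<times> carrier A" unfolding carrier_frob by auto
  then have "Poly_Mapping.keys (c + d) \<subseteq> carrier R \<times> carrier A" using keys_add[of c d] by blast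
  then show ?thesis using cd k
    by (simp add: cs_add frob_map_cs[OF T \<phi>] B.cs_add frag_extend_add)
qed

lemma frob_map_closed:
  assumes T: "tensor R B" and \<phi>: "\<phi> \<in> mod_hom R A B" and x: "x \<in> carrier (frob p R A)"
  shows "frob_map p R B \<phi> x \<in> carrier (frob p R B)"
  using x
proof (induction x rule: tensor_induct)
  case (tensor r m)
  then show ?case using \<phi> by (auto simp: frob_map_tensor[OF T \<phi>] mod_hom_def intro!: tensor.tensor_closed[OF T])
next
  case (add x y)
  interpret F: abelian_group "frob p R B" by (rule tensor.abelian_group_frob[OF T])
  show ?case using add by (simp add: frob_map_add[OF T \<phi>])
qed

lemma tensor: "tensor R A" ..

lemma smult_cs:
  assumes a: "a \<in> carrier R" and c: "Poly_Mapping.keys c \<subseteq> carrier R \<times> carrier A"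
  shows "a \<odot>\<^bsub>frob p R A\<^esub> cs c = cs (frag_extend (\<lambda>(r, m). frag_of (a \<otimes> r, m)) c)"
proof -
  have "tensor_relations p R A <+>\<^bsub>free_pairs p R A\<^esub>
      frag_extend (\<lambda>(r, m). frag_of (a \<otimes> r, m)) ` cs c = cs (frag_extend (\<lambda>(r, m). frag_of (a \<otimes> r, m)) c)"
  proof (rule coset_frag_extend[OF tensor _ _ c])
    show "Poly_Mapping.keys (case x of (r, m) \<Rightarrow> frag_of (a \<otimes> r, m)) \<subseteq> carrier R \<times> carrier A"
      if "x \<in> carrier R \<times> carrier A" for x
      using that a by (auto simp: keys_frag_of)
    have *: "a \<otimes> (s [^] p \<otimes> r) = s [^] p \<otimes> (a \<otimes> r)" if "s \<in> carrier R" "r \<in> carrier R" for r s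
      using that a by (simp add: R.m_lcomm)
    have "frag_extend (\<lambda>(r, m). frag_of (a \<otimes> r, m)) ` tensor_relators p R A \<subseteq> tensor_relators p R A"
      by (intro image_subsetI, erule tensor_relatorsE)
        (simp_all add: frag_extend_diff a R.r_distr * tensor_relatorsI)
    then show "frag_extend (\<lambda>(r, m). frag_of (a \<otimes> r, m)) ` tensor_relators p R A \<subseteq> tensor_relations p R A"
      unfolding tensor_relations_eq by (blast intro: generate.incl)
  qed
  then show ?thesis by (simp add: frob_def quot_gmodule_def free_pairs_def)
qed

lemma smult_tensor:
  assumes a: "a \<in> carrier R" "r \<in> carrier R" "m \<in> carrier A"
  shows "a \<odot>\<^bsub>frob p R A\<^esub> tens r m = tens (a \<otimes> r) m"
  using smult_cs[of a "frag_of (r, m)"] a by (simp add: frob_tensor_def keys_frag_of)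

lemma smult_add_frob:
  assumes a: "a \<in> carrier R" and x: "x \<in> carrier (frob p R A)" and y: "y \<in> carrier (frob p R A)"
  shows "a \<odot>\<^bsub>frob p R A\<^esub> (x \<oplus>\<^bsub>frob p R A\<^esub> y) =
    (a \<odot>\<^bsub>frob p R A\<^esub> x) \<oplus>\<^bsub>frob p R A\<^esub> (a \<odot>\<^bsub>frob p R A\<^esub> y)"
proof -
  let ?f = "frag_extend (\<lambda>(r, m). frag_of (a \<otimes> r, m))"
  have f: "?f \<in> hom (free_Abelian_group (carrier R \<times> carrier A))
      (free_Abelian_group (carrier R \<times> carrier A))"
    using a by (intro frag_extend_hom) (auto simp: keys_frag_of)
  then have k: "Poly_Mapping.keys (?f c) \<subseteq> carrier R \<times> carrier A"
    if "Poly_Mapping.keys c \<subseteq> carrier R \<times> carrier A" for c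
    using that by (auto simp: hom_def free_Abelian_group_def)
  from x y obtain c d where cd: "x = cs c" "y = cs d" "Poly_Mapping.keys c \<subseteq> carrier R \<times> carrier A"
    "Poly_Mapping.keys d \<subseteq> carrier R \<times> carrier A" unfolding carrier_frob by auto
  then have "Poly_Mapping.keys (c + d) \<subseteq> carrier R \<times> carrier A" using keys_add[of c d] by blast
  then show ?thesis using cd k a
    by (simp add: cs_add smult_cs frag_extend_add)
qed

lemma smult_closed_frob:
  assumes a: "a \<in> carrier R" and x: "x \<in> carrier (frob p R A)"
  shows "a \<odot>\<^bsub>frob p R A\<^esub> x \<in> carrier (frob p R A)"
  using x
proof (induction x rule: tensor_induct)
  case (tensor r m)
  then show ?case using a by (simp add: smult_tensor tensor_closed)
next
  case (add x y)
  interpret F: abelian_group "frob p R A" by (rule abelian_group_frob)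
  show ?case using add a by (simp add: smult_add_frob)
qed

text \<open>No case for inverses is needed: the inverse of a homogeneous tensor is again one.\<close>

lemma tensor_hcomp_induct:
  assumes neg: "\<And>r i. r \<in> rcomp R i \<Longrightarrow> r \<in> carrier R \<and> \<ominus> r \<in> rcomp R i"
    and z: "z \<in> hcomp (frob p R A) d"
    and H: "\<And>j. subgroup (hcomp A j) (add_monoid A)"
    and zero: "\<zero> \<in> rcomp R d"
    and t: "\<And>r m i j. r \<in> rcomp R i \<Longrightarrow> m \<in> hcomp A j \<Longrightarrow> i + int p * j = d \<Longrightarrow> P (tens r m)"
    and add: "\<And>x y. x \<in> carrier (frob p R A) \<Longrightarrow> y \<in> carrier (frob p R A) \<Longrightarrow> P x \<Longrightarrow> P y \<Longrightarrow>
      P (x \<oplus>\<^bsub>frob p R A\<^esub> y)"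
  shows "P z"
proof -
  interpret F: abelian_group "frob p R A" by (rule abelian_group_frob)
  have Hc: "m \<in> carrier A" if "m \<in> hcomp A j" for m j
    using subgroup.subset[OF H] that by auto
  define X where "X = {frag_of (r, m) | r m. \<exists>i j. r \<in> rcomp R i \<and> m \<in> hcomp A j \<and> i + int p * j = d}"
  let ?G = "free_Abelian_group (carrier R \<times> carrier A)"
  have z0: "tens \<zero> m = \<zero>\<^bsub>frob p R A\<^esub>" if "m \<in> carrier A" for m
  proof -
    have "tens \<zero> m \<oplus>\<^bsub>frob p R A\<^esub> tens \<zero> m = tens \<zero> m"
      using that tensor_add_left[of \<zero> \<zero> m] by simp
    then show ?thesis using tensor_closed[of \<zero> m] that by simp
  qed
  have cs0: "cs 0 = \<zero>\<^bsub>frob p R A\<^esub>"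
    using abelian_group.a_coset_add_zero[OF abelian_group_free_pairs[of p R A], of "tensor_relations p R A"]
        subgroup.subset[OF subgroup_relations]
      by (simp add: frob_def quot_gmodule_def free_Abelian_group_def)
  have "c \<in> carrier ?G \<and> P (cs c)" if "c \<in> generate ?G X" for c
    using that
  proof (induction c rule: generate.induct)
    case one
    \<comment> \<open>Zero is written as \<open>0 \<otimes> 0\<close>, with the left factor in
      degree \<open>d\<close> of \<open>R\<close> and the right one in degree \<open>0\<close> of
      the module.\<close>
    have "P (tens \<zero> \<zero>\<^bsub>A\<^esub>)"
      by (rule t[of _ d _ 0]) (use subgroup.one_closed[OF H] zero in auto)
    then show ?case by (simp add: cs0 z0)
  next
    case (incl h)
    then show ?case by (auto simp: X_def keys_frag_of frob_tensor_def[symmetric] neg Hc intro: t)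
  next
    case (inv h)
    then obtain r m i j where h: "h = frag_of (r, m)" and rm: "r \<in> rcomp R i" "m \<in> hcomp A j" "i + int p * j = d"
      by (auto simp: X_def)
    have c: "r \<in> carrier R" "m \<in> carrier A" using neg[OF rm(1)] Hc[OF rm(2)] by auto
    have "cs (- frag_of (r, m)) \<oplus>\<^bsub>frob p R A\<^esub> cs (frag_of (r, m)) = cs 0"
      using c by (subst cs_add) (simp_all add: keys_frag_of)
    moreover have "tens (\<ominus> r) m \<oplus>\<^bsub>frob p R A\<^esub> tens r m = \<zero>\<^bsub>frob p R A\<^esub>"
      using tensor_add_left[of "\<ominus> r" r m] c by (simp add: R.l_neg z0)
    moreover have "cs (- frag_of (r, m)) \<in> carrier (frob p R A)"
      using c by (auto simp: carrier_frob keys_frag_of)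
    ultimately have "cs (- frag_of (r, m)) = tens (\<ominus> r) m"
      using tensor_closed[of r m] tensor_closed[of "\<ominus> r" m] c cs0
      by (metis F.minus_equality R.a_inv_closed frob_tensor_def)
    moreover have "P (tens (\<ominus> r) m)" using t[of "\<ominus> r" i m j] neg[OF rm(1)] rm by auto
    ultimately show ?case using c by (simp add: h keys_frag_of)
  next
    case (eng h1 h2)
    have "cs (h1 + h2) = cs h1 \<oplus>\<^bsub>frob p R A\<^esub> cs h2" using eng by (subst cs_add) auto
    moreover have "Poly_Mapping.keys (h1 + h2) \<subseteq> carrier R \<times> carrier A"
      using eng keys_add[of h1 h2] by auto
    ultimately show ?case using eng add[of "cs h1" "cs h2"] by (auto simp: carrier_frob)
  qed
  then show ?thesis using z by (auto simp: frob_def quot_gmodule_def free_pairs_def X_def)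
qed

lemma tensor_hcomp:
  assumes "r \<in> rcomp R i" "m \<in> hcomp A j" "i + int p * j = d"
  shows "tens r m \<in> hcomp (frob p R A) d"
proof -
  have "frag_of (r, m) \<in> hcomp (free_pairs p R A) d"
    using assms by (auto simp: free_pairs_def intro!: generate.incl)
  then show ?thesis by (auto simp: frob_def quot_gmodule_def frob_tensor_def)
qed

lemma frob_hcomp_closed:
  assumes R: "\<And>r i. r \<in> rcomp R i \<Longrightarrow> r \<in> carrier R"
    and A: "\<And>m j. m \<in> hcomp A j \<Longrightarrow> m \<in> carrier A"
  shows "\<zero>\<^bsub>frob p R A\<^esub> \<in> hcomp (frob p R A) d"
    and "x \<in> hcomp (frob p R A) d \<Longrightarrow> x \<in> carrier (frob p R A)"
    and "x \<in> hcomp (frob p R A) d \<Longrightarrow> y \<in> hcomp (frob p R A) d \<Longrightarrow>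
      x \<oplus>\<^bsub>frob p R A\<^esub> y \<in> hcomp (frob p R A) d"
proof -
  define X where "X = {frag_of (r, m) | r m. \<exists>i j. r \<in> rcomp R i \<and> m \<in> hcomp A j \<and> i + int p * j = d}"
  let ?G = "free_Abelian_group (carrier R \<times> carrier A)"
  have H: "hcomp (frob p R A) d = cs ` generate ?G X"
    by (simp add: frob_def quot_gmodule_def free_pairs_def X_def)
  have X: "X \<subseteq> carrier ?G" using R A by (auto simp: X_def keys_frag_of)
  have g: "generate ?G X \<subseteq> {c. Poly_Mapping.keys c \<subseteq> carrier R \<times> carrier A}"
    using group.generate_incl[OF group_free_Abelian_group X] by (auto simp: free_Abelian_group_def)
  have "cs 0 = \<zero>\<^bsub>frob p R A\<^esub>"
    using abelian_group.a_coset_add_zero[OF abelian_group_free_pairs[of p R A], of "tensor_relations p R A"]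
        subgroup.subset[OF subgroup_relations]
      by (simp add: frob_def quot_gmodule_def free_Abelian_group_def)
  then show "\<zero>\<^bsub>frob p R A\<^esub> \<in> hcomp (frob p R A) d"
    using generate.one[of ?G X] unfolding H by (metis image_eqI one_free_Abelian_group)
  show "x \<in> hcomp (frob p R A) d \<Longrightarrow> x \<in> carrier (frob p R A)"
    using g by (auto simp: H carrier_frob)
  assume "x \<in> hcomp (frob p R A) d" "y \<in> hcomp (frob p R A) d"
  then obtain c c' where c: "x = cs c" "y = cs c'" "c \<in> generate ?G X" "c' \<in> generate ?G X"
    by (auto simp: H)
  then have "c + c' \<in> generate ?G X" using generate.eng[of c ?G X c'] by simp
  moreover have "x \<oplus>\<^bsub>frob p R A\<^esub> y = cs (c + c')"
    unfolding c(1,2) by (rule cs_add) (use c g in auto)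
  ultimately show "x \<oplus>\<^bsub>frob p R A\<^esub> y \<in> hcomp (frob p R A) d" by (simp add: H)
qed

lemma module_frob:
  "Module.module R (frob p R A)"
proof (rule moduleI)
  interpret F: abelian_group "frob p R A" by (rule abelian_group_frob)
  show "cring R" by (rule R.cring_axioms)
  show "abelian_group (frob p R A)" by (rule abelian_group_frob)
  show "a \<odot>\<^bsub>frob p R A\<^esub> x \<in> carrier (frob p R A)" if "a \<in> carrier R" "x \<in> carrier (frob p R A)" for a x
    using that by (rule smult_closed_frob)
  show "a \<odot>\<^bsub>frob p R A\<^esub> (x \<oplus>\<^bsub>frob p R A\<^esub> y) = a \<odot>\<^bsub>frob p R A\<^esub> x \<oplus>\<^bsub>frob p R A\<^esub> a \<odot>\<^bsub>frob p R A\<^esub> y"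
    if "a \<in> carrier R" "x \<in> carrier (frob p R A)" "y \<in> carrier (frob p R A)" for a x y
    using that by (rule smult_add_frob)
  show "(a \<oplus> b) \<odot>\<^bsub>frob p R A\<^esub> x = a \<odot>\<^bsub>frob p R A\<^esub> x \<oplus>\<^bsub>frob p R A\<^esub> b \<odot>\<^bsub>frob p R A\<^esub> x"
    if ab: "a \<in> carrier R" "b \<in> carrier R" and x: "x \<in> carrier (frob p R A)" for a b x
    using x
  proof (induction x rule: tensor_induct)
    case (tensor r m)
    then show ?case using ab by (simp add: smult_tensor R.l_distr tensor_add_left)
  next
    case (add x y)
    then show ?case using ab by (simp add: smult_add_frob smult_closed_frob F.add.m_ac)
  qed
  show "(a \<otimes> b) \<odot>\<^bsub>frob p R A\<^esub> x = a \<odot>\<^bsub>frob p R A\<^esub> (b \<odot>\<^bsub>frob p R A\<^esub> x)"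
    if ab: "a \<in> carrier R" "b \<in> carrier R" and x: "x \<in> carrier (frob p R A)" for a b x
    using x
  proof (induction x rule: tensor_induct)
    case (tensor r m)
    then show ?case using ab by (simp add: smult_tensor R.m_assoc)
  next
    case (add x y)
    then show ?case using ab by (simp add: smult_add_frob smult_closed_frob)
  qed
  show "\<one> \<odot>\<^bsub>frob p R A\<^esub> x = x" if x: "x \<in> carrier (frob p R A)" for x
    using x
  proof (induction x rule: tensor_induct)
    case (tensor r m)
    then show ?case by (simp add: smult_tensor)
  next
    case (add x y)
    then show ?case by (simp add: smult_add_frob)
  qed
qed

lemma tensor_frob: "tensor R (frob p R A)"
  using module_frob by (simp add: tensor_def)

end

text \<open>The two records may have different extension fields, so \<open>frob\<close> of an
  F-module can be identified with \<open>frob\<close> of the graded module that it extends.\<close>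

lemma frob_cong:
  assumes "carrier M = carrier N" "ring.add M = ring.add N" "module.smult M = module.smult N" "hcomp M = hcomp N"
  shows "frob p R M = frob p R N" "frob_tensor p R M = frob_tensor p R N"
proof -
  have 1: "free_pairs p R M = free_pairs p R N" using assms by (simp add: free_pairs_def)
  have 2: "tensor_relations p R M = tensor_relations p R N" using assms by (simp add: tensor_relations_def)
  show "frob p R M = frob p R N" "frob_tensor p R M = frob_tensor p R N"
    using 1 2 by (simp_all add: frob_def frob_tensor_def fun_eq_iff)
qed


section \<open>Polynomial rings in characteristic p\<close>

lemma poly_mapping_sum_single: "f = (\<Sum>m\<in>Poly_Mapping.keys f. Poly_Mapping.single m (Poly_Mapping.lookup f m))"
  by (rule poly_mapping_eqI) (auto simp: lookup_sum lookup_single when_def in_keys_iff sum.delta')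

lemma lookup_single_mult:
  fixes u :: "nat \<Rightarrow>\<^sub>0 nat"
  shows "Poly_Mapping.lookup (Poly_Mapping.single u c * f) (u + m) = c * Poly_Mapping.lookup f m"
proof -
  have "(\<lambda>l. Poly_Mapping.lookup (Poly_Mapping.single u c) l *
      (\<Sum>q. Poly_Mapping.lookup f q when u + m = l + q)) = (\<lambda>l. c * Poly_Mapping.lookup f m when l = u)"
    by (auto simp: fun_eq_iff lookup_single when_def)
  then show ?thesis by (simp only: lookup_mult) simp
qed

lemma lookup_single_mult_zero:
  fixes u :: "nat \<Rightarrow>\<^sub>0 nat"
  assumes "\<And>m'. m \<noteq> u + m'"
  shows "Poly_Mapping.lookup (Poly_Mapping.single u c * f) m = 0"
proof -
  have "(\<lambda>l. Poly_Mapping.lookup (Poly_Mapping.single u c) l *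
      (\<Sum>q. Poly_Mapping.lookup f q when m = l + q)) = (\<lambda>l. 0)"
    using assms by (auto simp: fun_eq_iff lookup_single when_def)
  then show ?thesis by (simp only: lookup_mult) simp
qed

lemma keys_plus_nat: "Poly_Mapping.keys (a + b :: 'a \<Rightarrow>\<^sub>0 nat) = Poly_Mapping.keys a \<union> Poly_Mapping.keys b"
  by (auto simp: in_keys_iff lookup_add)

section \<open>The polynomial ring as a graded ring\<close>

lemma poly_ring_simps [simp]:
  "x \<oplus>\<^bsub>poly_ring n\<^esub> y = x + y" "x \<otimes>\<^bsub>poly_ring n\<^esub> y = x * y"
  "\<one>\<^bsub>poly_ring n\<^esub> = 1" "\<zero>\<^bsub>poly_ring n\<^esub> = 0"
  by (auto simp: poly_ring_def Let_def)

lemma poly_ring_pow [simp]: "x [^]\<^bsub>poly_ring n\<^esub> (k::nat) = x ^ k"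
  by (induction k) (simp_all add: nat_pow_def mult.commute)

lemma in_poly_ring: "f \<in> carrier (poly_ring n) \<longleftrightarrow>
    (\<forall>m\<in>Poly_Mapping.keys f. Poly_Mapping.keys m \<subseteq> {..<n})"
  by (simp add: poly_ring_def Let_def)

lemma in_rcomp: "f \<in> rcomp (poly_ring n) d \<longleftrightarrow>
    f \<in> carrier (poly_ring n) \<and> (\<forall>m\<in>Poly_Mapping.keys f. int (mdeg m) = d)"
  by (simp add: poly_ring_def Let_def)

lemma poly_ring_add_closed [simp]:
  "f \<in> carrier (poly_ring n) \<Longrightarrow> g \<in> carrier (poly_ring n) \<Longrightarrow> f + g \<in> carrier (poly_ring n)"
  using keys_add[of f g] by (auto simp: in_poly_ring)

lemma poly_ring_closed [simp]:
  "0 \<in> carrier (poly_ring n)" "1 \<in> carrier (poly_ring n)"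
  "f \<in> carrier (poly_ring n) \<Longrightarrow> - f \<in> carrier (poly_ring n)"
  by (auto simp: in_poly_ring)

lemma poly_ring_mult_closed [simp]:
  "f \<in> carrier (poly_ring n) \<Longrightarrow> g \<in> carrier (poly_ring n) \<Longrightarrow> f * g \<in> carrier (poly_ring n)"
  using keys_mult[of f g] by (fastforce simp: in_poly_ring keys_plus_nat)

lemma poly_ring_power_closed [simp]: "f \<in> carrier (poly_ring n) \<Longrightarrow> f ^ k \<in> carrier (poly_ring n)"
  by (induction k) auto

lemma poly_ring_sum_closed:
  "(\<And>i. i \<in> I \<Longrightarrow> f i \<in> carrier (poly_ring n)) \<Longrightarrow> (\<Sum>i\<in>I. f i) \<in> carrier (poly_ring n)"
  by (induction I rule: infinite_finite_induct) auto

lemma single_in_poly_ring [simp]: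
  "Poly_Mapping.single m c \<in> carrier (poly_ring n) \<longleftrightarrow> c = 0 \<or> Poly_Mapping.keys m \<subseteq> {..<n}"
  by (auto simp: in_poly_ring)

lemma cring_poly_ring: "cring (poly_ring n :: 'k::field mpol graded_ring)"
proof (rule cringI)
  show "abelian_group (poly_ring n :: 'k mpol graded_ring)"
  proof (rule abelian_groupI)
    fix x :: "'k mpol" assume "x \<in> carrier (poly_ring n)"
    then show "\<exists>y\<in>carrier (poly_ring n). y \<oplus>\<^bsub>poly_ring n\<^esub> x = \<zero>\<^bsub>poly_ring n\<^esub>"
      by (intro bexI[of _ "- x"]) auto
  qed auto
  show "comm_monoid (poly_ring n :: 'k mpol graded_ring)"
    by (rule comm_monoidI) (auto simp: algebra_simps)
qed (auto simp: algebra_simps)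

lemma poly_ring_minus [simp]: "x \<in> carrier (poly_ring n) \<Longrightarrow> \<ominus>\<^bsub>poly_ring n\<^esub> x = (- x :: 'k::field mpol)"
proof -
  assume x: "x \<in> carrier (poly_ring n)"
  interpret cring "poly_ring n :: 'k mpol graded_ring" by (rule cring_poly_ring)
  show ?thesis using minus_equality[of "- x" x] x by simp
qed

lemma poly_ring_induct [consumes 1, case_names single add]:
  assumes f: "f \<in> carrier (poly_ring n)"
    and single: "\<And>m c. Poly_Mapping.keys m \<subseteq> {..<n} \<Longrightarrow> P (Poly_Mapping.single m c)"
    and add: "\<And>f g. f \<in> carrier (poly_ring n) \<Longrightarrow> g \<in> carrier (poly_ring n) \<Longrightarrow> P f \<Longrightarrow> P g \<Longrightarrow> P (f + g)"
  shows "P f"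
proof -
  have P0: "P 0" using single[of 0 0] by simp
  have "P (\<Sum>m\<in>K. Poly_Mapping.single m (Poly_Mapping.lookup f m))"
    if "finite K" "K \<subseteq> Poly_Mapping.keys f" for K
    using that
  proof (induction K rule: finite_induct)
    case (insert x K)
    have "Poly_Mapping.keys m \<subseteq> {..<n}" if "m \<in> insert x K" for m
      using f insert.prems that unfolding in_poly_ring by blast
    then show ?case using insert
      by (auto intro!: add single poly_ring_sum_closed)
  qed (use P0 in auto)
  from this[of "Poly_Mapping.keys f"] show ?thesis using poly_mapping_sum_single[of f] by simp
qed

lemma mdeg_add: "mdeg (a + b) = mdeg a + mdeg b"
proof -
  let ?K = "Poly_Mapping.keys a \<union> Poly_Mapping.keys b"
  have 1: "mdeg a = sum (Poly_Mapping.lookup a) ?K" "mdeg b = sum (Poly_Mapping.lookup b) ?K"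
    unfolding mdeg_def by (rule sum.mono_neutral_left; auto simp: in_keys_iff)+
  show ?thesis unfolding 1 by (simp add: mdeg_def keys_plus_nat lookup_add sum.distrib)
qed

lemma mdeg_zero [simp]: "mdeg 0 = 0" by (simp add: mdeg_def)

lemma rcomp_closed:
  "0 \<in> rcomp (poly_ring n) d"
  "f \<in> rcomp (poly_ring n) d \<Longrightarrow> - f \<in> rcomp (poly_ring n) d"
  "f \<in> rcomp (poly_ring n) d \<Longrightarrow> g \<in> rcomp (poly_ring n) d \<Longrightarrow> f + g \<in> rcomp (poly_ring n) d"
  "f \<in> rcomp (poly_ring n) i \<Longrightarrow> g \<in> rcomp (poly_ring n) j \<Longrightarrow> f * g \<in> rcomp (poly_ring n) (i + j)"
  using keys_add[of f g] keys_mult[of f g] by (fastforce simp: in_rcomp mdeg_add)+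

lemma rcomp_carrier: "f \<in> rcomp (poly_ring n) d \<Longrightarrow> f \<in> carrier (poly_ring n)"
  by (simp add: in_rcomp)

lemma single_in_rcomp: "Poly_Mapping.keys m \<subseteq> {..<n} \<Longrightarrow> int (mdeg m) = d \<Longrightarrow>
    Poly_Mapping.single m c \<in> rcomp (poly_ring n) d"
  by (simp add: in_rcomp)

lemma one_in_rcomp: "1 \<in> rcomp (poly_ring n) 0"
  by (simp add: in_rcomp)

section \<open>Exponent vectors: multiples, quotients and remainders\<close>

definition mscale :: "nat \<Rightarrow> (nat \<Rightarrow>\<^sub>0 nat) \<Rightarrow> nat \<Rightarrow>\<^sub>0 nat" where
  "mscale k m = Poly_Mapping.map ((*) k) m"

lemma lookup_mscale [simp]: "Poly_Mapping.lookup (mscale k m) i = k * Poly_Mapping.lookup m i"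
  by (auto simp: mscale_def map.rep_eq when_def)

lemma mscale_simps [simp]: "mscale k 0 = 0" "mscale 0 m = 0"
  by (auto intro!: poly_mapping_eqI)

lemma mscale_add: "mscale k (a + b) = mscale k a + mscale k b"
  by (rule poly_mapping_eqI) (simp add: lookup_add algebra_simps)

lemma mscale_Suc: "mscale (Suc k) a = a + mscale k a"
  by (rule poly_mapping_eqI) (simp add: lookup_add algebra_simps)

lemma keys_mscale [simp]: "k > 0 \<Longrightarrow> Poly_Mapping.keys (mscale k m) = Poly_Mapping.keys m"
  by (auto simp: in_keys_iff)

lemma mdeg_mscale: "mdeg (mscale k m) = k * mdeg m"
  by (induction k) (simp_all add: mscale_Suc mdeg_add)

lemma single_power: "Poly_Mapping.single u c ^ k = Poly_Mapping.single (mscale k u) (c ^ k :: 'k::field)"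
  by (induction k) (simp_all add: mscale_Suc mult_single)

lemma mscale_inj: "k > 0 \<Longrightarrow> mscale k a = mscale k b \<Longrightarrow> a = b"
  by (metis lookup_mscale mult_cancel1 not_gr_zero poly_mapping_eqI)

definition mquot :: "nat \<Rightarrow> (nat \<Rightarrow>\<^sub>0 nat) \<Rightarrow> nat \<Rightarrow>\<^sub>0 nat" where
  "mquot k m = Poly_Mapping.map (\<lambda>i. i div k) m"

definition mrem :: "nat \<Rightarrow> (nat \<Rightarrow>\<^sub>0 nat) \<Rightarrow> nat \<Rightarrow>\<^sub>0 nat" where
  "mrem k m = Poly_Mapping.map (\<lambda>i. i mod k) m"

lemma lookup_mquot [simp]: "Poly_Mapping.lookup (mquot k m) i = Poly_Mapping.lookup m i div k"
  and lookup_mrem [simp]: "Poly_Mapping.lookup (mrem k m) i = Poly_Mapping.lookup m i mod k"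
  by (auto simp: mquot_def mrem_def map.rep_eq when_def)

lemma mquot_mrem: "mscale k (mquot k m) + mrem k m = m"
  by (rule poly_mapping_eqI) (simp add: lookup_add)

definition mbox :: "nat \<Rightarrow> nat \<Rightarrow> (nat \<Rightarrow>\<^sub>0 nat) set" where
  "mbox n k = {r. Poly_Mapping.keys r \<subseteq> {..<n} \<and> (\<forall>i. Poly_Mapping.lookup r i < k)}"

text \<open>Division with remainder in each coordinate, the box bounding the remainders.\<close>

lemma mbox_unique:
  assumes "mscale k s + r = mscale k s' + r'" "r \<in> mbox n k" "r' \<in> mbox n' k"
  shows "s = s'" "r = r'"
proof -
  have *: "k * Poly_Mapping.lookup s i + Poly_Mapping.lookup r i =
      k * Poly_Mapping.lookup s' i + Poly_Mapping.lookup r' i" for i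
    using assms(1)[THEN arg_cong, of "\<lambda>m. Poly_Mapping.lookup m i"] by (simp add: lookup_add)
  have lt: "Poly_Mapping.lookup r i < k" "Poly_Mapping.lookup r' i < k" for i
    using assms by (auto simp: mbox_def)
  have "Poly_Mapping.lookup s i = Poly_Mapping.lookup s' i" for i
  proof -
    have "(k * Poly_Mapping.lookup s i + Poly_Mapping.lookup r i) div k = Poly_Mapping.lookup s i"
      "(k * Poly_Mapping.lookup s' i + Poly_Mapping.lookup r' i) div k = Poly_Mapping.lookup s' i"
      using lt[of i] by simp_all
    then show ?thesis using *[of i] by simp
  qed
  then show "s = s'" by (rule poly_mapping_eqI)
  then show "r = r'" using assms(1) by simp
qed

lemma mrem_mbox: "k > 0 \<Longrightarrow> Poly_Mapping.keys m \<subseteq> {..<n} \<Longrightarrow> mrem k m \<in> mbox n k"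
  by (auto simp: mbox_def in_keys_iff subset_iff) (metis mod_0 not_gr_zero)

lemma mquot_keys: "Poly_Mapping.keys (mquot k m) \<subseteq> Poly_Mapping.keys m"
  by (auto simp: in_keys_iff) (metis div_0 not_gr_zero)

text \<open>For \<open>k = p\<close> this bound produces the window of degrees in
  \<open>mono_kernel\<close>: if \<open>p e + mdeg r = d\<close> and \<open>d \<ge> -n\<close>, then
  \<open>p e \<ge> -n - n (p - 1)\<close>, so \<open>e \<ge> -n\<close>.\<close>

lemma mdeg_mbox:
  assumes "r \<in> mbox n k" shows "mdeg r \<le> n * (k - 1)"
proof -
  have "mdeg r \<le> (\<Sum>i\<in>Poly_Mapping.keys r. k - 1)"
    unfolding mdeg_def using assms by (intro sum_mono) (simp add: mbox_def Suc_leI le_diff_conv2 less_Suc_eq_le[symmetric] le_eq_less_or_eq, metis One_nat_def Suc_pred less_Suc_eq not_less_zero zero_less_iff_neq_zero)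
  also have "\<dots> = card (Poly_Mapping.keys r) * (k - 1)" by simp
  also have "\<dots> \<le> n * (k - 1)"
    using assms card_mono[of "{..<n}" "Poly_Mapping.keys r"] by (intro mult_right_mono) (auto simp: mbox_def)
  finally show ?thesis .
qed

section \<open>Characteristic \<open>p\<close>: the ring \<open>R'\<close> as a free right module
  over \<open>R\<close>\<close>

locale char_p =
  fixes p n :: nat and ty :: "'k::field itself"
  assumes p_CHAR: "p = CHAR('k)" and p_pos: "p > 0"
begin

lemma prime_p: "prime p"
  using prime_CHAR_semidom[where 'a = 'k] p_CHAR p_pos by simp

lemma CHAR_mpol: "CHAR('k mpol) = p"
proof (rule CHAR_eqI)
  have *: "(of_nat m :: 'k mpol) = Poly_Mapping.single 0 (of_nat m)" for m by simp
  have "Poly_Mapping.single 0 (of_nat p :: 'k) = (0 :: 'k mpol)" by (simp only: p_CHAR of_nat_CHAR single_zero)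
  then show "(of_nat p :: 'k mpol) = 0" by (simp only: *)
  show "p dvd m" if "(of_nat m :: 'k mpol) = 0" for m
  proof -
    have "(of_nat m :: 'k) = Poly_Mapping.lookup (of_nat m :: 'k mpol) 0" by (simp add: lookup_of_nat)
    then show ?thesis using that by (simp add: p_CHAR of_nat_eq_0_iff_char_dvd)
  qed
qed

lemma frob_add_field: "(x + y :: 'k) ^ p = x ^ p + y ^ p"
  by (rule freshmans_dream) (simp_all add: p_CHAR[symmetric] prime_p)

lemma frob_add_mpol: "(x + y :: 'k mpol) ^ p = x ^ p + y ^ p"
  by (rule freshmans_dream) (simp_all add: CHAR_mpol prime_p)

text \<open>The field acts on itself through the Frobenius. A basis for this action is a basis over
  the subfield of \<open>p\<close>-th powers, and a coefficient in it is already the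
  \<open>p\<close>-th root of the usual one; hence the form of \<open>frep_scale\<close> and
  \<open>frep_sum\<close>.\<close>

sublocale V: vector_space "\<lambda>c x :: 'k. c ^ p * x"
  by unfold_locales (simp_all add: frob_add_field algebra_simps power_mult_distrib)

definition fb :: "'k set" where "fb = V.extend_basis {}"

lemma fb: "V.independent fb" "V.span fb = UNIV"
  unfolding fb_def by (simp_all add: V.independent_extend_basis V.independent_empty V.span_extend_basis)

definition frep :: "'k \<Rightarrow> 'k \<Rightarrow> 'k" where "frep b x = V.representation fb x b"

lemma frep_add: "frep b (x + y) = frep b x + frep b y"
  using V.representation_add[OF fb(1), of y x] fb(2) by (simp add: frep_def)

lemma frep_zero [simp]: "frep b 0 = 0"
  by (simp add: frep_def V.representation_zero)

lemma frep_scale: "frep b (c ^ p * x) = c * frep b x"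
  using V.representation_scale[OF fb(1), of x c] fb(2) by (simp add: frep_def)

lemma finite_frep: "finite {b. frep b x \<noteq> 0}"
  by (simp add: frep_def V.finite_representation)

lemma frep_fb: "frep b x \<noteq> 0 \<Longrightarrow> b \<in> fb"
  using V.representation_ne_zero[of fb x b] by (simp add: frep_def)

lemma frep_sum: "(\<Sum>b | frep b x \<noteq> 0. frep b x ^ p * b) = x"
  using V.sum_nonzero_representation_eq[OF fb(1), of x] fb(2) by (simp add: frep_def)

abbreviation R :: "'k mpol graded_ring" where "R \<equiv> poly_ring n"

text \<open>The index set of a basis of \<open>R'\<close> as a right \<open>R\<close>-module: the products \<open>b x\<^sup>r\<close> with \<open>b\<close> in a basis of the
  field over its \<open>p\<close>-th powers and all exponents of \<open>x\<^sup>r\<close> below \<open>p\<close>.\<close>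

definition fidx :: "('k \<times> (nat \<Rightarrow>\<^sub>0 nat)) set" where "fidx = fb \<times> mbox n p"

definition fbasis :: "'k \<times> (nat \<Rightarrow>\<^sub>0 nat) \<Rightarrow> 'k mpol" where
  "fbasis j = Poly_Mapping.single (snd j) (fst j)"

text \<open>With \<open>j = (b, r)\<close>, the coefficient at \<open>s\<close> is the
  \<open>b\<close>-component of the coefficient of \<open>f\<close> at \<open>p s + r\<close>. This
  is forced by the expansion of \<open>f\<close> into the terms \<open>(fcoord j f)^p b x^r\<close>,
  because each exponent is \<open>p s + r\<close> for exactly one \<open>s\<close> and one
  \<open>r\<close> in the box.\<close>

definition fcoord :: "'k \<times> (nat \<Rightarrow>\<^sub>0 nat) \<Rightarrow> 'k mpol \<Rightarrow> 'k mpol" where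
  "fcoord j f = Abs_poly_mapping (\<lambda>s. frep (fst j) (Poly_Mapping.lookup f (mscale p s + snd j)))"

lemma lookup_fcoord: "Poly_Mapping.lookup (fcoord j f) s = frep (fst j) (Poly_Mapping.lookup f (mscale p s + snd j))"
proof -
  have "{s. frep (fst j) (Poly_Mapping.lookup f (mscale p s + snd j)) \<noteq> 0} \<subseteq>
      (\<lambda>s. mscale p s + snd j) -` Poly_Mapping.keys f"
    by (auto simp: in_keys_iff)
  moreover have "finite \<dots>"
    by (rule finite_vimageI) (auto intro!: injI dest: mscale_inj[OF p_pos])
  ultimately have "finite {s. frep (fst j) (Poly_Mapping.lookup f (mscale p s + snd j)) \<noteq> 0}"
    by (rule finite_subset)
  then show ?thesis by (simp add: fcoord_def)
qed

lemma fcoord_keys: "s \<in> Poly_Mapping.keys (fcoord j f) \<Longrightarrow> mscale p s + snd j \<in> Poly_Mapping.keys f"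
  using frep_zero[of "fst j"] by (auto simp: in_keys_iff lookup_fcoord)

lemma fcoord_add: "fcoord j (f + g) = fcoord j f + fcoord j g"
  by (rule poly_mapping_eqI) (simp add: lookup_fcoord lookup_add frep_add)

lemma fcoord_closed: "f \<in> carrier R \<Longrightarrow> fcoord j f \<in> carrier R"
  using fcoord_keys[of _ j f] unfolding in_poly_ring by (metis (no_types, lifting) keys_mscale keys_plus_nat le_sup_iff p_pos)

text \<open>Linearity for the right action of \<open>R\<close> on \<open>R'\<close>. It suffices to
  treat \<open>s = x^u\<close>; the remainder \<open>snd j\<close> has entries below
  \<open>p\<close>, so if \<open>p m + snd j\<close> is divisible by \<open>x^u\<close> to the power
  \<open>p\<close>, then \<open>u\<close> is already at most \<open>m\<close> in every
  coordinate.\<close>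

lemma fcoord_frob:
  assumes j: "snd j \<in> mbox n p" and s: "s \<in> carrier R"
  shows "fcoord j (s ^ p * f) = s * fcoord j f"
  using s
proof (induction s rule: poly_ring_induct)
  case (single u c)
  show ?case
  proof (rule poly_mapping_eqI)
    fix m
    show "Poly_Mapping.lookup (fcoord j (Poly_Mapping.single u c ^ p * f)) m =
      Poly_Mapping.lookup (Poly_Mapping.single u c * fcoord j f) m"
    proof (cases "\<exists>m'. m = u + m'")
      case True
      then obtain m' where m: "m = u + m'" by auto
      have "mscale p m + snd j = mscale p u + (mscale p m' + snd j)"
        by (simp add: m mscale_add ac_simps)
      then show ?thesis
        by (simp only: lookup_fcoord single_power m lookup_single_mult frep_scale)
    next
      case False
      then have z: "Poly_Mapping.lookup (Poly_Mapping.single u c * fcoord j f) m = 0"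
        by (intro lookup_single_mult_zero) auto
      have "mscale p m + snd j \<noteq> mscale p u + m'" for m'
      proof
        assume a: "mscale p m + snd j = mscale p u + m'"
        have "Poly_Mapping.lookup u i \<le> Poly_Mapping.lookup m i" for i
        proof (rule ccontr)
          assume "\<not> ?thesis"
          then have "Suc (Poly_Mapping.lookup m i) \<le> Poly_Mapping.lookup u i" by simp
          from mult_le_mono2[OF this, of p]
          have "p + p * Poly_Mapping.lookup m i \<le> p * Poly_Mapping.lookup u i" by simp
          moreover have "p * Poly_Mapping.lookup m i + Poly_Mapping.lookup (snd j) i =
            p * Poly_Mapping.lookup u i + Poly_Mapping.lookup m' i"
            using a[THEN arg_cong, of "\<lambda>m. Poly_Mapping.lookup m i"] by (simp add: lookup_add)
          moreover have "Poly_Mapping.lookup (snd j) i < p" using j by (auto simp: mbox_def)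
          ultimately show False by linarith
        qed
        then have "m = u + (m - u)"
          by (intro poly_mapping_eqI) (simp add: lookup_add lookup_minus)
        then show False using False by blast
      qed
      then have "Poly_Mapping.lookup (Poly_Mapping.single (mscale p u) (c ^ p) * f) (mscale p m + snd j) = 0"
        by (rule lookup_single_mult_zero)
      then show ?thesis by (simp only: z lookup_fcoord single_power frep_zero)
    qed
  qed
next
  case (add s t)
  then show ?case by (simp add: frob_add_mpol fcoord_add algebra_simps)
qed

text \<open>The basis may be infinite, so the sum runs over a finite index set. Allowing every
  finite superset of \<open>J0\<close> lets the expansions of two polynomials be added over a common
  index set.\<close>

lemma fcoord_recon:
  assumes "f \<in> carrier R"
  shows "\<exists>J0\<subseteq>fidx. finite J0 \<and> (\<forall>J. finite J \<and> J0 \<subseteq> J \<and> J \<subseteq> fidx \<longrightarrow> f = (\<Sum>j\<in>J. fcoord j f ^ p * fbasis j))"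
  using assms
proof (induction f rule: poly_ring_induct)
  case (single m c)
  let ?s = "mquot p m" and ?r = "mrem p m"
  let ?J0 = "{b. frep b c \<noteq> 0} \<times> {?r}"
  have r: "?r \<in> mbox n p" using single p_pos by (intro mrem_mbox)
  have fc: "fcoord (b, r') (Poly_Mapping.single m c) = (if r' = ?r then Poly_Mapping.single ?s (frep b c) else 0)"
    if "r' \<in> mbox n p" for b r'
  proof (rule poly_mapping_eqI)
    fix s
    have "m = mscale p s + r' \<longleftrightarrow> r' = ?r \<and> s = ?s"
      using mbox_unique[of p s r' ?s ?r, OF _ that r] mquot_mrem[of p m] by auto
    then show "Poly_Mapping.lookup (fcoord (b, r') (Poly_Mapping.single m c)) s =
      Poly_Mapping.lookup (if r' = ?r then Poly_Mapping.single ?s (frep b c) else 0) s"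
      by (auto simp: lookup_fcoord lookup_single when_def)
  qed
  have "Poly_Mapping.single m c = (\<Sum>j\<in>J. fcoord j (Poly_Mapping.single m c) ^ p * fbasis j)"
    if J: "finite J" "?J0 \<subseteq> J" "J \<subseteq> fidx" for J
  proof -
    have "(\<Sum>j\<in>J. fcoord j (Poly_Mapping.single m c) ^ p * fbasis j) =
        (\<Sum>j\<in>?J0. fcoord j (Poly_Mapping.single m c) ^ p * fbasis j)"
    proof (rule sum.mono_neutral_right[OF J(1,2)], intro ballI)
      fix j assume j: "j \<in> J - ?J0"
      obtain b r' where br: "j = (b, r')" by (cases j)
      have "r' \<in> mbox n p" using j J(3) by (auto simp: br fidx_def)
      then have "fcoord j (Poly_Mapping.single m c) = 0"
        unfolding br using fc[of r' b] j by (auto simp: br)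
      then show "fcoord j (Poly_Mapping.single m c) ^ p * fbasis j = 0"
        using p_pos by (simp add: zero_power)
    qed
    also have "\<dots> = (\<Sum>b | frep b c \<noteq> 0. fcoord (b, ?r) (Poly_Mapping.single m c) ^ p * fbasis (b, ?r))"
      by (rule sum.reindex_bij_witness[of _ "\<lambda>b. (b, ?r)" fst]) (auto split: prod.splits)
    also have "\<dots> = (\<Sum>b | frep b c \<noteq> 0. Poly_Mapping.single m (frep b c ^ p * b))"
      by (rule sum.cong) (auto simp: fc[OF r] single_power mult_single fbasis_def mquot_mrem)
    also have "\<dots> = Poly_Mapping.single m (\<Sum>b | frep b c \<noteq> 0. frep b c ^ p * b)"
      by (rule poly_mapping_eqI) (simp add: lookup_sum lookup_single when_def)
    finally show ?thesis by (simp add: frep_sum)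
  qed
  moreover have "?J0 \<subseteq> fidx" using r frep_fb by (auto simp: fidx_def)
  moreover have "finite ?J0" using finite_frep by auto
  ultimately show ?case by blast
next
  case (add f g)
  from add(3) obtain J1 where J1: "J1 \<subseteq> fidx" "finite J1"
    and f: "\<And>J. finite J \<and> J1 \<subseteq> J \<and> J \<subseteq> fidx \<Longrightarrow> f = (\<Sum>j\<in>J. fcoord j f ^ p * fbasis j)"
    by (elim exE conjE) blast
  from add(4) obtain J2 where J2: "J2 \<subseteq> fidx" "finite J2"
    and g: "\<And>J. finite J \<and> J2 \<subseteq> J \<and> J \<subseteq> fidx \<Longrightarrow> g = (\<Sum>j\<in>J. fcoord j g ^ p * fbasis j)"
    by (elim exE conjE) blast
  have "f + g = (\<Sum>j\<in>J. fcoord j (f + g) ^ p * fbasis j)"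
    if "finite J" "J1 \<union> J2 \<subseteq> J" "J \<subseteq> fidx" for J
    using f[of J] g[of J] that by (simp add: fcoord_add frob_add_mpol distrib_right sum.distrib)
  moreover have "J1 \<union> J2 \<subseteq> fidx" "finite (J1 \<union> J2)" using J1 J2 by auto
  ultimately show ?case by blast
qed

lemma fbasis_closed: "j \<in> fidx \<Longrightarrow> fbasis j \<in> rcomp R (int (mdeg (snd j)))"
  by (auto simp: fidx_def mbox_def fbasis_def intro!: single_in_rcomp)

text \<open>The term \<open>(x^s)^p * x^r\<close> has degree \<open>p * mdeg s + mdeg r\<close>, and
  this is solved for \<open>mdeg s\<close>.\<close>

lemma fcoord_degree:
  assumes "f \<in> rcomp R d" "int p * e + int (mdeg (snd j)) = d"
  shows "fcoord j f \<in> rcomp R e"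
proof -
  have "int (mdeg s) = e" if "s \<in> Poly_Mapping.keys (fcoord j f)" for s
  proof -
    have "int (mdeg (mscale p s + snd j)) = d"
      using fcoord_keys[OF that] assms(1) by (auto simp: in_rcomp)
    then have "int p * int (mdeg s) + int (mdeg (snd j)) = d" by (simp add: mdeg_add mdeg_mscale)
    then have "int p * int (mdeg s) = int p * e" using assms(2) by linarith
    then show ?thesis using p_pos by (metis mult_cancel_left of_nat_eq_0_iff not_gr_zero)
  qed
  then show ?thesis using assms(1) fcoord_closed[of f j] by (simp add: in_rcomp)
qed

lemma fcoord_degree_zero:
  assumes "f \<in> rcomp R d" "\<And>e. int p * e + int (mdeg (snd j)) \<noteq> d"
  shows "fcoord j f = 0"
proof -
  have "Poly_Mapping.keys (fcoord j f) = {}"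
  proof (rule ccontr)
    assume "Poly_Mapping.keys (fcoord j f) \<noteq> {}"
    then obtain s where "s \<in> Poly_Mapping.keys (fcoord j f)" by blast
    from fcoord_keys[OF this] have "int (mdeg (mscale p s + snd j)) = d"
      using assms(1) by (auto simp: in_rcomp)
    then show False using assms(2)[of "int (mdeg s)"] by (simp add: mdeg_add mdeg_mscale)
  qed
  then show ?thesis by simp
qed

end


section \<open>Homogeneous parts\<close>

context graded_module
begin

definition hpart :: "int \<Rightarrow> 'b \<Rightarrow> 'b" where
  "hpart d x = (THE c. (\<forall>d. c d \<in> hcomp M d) \<and> finite {d. c d \<noteq> \<zero>\<^bsub>M\<^esub>} \<and>
           x = finsum M c {d. c d \<noteq> \<zero>\<^bsub>M\<^esub>}) d"

lemma hcomp_carrier: "x \<in> hcomp M d \<Longrightarrow> x \<in> carrier M"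
  using subgroup.subset[OF hcomp_subgroup] by auto

lemma hcomp_zero [simp]: "\<zero>\<^bsub>M\<^esub> \<in> hcomp M d"
  using subgroup.one_closed[OF hcomp_subgroup] by auto

lemma hcomp_add: "x \<in> hcomp M d \<Longrightarrow> y \<in> hcomp M d \<Longrightarrow> x \<oplus>\<^bsub>M\<^esub> y \<in> hcomp M d"
  using subgroup.m_closed[OF hcomp_subgroup] by auto

lemma hcomp_minus: "x \<in> hcomp M d \<Longrightarrow> \<ominus>\<^bsub>M\<^esub> x \<in> hcomp M d"
  using subgroup.m_inv_closed[OF hcomp_subgroup] by (auto simp: a_inv_def)

lemma hpart_props:
  assumes "x \<in> carrier M"
  shows "hpart d x \<in> hcomp M d" "finite {d. hpart d x \<noteq> \<zero>\<^bsub>M\<^esub>}"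
    "x = finsum M (\<lambda>d. hpart d x) {d. hpart d x \<noteq> \<zero>\<^bsub>M\<^esub>}"
  using theI'[OF hcomp_direct_sum[OF assms]] unfolding hpart_def by auto

lemma hpart_closed [simp]: "x \<in> carrier M \<Longrightarrow> hpart d x \<in> carrier M"
  using hpart_props(1) hcomp_carrier by blast

lemma hpart_eqI:
  assumes "\<And>d. c d \<in> hcomp M d" "finite D" "\<And>d. d \<notin> D \<Longrightarrow> c d = \<zero>\<^bsub>M\<^esub>" "x = finsum M c D"
  shows "hpart d x = c d"
proof -
  have cl: "c d \<in> carrier M" for d using assms(1) hcomp_carrier by blast
  have sub: "{d. c d \<noteq> \<zero>\<^bsub>M\<^esub>} \<subseteq> D" using assms(3) by auto
  have "finsum M c D = finsum M c {d. c d \<noteq> \<zero>\<^bsub>M\<^esub>}"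
    by (rule M.add.finprod_mono_neutral_cong_right) (use assms(2) sub cl in auto)
  then have P: "(\<forall>d. c d \<in> hcomp M d) \<and> finite {d. c d \<noteq> \<zero>\<^bsub>M\<^esub>} \<and> x = finsum M c {d. c d \<noteq> \<zero>\<^bsub>M\<^esub>}"
    using assms(1,2,4) finite_subset[OF sub] by simp
  have "x \<in> carrier M" using assms(4) cl by auto
  from the1_equality[OF hcomp_direct_sum[OF this], OF P] show ?thesis by (simp add: hpart_def)
qed

lemma finsum_superset_hpart:
  assumes "x \<in> carrier M" "finite D" "{d. hpart d x \<noteq> \<zero>\<^bsub>M\<^esub>} \<subseteq> D"
  shows "x = finsum M (\<lambda>d. hpart d x) D"
proof -
  have "finsum M (\<lambda>d. hpart d x) D = finsum M (\<lambda>d. hpart d x) {d. hpart d x \<noteq> \<zero>\<^bsub>M\<^esub>}"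
    by (rule M.add.finprod_mono_neutral_cong_right) (use assms in auto)
  then show ?thesis using hpart_props(3)[OF assms(1)] by simp
qed

lemma hpart_homog: "x \<in> hcomp M d \<Longrightarrow> hpart e x = (if e = d then x else \<zero>\<^bsub>M\<^esub>)"
  by (rule hpart_eqI[of "\<lambda>e. if e = d then x else \<zero>\<^bsub>M\<^esub>" "{d}"]) (auto simp: hcomp_carrier)

lemma hpart_zero [simp]: "hpart e \<zero>\<^bsub>M\<^esub> = \<zero>\<^bsub>M\<^esub>"
  using hpart_homog[of "\<zero>\<^bsub>M\<^esub>" e] by simp

lemma hpart_add:
  assumes "x \<in> carrier M" "y \<in> carrier M"
  shows "hpart d (x \<oplus>\<^bsub>M\<^esub> y) = hpart d x \<oplus>\<^bsub>M\<^esub> hpart d y"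
proof -
  let ?D = "{d. hpart d x \<noteq> \<zero>\<^bsub>M\<^esub>} \<union> {d. hpart d y \<noteq> \<zero>\<^bsub>M\<^esub>}"
  have fin: "finite ?D" using assms hpart_props(2) by blast
  have "finsum M (\<lambda>d. hpart d x \<oplus>\<^bsub>M\<^esub> hpart d y) ?D =
      finsum M (\<lambda>d. hpart d x) ?D \<oplus>\<^bsub>M\<^esub> finsum M (\<lambda>d. hpart d y) ?D"
    by (rule M.finsum_addf) (use assms in auto)
  also have "\<dots> = x \<oplus>\<^bsub>M\<^esub> y"
    using finsum_superset_hpart[OF assms(1) fin] finsum_superset_hpart[OF assms(2) fin] by auto
  finally show ?thesis
    by (intro hpart_eqI[OF _ fin]) (use assms hpart_props(1) in \<open>auto intro: hcomp_add\<close>)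
qed

lemma homog_induct [consumes 1, case_names homog add]:
  assumes x: "x \<in> carrier M"
    and homog: "\<And>x d. x \<in> hcomp M d \<Longrightarrow> P x"
    and add: "\<And>x y. x \<in> carrier M \<Longrightarrow> y \<in> carrier M \<Longrightarrow> P x \<Longrightarrow> P y \<Longrightarrow> P (x \<oplus>\<^bsub>M\<^esub> y)"
  shows "P x"
proof -
  have "finsum M (\<lambda>d. hpart d x) D \<in> carrier M \<and> P (finsum M (\<lambda>d. hpart d x) D)" if "finite D" for D
    using that
  proof (induction D rule: finite_induct)
    case empty
    then show ?case using homog[OF hcomp_zero] by simp
  next
    case (insert d D)
    then show ?case using x add homog[OF hpart_props(1)[OF x]] by (simp add: Pi_def)
  qed
  from this[OF hpart_props(2)[OF x]] show ?thesis using hpart_props(3)[OF x] by simp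
qed

lemma hpart_smult:
  assumes a: "a \<in> rcomp R i" "a \<in> carrier R" and x: "x \<in> carrier M"
  shows "hpart (i + d) (a \<odot>\<^bsub>M\<^esub> x) = a \<odot>\<^bsub>M\<^esub> hpart d x"
  using x
proof (induction x rule: homog_induct)
  case (homog x e)
  then show ?case using hcomp_smult[OF a(1) homog] a by (simp add: hpart_homog)
next
  case (add x y)
  then show ?case using a by (simp add: smult_r_distr hpart_add)
qed

lemma homog_if_hparts_zero:
  assumes "x \<in> carrier M" "\<And>e. e \<noteq> d \<Longrightarrow> hpart e x = \<zero>\<^bsub>M\<^esub>"
  shows "x \<in> hcomp M d"
proof -
  have "x = finsum M (\<lambda>d. hpart d x) {d}"
    by (rule finsum_superset_hpart[OF assms(1)]) (use assms(2) in auto)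
  then show ?thesis using assms(1) hpart_props(1)[OF assms(1), of d] by simp
qed

text \<open>Stated for maps that change degrees: the coordinate maps \<open>fq\<close> send degree
  \<open>p e + mdeg r\<close> to degree \<open>e\<close> and contribute nothing in degree
  \<open>e\<close> from any other source degree.\<close>

lemma hpart_image:
  assumes N: "graded_module R' N"
    and h: "\<And>x. x \<in> carrier M \<Longrightarrow> h x \<in> carrier N"
    and hadd: "\<And>x y. x \<in> carrier M \<Longrightarrow> y \<in> carrier M \<Longrightarrow> h (x \<oplus>\<^bsub>M\<^esub> y) = h x \<oplus>\<^bsub>N\<^esub> h y"
    and hd: "\<And>x. x \<in> hcomp M d \<Longrightarrow> h x \<in> hcomp N d'"
    and h0: "\<And>x e. x \<in> hcomp M e \<Longrightarrow> e \<noteq> d \<Longrightarrow> graded_module.hpart N d' (h x) = \<zero>\<^bsub>N\<^esub>"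
    and x: "x \<in> carrier M"
  shows "graded_module.hpart N d' (h x) = h (hpart d x)"
proof -
  interpret N: graded_module R' N by fact
  have h_zero: "h \<zero>\<^bsub>M\<^esub> = \<zero>\<^bsub>N\<^esub>"
    using hadd[of "\<zero>\<^bsub>M\<^esub>" "\<zero>\<^bsub>M\<^esub>"] h[of "\<zero>\<^bsub>M\<^esub>"] by simp
  show ?thesis using x
  proof (induction x rule: homog_induct)
    case (homog x e)
    show ?case
    proof (cases "e = d")
      case True
      then have "x \<in> hcomp M d" using homog by simp
      then show ?thesis using True hd[of x] by (simp add: hpart_homog N.hpart_homog)
    next
      case False
      then show ?thesis using homog h0[OF homog] by (simp add: hpart_homog h_zero)
    qed
  next
    case (add x y)
    then show ?case by (simp add: hadd hpart_add N.hpart_add h)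
  qed
qed

end

lemma gmod_hom_hpart:
  assumes "graded_module R M" "graded_module R N" "h \<in> gmod_hom R M N" "x \<in> carrier M"
  shows "graded_module.hpart N d (h x) = h (graded_module.hpart M d x)"
proof -
  interpret M: graded_module R M by fact
  interpret N: graded_module R N by fact
  have h: "h y \<in> hcomp N d" if "y \<in> hcomp M d" for y d
    using assms(3) that by (auto simp: gmod_hom_def)
  show ?thesis
  proof (rule M.hpart_image[OF assms(2) _ _ _ _ assms(4)])
    fix x e assume "x \<in> hcomp M e" "e \<noteq> d"
    then show "N.hpart d (h x) = \<zero>\<^bsub>N\<^esub>" using h[of x e] by (simp add: N.hpart_homog)
  qed (use assms(3) h in \<open>auto simp: gmod_hom_def mod_hom_def\<close>)
qed

text \<open>Transport of structure: every axiom is an equation or a membership that injectivity of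
  \<open>h\<close> pulls back from \<open>M\<close>. It yields the grading of local cohomology and
  the copies of submodules in another element type.\<close>

lemma graded_module_transport:
  fixes M :: "('a, 'b, 'z) graded_module_scheme" and N :: "('a, 'c, 'y) graded_module_scheme"
  assumes M: "graded_module R M" and bij: "bij_betw h (carrier N) (carrier M)"
    and add: "\<And>x y. x \<in> carrier N \<Longrightarrow> y \<in> carrier N \<Longrightarrow> x \<oplus>\<^bsub>N\<^esub> y \<in> carrier N \<and> h (x \<oplus>\<^bsub>N\<^esub> y) = h x \<oplus>\<^bsub>M\<^esub> h y"
    and zero: "\<zero>\<^bsub>N\<^esub> \<in> carrier N" "h \<zero>\<^bsub>N\<^esub> = \<zero>\<^bsub>M\<^esub>"
    and smult: "\<And>a x. a \<in> carrier R \<Longrightarrow> x \<in> carrier N \<Longrightarrow> a \<odot>\<^bsub>N\<^esub> x \<in> carrier N \<and> h (a \<odot>\<^bsub>N\<^esub> x) = a \<odot>\<^bsub>M\<^esub> h x"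
    and hc: "\<And>d. hcomp N d = {x \<in> carrier N. h x \<in> hcomp M d}"
    and R: "\<And>a i. a \<in> rcomp R i \<Longrightarrow> a \<in> carrier R"
  shows "graded_module R N"
proof -
  interpret M: graded_module R M by fact
  have hM: "h x \<in> carrier M" if "x \<in> carrier N" for x using bij that by (auto simp: bij_betw_def)
  have inj: "x = y" if "x \<in> carrier N" "y \<in> carrier N" "h x = h y" for x y
    using bij that by (auto simp: bij_betw_def inj_on_def)
  have surj: "\<exists>x\<in>carrier N. h x = y" if "y \<in> carrier M" for y
    using bij that unfolding bij_betw_def by (metis imageE)
  have ag: "abelian_group N"
  proof (rule abelian_groupI)
    fix x assume x: "x \<in> carrier N"
    from surj[of "\<ominus>\<^bsub>M\<^esub> h x"] x hM obtain y where y: "y \<in> carrier N" "h y = \<ominus>\<^bsub>M\<^esub> h x" by auto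
    have "h (y \<oplus>\<^bsub>N\<^esub> x) = h \<zero>\<^bsub>N\<^esub>" using add[OF y(1) x] y x hM by (simp add: zero M.M.l_neg)
    then show "\<exists>y\<in>carrier N. y \<oplus>\<^bsub>N\<^esub> x = \<zero>\<^bsub>N\<^esub>" using inj add[OF y(1) x] zero y by blast
  next
    fix x y z assume *: "x \<in> carrier N" "y \<in> carrier N" "z \<in> carrier N"
    show "x \<oplus>\<^bsub>N\<^esub> y \<oplus>\<^bsub>N\<^esub> z = x \<oplus>\<^bsub>N\<^esub> (y \<oplus>\<^bsub>N\<^esub> z)"
      using * add hM by (intro inj) (auto simp: M.M.a_assoc)
  next
    fix x y assume *: "x \<in> carrier N" "y \<in> carrier N"
    show "x \<oplus>\<^bsub>N\<^esub> y = y \<oplus>\<^bsub>N\<^esub> x" using * add hM by (intro inj) (auto simp: M.M.a_comm)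
  next
    fix x assume *: "x \<in> carrier N"
    show "\<zero>\<^bsub>N\<^esub> \<oplus>\<^bsub>N\<^esub> x = x" using * add hM zero by (intro inj) auto
  qed (use add zero in auto)
  interpret N: abelian_group N by (rule ag)
  have hfin: "h (finsum N c D) = finsum M (\<lambda>d. h (c d)) D \<and> finsum N c D \<in> carrier N"
    if "finite D" "\<And>d. c d \<in> carrier N" for D :: "int set" and c
    using that by (induction D rule: finite_induct) (auto simp: zero add hM)
  have mod: "Module.module R N"
  proof (rule moduleI)
    show "cring R" by (rule M.R.cring_axioms)
    show "a \<odot>\<^bsub>N\<^esub> x \<in> carrier N" if "a \<in> carrier R" "x \<in> carrier N" for a x using smult that by blast
  qed (rule ag, (rule inj; auto simp: smult add hM M.smult_l_distr M.smult_r_distr M.smult_assoc1)+)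
  show ?thesis
  proof (rule graded_module.intro[OF mod graded_module_axioms.intro])
    fix d
    show "subgroup (hcomp N d) (add_monoid N)"
    proof (rule subgroup.intro)
      fix x assume x: "x \<in> hcomp N d"
      then have xc: "x \<in> carrier N" "h x \<in> hcomp M d" by (auto simp: hc)
      have "h (\<ominus>\<^bsub>N\<^esub> x) \<oplus>\<^bsub>M\<^esub> h x = \<zero>\<^bsub>M\<^esub>"
        using add[of "\<ominus>\<^bsub>N\<^esub> x" x] xc by (simp add: N.l_neg zero)
      then have "h (\<ominus>\<^bsub>N\<^esub> x) = \<ominus>\<^bsub>M\<^esub> h x" using xc hM by (intro M.M.minus_equality[symmetric]) auto
      then have "\<ominus>\<^bsub>N\<^esub> x \<in> hcomp N d" using xc M.hcomp_minus by (auto simp: hc)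
      then show "inv\<^bsub>add_monoid N\<^esub> x \<in> hcomp N d" by (simp add: a_inv_def)
    qed (auto simp: hc zero add M.hcomp_add)
  next
    fix a i x j assume "a \<in> rcomp R i" "x \<in> hcomp N j"
    then show "a \<odot>\<^bsub>N\<^esub> x \<in> hcomp N (i + j)" using M.hcomp_smult R by (auto simp: hc smult)
  next
    fix x assume x: "x \<in> carrier N"
    have hx: "h x \<in> carrier M" using x by (rule hM)
    define c where "c d = (THE y. y \<in> carrier N \<and> h y = M.hpart d (h x))" for d
    have c: "c d \<in> carrier N \<and> h (c d) = M.hpart d (h x)" for d
      unfolding c_def by (rule theI') (use surj[OF M.hpart_closed[OF hx, of d]] inj in metis)
    have c0: "c d = \<zero>\<^bsub>N\<^esub> \<longleftrightarrow> M.hpart d (h x) = \<zero>\<^bsub>M\<^esub>" for d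
      using c[of d] inj[of "c d" "\<zero>\<^bsub>N\<^esub>"] zero by auto
    show "\<exists>!c. (\<forall>d. c d \<in> hcomp N d) \<and> finite {d. c d \<noteq> \<zero>\<^bsub>N\<^esub>} \<and> x = finsum N c {d. c d \<noteq> \<zero>\<^bsub>N\<^esub>}"
    proof (rule ex1I[of _ c])
      have fin: "finite {d. c d \<noteq> \<zero>\<^bsub>N\<^esub>}" using M.hpart_props(2)[OF hx] by (simp add: c0)
      have "h (finsum N c {d. c d \<noteq> \<zero>\<^bsub>N\<^esub>}) = h x"
        using hfin[OF fin, of c] c M.hpart_props(3)[OF hx] by (simp add: c0)
      then have "x = finsum N c {d. c d \<noteq> \<zero>\<^bsub>N\<^esub>}"
        using hfin[OF fin, of c] c x by (intro inj) auto
      then show "(\<forall>d. c d \<in> hcomp N d) \<and> finite {d. c d \<noteq> \<zero>\<^bsub>N\<^esub>} \<and> x = finsum N c {d. c d \<noteq> \<zero>\<^bsub>N\<^esub>}"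
        using fin c M.hpart_props(1)[OF hx] by (auto simp: hc)
    next
      fix c' assume c': "(\<forall>d. c' d \<in> hcomp N d) \<and> finite {d. c' d \<noteq> \<zero>\<^bsub>N\<^esub>} \<and> x = finsum N c' {d. c' d \<noteq> \<zero>\<^bsub>N\<^esub>}"
      then have c'c: "c' d \<in> carrier N" "h (c' d) \<in> hcomp M d" for d by (auto simp: hc)
      have "M.hpart d (h x) = h (c' d)" for d
      proof (rule M.hpart_eqI[of "\<lambda>d. h (c' d)" "{d. c' d \<noteq> \<zero>\<^bsub>N\<^esub>}"])
        have "h x = h (finsum N c' {d. c' d \<noteq> \<zero>\<^bsub>N\<^esub>})" using c' by simp
        also have "\<dots> = finsum M (\<lambda>d. h (c' d)) {d. c' d \<noteq> \<zero>\<^bsub>N\<^esub>}"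
          using hfin[of _ c'] c' c'c by blast
        finally show "h x = finsum M (\<lambda>d. h (c' d)) {d. c' d \<noteq> \<zero>\<^bsub>N\<^esub>}" .
      qed (use c'c c' zero in auto)
      then show "c' = c" using c c'c inj by (intro ext) metis
    qed
  qed
qed

definition subgmodule :: "('a, 'b, 'z) graded_module_scheme \<Rightarrow> 'b set \<Rightarrow> ('a, 'b, 'z) graded_module_scheme" where
  "subgmodule M H = M\<lparr>carrier := H, hcomp := \<lambda>d. hcomp M d \<inter> H\<rparr>"

lemma subgmodule_simps [simp]:
  "carrier (subgmodule M H) = H" "hcomp (subgmodule M H) d = hcomp M d \<inter> H"
  "x \<oplus>\<^bsub>subgmodule M H\<^esub> y = x \<oplus>\<^bsub>M\<^esub> y" "\<zero>\<^bsub>subgmodule M H\<^esub> = \<zero>\<^bsub>M\<^esub>"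
  "a \<odot>\<^bsub>subgmodule M H\<^esub> x = a \<odot>\<^bsub>M\<^esub> x"
  by (simp_all add: subgmodule_def)

lemma (in graded_module) graded_module_subgmodule:
  assumes R: "\<And>a i. a \<in> rcomp R i \<Longrightarrow> a \<in> carrier R"
    and sub: "H \<subseteq> carrier M" and z: "\<zero>\<^bsub>M\<^esub> \<in> H"
    and add: "\<And>x y. x \<in> H \<Longrightarrow> y \<in> H \<Longrightarrow> x \<oplus>\<^bsub>M\<^esub> y \<in> H"
    and sm: "\<And>a x. a \<in> carrier R \<Longrightarrow> x \<in> H \<Longrightarrow> a \<odot>\<^bsub>M\<^esub> x \<in> H"
    and hp: "\<And>x d. x \<in> H \<Longrightarrow> hpart d x \<in> H"
  shows "graded_module R (subgmodule M H)"
proof -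
  let ?N = "subgmodule M H"
  have neg: "\<ominus>\<^bsub>M\<^esub> x \<in> H" if "x \<in> H" for x
    using sm[of "\<ominus> \<one>" x] that sub by (auto simp: smult_l_minus)
  have ag: "abelian_group ?N"
  proof (rule abelian_groupI)
    fix x assume x: "x \<in> carrier ?N"
    then show "\<exists>y\<in>carrier ?N. y \<oplus>\<^bsub>?N\<^esub> x = \<zero>\<^bsub>?N\<^esub>"
      using sub neg by (intro bexI[of _ "\<ominus>\<^bsub>M\<^esub> x"]) (auto simp: M.l_neg)
  qed (use sub z add in \<open>auto simp: subset_iff M.a_assoc intro: M.a_comm\<close>)
  interpret N: abelian_group ?N by (rule ag)
  have fin: "finsum ?N c D = finsum M c D" if "finite D" "\<And>d. c d \<in> H" for c and D :: "int set"
    using that sub by (induction D rule: finite_induct) (auto simp: subset_iff)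
  have mod: "Module.module R ?N"
    by (rule moduleI) (use ag sm sub R.cring_axioms in \<open>auto simp: subset_iff smult_l_distr smult_r_distr smult_assoc1\<close>)
  show ?thesis
  proof (rule graded_module.intro[OF mod graded_module_axioms.intro])
    fix d
    show "subgroup (hcomp ?N d) (add_monoid ?N)"
    proof (rule subgroup.intro)
      fix x assume x: "x \<in> hcomp ?N d"
      have "\<ominus>\<^bsub>?N\<^esub> x = \<ominus>\<^bsub>M\<^esub> x"
        using x sub neg by (intro N.minus_equality) (auto simp: M.l_neg subset_iff)
      then have "\<ominus>\<^bsub>?N\<^esub> x \<in> hcomp ?N d"
        using x hcomp_minus neg by simp
      then show "inv\<^bsub>add_monoid ?N\<^esub> x \<in> hcomp ?N d"
        by (simp add: a_inv_def)
    qed (use z add hcomp_add in auto)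
  next
    fix a i x j assume "a \<in> rcomp R i" "x \<in> hcomp ?N j"
    then show "a \<odot>\<^bsub>?N\<^esub> x \<in> hcomp ?N (i + j)" using hcomp_smult sm R by auto
  next
    fix x assume x: "x \<in> carrier ?N"
    then have xM: "x \<in> carrier M" using sub by auto
    show "\<exists>!c. (\<forall>d. c d \<in> hcomp ?N d) \<and> finite {d. c d \<noteq> \<zero>\<^bsub>?N\<^esub>} \<and> x = finsum ?N c {d. c d \<noteq> \<zero>\<^bsub>?N\<^esub>}"
    proof (rule ex1I[of _ "\<lambda>d. hpart d x"])
      show "(\<forall>d. hpart d x \<in> hcomp ?N d) \<and> finite {d. hpart d x \<noteq> \<zero>\<^bsub>?N\<^esub>} \<and>
          x = finsum ?N (\<lambda>d. hpart d x) {d. hpart d x \<noteq> \<zero>\<^bsub>?N\<^esub>}"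
        using hpart_props[OF xM] hp x by (simp add: fin)
    next
      fix c assume c: "(\<forall>d. c d \<in> hcomp ?N d) \<and> finite {d. c d \<noteq> \<zero>\<^bsub>?N\<^esub>} \<and> x = finsum ?N c {d. c d \<noteq> \<zero>\<^bsub>?N\<^esub>}"
      then have "x = finsum M c {d. c d \<noteq> \<zero>\<^bsub>M\<^esub>}" using fin[of _ c] by auto
      then have "hpart d x = c d" for d by (intro hpart_eqI) (use c in auto)
      then show "c = (\<lambda>d. hpart d x)" by auto
    qed
  qed
qed


section \<open>Frobenius actions and their coordinates\<close>

context char_p
begin

lemma fbasis_carrier: "j \<in> fidx \<Longrightarrow> fbasis j \<in> carrier R"
  using rcomp_carrier[OF fbasis_closed] .

text \<open>Expansion of an element of \<open>R' \<otimes> C\<close> in the basis of \<open>R'\<close>, transported along a balanced map \<open>\<tau>\<close>.\<close>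

lemma balanced_expand:
  assumes C: "Module.module R C" and G: "abelian_group G"
    and \<tau>: "\<And>r m. r \<in> carrier R \<Longrightarrow> m \<in> carrier C \<Longrightarrow> \<tau> r m \<in> carrier G"
    and addl: "\<And>r s m. r \<in> carrier R \<Longrightarrow> s \<in> carrier R \<Longrightarrow> m \<in> carrier C \<Longrightarrow>
        \<tau> (r + s) m = \<tau> r m \<oplus>\<^bsub>G\<^esub> \<tau> s m"
    and bal: "\<And>r s m. r \<in> carrier R \<Longrightarrow> s \<in> carrier R \<Longrightarrow> m \<in> carrier C \<Longrightarrow>
        \<tau> (s ^ p * r) m = \<tau> r (s \<odot>\<^bsub>C\<^esub> m)"
    and r: "r \<in> carrier R" and c: "c \<in> carrier C"
    and J: "finite J" "J \<subseteq> fidx" "r = (\<Sum>j\<in>J. fcoord j r ^ p * fbasis j)"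
  shows "\<tau> r c = finsum G (\<lambda>j. \<tau> (fbasis j) (fcoord j r \<odot>\<^bsub>C\<^esub> c)) J"
proof -
  interpret G: abelian_group G by fact
  interpret C: Module.module R C by fact
  have z: "\<tau> 0 c = \<zero>\<^bsub>G\<^esub>" using addl[of 0 0 c] \<tau>[of 0 c] c by simp
  have b: "fbasis j \<in> carrier R" if "j \<in> J" for j
    using fbasis_closed[of j] that J(2) by (auto simp: in_rcomp)
  have fc: "fcoord j r \<in> carrier R" for j using fcoord_closed[OF r] .
  have "\<tau> (\<Sum>j\<in>K. fcoord j r ^ p * fbasis j) c = finsum G (\<lambda>j. \<tau> (fbasis j) (fcoord j r \<odot>\<^bsub>C\<^esub> c)) K"
    if "finite K" "K \<subseteq> J" for K
    using that
  proof (induction K rule: finite_induct)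
    case (insert j K)
    have "(\<Sum>j\<in>K. fcoord j r ^ p * fbasis j) \<in> carrier R"
      using insert b fc by (intro poly_ring_sum_closed poly_ring_mult_closed poly_ring_power_closed) auto
    moreover have "fbasis j \<in> carrier R" "K \<subseteq> J" using insert b by auto
    moreover have "\<tau> (fbasis i) (fcoord i r \<odot>\<^bsub>C\<^esub> c) \<in> carrier G" if "i \<in> insert j K" for i
      using that insert.prems by (intro \<tau> C.smult_closed fc c b) blast
    ultimately show ?case using insert.hyps insert.IH fc c
      by (simp add: addl bal Pi_def)
  qed (simp add: z)
  from this[OF J(1)] show ?thesis using J(3) by simp
qed

end

text \<open>The \<open>p\<close>-linear map \<open>fr\<close> with
  \<open>\<theta> (fr y) = 1 \<otimes> y\<close>. By linearity
  \<open>\<theta> (r fr y) = r \<otimes> y\<close>, so \<open>fr\<close> and \<open>\<theta>\<close>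
  determine each other and the tensor product can be left behind.\<close>

definition froact :: "nat \<Rightarrow> 'a graded_ring \<Rightarrow> ('a, 'b) F_module \<Rightarrow> 'b \<Rightarrow> 'b" where
  "froact p R A y = inv_into (carrier A) (struct A) (frob_tensor p R A \<one>\<^bsub>R\<^esub> y)"

text \<open>A \<open>p\<close>-linear map \<open>f\<close> exhibits \<open>D\<close> as \<open>F(C)\<close> when \<open>r \<otimes> c \<mapsto> r f(c)\<close> is an isomorphism; this is
  witnessed by the coordinate maps \<open>q\<close> in a basis of \<open>R'\<close>.\<close>

locale frob_coords = char_p p n ty + C: graded_module "poly_ring n :: 'k mpol graded_ring" C +
  D: graded_module "poly_ring n :: 'k mpol graded_ring" D
  for p n and ty :: "'k::field itself"
    and C :: "('k mpol, 'b, 'y) graded_module_scheme" and D :: "('k mpol, 'c, 'z) graded_module_scheme" +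
  fixes f :: "'b \<Rightarrow> 'c" and q :: "'k \<times> (nat \<Rightarrow>\<^sub>0 nat) \<Rightarrow> 'c \<Rightarrow> 'b"
  assumes f_closed: "c \<in> carrier C \<Longrightarrow> f c \<in> carrier D"
    and f_add: "c \<in> carrier C \<Longrightarrow> c' \<in> carrier C \<Longrightarrow> f (c \<oplus>\<^bsub>C\<^esub> c') = f c \<oplus>\<^bsub>D\<^esub> f c'"
    and f_smult: "s \<in> carrier R \<Longrightarrow> c \<in> carrier C \<Longrightarrow> f (s \<odot>\<^bsub>C\<^esub> c) = s ^ p \<odot>\<^bsub>D\<^esub> f c"
    and q_closed: "j \<in> fidx \<Longrightarrow> x \<in> carrier D \<Longrightarrow> q j x \<in> carrier C"
    and q_add: "j \<in> fidx \<Longrightarrow> x \<in> carrier D \<Longrightarrow> y \<in> carrier D \<Longrightarrow> q j (x \<oplus>\<^bsub>D\<^esub> y) = q j x \<oplus>\<^bsub>C\<^esub> q j y"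
    and q_f: "j \<in> fidx \<Longrightarrow> r \<in> carrier R \<Longrightarrow> c \<in> carrier C \<Longrightarrow> q j (r \<odot>\<^bsub>D\<^esub> f c) = fcoord j r \<odot>\<^bsub>C\<^esub> c"
    and D_induct: "x \<in> carrier D \<Longrightarrow> (\<And>r c. r \<in> carrier R \<Longrightarrow> c \<in> carrier C \<Longrightarrow> P (r \<odot>\<^bsub>D\<^esub> f c)) \<Longrightarrow>
      (\<And>x y. x \<in> carrier D \<Longrightarrow> y \<in> carrier D \<Longrightarrow> P x \<Longrightarrow> P y \<Longrightarrow> P (x \<oplus>\<^bsub>D\<^esub> y)) \<Longrightarrow> P x"
begin

sublocale T: tensor R C p by unfold_locales

text \<open>For \<open>r f(c)\<close> this is \<open>fcoord_recon\<close> pushed through the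
  balanced map \<open>(r, c) \<mapsto> r f(c)\<close>; \<open>D_induct\<close>, which expresses
  surjectivity, extends it to sums.\<close>

lemma q_expand:
  assumes "x \<in> carrier D"
  shows "\<exists>J0\<subseteq>fidx. finite J0 \<and> (\<forall>J. finite J \<and> J0 \<subseteq> J \<and> J \<subseteq> fidx \<longrightarrow>
    x = finsum D (\<lambda>j. fbasis j \<odot>\<^bsub>D\<^esub> f (q j x)) J)"
  using assms
proof (rule D_induct)
  fix r c assume r: "r \<in> carrier R" and c: "c \<in> carrier C"
  obtain J0 where J0: "J0 \<subseteq> fidx" "finite J0"
    "\<And>J. finite J \<Longrightarrow> J0 \<subseteq> J \<Longrightarrow> J \<subseteq> fidx \<Longrightarrow> r = (\<Sum>j\<in>J. fcoord j r ^ p * fbasis j)"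
    using fcoord_recon[OF r] by (elim exE conjE) blast
  have "r \<odot>\<^bsub>D\<^esub> f c = finsum D (\<lambda>j. fbasis j \<odot>\<^bsub>D\<^esub> f (q j (r \<odot>\<^bsub>D\<^esub> f c))) J"
    if J: "finite J" "J0 \<subseteq> J" "J \<subseteq> fidx" for J
  proof -
    have "r \<odot>\<^bsub>D\<^esub> f c = finsum D (\<lambda>j. fbasis j \<odot>\<^bsub>D\<^esub> f (fcoord j r \<odot>\<^bsub>C\<^esub> c)) J"
    proof (rule balanced_expand[where \<tau> = "\<lambda>r c. r \<odot>\<^bsub>D\<^esub> f c"])
      fix r s m assume *: "r \<in> carrier R" "s \<in> carrier R" "m \<in> carrier C"
      show "(r + s) \<odot>\<^bsub>D\<^esub> f m = r \<odot>\<^bsub>D\<^esub> f m \<oplus>\<^bsub>D\<^esub> s \<odot>\<^bsub>D\<^esub> f m"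
        using D.smult_l_distr[of r s "f m"] * f_closed by simp
      show "(s ^ p * r) \<odot>\<^bsub>D\<^esub> f m = r \<odot>\<^bsub>D\<^esub> f (s \<odot>\<^bsub>C\<^esub> m)"
        using D.smult_assoc1[of r "s ^ p" "f m"] * f_closed by (simp add: f_smult mult.commute)
    qed (use r c J J0 f_closed C.module_axioms D.M.abelian_group_axioms in auto)
    also have "\<dots> = finsum D (\<lambda>j. fbasis j \<odot>\<^bsub>D\<^esub> f (q j (r \<odot>\<^bsub>D\<^esub> f c))) J"
      using J r c by (intro D.M.finsum_cong') (auto simp: q_f subset_iff f_closed fcoord_closed
          intro!: D.smult_closed fbasis_carrier)
    finally show ?thesis .
  qed
  then show "\<exists>J0\<subseteq>fidx. finite J0 \<and> (\<forall>J. finite J \<and> J0 \<subseteq> J \<and> J \<subseteq> fidx \<longrightarrow>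
    r \<odot>\<^bsub>D\<^esub> f c = finsum D (\<lambda>j. fbasis j \<odot>\<^bsub>D\<^esub> f (q j (r \<odot>\<^bsub>D\<^esub> f c))) J)"
    using J0(1,2) by blast
next
  fix x y assume xy: "x \<in> carrier D" "y \<in> carrier D"
  assume "\<exists>J0\<subseteq>fidx. finite J0 \<and> (\<forall>J. finite J \<and> J0 \<subseteq> J \<and> J \<subseteq> fidx \<longrightarrow>
    x = finsum D (\<lambda>j. fbasis j \<odot>\<^bsub>D\<^esub> f (q j x)) J)"
  then obtain J1 where J1: "J1 \<subseteq> fidx" "finite J1" "\<And>J. finite J \<Longrightarrow> J1 \<subseteq> J \<Longrightarrow> J \<subseteq> fidx \<Longrightarrow>
    x = finsum D (\<lambda>j. fbasis j \<odot>\<^bsub>D\<^esub> f (q j x)) J" by (elim exE conjE) blast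
  assume "\<exists>J0\<subseteq>fidx. finite J0 \<and> (\<forall>J. finite J \<and> J0 \<subseteq> J \<and> J \<subseteq> fidx \<longrightarrow>
    y = finsum D (\<lambda>j. fbasis j \<odot>\<^bsub>D\<^esub> f (q j y)) J)"
  then obtain J2 where J2: "J2 \<subseteq> fidx" "finite J2" "\<And>J. finite J \<Longrightarrow> J2 \<subseteq> J \<Longrightarrow> J \<subseteq> fidx \<Longrightarrow>
    y = finsum D (\<lambda>j. fbasis j \<odot>\<^bsub>D\<^esub> f (q j y)) J" by (elim exE conjE) blast
  have "x \<oplus>\<^bsub>D\<^esub> y = finsum D (\<lambda>j. fbasis j \<odot>\<^bsub>D\<^esub> f (q j (x \<oplus>\<^bsub>D\<^esub> y))) J"
    if J: "finite J" "J1 \<union> J2 \<subseteq> J" "J \<subseteq> fidx" for J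
  proof -
    have cl: "fbasis j \<odot>\<^bsub>D\<^esub> f (q j z) \<in> carrier D" if "j \<in> J" "z \<in> carrier D" for j z
      using that J(3) by (auto intro!: D.smult_closed f_closed q_closed fbasis_carrier)
    have "x \<oplus>\<^bsub>D\<^esub> y = finsum D (\<lambda>j. fbasis j \<odot>\<^bsub>D\<^esub> f (q j x)) J \<oplus>\<^bsub>D\<^esub> finsum D (\<lambda>j. fbasis j \<odot>\<^bsub>D\<^esub> f (q j y)) J"
      using J1(3)[of J] J2(3)[of J] J by simp
    also have "\<dots> = finsum D (\<lambda>j. fbasis j \<odot>\<^bsub>D\<^esub> f (q j x) \<oplus>\<^bsub>D\<^esub> fbasis j \<odot>\<^bsub>D\<^esub> f (q j y)) J"
      by (rule D.M.finsum_addf[symmetric]) (use cl xy in auto)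
    also have "\<dots> = finsum D (\<lambda>j. fbasis j \<odot>\<^bsub>D\<^esub> f (q j (x \<oplus>\<^bsub>D\<^esub> y))) J"
    proof (rule D.M.finsum_cong')
      fix j assume "j \<in> J"
      then have j: "j \<in> fidx" "fbasis j \<in> carrier R" using J(3) fbasis_carrier[of j] by blast+
      show "fbasis j \<odot>\<^bsub>D\<^esub> f (q j x) \<oplus>\<^bsub>D\<^esub> fbasis j \<odot>\<^bsub>D\<^esub> f (q j y) = fbasis j \<odot>\<^bsub>D\<^esub> f (q j (x \<oplus>\<^bsub>D\<^esub> y))"
        using j xy by (simp add: q_add f_add q_closed D.smult_r_distr f_closed)
    qed (use cl xy in auto)
    finally show ?thesis .
  qed
  moreover have "J1 \<union> J2 \<subseteq> fidx" "finite (J1 \<union> J2)" using J1 J2 by auto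
  ultimately show "\<exists>J0\<subseteq>fidx. finite J0 \<and> (\<forall>J. finite J \<and> J0 \<subseteq> J \<and> J \<subseteq> fidx \<longrightarrow>
    x \<oplus>\<^bsub>D\<^esub> y = finsum D (\<lambda>j. fbasis j \<odot>\<^bsub>D\<^esub> f (q j (x \<oplus>\<^bsub>D\<^esub> y))) J)" by blast
qed

lemma q_expandE:
  assumes "x \<in> carrier D"
  obtains J where "J \<subseteq> fidx" "finite J" "x = finsum D (\<lambda>j. fbasis j \<odot>\<^bsub>D\<^esub> f (q j x)) J"
  using q_expand[OF assms] by (elim exE conjE) blast

lemma f_zero: "f \<zero>\<^bsub>C\<^esub> = \<zero>\<^bsub>D\<^esub>"
  using f_add[of "\<zero>\<^bsub>C\<^esub>" "\<zero>\<^bsub>C\<^esub>"] f_closed[of "\<zero>\<^bsub>C\<^esub>"] by simp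

lemma zero_if_q_zero:
  assumes "x \<in> carrier D" "\<And>j. j \<in> fidx \<Longrightarrow> q j x = \<zero>\<^bsub>C\<^esub>"
  shows "x = \<zero>\<^bsub>D\<^esub>"
proof -
  obtain J where J: "J \<subseteq> fidx" "finite J" "x = finsum D (\<lambda>j. fbasis j \<odot>\<^bsub>D\<^esub> f (q j x)) J"
    using q_expandE[OF assms(1)] .
  have "fbasis j \<odot>\<^bsub>D\<^esub> f (q j x) = \<zero>\<^bsub>D\<^esub>" if "j \<in> J" for j
    using that J(1) assms(2)[of j] fbasis_carrier[of j] by (auto simp: f_zero)
  then have "finsum D (\<lambda>j. fbasis j \<odot>\<^bsub>D\<^esub> f (q j x)) J = \<zero>\<^bsub>D\<^esub>"
    by (simp cong: D.M.finsum_cong)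
  then show ?thesis using J(3) by simp
qed

end

text \<open>Kept apart from \<open>frob_coords\<close> because for an F-module the degree formula
  for \<open>fr\<close> is itself deduced from the coordinates, in \<open>fr_degree\<close>.\<close>

locale frob_ext = frob_coords +
  assumes f_degree: "c \<in> hcomp C d \<Longrightarrow> f c \<in> hcomp D (int p * d)"
begin

text \<open>The coordinates of a tensor can be recovered from its image, which gives injectivity;
  \<open>D_induct\<close> gives surjectivity. The lifting of homogeneous elements is recorded
  separately because it makes the inverse degree-preserving.\<close>

lemma frob_iso:
  obtains \<psi> where "\<psi> \<in> gmod_iso R (frob p R C) D"
    "\<And>r c. r \<in> carrier R \<Longrightarrow> c \<in> carrier C \<Longrightarrow> \<psi> (frob_tensor p R C r c) = r \<odot>\<^bsub>D\<^esub> f c"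
    "\<And>x d. x \<in> hcomp D d \<Longrightarrow> \<exists>z\<in>hcomp (frob p R C) d. \<psi> z = x"
proof -
  interpret F: abelian_group "frob p R C" by (rule T.abelian_group_frob)
  have bal: "(s ^ p * r) \<odot>\<^bsub>D\<^esub> f m = r \<odot>\<^bsub>D\<^esub> f (s \<odot>\<^bsub>C\<^esub> m)"
    if *: "r \<in> carrier R" "s \<in> carrier R" "m \<in> carrier C" for r s m
    using D.smult_assoc1[of r "s ^ p" "f m"] * f_closed by (simp add: f_smult mult.commute)
  obtain \<psi> where \<psi>c: "\<psi> \<in> carrier (frob p R C) \<rightarrow> carrier D"
    and \<psi>a: "\<And>x y. x \<in> carrier (frob p R C) \<Longrightarrow> y \<in> carrier (frob p R C) \<Longrightarrow>
        \<psi> (x \<oplus>\<^bsub>frob p R C\<^esub> y) = \<psi> x \<oplus>\<^bsub>D\<^esub> \<psi> y"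
    and \<psi>t: "\<And>r m. r \<in> carrier R \<Longrightarrow> m \<in> carrier C \<Longrightarrow> \<psi> (frob_tensor p R C r m) = r \<odot>\<^bsub>D\<^esub> f m"
    by (rule T.tensor_lift[OF D.M.abelian_group_axioms, of "\<lambda>r m. r \<odot>\<^bsub>D\<^esub> f m"])
       (use D.smult_l_distr D.smult_r_distr bal in \<open>auto simp: f_closed f_add\<close>)
  have \<psi>s: "\<psi> (a \<odot>\<^bsub>frob p R C\<^esub> z) = a \<odot>\<^bsub>D\<^esub> \<psi> z" if "a \<in> carrier R" "z \<in> carrier (frob p R C)" for a z
    using that(2)
  proof (induction z rule: T.tensor_induct)
    case (tensor r m)
    then show ?case using that(1) D.smult_assoc1[of a r "f m"] by (simp add: T.smult_tensor \<psi>t f_closed)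
  next
    case (add x y)
    then show ?case using that(1) \<psi>c
      by (simp add: T.smult_add_frob \<psi>a T.smult_closed_frob D.smult_r_distr Pi_def)
  qed
  have rc: "\<And>r i. r \<in> rcomp R i \<Longrightarrow> r \<in> carrier R \<and> \<ominus>\<^bsub>R\<^esub> r \<in> rcomp R i"
    using rcomp_carrier rcomp_closed(2) by force
  have \<psi>d: "\<psi> z \<in> hcomp D d" if "z \<in> hcomp (frob p R C) d" for z d
  proof (rule T.tensor_hcomp_induct[where P = "\<lambda>z. \<psi> z \<in> hcomp D d", OF rc that C.hcomp_subgroup])
    fix r m i j assume rm: "r \<in> rcomp R i" "m \<in> hcomp C j" "i + int p * j = d"
    have "r \<odot>\<^bsub>D\<^esub> f m \<in> hcomp D (i + int p * j)" using rm by (intro D.hcomp_smult f_degree)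
    then show "\<psi> (frob_tensor p R C r m) \<in> hcomp D d"
      using rm \<psi>t[OF rcomp_carrier[OF rm(1)] C.hcomp_carrier[OF rm(2)]] by simp
  qed (simp_all add: rcomp_closed \<psi>a D.hcomp_add)
  have hom: "\<psi> \<in> gmod_hom R (frob p R C) D"
    using \<psi>c \<psi>a \<psi>s \<psi>d by (auto simp: gmod_hom_def mod_hom_def)
  \<comment> \<open>The coefficients are functions of \<open>\<psi> z\<close> alone, so two elements
    with equal images have the same expansion.\<close>
  have ex: "\<exists>J0\<subseteq>fidx. finite J0 \<and> (\<forall>J. finite J \<and> J0 \<subseteq> J \<and> J \<subseteq> fidx \<longrightarrow>
      z = finsum (frob p R C) (\<lambda>j. frob_tensor p R C (fbasis j) (q j (\<psi> z))) J)"
    if "z \<in> carrier (frob p R C)" for z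
    using that
  proof (induction z rule: T.tensor_induct)
    case (tensor r c)
    note r = tensor(1) and c = tensor(2)
    obtain J0 where J0: "J0 \<subseteq> fidx" "finite J0"
      "\<And>J. finite J \<Longrightarrow> J0 \<subseteq> J \<Longrightarrow> J \<subseteq> fidx \<Longrightarrow> r = (\<Sum>j\<in>J. fcoord j r ^ p * fbasis j)"
      using fcoord_recon[OF r] by (elim exE conjE) blast
    have "frob_tensor p R C r c = finsum (frob p R C) (\<lambda>j. frob_tensor p R C (fbasis j) (q j (\<psi> (frob_tensor p R C r c)))) J"
      if J: "finite J" "J0 \<subseteq> J" "J \<subseteq> fidx" for J
    proof -
      have "frob_tensor p R C r c = finsum (frob p R C) (\<lambda>j. frob_tensor p R C (fbasis j) (fcoord j r \<odot>\<^bsub>C\<^esub> c)) J"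
        by (rule balanced_expand[where \<tau> = "frob_tensor p R C"])
           (use r c J J0 T.tensor_closed T.tensor_add_left T.tensor_balanced C.module_axioms F.abelian_group_axioms in auto)
      also have "\<dots> = finsum (frob p R C) (\<lambda>j. frob_tensor p R C (fbasis j) (q j (\<psi> (frob_tensor p R C r c)))) J"
        using J r c by (intro F.finsum_cong') (auto simp: q_f \<psi>t subset_iff fcoord_closed
            intro!: T.tensor_closed C.smult_closed fbasis_carrier)
      finally show ?thesis .
    qed
    then show ?case using J0(1,2) by blast
  next
    case (add x y)
    note xy = add(1,2)
    from add(3) obtain J1 where J1: "J1 \<subseteq> fidx" "finite J1" "\<And>J. finite J \<Longrightarrow> J1 \<subseteq> J \<Longrightarrow> J \<subseteq> fidx \<Longrightarrow>
      x = finsum (frob p R C) (\<lambda>j. frob_tensor p R C (fbasis j) (q j (\<psi> x))) J" by (elim exE conjE) blast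
    from add(4) obtain J2 where J2: "J2 \<subseteq> fidx" "finite J2" "\<And>J. finite J \<Longrightarrow> J2 \<subseteq> J \<Longrightarrow> J \<subseteq> fidx \<Longrightarrow>
      y = finsum (frob p R C) (\<lambda>j. frob_tensor p R C (fbasis j) (q j (\<psi> y))) J" by (elim exE conjE) blast
    let ?t = "\<lambda>z j. frob_tensor p R C (fbasis j) (q j (\<psi> z))"
    have "x \<oplus>\<^bsub>frob p R C\<^esub> y = finsum (frob p R C) (?t (x \<oplus>\<^bsub>frob p R C\<^esub> y)) J"
      if J: "finite J" "J1 \<union> J2 \<subseteq> J" "J \<subseteq> fidx" for J
    proof -
      have \<psi>z: "\<psi> z \<in> carrier D" if "z \<in> carrier (frob p R C)" for z using \<psi>c that by auto
      have cl: "?t z j \<in> carrier (frob p R C)" if "j \<in> J" "z \<in> carrier (frob p R C)" for j z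
        using that J(3) \<psi>z by (auto intro!: T.tensor_closed q_closed fbasis_carrier)
      have "x \<oplus>\<^bsub>frob p R C\<^esub> y = finsum (frob p R C) (?t x) J \<oplus>\<^bsub>frob p R C\<^esub> finsum (frob p R C) (?t y) J"
        using J1(3)[of J] J2(3)[of J] J by (simp only: Un_subset_iff)
      also have "\<dots> = finsum (frob p R C) (\<lambda>j. ?t x j \<oplus>\<^bsub>frob p R C\<^esub> ?t y j) J"
        by (rule F.finsum_addf[symmetric]) (use cl xy in auto)
      also have "\<dots> = finsum (frob p R C) (?t (x \<oplus>\<^bsub>frob p R C\<^esub> y)) J"
      proof (rule F.finsum_cong')
        fix j assume "j \<in> J"
        then have j: "j \<in> fidx" "fbasis j \<in> carrier R" using J(3) fbasis_carrier[of j] by blast+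
        show "?t x j \<oplus>\<^bsub>frob p R C\<^esub> ?t y j = ?t (x \<oplus>\<^bsub>frob p R C\<^esub> y) j"
          using j xy \<psi>z by (simp add: \<psi>a q_add q_closed T.tensor_add_right)
      qed (use cl xy in auto)
      finally show ?thesis .
    qed
    moreover have "J1 \<union> J2 \<subseteq> fidx" "finite (J1 \<union> J2)" using J1 J2 by auto
    ultimately show ?case by blast
  qed
  have inj: "inj_on \<psi> (carrier (frob p R C))"
  proof (rule inj_onI)
    fix z w assume z: "z \<in> carrier (frob p R C)" and w: "w \<in> carrier (frob p R C)" and eq: "\<psi> z = \<psi> w"
    from ex[OF z] obtain J1 where J1: "J1 \<subseteq> fidx" "finite J1" "\<And>J. finite J \<Longrightarrow> J1 \<subseteq> J \<Longrightarrow> J \<subseteq> fidx \<Longrightarrow>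
      z = finsum (frob p R C) (\<lambda>j. frob_tensor p R C (fbasis j) (q j (\<psi> z))) J" by (elim exE conjE) blast
    from ex[OF w] obtain J2 where J2: "J2 \<subseteq> fidx" "finite J2" "\<And>J. finite J \<Longrightarrow> J2 \<subseteq> J \<Longrightarrow> J \<subseteq> fidx \<Longrightarrow>
      w = finsum (frob p R C) (\<lambda>j. frob_tensor p R C (fbasis j) (q j (\<psi> w))) J" by (elim exE conjE) blast
    have J: "finite (J1 \<union> J2)" "J1 \<union> J2 \<subseteq> fidx" using J1(1,2) J2(1,2) by auto
    have "z = finsum (frob p R C) (\<lambda>j. frob_tensor p R C (fbasis j) (q j (\<psi> z))) (J1 \<union> J2)"
      by (rule J1(3)[OF J(1) _ J(2)]) blast
    also have "\<dots> = finsum (frob p R C) (\<lambda>j. frob_tensor p R C (fbasis j) (q j (\<psi> w))) (J1 \<union> J2)"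
      by (simp only: eq)
    also have "\<dots> = w" by (rule J2(3)[OF J(1) _ J(2), symmetric]) blast
    finally show "z = w" .
  qed
  have surj: "x \<in> \<psi> ` carrier (frob p R C)" if "x \<in> carrier D" for x
    using that
  proof (rule D_induct)
    fix r c assume "r \<in> carrier R" "c \<in> carrier C"
    then show "r \<odot>\<^bsub>D\<^esub> f c \<in> \<psi> ` carrier (frob p R C)" by (metis \<psi>t T.tensor_closed image_eqI)
  next
    fix x y assume "x \<in> \<psi> ` carrier (frob p R C)" "y \<in> \<psi> ` carrier (frob p R C)"
    then obtain z w where "z \<in> carrier (frob p R C)" "w \<in> carrier (frob p R C)" "x = \<psi> z" "y = \<psi> w"
      by blast
    then show "x \<oplus>\<^bsub>D\<^esub> y \<in> \<psi> ` carrier (frob p R C)"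
      by (intro image_eqI[of _ _ "z \<oplus>\<^bsub>frob p R C\<^esub> w"]) (simp_all add: \<psi>a)
  qed
  \<comment> \<open>By additivity it suffices to take \<open>r f(c)\<close> with \<open>r\<close> a
    monomial and \<open>c\<close> homogeneous, where the only nonzero part is the image of the
    homogeneous tensor \<open>r \<otimes> c\<close>.\<close>
  have gr: "D.hpart d x \<in> \<psi> ` hcomp (frob p R C) d" if "x \<in> carrier D" for x d
  proof -
    have c0: "\<And>m j. m \<in> hcomp C j \<Longrightarrow> m \<in> carrier C" by (rule C.hcomp_carrier)
    have fc: "\<zero>\<^bsub>frob p R C\<^esub> \<in> hcomp (frob p R C) d"
      "\<And>z. z \<in> hcomp (frob p R C) d \<Longrightarrow> z \<in> carrier (frob p R C)"
      "\<And>z w. z \<in> hcomp (frob p R C) d \<Longrightarrow> w \<in> hcomp (frob p R C) d \<Longrightarrow>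
        z \<oplus>\<^bsub>frob p R C\<^esub> w \<in> hcomp (frob p R C) d"
      by (rule T.frob_hcomp_closed; (assumption | erule rcomp_carrier | erule c0))+
    have z0: "\<zero>\<^bsub>D\<^esub> \<in> \<psi> ` hcomp (frob p R C) d"
    proof -
      have "\<psi> \<zero>\<^bsub>frob p R C\<^esub> = \<zero>\<^bsub>D\<^esub>"
        using \<psi>a[of "\<zero>\<^bsub>frob p R C\<^esub>" "\<zero>\<^bsub>frob p R C\<^esub>"] \<psi>c by (simp add: Pi_def)
      then show ?thesis using fc(1) by (metis image_eqI)
    qed
    have addc: "x \<oplus>\<^bsub>D\<^esub> y \<in> \<psi> ` hcomp (frob p R C) d"
      if xy: "x \<in> \<psi> ` hcomp (frob p R C) d" "y \<in> \<psi> ` hcomp (frob p R C) d" for x y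
    proof -
      obtain z w where zw: "z \<in> hcomp (frob p R C) d" "w \<in> hcomp (frob p R C) d" "x = \<psi> z" "y = \<psi> w"
        using xy by blast
      then have "x \<oplus>\<^bsub>D\<^esub> y = \<psi> (z \<oplus>\<^bsub>frob p R C\<^esub> w)" using fc(2) by (simp add: \<psi>a)
      then show ?thesis using fc(3)[OF zw(1,2)] by blast
    qed
    show ?thesis using that
    proof (rule D_induct)
      fix r c assume r: "r \<in> carrier R" and c: "c \<in> carrier C"
      have *: "D.hpart d (r \<odot>\<^bsub>D\<^esub> f c) \<in> \<psi> ` hcomp (frob p R C) d" if c: "c \<in> hcomp C e" for c e
        using r
      proof (induction r rule: poly_ring_induct)
        case (single m a)
        let ?s = "Poly_Mapping.single m a"
        have s: "?s \<in> rcomp R (int (mdeg m))" using single by (intro single_in_rcomp) auto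
        then have "?s \<odot>\<^bsub>D\<^esub> f c \<in> hcomp D (int (mdeg m) + int p * e)"
          using f_degree[OF c] by (intro D.hcomp_smult)
        moreover have "?s \<odot>\<^bsub>D\<^esub> f c \<in> \<psi> ` hcomp (frob p R C) d" if "int (mdeg m) + int p * e = d"
          using T.tensor_hcomp[OF s c that] \<psi>t[OF rcomp_carrier[OF s] c0[OF c]] by (metis image_eqI)
        ultimately show ?case using z0 by (auto simp: D.hpart_homog)
      next
        case (add r s)
        then show ?case
          using D.smult_l_distr[of r s "f c"] f_closed[OF c0[OF c]] addc by (simp add: D.hpart_add)
      qed
      show "D.hpart d (r \<odot>\<^bsub>D\<^esub> f c) \<in> \<psi> ` hcomp (frob p R C) d"
        using c
      proof (induction c rule: C.homog_induct)
        case (homog x d)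
        then show ?case by (rule *)
      next
        case (add x y)
        then show ?case using r addc by (simp add: f_add f_closed D.smult_r_distr D.hpart_add)
      qed
    qed (simp add: D.hpart_add addc)
  qed
  show thesis
  proof (rule that)
    show "\<psi> \<in> gmod_iso R (frob p R C) D"
      using hom inj surj \<psi>c by (auto simp: gmod_iso_def bij_betw_def)
    show "\<psi> (frob_tensor p R C r c) = r \<odot>\<^bsub>D\<^esub> f c" if "r \<in> carrier R" "c \<in> carrier C" for r c
      using \<psi>t that by simp
    show "\<exists>z\<in>hcomp (frob p R C) d. \<psi> z = x" if "x \<in> hcomp D d" for x d
      using gr[of x d] D.hcomp_carrier[OF that] that by (auto simp: D.hpart_homog)
  qed
qed

end


section \<open>F-modules as modules with a Frobenius action\<close>

locale fmod = char_p p n ty for p n and ty :: "'k::field itself" +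
  fixes A :: "('k mpol, 'b) F_module"
  assumes fmod: "graded_F_module p R A"
begin

sublocale graded_module R A using fmod by (simp add: graded_F_module_def)
sublocale T: tensor R A p by unfold_locales

abbreviation fr where "fr \<equiv> froact p R A"
abbreviation FA where "FA \<equiv> frob p R A"

lemma struct_props:
  "struct A \<in> gmod_hom R A FA" "struct A \<in> mod_hom R A FA" "bij_betw (struct A) (carrier A) (carrier FA)"
  using fmod by (auto simp: graded_F_module_def gmod_iso_def gmod_hom_def)

lemma struct_closed: "x \<in> carrier A \<Longrightarrow> struct A x \<in> carrier FA"
  and struct_add: "x \<in> carrier A \<Longrightarrow> y \<in> carrier A \<Longrightarrow> struct A (x \<oplus>\<^bsub>A\<^esub> y) = struct A x \<oplus>\<^bsub>FA\<^esub> struct A y"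
  and struct_smult: "a \<in> carrier R \<Longrightarrow> x \<in> carrier A \<Longrightarrow> struct A (a \<odot>\<^bsub>A\<^esub> x) = a \<odot>\<^bsub>FA\<^esub> struct A x"
  using struct_props(2) by (auto simp: mod_hom_def)

lemma struct_inj: "x \<in> carrier A \<Longrightarrow> y \<in> carrier A \<Longrightarrow> struct A x = struct A y \<Longrightarrow> x = y"
  using struct_props(3) by (auto simp: bij_betw_def inj_on_def)

lemma fr_closed: "y \<in> carrier A \<Longrightarrow> fr y \<in> carrier A"
  and struct_fr: "y \<in> carrier A \<Longrightarrow> struct A (fr y) = frob_tensor p R A 1 y"
proof -
  assume y: "y \<in> carrier A"
  have *: "frob_tensor p R A 1 y \<in> struct A ` carrier A"
    using T.tensor_closed[of 1 y] y struct_props(3) by (simp add: bij_betw_def)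
  show "fr y \<in> carrier A" "struct A (fr y) = frob_tensor p R A 1 y"
    using inv_into_into[OF *] f_inv_into_f[OF *] by (simp_all add: froact_def)
qed

lemma struct_smult_fr:
  assumes "r \<in> carrier R" "y \<in> carrier A"
  shows "struct A (r \<odot>\<^bsub>A\<^esub> fr y) = frob_tensor p R A r y"
  using assms T.smult_tensor[of r 1 y] by (simp add: struct_smult fr_closed struct_fr)

lemma fr_add: "x \<in> carrier A \<Longrightarrow> y \<in> carrier A \<Longrightarrow> fr (x \<oplus>\<^bsub>A\<^esub> y) = fr x \<oplus>\<^bsub>A\<^esub> fr y"
  by (rule struct_inj) (simp_all add: fr_closed struct_fr struct_add T.tensor_add_right)

lemma fr_smult: "s \<in> carrier R \<Longrightarrow> y \<in> carrier A \<Longrightarrow> fr (s \<odot>\<^bsub>A\<^esub> y) = s ^ p \<odot>\<^bsub>A\<^esub> fr y"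
  using T.tensor_balanced[of 1 s y]
  by (intro struct_inj) (simp_all add: fr_closed struct_fr struct_smult_fr)

lemma fr_zero: "fr \<zero>\<^bsub>A\<^esub> = \<zero>\<^bsub>A\<^esub>"
  using fr_add[of "\<zero>\<^bsub>A\<^esub>" "\<zero>\<^bsub>A\<^esub>"] fr_closed[of "\<zero>\<^bsub>A\<^esub>"] by simp

lemma fr_induct [consumes 1, case_names fr add]:
  assumes x: "x \<in> carrier A"
    and fr: "\<And>r c. r \<in> carrier R \<Longrightarrow> c \<in> carrier A \<Longrightarrow> P (r \<odot>\<^bsub>A\<^esub> fr c)"
    and add: "\<And>x y. x \<in> carrier A \<Longrightarrow> y \<in> carrier A \<Longrightarrow> P x \<Longrightarrow> P y \<Longrightarrow> P (x \<oplus>\<^bsub>A\<^esub> y)"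
  shows "P x"
proof -
  let ?g = "inv_into (carrier A) (struct A)"
  have g: "?g (struct A y) = y" if "y \<in> carrier A" for y
    using that struct_props(3) by (simp add: bij_betw_def)
  have "?g z \<in> carrier A \<and> P (?g z)" if "z \<in> carrier FA" for z
    using that
  proof (induction z rule: T.tensor_induct)
    case (tensor r m)
    then show ?case using g[of "r \<odot>\<^bsub>A\<^esub> fr m"] fr by (simp add: struct_smult_fr fr_closed)
  next
    case (add z w)
    have s: "struct A (?g z) = z" "struct A (?g w) = w"
      using add(1,2) struct_props(3) by (simp_all add: bij_betw_def f_inv_into_f)
    have "z \<oplus>\<^bsub>FA\<^esub> w = struct A (?g z \<oplus>\<^bsub>A\<^esub> ?g w)"
      using add(3,4) by (simp add: struct_add s)
    then show ?case using add(3,4) g[of "?g z \<oplus>\<^bsub>A\<^esub> ?g w"] assms(3) by simp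
  qed
  from this[OF struct_closed[OF x]] show ?thesis using g[OF x] by simp
qed

lemma fr_lift:
  assumes G: "abelian_group G"
    and \<tau>: "\<And>r m. r \<in> carrier R \<Longrightarrow> m \<in> carrier A \<Longrightarrow> \<tau> r m \<in> carrier G"
    and addl: "\<And>r s m. r \<in> carrier R \<Longrightarrow> s \<in> carrier R \<Longrightarrow> m \<in> carrier A \<Longrightarrow>
        \<tau> (r + s) m = \<tau> r m \<oplus>\<^bsub>G\<^esub> \<tau> s m"
    and addr: "\<And>r m m'. r \<in> carrier R \<Longrightarrow> m \<in> carrier A \<Longrightarrow> m' \<in> carrier A \<Longrightarrow>
        \<tau> r (m \<oplus>\<^bsub>A\<^esub> m') = \<tau> r m \<oplus>\<^bsub>G\<^esub> \<tau> r m'"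
    and bal: "\<And>r s m. r \<in> carrier R \<Longrightarrow> s \<in> carrier R \<Longrightarrow> m \<in> carrier A \<Longrightarrow>
        \<tau> (s ^ p * r) m = \<tau> r (s \<odot>\<^bsub>A\<^esub> m)"
  obtains \<phi> where "\<And>x. x \<in> carrier A \<Longrightarrow> \<phi> x \<in> carrier G"
    "\<And>x y. x \<in> carrier A \<Longrightarrow> y \<in> carrier A \<Longrightarrow> \<phi> (x \<oplus>\<^bsub>A\<^esub> y) = \<phi> x \<oplus>\<^bsub>G\<^esub> \<phi> y"
    "\<And>r m. r \<in> carrier R \<Longrightarrow> m \<in> carrier A \<Longrightarrow> \<phi> (r \<odot>\<^bsub>A\<^esub> fr m) = \<tau> r m"
proof -
  obtain \<phi> where \<phi>: "\<phi> \<in> carrier FA \<rightarrow> carrier G"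
    "\<And>x y. x \<in> carrier FA \<Longrightarrow> y \<in> carrier FA \<Longrightarrow> \<phi> (x \<oplus>\<^bsub>FA\<^esub> y) = \<phi> x \<oplus>\<^bsub>G\<^esub> \<phi> y"
    "\<And>r m. r \<in> carrier R \<Longrightarrow> m \<in> carrier A \<Longrightarrow> \<phi> (frob_tensor p R A r m) = \<tau> r m"
    by (rule T.tensor_lift[OF G, of \<tau>]) (use \<tau> addl addr bal in auto)
  show thesis
    by (rule that[of "\<lambda>x. \<phi> (struct A x)"])
       (use \<phi> struct_closed in \<open>auto simp: struct_add struct_smult_fr Pi_def\<close>)
qed

text \<open>The map \<open>r \<otimes> m \<mapsto> fcoord j r \<odot> m\<close> is balanced by
  \<open>fcoord_frob\<close>; it is read on \<open>A\<close> through the structure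
  isomorphism.\<close>

lemma fq_exists:
  assumes j: "j \<in> fidx"
  shows "\<exists>q. (\<forall>x\<in>carrier A. q x \<in> carrier A) \<and>
    (\<forall>x\<in>carrier A. \<forall>y\<in>carrier A. q (x \<oplus>\<^bsub>A\<^esub> y) = q x \<oplus>\<^bsub>A\<^esub> q y) \<and>
    (\<forall>r\<in>carrier R. \<forall>m\<in>carrier A. q (r \<odot>\<^bsub>A\<^esub> fr m) = fcoord j r \<odot>\<^bsub>A\<^esub> m)"
proof -
  have j': "snd j \<in> mbox n p" using j by (auto simp: fidx_def)
  obtain \<phi> where "\<And>x. x \<in> carrier A \<Longrightarrow> \<phi> x \<in> carrier A"
    "\<And>x y. x \<in> carrier A \<Longrightarrow> y \<in> carrier A \<Longrightarrow> \<phi> (x \<oplus>\<^bsub>A\<^esub> y) = \<phi> x \<oplus>\<^bsub>A\<^esub> \<phi> y"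
    "\<And>r m. r \<in> carrier R \<Longrightarrow> m \<in> carrier A \<Longrightarrow> \<phi> (r \<odot>\<^bsub>A\<^esub> fr m) = fcoord j r \<odot>\<^bsub>A\<^esub> m"
  proof (rule fr_lift[OF M.abelian_group_axioms, of "\<lambda>r m. fcoord j r \<odot>\<^bsub>A\<^esub> m"])
    fix r s m assume *: "r \<in> carrier R" "s \<in> carrier R" "m \<in> carrier A"
    show "fcoord j (r + s) \<odot>\<^bsub>A\<^esub> m = fcoord j r \<odot>\<^bsub>A\<^esub> m \<oplus>\<^bsub>A\<^esub> fcoord j s \<odot>\<^bsub>A\<^esub> m"
      using smult_l_distr[of "fcoord j r" "fcoord j s" m] * by (simp add: fcoord_add fcoord_closed)
    show "fcoord j (s ^ p * r) \<odot>\<^bsub>A\<^esub> m = fcoord j r \<odot>\<^bsub>A\<^esub> (s \<odot>\<^bsub>A\<^esub> m)"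
      using smult_assoc1[of "fcoord j r" s m] * by (simp add: fcoord_frob[OF j'] fcoord_closed mult.commute[of s])
  qed (auto simp: fcoord_closed smult_r_distr)
  then show ?thesis by blast
qed

definition fq :: "'k \<times> (nat \<Rightarrow>\<^sub>0 nat) \<Rightarrow> 'b \<Rightarrow> 'b" where
  "fq j = (SOME q. (\<forall>x\<in>carrier A. q x \<in> carrier A) \<and>
    (\<forall>x\<in>carrier A. \<forall>y\<in>carrier A. q (x \<oplus>\<^bsub>A\<^esub> y) = q x \<oplus>\<^bsub>A\<^esub> q y) \<and>
    (\<forall>r\<in>carrier R. \<forall>m\<in>carrier A. q (r \<odot>\<^bsub>A\<^esub> fr m) = fcoord j r \<odot>\<^bsub>A\<^esub> m))"

lemma fq_closed: "j \<in> fidx \<Longrightarrow> x \<in> carrier A \<Longrightarrow> fq j x \<in> carrier A"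
  and fq_add: "j \<in> fidx \<Longrightarrow> x \<in> carrier A \<Longrightarrow> y \<in> carrier A \<Longrightarrow> fq j (x \<oplus>\<^bsub>A\<^esub> y) = fq j x \<oplus>\<^bsub>A\<^esub> fq j y"
  and fq_fr: "j \<in> fidx \<Longrightarrow> r \<in> carrier R \<Longrightarrow> m \<in> carrier A \<Longrightarrow> fq j (r \<odot>\<^bsub>A\<^esub> fr m) = fcoord j r \<odot>\<^bsub>A\<^esub> m"
  using someI_ex[OF fq_exists[of j], folded fq_def] by blast+

lemma fq_zero: "j \<in> fidx \<Longrightarrow> fq j \<zero>\<^bsub>A\<^esub> = \<zero>\<^bsub>A\<^esub>"
  using fq_add[of j "\<zero>\<^bsub>A\<^esub>" "\<zero>\<^bsub>A\<^esub>"] fq_closed[of j "\<zero>\<^bsub>A\<^esub>"] by simp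

text \<open>The structure map preserves degrees, so a homogeneous element becomes a sum of
  homogeneous tensors \<open>r \<otimes> m\<close> in \<open>F(A)\<close>, which is then pulled
  back.\<close>

lemma fr_hcomp_induct:
  assumes x: "x \<in> hcomp A d"
    and fr: "\<And>r m i j. r \<in> rcomp R i \<Longrightarrow> m \<in> hcomp A j \<Longrightarrow> i + int p * j = d \<Longrightarrow> P (r \<odot>\<^bsub>A\<^esub> fr m)"
    and add: "\<And>x y. x \<in> carrier A \<Longrightarrow> y \<in> carrier A \<Longrightarrow> P x \<Longrightarrow> P y \<Longrightarrow> P (x \<oplus>\<^bsub>A\<^esub> y)"
  shows "P x"
proof -
  let ?g = "inv_into (carrier A) (struct A)"
  have g: "?g (struct A y) = y" if "y \<in> carrier A" for y
    using that struct_props(3) by (simp add: bij_betw_def)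
  have gc: "?g z \<in> carrier A" "struct A (?g z) = z" if "z \<in> carrier FA" for z
    using that struct_props(3) by (simp_all add: bij_betw_def f_inv_into_f inv_into_into)
  have rc: "r \<in> carrier R \<and> \<ominus>\<^bsub>R\<^esub> r \<in> rcomp R i" if "r \<in> rcomp R i" for r i
    using that rcomp_carrier[OF that] rcomp_closed(2)[OF that] by simp
  have z: "struct A x \<in> hcomp FA d" using struct_props(1) x by (auto simp: gmod_hom_def)
  have "P (?g (struct A x))"
  proof (rule T.tensor_hcomp_induct[where P = "\<lambda>z. P (?g z)", OF rc z hcomp_subgroup])
    fix r m i j assume rm: "r \<in> rcomp R i" "m \<in> hcomp A j" "i + int p * j = d"
    have c: "r \<in> carrier R" "m \<in> carrier A" using rm rcomp_carrier hcomp_carrier by blast+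
    show "P (?g (frob_tensor p R A r m))"
      using g[of "r \<odot>\<^bsub>A\<^esub> fr m"] fr[OF rm] c by (simp add: struct_smult_fr fr_closed)
  next
    fix z w assume zw: "z \<in> carrier FA" "w \<in> carrier FA" "P (?g z)" "P (?g w)"
    have "z \<oplus>\<^bsub>FA\<^esub> w = struct A (?g z \<oplus>\<^bsub>A\<^esub> ?g w)" using zw(1,2) by (simp add: struct_add gc)
    then show "P (?g (z \<oplus>\<^bsub>FA\<^esub> w))" using g[of "?g z \<oplus>\<^bsub>A\<^esub> ?g w"] gc zw add by simp
  qed (simp_all add: rcomp_closed)
  then show ?thesis using g[OF hcomp_carrier[OF x]] by simp
qed

lemma fq_degree:
  assumes j: "j \<in> fidx" and x: "x \<in> hcomp A d" and e: "int p * e + int (mdeg (snd j)) = d"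
  shows "fq j x \<in> hcomp A e"
  using x
proof (rule fr_hcomp_induct)
  fix r m i k assume rm: "r \<in> rcomp R i" "m \<in> hcomp A k" "i + int p * k = d"
  have "fcoord j r \<in> rcomp R (e - k)"
    by (rule fcoord_degree[OF rm(1)]) (use e rm(3) in \<open>simp add: algebra_simps\<close>)
  from hcomp_smult[OF this rm(2)] show "fq j (r \<odot>\<^bsub>A\<^esub> fr m) \<in> hcomp A e"
    using fq_fr[OF j rcomp_carrier[OF rm(1)] hcomp_carrier[OF rm(2)]] by simp
qed (simp add: fq_add[OF j] hcomp_add)

lemma fq_degree_zero:
  assumes j: "j \<in> fidx" and x: "x \<in> hcomp A d" and e: "\<And>e. int p * e + int (mdeg (snd j)) \<noteq> d"
  shows "fq j x = \<zero>\<^bsub>A\<^esub>"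
  using x
proof (rule fr_hcomp_induct)
  fix r m i k assume rm: "r \<in> rcomp R i" "m \<in> hcomp A k" "i + int p * k = d"
  have "fcoord j r = 0"
  proof (rule fcoord_degree_zero[OF rm(1)])
    show "int p * e' + int (mdeg (snd j)) \<noteq> i" for e'
      using e[of "e' + k"] rm(3) by (simp only: distrib_left)
  qed
  then show "fq j (r \<odot>\<^bsub>A\<^esub> fr m) = \<zero>\<^bsub>A\<^esub>"
    using fq_fr[OF j rcomp_carrier[OF rm(1)] hcomp_carrier[OF rm(2)]] hcomp_carrier[OF rm(2)]
      smult_l_null[OF hcomp_carrier[OF rm(2)]] by simp
qed (simp add: fq_add[OF j])

sublocale E0: frob_coords p n ty A A fr fq
  by unfold_locales
    (auto simp: fr_closed fr_add fr_smult fq_closed fq_add fq_fr intro: fr_induct)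

text \<open>The definition asks \<open>\<theta>\<close> to preserve degrees and says nothing of its
  inverse, through which \<open>fr\<close> is defined. The parts of \<open>fr y\<close> outside
  degree \<open>p d\<close> are therefore shown to vanish by computing their coordinates.\<close>

lemma fr_degree:
  assumes y: "y \<in> hcomp A d"
  shows "fr y \<in> hcomp A (int p * d)"
proof (rule homog_if_hparts_zero)
  have yc: "y \<in> carrier A" using y by (rule hcomp_carrier)
  show fc: "fr y \<in> carrier A" using yc by (rule fr_closed)
  fix e assume e: "e \<noteq> int p * d"
  show "hpart e (fr y) = \<zero>\<^bsub>A\<^esub>"
  proof (rule E0.zero_if_q_zero)
    show "hpart e (fr y) \<in> carrier A" using fc by simp
    fix j assume j: "j \<in> fidx"
    show "fq j (hpart e (fr y)) = \<zero>\<^bsub>A\<^esub>"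
    proof (cases "\<exists>e'. int p * e' + int (mdeg (snd j)) = e")
      case False
      then show ?thesis using fq_degree_zero[OF j hpart_props(1)[OF fc, of e]] by blast
    next
      case True
      then obtain e' where e': "int p * e' + int (mdeg (snd j)) = e" by auto
      have "hpart e' (fq j (fr y)) = fq j (hpart e (fr y))"
      proof (rule hpart_image[OF graded_module_axioms _ _ _ _ fc])
        fix x assume "x \<in> hcomp A e"
        then show "fq j x \<in> hcomp A e'" by (rule fq_degree[OF j _ e'])
      next
        fix x e2 assume x: "x \<in> hcomp A e2" "e2 \<noteq> e"
        show "hpart e' (fq j x) = \<zero>\<^bsub>A\<^esub>"
        proof (cases "\<exists>e3. int p * e3 + int (mdeg (snd j)) = e2")
          case True
          then obtain e3 where e3: "int p * e3 + int (mdeg (snd j)) = e2" by auto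
          then have "e3 \<noteq> e'" using e' x(2) by auto
          then show ?thesis using fq_degree[OF j x(1) e3] by (simp add: hpart_homog)
        next
          case False
          then have "fq j x = \<zero>\<^bsub>A\<^esub>" using fq_degree_zero[OF j x(1)] by blast
          then show ?thesis by simp
        qed
      qed (use j in \<open>auto simp: fq_closed fq_add\<close>)
      \<comment> \<open>As \<open>fr y = 1 fr y\<close>, its coordinate is a multiple of
        \<open>y\<close> by \<open>fcoord j 1\<close>, which is zero or homogeneous of the degree
        \<open>e4\<close> with \<open>p e4 + mdeg (snd j) = 0\<close>. That product lies in degree
        \<open>e4 + d\<close>, and \<open>e' = e4 + d\<close> would give
        \<open>e = p d\<close>.\<close>
      moreover have "fq j (fr y) = fcoord j 1 \<odot>\<^bsub>A\<^esub> y"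
        using fq_fr[OF j _ yc, of 1] smult_one[OF fr_closed[OF yc]] by simp
      moreover have "hpart e' (fcoord j 1 \<odot>\<^bsub>A\<^esub> y) = \<zero>\<^bsub>A\<^esub>"
      proof (cases "\<exists>e4. int p * e4 + int (mdeg (snd j)) = 0")
        case True
        then obtain e4 where e4: "int p * e4 + int (mdeg (snd j)) = 0" by auto
        have "fcoord j 1 \<odot>\<^bsub>A\<^esub> y \<in> hcomp A (e4 + d)"
          using fcoord_degree[OF one_in_rcomp e4] y by (rule hcomp_smult)
        moreover have "e' \<noteq> e4 + d" using e e' e4 by (auto simp: algebra_simps)
        ultimately show ?thesis by (simp add: hpart_homog)
      next
        case False
        then have "fcoord j 1 = 0" using fcoord_degree_zero[OF one_in_rcomp] by blast
        then show ?thesis using smult_l_null[OF yc] by simp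
      qed
      ultimately show ?thesis by simp
    qed
  qed
qed

sublocale E: frob_ext p n ty A A fr fq
  by unfold_locales (rule fr_degree)

text \<open>The elements \<open>r fr m\<close> generate \<open>A\<close> additively. The target
  enters only through an operation \<open>pl\<close>, so values in \<open>F(B)\<close>, polynomials
  and other groups are treated alike.\<close>

lemma fr_fun_eqI:
  assumes "\<And>x y. x \<in> carrier A \<Longrightarrow> y \<in> carrier A \<Longrightarrow> \<phi> (x \<oplus>\<^bsub>A\<^esub> y) = pl (\<phi> x) (\<phi> y)"
    and "\<And>x y. x \<in> carrier A \<Longrightarrow> y \<in> carrier A \<Longrightarrow> \<chi> (x \<oplus>\<^bsub>A\<^esub> y) = pl (\<chi> x) (\<chi> y)"
    and "\<And>r m. r \<in> carrier R \<Longrightarrow> m \<in> carrier A \<Longrightarrow> \<phi> (r \<odot>\<^bsub>A\<^esub> fr m) = \<chi> (r \<odot>\<^bsub>A\<^esub> fr m)"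
    and x: "x \<in> carrier A"
  shows "\<phi> x = \<chi> x"
  using x by (induction x rule: fr_induct) (simp_all add: assms)

end

section \<open>Structure maps and morphisms in terms of the Frobenius action\<close>

context char_p
begin

text \<open>The hypothesis on homogeneous lifts is what gives degree preservation of the inverse, as
  \<open>gmod_iso\<close> demands only a degree-preserving bijection.\<close>

lemma gmod_iso_inv:
  fixes M :: "('k mpol, 'b, 'y) graded_module_scheme" and N :: "('k mpol, 'c, 'z) graded_module_scheme"
  assumes M: "graded_module R M" and N: "graded_module R N" and \<psi>: "\<psi> \<in> gmod_iso R (frob p R M) N"
    and gr: "\<And>x d. x \<in> hcomp N d \<Longrightarrow> \<exists>z\<in>hcomp (frob p R M) d. \<psi> z = x"
  shows "inv_into (carrier (frob p R M)) \<psi> \<in> gmod_iso R N (frob p R M)"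
proof -
  interpret M: graded_module R M by fact
  interpret N: graded_module R N by fact
  interpret T: tensor R M p by unfold_locales
  interpret F: abelian_group "frob p R M" by (rule T.abelian_group_frob)
  let ?g = "inv_into (carrier (frob p R M)) \<psi>"
  have bij: "bij_betw \<psi> (carrier (frob p R M)) (carrier N)" using \<psi> by (simp add: gmod_iso_def)
  have \<psi>a: "\<psi> (x \<oplus>\<^bsub>frob p R M\<^esub> y) = \<psi> x \<oplus>\<^bsub>N\<^esub> \<psi> y"
    if "x \<in> carrier (frob p R M)" "y \<in> carrier (frob p R M)" for x y
    using \<psi> that by (auto simp: gmod_iso_def gmod_hom_def mod_hom_def)
  have \<psi>s: "\<psi> (a \<odot>\<^bsub>frob p R M\<^esub> y) = a \<odot>\<^bsub>N\<^esub> \<psi> y" if "a \<in> carrier R" "y \<in> carrier (frob p R M)" for a y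
    using \<psi> that by (auto simp: gmod_iso_def gmod_hom_def mod_hom_def)
  have g: "?g x \<in> carrier (frob p R M)" "\<psi> (?g x) = x" if "x \<in> carrier N" for x
    using bij that by (auto simp: bij_betw_def intro: inv_into_into f_inv_into_f)
  have eq: "?g x = z" if "z \<in> carrier (frob p R M)" "\<psi> z = x" for x z
    using bij that by (auto simp: bij_betw_def)
  have hc: "z \<in> carrier (frob p R M)" if "z \<in> hcomp (frob p R M) d" for z d
    using that by (rule T.frob_hcomp_closed(2)[rotated 2]) (erule rcomp_carrier M.hcomp_carrier)+
  have "?g (x \<oplus>\<^bsub>N\<^esub> y) = ?g x \<oplus>\<^bsub>frob p R M\<^esub> ?g y" if "x \<in> carrier N" "y \<in> carrier N" for x y
    by (rule eq) (simp_all add: \<psi>a that g)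
  moreover have "?g (a \<odot>\<^bsub>N\<^esub> x) = a \<odot>\<^bsub>frob p R M\<^esub> ?g x" if "a \<in> carrier R" "x \<in> carrier N" for a x
    by (rule eq) (simp_all add: \<psi>s T.smult_closed_frob that g)
  moreover have "?g x \<in> hcomp (frob p R M) d" if x: "x \<in> hcomp N d" for x d
  proof -
    obtain z where z: "z \<in> hcomp (frob p R M) d" "\<psi> z = x" using gr[OF x] by blast
    then show ?thesis using eq[OF hc[OF z(1)] z(2)] by simp
  qed
  ultimately show ?thesis
    using g bij_betw_inv_into[OF bij] by (auto simp: gmod_iso_def gmod_hom_def mod_hom_def)
qed

text \<open>Both sides of the compatibility with the structure maps are additive, and on
  \<open>r fr m\<close> they are \<open>r \<otimes> \<phi> m\<close> once \<open>\<phi>\<close>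
  commutes with the Frobenius actions. The converse is the case \<open>r = 1\<close>.\<close>

lemma F_hom_iff:
  assumes A: "graded_F_module p R A" and B: "graded_F_module p R B"
  shows "\<phi> \<in> F_hom p R A B \<longleftrightarrow> \<phi> \<in> gmod_hom R A B \<and>
    (\<forall>y\<in>carrier A. \<phi> (froact p R A y) = froact p R B (\<phi> y))"
proof -
  interpret A: fmod p n ty A by unfold_locales (rule A)
  interpret B: fmod p n ty B by unfold_locales (rule B)
  show ?thesis
  proof (intro iffI conjI ballI)
    assume "\<phi> \<in> F_hom p R A B"
    then have \<phi>: "\<phi> \<in> gmod_hom R A B" "\<phi> \<in> mod_hom R A B"
      and F: "\<And>x. x \<in> carrier A \<Longrightarrow> struct B (\<phi> x) = frob_map p R B \<phi> (struct A x)"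
      by (auto simp: F_hom_def gmod_hom_def)
    show "\<phi> \<in> gmod_hom R A B" by fact
    fix y assume y: "y \<in> carrier A"
    have \<phi>c: "\<And>x. x \<in> carrier A \<Longrightarrow> \<phi> x \<in> carrier B" using \<phi>(2) by (auto simp: mod_hom_def)
    have "struct B (\<phi> (A.fr y)) = struct B (B.fr (\<phi> y))"
      using F[OF A.fr_closed[OF y]] y \<phi>c
      by (simp add: A.struct_fr B.struct_fr A.T.frob_map_tensor[OF B.T.tensor \<phi>(2)])
    then show "\<phi> (A.fr y) = B.fr (\<phi> y)"
      using y \<phi>c A.fr_closed B.fr_closed by (intro B.struct_inj) auto
  next
    assume "\<phi> \<in> gmod_hom R A B \<and> (\<forall>y\<in>carrier A. \<phi> (A.fr y) = B.fr (\<phi> y))"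
    then have \<phi>: "\<phi> \<in> gmod_hom R A B" "\<phi> \<in> mod_hom R A B"
      and F: "\<And>y. y \<in> carrier A \<Longrightarrow> \<phi> (A.fr y) = B.fr (\<phi> y)"
      by (auto simp: gmod_hom_def)
    have \<phi>c: "\<And>x. x \<in> carrier A \<Longrightarrow> \<phi> x \<in> carrier B"
      and \<phi>a: "\<And>x y. x \<in> carrier A \<Longrightarrow> y \<in> carrier A \<Longrightarrow> \<phi> (x \<oplus>\<^bsub>A\<^esub> y) = \<phi> x \<oplus>\<^bsub>B\<^esub> \<phi> y"
      and \<phi>s: "\<And>a x. a \<in> carrier R \<Longrightarrow> x \<in> carrier A \<Longrightarrow> \<phi> (a \<odot>\<^bsub>A\<^esub> x) = a \<odot>\<^bsub>B\<^esub> \<phi> x"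
      using \<phi>(2) by (auto simp: mod_hom_def)
    have "struct B (\<phi> x) = frob_map p R B \<phi> (struct A x)" if "x \<in> carrier A" for x
      using that
    proof (rule A.fr_fun_eqI[where pl = "add B.FA", rotated 3])
      fix x y assume xy: "x \<in> carrier A" "y \<in> carrier A"
      show "struct B (\<phi> (x \<oplus>\<^bsub>A\<^esub> y)) = struct B (\<phi> x) \<oplus>\<^bsub>B.FA\<^esub> struct B (\<phi> y)"
        using xy by (simp add: \<phi>a \<phi>c B.struct_add)
      show "frob_map p R B \<phi> (struct A (x \<oplus>\<^bsub>A\<^esub> y)) =
          frob_map p R B \<phi> (struct A x) \<oplus>\<^bsub>B.FA\<^esub> frob_map p R B \<phi> (struct A y)"
        using xy by (simp add: A.struct_add A.struct_closed A.T.frob_map_add[OF B.T.tensor \<phi>(2)])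
    next
      fix r m assume "r \<in> carrier R" "m \<in> carrier A"
      then show "struct B (\<phi> (r \<odot>\<^bsub>A\<^esub> A.fr m)) = frob_map p R B \<phi> (struct A (r \<odot>\<^bsub>A\<^esub> A.fr m))"
        by (simp add: \<phi>s F A.fr_closed \<phi>c A.struct_smult_fr B.struct_smult_fr
            A.T.frob_map_tensor[OF B.T.tensor \<phi>(2)])
    qed
    then show "\<phi> \<in> F_hom p R A B" using \<phi>(1) by (simp add: F_hom_def)
  qed
qed

lemma frob_ext_struct:
  fixes M :: "('k mpol, 'b, 'z) graded_module_scheme"
  assumes "frob_ext p n M M f q"
  obtains \<theta> where "\<theta> \<in> gmod_iso R M (frob p R M)"
    "\<And>r c. r \<in> carrier R \<Longrightarrow> c \<in> carrier M \<Longrightarrow> \<theta> (r \<odot>\<^bsub>M\<^esub> f c) = frob_tensor p R M r c"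
proof -
  interpret frob_ext p n ty M M f q by fact
  obtain \<psi> where \<psi>: "\<psi> \<in> gmod_iso R (frob p R M) M"
    "\<And>r c. r \<in> carrier R \<Longrightarrow> c \<in> carrier M \<Longrightarrow> \<psi> (frob_tensor p R M r c) = r \<odot>\<^bsub>M\<^esub> f c"
    "\<And>x d. x \<in> hcomp M d \<Longrightarrow> \<exists>z\<in>hcomp (frob p R M) d. \<psi> z = x"
    using frob_iso by blast
  have \<theta>: "inv_into (carrier (frob p R M)) \<psi> \<in> gmod_iso R M (frob p R M)"
    by (rule gmod_iso_inv[OF C.graded_module_axioms C.graded_module_axioms \<psi>(1,3)])
  show thesis
  proof (rule that[OF \<theta>])
    fix r c assume rc: "r \<in> carrier R" "c \<in> carrier M"
    have "inj_on \<psi> (carrier (frob p R M))" using \<psi>(1) by (auto simp: gmod_iso_def bij_betw_def)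
    from inv_into_f_f[OF this T.tensor_closed[OF rc]] show
      "inv_into (carrier (frob p R M)) \<psi> (r \<odot>\<^bsub>M\<^esub> f c) = frob_tensor p R M r c"
      using \<psi>(2)[OF rc] by simp
  qed
qed

end


section \<open>Roots of F-finite modules\<close>

text \<open>The coefficient set \<open>Q\<close> is a parameter: \<open>Q = carrier R\<close> gives
  generated submodules, and \<open>Q = scalars\<close> gives spans over the field.\<close>

inductive_set lspan :: "'a set \<Rightarrow> ('a, 'b, 'z) module_scheme \<Rightarrow> 'b set \<Rightarrow> 'b set"
  for Q :: "'a set" and M :: "('a, 'b, 'z) module_scheme" and S :: "'b set" where
  lspan_zero: "\<zero>\<^bsub>M\<^esub> \<in> lspan Q M S"
| lspan_step: "a \<in> Q \<Longrightarrow> s \<in> S \<Longrightarrow> y \<in> lspan Q M S \<Longrightarrow> a \<odot>\<^bsub>M\<^esub> s \<oplus>\<^bsub>M\<^esub> y \<in> lspan Q M S"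

lemma lspan_mono: "S \<subseteq> T \<Longrightarrow> lspan Q M S \<subseteq> lspan Q M T"
proof (rule subsetI)
  fix x assume "S \<subseteq> T" "x \<in> lspan Q M S"
  from this(2,1) show "x \<in> lspan Q M T" by induction (auto intro: lspan.intros)
qed

lemma lspan_least:
  assumes "\<zero>\<^bsub>M\<^esub> \<in> H" "\<And>x y. x \<in> H \<Longrightarrow> y \<in> H \<Longrightarrow> x \<oplus>\<^bsub>M\<^esub> y \<in> H"
    "\<And>a x. a \<in> Q \<Longrightarrow> x \<in> S \<Longrightarrow> a \<odot>\<^bsub>M\<^esub> x \<in> H"
  shows "lspan Q M S \<subseteq> H"
proof
  fix x assume "x \<in> lspan Q M S"
  then show "x \<in> H" by induction (auto intro: assms)
qed

context Module.module
begin

lemma lspan_closed: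
  assumes "Q \<subseteq> carrier R" "S \<subseteq> carrier M"
  shows "lspan Q M S \<subseteq> carrier M"
  by (rule lspan_least) (use assms in auto)

lemma lspan_add:
  assumes Q: "Q \<subseteq> carrier R" and S: "S \<subseteq> carrier M" and x: "x \<in> lspan Q M S" and y: "y \<in> lspan Q M S"
  shows "x \<oplus>\<^bsub>M\<^esub> y \<in> lspan Q M S"
  using x
proof induction
  case lspan_zero
  then show ?case using y lspan_closed[OF Q S] by auto
next
  case (lspan_step a s z)
  have "a \<odot>\<^bsub>M\<^esub> s \<oplus>\<^bsub>M\<^esub> z \<oplus>\<^bsub>M\<^esub> y = a \<odot>\<^bsub>M\<^esub> s \<oplus>\<^bsub>M\<^esub> (z \<oplus>\<^bsub>M\<^esub> y)"
    using lspan_step y Q S lspan_closed[OF Q S] by (intro M.a_assoc) auto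
  then show ?case using lspan_step by (auto intro: lspan.lspan_step)
qed

lemma lspan_smult:
  assumes Q: "Q \<subseteq> carrier R" and S: "S \<subseteq> carrier M" and b: "b \<in> carrier R"
    and bQ: "\<And>a. a \<in> Q \<Longrightarrow> b \<otimes> a \<in> Q" and x: "x \<in> lspan Q M S"
  shows "b \<odot>\<^bsub>M\<^esub> x \<in> lspan Q M S"
  using x
proof induction
  case lspan_zero
  then show ?case using b by (auto intro: lspan.lspan_zero)
next
  case (lspan_step a s z)
  have "a \<in> carrier R" "s \<in> carrier M" "z \<in> carrier M"
    using lspan_step Q S lspan_closed[OF Q S] by auto
  then have "b \<odot>\<^bsub>M\<^esub> (a \<odot>\<^bsub>M\<^esub> s \<oplus>\<^bsub>M\<^esub> z) = (b \<otimes> a) \<odot>\<^bsub>M\<^esub> s \<oplus>\<^bsub>M\<^esub> b \<odot>\<^bsub>M\<^esub> z"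
    using b by (simp add: smult_r_distr smult_assoc1)
  then show ?case using lspan_step bQ by (auto intro: lspan.lspan_step)
qed

lemma lspan_incl:
  assumes "Q \<subseteq> carrier R" "\<one> \<in> Q" "S \<subseteq> carrier M" "s \<in> S"
  shows "s \<in> lspan Q M S"
  using lspan_step[of "\<one>" Q s S "\<zero>\<^bsub>M\<^esub>" M] lspan_zero[of M Q S] assms by auto

lemma lspan_subset:
  assumes S: "S \<subseteq> carrier M" and T: "T \<subseteq> lspan (carrier R) M S"
  shows "lspan (carrier R) M T \<subseteq> lspan (carrier R) M S"
  by (rule lspan_least) (use T S in \<open>auto intro: lspan.lspan_zero lspan_add lspan_smult\<close>)

lemma lspan_insert:
  assumes Q: "Q \<subseteq> carrier R" "\<zero> \<in> Q" "\<And>a b. a \<in> Q \<Longrightarrow> b \<in> Q \<Longrightarrow> a \<oplus> b \<in> Q"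
    and T: "T \<subseteq> carrier M" "t \<in> carrier M" and x: "x \<in> lspan Q M (insert t T)"
  shows "\<exists>r y. r \<in> Q \<and> y \<in> lspan Q M T \<and> x = r \<odot>\<^bsub>M\<^esub> t \<oplus>\<^bsub>M\<^esub> y"
  using x
proof induction
  case lspan_zero
  show ?case by (rule exI[of _ \<zero>], rule exI[of _ "\<zero>\<^bsub>M\<^esub>"]) (auto simp: T Q lspan.lspan_zero)
next
  case (lspan_step a s z)
  then obtain r y where ry: "r \<in> Q" "y \<in> lspan Q M T" "z = r \<odot>\<^bsub>M\<^esub> t \<oplus>\<^bsub>M\<^esub> y" by auto
  have yc: "y \<in> carrier M" "r \<in> carrier R" "a \<in> carrier R"
    using ry lspan_step(1) lspan_closed[OF Q(1) T(1)] Q(1) by auto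
  show ?case
  proof (cases "s = t")
    case True
    have "a \<odot>\<^bsub>M\<^esub> s \<oplus>\<^bsub>M\<^esub> z = (a \<oplus> r) \<odot>\<^bsub>M\<^esub> t \<oplus>\<^bsub>M\<^esub> y"
      using ry yc T True by (simp add: smult_l_distr M.a_assoc)
    then show ?thesis using lspan_step ry Q(3) by blast
  next
    case False
    then have s: "s \<in> T" "s \<in> carrier M" using lspan_step T by auto
    have "a \<odot>\<^bsub>M\<^esub> s \<oplus>\<^bsub>M\<^esub> z = r \<odot>\<^bsub>M\<^esub> t \<oplus>\<^bsub>M\<^esub> (a \<odot>\<^bsub>M\<^esub> s \<oplus>\<^bsub>M\<^esub> y)"
      using ry yc T s by (simp add: M.a_lcomm)
    then show ?thesis using lspan_step ry s by (meson lspan.lspan_step)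
  qed
qed

text \<open>The hypotheses make \<open>Q\<close> a field, and this says that a subspace of a
  finite-dimensional space is finite-dimensional. In the induction, one element of \<open>V\<close>
  outside the span of \<open>T\<close> splits off the direction \<open>t\<close>, and the rest of
  \<open>V\<close> reduces to \<open>V'\<close>.\<close>

lemma lspan_subspace_finite:
  assumes Q: "Q \<subseteq> carrier R" "\<zero> \<in> Q" "\<one> \<in> Q" "\<And>a b. a \<in> Q \<Longrightarrow> b \<in> Q \<Longrightarrow> a \<oplus> b \<in> Q"
      "\<And>a b. a \<in> Q \<Longrightarrow> b \<in> Q \<Longrightarrow> a \<otimes> b \<in> Q" "\<And>a. a \<in> Q \<Longrightarrow> \<ominus> a \<in> Q"
      "\<And>a. a \<in> Q \<Longrightarrow> a \<noteq> \<zero> \<Longrightarrow> \<exists>b\<in>Q. b \<otimes> a = \<one>"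
    and T: "finite T" "T \<subseteq> carrier M"
    and V: "V \<subseteq> lspan Q M T" "\<And>x y. x \<in> V \<Longrightarrow> y \<in> V \<Longrightarrow> x \<oplus>\<^bsub>M\<^esub> y \<in> V"
      "\<And>a x. a \<in> Q \<Longrightarrow> x \<in> V \<Longrightarrow> a \<odot>\<^bsub>M\<^esub> x \<in> V"
  shows "\<exists>T'\<subseteq>V. finite T' \<and> V \<subseteq> lspan Q M T'"
  using T V
proof (induction T arbitrary: V rule: finite_induct)
  case empty
  have "lspan Q M {} \<subseteq> {\<zero>\<^bsub>M\<^esub>}" by (rule lspan_least) auto
  then show ?case using empty.prems(2) lspan_zero[of M Q "{}"] by (intro exI[of _ "{}"]) auto
next
  case (insert t T)
  have T: "T \<subseteq> carrier M" "t \<in> carrier M" using insert.prems by auto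
  have tT: "insert t T \<subseteq> carrier M" using T by auto
  have Vc: "x \<in> carrier M" if "x \<in> V" for x using that insert.prems(2) lspan_closed[OF Q(1) tT] by auto
  define V' where "V' = V \<inter> lspan Q M T"
  have "\<exists>T'\<subseteq>V'. finite T' \<and> V' \<subseteq> lspan Q M T'"
  proof (rule insert.IH[OF T(1)])
    show "V' \<subseteq> lspan Q M T" by (auto simp: V'_def)
    show "x \<oplus>\<^bsub>M\<^esub> y \<in> V'" if "x \<in> V'" "y \<in> V'" for x y
      using that insert.prems(3) lspan_add[OF Q(1) T(1)] by (auto simp: V'_def)
    show "a \<odot>\<^bsub>M\<^esub> x \<in> V'" if "a \<in> Q" "x \<in> V'" for a x
      using that insert.prems(4) lspan_smult[OF Q(1) T(1), of a x] Q(1,5) by (auto simp: V'_def)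
  qed
  then obtain T' where T': "T' \<subseteq> V'" "finite T'" "V' \<subseteq> lspan Q M T'" by auto
  show ?case
  proof (cases "V \<subseteq> lspan Q M T")
    case True
    then have "V' = V" by (auto simp: V'_def)
    then show ?thesis using T' by auto
  next
    case False
    then obtain u where u: "u \<in> V" "u \<notin> lspan Q M T" by auto
    obtain a y where ay: "a \<in> Q" "y \<in> lspan Q M T" "u = a \<odot>\<^bsub>M\<^esub> t \<oplus>\<^bsub>M\<^esub> y"
      using lspan_insert[OF Q(1,2,4) T, of u] u(1) insert.prems(2) by blast
    have yc: "y \<in> carrier M" using ay(2) lspan_closed[OF Q(1) T(1)] by auto
    have "a \<noteq> \<zero>" using u(2) ay yc T by auto
    then obtain b where b: "b \<in> Q" "b \<otimes> a = \<one>" using Q(7)[OF ay(1)] by auto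
    have T'c: "insert u T' \<subseteq> carrier M" using T'(1) Vc u(1) by (auto simp: V'_def)
    have "v \<in> lspan Q M (insert u T')" if v: "v \<in> V" for v
    proof -
      obtain a' y' where ay': "a' \<in> Q" "y' \<in> lspan Q M T" "v = a' \<odot>\<^bsub>M\<^esub> t \<oplus>\<^bsub>M\<^esub> y'"
        using lspan_insert[OF Q(1,2,4) T, of v] v insert.prems(2) by blast
      have yc': "y' \<in> carrier M" using ay'(2) lspan_closed[OF Q(1) T(1)] by auto
      have c: "a \<in> carrier R" "a' \<in> carrier R" "b \<in> carrier R" using ay ay' b Q(1) by auto
      \<comment> \<open>As \<open>b\<close> inverts the \<open>t\<close>-coefficient
        \<open>a\<close> of \<open>u\<close>, subtracting \<open>a' b u\<close> from
        \<open>v\<close> removes the term in \<open>t\<close>.\<close>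
      let ?c = "a' \<otimes> b"
      define w where "w = v \<oplus>\<^bsub>M\<^esub> (\<ominus> ?c) \<odot>\<^bsub>M\<^esub> u"
      have wV: "w \<in> V" unfolding w_def
        by (intro insert.prems(3,4) Q(5,6) ay'(1) b(1) v u(1))
      have ca: "\<ominus> ?c \<otimes> a = \<ominus> a'" using c b(2) by (simp add: R.l_minus R.m_assoc)
      have "w = a' \<odot>\<^bsub>M\<^esub> t \<oplus>\<^bsub>M\<^esub> y' \<oplus>\<^bsub>M\<^esub> ((\<ominus> a') \<odot>\<^bsub>M\<^esub> t \<oplus>\<^bsub>M\<^esub> (\<ominus> ?c) \<odot>\<^bsub>M\<^esub> y)"
      proof -
        have "(\<ominus> ?c) \<odot>\<^bsub>M\<^esub> u = (\<ominus> ?c \<otimes> a) \<odot>\<^bsub>M\<^esub> t \<oplus>\<^bsub>M\<^esub> (\<ominus> ?c) \<odot>\<^bsub>M\<^esub> y"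
          using c T yc by (simp only: ay(3) smult_r_distr smult_assoc1 R.m_closed R.a_inv_closed smult_closed)
        then show ?thesis by (simp only: w_def ay'(3) ca)
      qed
      also have "\<dots> = (a' \<odot>\<^bsub>M\<^esub> t \<oplus>\<^bsub>M\<^esub> (\<ominus> a') \<odot>\<^bsub>M\<^esub> t) \<oplus>\<^bsub>M\<^esub> (y' \<oplus>\<^bsub>M\<^esub> (\<ominus> ?c) \<odot>\<^bsub>M\<^esub> y)"
      proof -
        have "a' \<odot>\<^bsub>M\<^esub> t \<in> carrier M" "(\<ominus> a') \<odot>\<^bsub>M\<^esub> t \<in> carrier M" "(\<ominus> ?c) \<odot>\<^bsub>M\<^esub> y \<in> carrier M"
          using c T yc by auto
        then show ?thesis using yc' by (simp only: M.add.m_ac M.a_closed)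
      qed
      also have "a' \<odot>\<^bsub>M\<^esub> t \<oplus>\<^bsub>M\<^esub> (\<ominus> a') \<odot>\<^bsub>M\<^esub> t = \<zero>\<^bsub>M\<^esub>"
        using c T by (simp add: smult_l_minus M.r_neg)
      finally have "w = y' \<oplus>\<^bsub>M\<^esub> (\<ominus> ?c) \<odot>\<^bsub>M\<^esub> y" using c yc yc' by simp
      moreover have "\<ominus> ?c \<in> Q" using Q(5,6) ay'(1) b(1) by blast
      then have "(\<ominus> ?c) \<odot>\<^bsub>M\<^esub> y \<in> lspan Q M T"
        by (intro lspan_smult[OF Q(1) T(1) _ _ ay(2)]) (use Q(1,5) in auto)
      ultimately have "w \<in> V'" using wV lspan_add[OF Q(1) T(1) ay'(2)] by (auto simp: V'_def)
      then have "w \<in> lspan Q M (insert u T')" using T'(3) lspan_mono[of T' "insert u T'" Q M] by auto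
      then have "?c \<odot>\<^bsub>M\<^esub> u \<oplus>\<^bsub>M\<^esub> w \<in> lspan Q M (insert u T')"
        using Q(5)[OF ay'(1) b(1)] by (intro lspan_step) auto
      moreover have "?c \<odot>\<^bsub>M\<^esub> u \<oplus>\<^bsub>M\<^esub> w = v"
      proof -
        have "?c \<odot>\<^bsub>M\<^esub> u \<oplus>\<^bsub>M\<^esub> w = v \<oplus>\<^bsub>M\<^esub> (?c \<odot>\<^bsub>M\<^esub> u \<oplus>\<^bsub>M\<^esub> \<ominus>\<^bsub>M\<^esub> (?c \<odot>\<^bsub>M\<^esub> u))"
          using c Vc[OF v] Vc[OF u(1)] by (simp add: w_def smult_l_minus M.a_lcomm)
        then show ?thesis using c Vc[OF v] Vc[OF u(1)] by (simp add: M.r_neg)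
      qed
      ultimately show ?thesis by simp
    qed
    then show ?thesis using T' u(1) by (intro exI[of _ "insert u T'"]) (auto simp: V'_def)
  qed
qed

lemma lspan_submodule: "S \<subseteq> carrier M \<Longrightarrow> submodule (lspan (carrier R) M S) R M"
proof (rule submoduleI)
  assume S: "S \<subseteq> carrier M"
  show sub: "lspan (carrier R) M S \<subseteq> carrier M" using lspan_closed[OF _ S] by auto
  show "\<ominus>\<^bsub>M\<^esub> a \<in> lspan (carrier R) M S" if "a \<in> lspan (carrier R) M S" for a
    using lspan_smult[OF _ S, of "carrier R" "\<ominus> \<one>" a] that sub by (auto simp: smult_l_minus)
qed (auto intro: lspan.lspan_zero lspan_add lspan_smult)

text \<open>An element is coded by the coefficients of one chosen expression in the generators. This
  moves finitely generated submodules into the element type that \<open>graded_F_finite\<close>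
  prescribes.\<close>

lemma lspan_encode:
  assumes S: "finite S" "S \<subseteq> carrier M"
  shows "\<exists>\<sigma> :: 'c \<Rightarrow> nat \<Rightarrow> 'a. inj_on \<sigma> (lspan (carrier R) M S)"
  using S
proof (induction S rule: finite_induct)
  case empty
  have "lspan (carrier R) M {} \<subseteq> {\<zero>\<^bsub>M\<^esub>}" by (rule lspan_least) auto
  then show ?case by (intro exI[of _ "\<lambda>_ _. undefined"]) (auto intro!: inj_onI)
next
  case (insert t T)
  then obtain \<sigma> :: "'c \<Rightarrow> nat \<Rightarrow> 'a" where \<sigma>: "inj_on \<sigma> (lspan (carrier R) M T)" by auto
  have T: "T \<subseteq> carrier M" "t \<in> carrier M" using insert.prems by auto
  have "\<exists>r y. r \<in> carrier R \<and> y \<in> lspan (carrier R) M T \<and> x = r \<odot>\<^bsub>M\<^esub> t \<oplus>\<^bsub>M\<^esub> y"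
    if "x \<in> lspan (carrier R) M (insert t T)" for x
    by (rule lspan_insert[OF _ _ _ T that]) auto
  then obtain r y where ry: "\<And>x. x \<in> lspan (carrier R) M (insert t T) \<Longrightarrow>
      y x \<in> lspan (carrier R) M T \<and> x = r x \<odot>\<^bsub>M\<^esub> t \<oplus>\<^bsub>M\<^esub> y x" by metis
  have "inj_on (\<lambda>x i. case i of 0 \<Rightarrow> r x | Suc i \<Rightarrow> \<sigma> (y x) i) (lspan (carrier R) M (insert t T))"
  proof (rule inj_onI)
    fix x x' assume x: "x \<in> lspan (carrier R) M (insert t T)" "x' \<in> lspan (carrier R) M (insert t T)"
      and eq: "(\<lambda>i. case i of 0 \<Rightarrow> r x | Suc i \<Rightarrow> \<sigma> (y x) i) = (\<lambda>i. case i of 0 \<Rightarrow> r x' | Suc i \<Rightarrow> \<sigma> (y x') i)"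
    have "r x = r x'" using fun_cong[OF eq, of 0] by simp
    moreover have "\<sigma> (y x) = \<sigma> (y x')" using fun_cong[OF eq, of "Suc _"] by (intro ext) simp
    then have "y x = y x'" using \<sigma> ry x by (auto dest: inj_onD)
    ultimately show "x = x'" using ry[OF x(1)] ry[OF x(2)] by metis
  qed
  then show ?case by blast
qed

end

lemma mod_hom_lspan:
  assumes M: "Module.module R M" and N: "Module.module R N" and h: "h \<in> mod_hom R M N"
    and S: "S \<subseteq> carrier M" and x: "x \<in> lspan (carrier R) M S"
  shows "h x \<in> lspan (carrier R) N (h ` S)"
  using x
proof induction
  interpret M: Module.module R M by fact
  interpret N: Module.module R N by fact
  case lspan_zero
  have "h (\<zero>\<^bsub>M\<^esub> \<oplus>\<^bsub>M\<^esub> \<zero>\<^bsub>M\<^esub>) = h \<zero>\<^bsub>M\<^esub> \<oplus>\<^bsub>N\<^esub> h \<zero>\<^bsub>M\<^esub>" "h \<zero>\<^bsub>M\<^esub> \<in> carrier N"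
    using h by (auto simp: mod_hom_def simp del: M.M.l_zero M.M.r_zero)
  then have "h \<zero>\<^bsub>M\<^esub> = \<zero>\<^bsub>N\<^esub>" by simp
  then show ?case by (simp add: lspan.lspan_zero)
next
  interpret M: Module.module R M by fact
  case (lspan_step a s y)
  then have "y \<in> carrier M" "s \<in> carrier M" using M.lspan_closed[OF _ S] S by auto
  then have "h (a \<odot>\<^bsub>M\<^esub> s \<oplus>\<^bsub>M\<^esub> y) = a \<odot>\<^bsub>N\<^esub> h s \<oplus>\<^bsub>N\<^esub> h y"
    using h lspan_step by (auto simp: mod_hom_def)
  then show ?case using lspan_step by (auto intro: lspan.lspan_step)
qed

lemma lspan_hpart:
  fixes M :: "('k::field mpol, 'b, 'z) graded_module_scheme"
  assumes M: "graded_module (poly_ring n) M" and S: "\<And>s. s \<in> S \<Longrightarrow> \<exists>d. s \<in> hcomp M d"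
    and x: "x \<in> lspan (carrier (poly_ring n)) M S"
  shows "graded_module.hpart M d x \<in> lspan (carrier (poly_ring n)) M S"
proof -
  interpret graded_module "poly_ring n :: 'k mpol graded_ring" M by fact
  have Sc: "S \<subseteq> carrier M" using S hcomp_carrier by blast
  have hom: "hpart d (a \<odot>\<^bsub>M\<^esub> s) \<in> lspan (carrier (poly_ring n)) M S"
    if a: "a \<in> carrier (poly_ring n)" and s: "s \<in> S" for a s
    using a
  proof (induction a rule: poly_ring_induct)
    case (single m c)
    obtain e where e: "s \<in> hcomp M e" using S s by auto
    have "Poly_Mapping.single m c \<odot>\<^bsub>M\<^esub> s \<in> hcomp M (int (mdeg m) + e)"
      using single e by (intro hcomp_smult single_in_rcomp) auto
    moreover have "Poly_Mapping.single m c \<odot>\<^bsub>M\<^esub> s \<in> lspan (carrier (poly_ring n)) M S"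
      using lspan_smult[OF _ Sc, of "carrier (poly_ring n)"] lspan_incl[OF _ _ Sc s, of "carrier (poly_ring n)"] single
      by auto
    ultimately show ?case by (simp add: hpart_homog lspan.lspan_zero)
  next
    case (add a b)
    then show ?case using smult_l_distr[of a b s] s Sc
      by (auto simp: hpart_add subset_iff intro!: lspan_add)
  qed
  show ?thesis using x
  proof induction
    case lspan_zero
    then show ?case by (simp add: lspan.lspan_zero)
  next
    case (lspan_step a s y)
    then have "hpart d (a \<odot>\<^bsub>M\<^esub> s \<oplus>\<^bsub>M\<^esub> y) = hpart d (a \<odot>\<^bsub>M\<^esub> s) \<oplus>\<^bsub>M\<^esub> hpart d y"
      using Sc lspan_closed[OF _ Sc] by (intro hpart_add) auto
    then show ?case using lspan_step hom Sc by (auto intro: lspan_add)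
  qed
qed

lemma graded_module_lspan:
  fixes M :: "('k::field mpol, 'b, 'z) graded_module_scheme"
  assumes M: "graded_module (poly_ring n) M" and S: "\<And>s. s \<in> S \<Longrightarrow> \<exists>d. s \<in> hcomp M d"
  shows "graded_module (poly_ring n) (subgmodule M (lspan (carrier (poly_ring n)) M S))"
proof -
  interpret graded_module "poly_ring n :: 'k mpol graded_ring" M by fact
  have Sc: "S \<subseteq> carrier M" using S hcomp_carrier by blast
  show ?thesis
    by (rule graded_module_subgmodule)
       (use lspan_closed[OF _ Sc] Sc lspan_hpart[OF M S] in
         \<open>auto simp: rcomp_carrier lspan.lspan_zero intro: lspan_add lspan_smult\<close>)
qed

section \<open>Frobenius iterates of finitely generated submodules\<close>

context fmod
begin

text \<open>If \<open>M\<close> is the submodule generated by \<open>S\<close>, this is the image of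
  \<open>F^e(M)\<close> in \<open>A\<close> under the identification of \<open>A\<close> with
  \<open>F^e(A)\<close>.\<close>

definition iter :: "nat \<Rightarrow> 'b set \<Rightarrow> 'b set" where "iter e S = lspan (carrier R) A ((fr ^^ e) ` S)"

lemma fr_pow_closed: "y \<in> carrier A \<Longrightarrow> (fr ^^ e) y \<in> carrier A"
  by (induction e) (auto simp: fr_closed)

lemma fr_pow_degree: "y \<in> hcomp A d \<Longrightarrow> \<exists>d. (fr ^^ e) y \<in> hcomp A d"
  by (induction e) (auto dest: fr_degree)

lemma fr_pow_sub: "S \<subseteq> carrier A \<Longrightarrow> (fr ^^ e) ` S \<subseteq> carrier A"
  by (auto simp: fr_pow_closed)

lemma iter_closed: "S \<subseteq> carrier A \<Longrightarrow> iter e S \<subseteq> carrier A"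
  unfolding iter_def by (rule lspan_closed[OF _ fr_pow_sub]) auto

lemma fr_lspan:
  assumes S: "S \<subseteq> carrier A" and x: "x \<in> lspan (carrier R) A S"
  shows "fr x \<in> lspan (carrier R) A (fr ` S)"
  using x
proof induction
  case lspan_zero
  then show ?case by (simp add: fr_zero lspan.lspan_zero)
next
  case (lspan_step a s y)
  then have "s \<in> carrier A" "y \<in> carrier A" using S lspan_closed[OF _ S] by auto
  then have "fr (a \<odot>\<^bsub>A\<^esub> s \<oplus>\<^bsub>A\<^esub> y) = a ^ p \<odot>\<^bsub>A\<^esub> fr s \<oplus>\<^bsub>A\<^esub> fr y"
    using lspan_step by (simp add: fr_add fr_smult)
  then show ?case using lspan_step by (auto intro: lspan.lspan_step)
qed

lemma fr_iter: "S \<subseteq> carrier A \<Longrightarrow> x \<in> iter e S \<Longrightarrow> fr x \<in> iter (Suc e) S"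
  using fr_lspan[OF fr_pow_sub, of S x e] by (simp add: iter_def image_comp)

lemma iter_zero: "\<zero>\<^bsub>A\<^esub> \<in> iter e S"
  by (simp add: iter_def lspan.lspan_zero)

lemma iter_add: "S \<subseteq> carrier A \<Longrightarrow> x \<in> iter e S \<Longrightarrow> y \<in> iter e S \<Longrightarrow> x \<oplus>\<^bsub>A\<^esub> y \<in> iter e S"
  unfolding iter_def by (rule lspan_add[OF _ fr_pow_sub]) auto

lemma iter_smult: "S \<subseteq> carrier A \<Longrightarrow> a \<in> carrier R \<Longrightarrow> x \<in> iter e S \<Longrightarrow> a \<odot>\<^bsub>A\<^esub> x \<in> iter e S"
  unfolding iter_def by (rule lspan_smult[OF _ fr_pow_sub]) auto

lemma iter_Suc_induct [consumes 2, case_names fr add]: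
  assumes S: "S \<subseteq> carrier A" and x: "x \<in> iter (Suc e) S"
    and fr: "\<And>r c. r \<in> carrier R \<Longrightarrow> c \<in> iter e S \<Longrightarrow> P (r \<odot>\<^bsub>A\<^esub> fr c)"
    and add: "\<And>x y. x \<in> iter (Suc e) S \<Longrightarrow> y \<in> iter (Suc e) S \<Longrightarrow> P x \<Longrightarrow> P y \<Longrightarrow> P (x \<oplus>\<^bsub>A\<^esub> y)"
  shows "P x"
  using x unfolding iter_def
proof induction
  case lspan_zero
  show ?case using fr[of 0 "\<zero>\<^bsub>A\<^esub>"] smult_l_null[of "\<zero>\<^bsub>A\<^esub>"] by (simp add: iter_zero fr_zero)
next
  case (lspan_step a s y)
  then obtain s' where s': "s' \<in> S" "s = fr ((fr ^^ e) s')" by auto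
  have i: "(fr ^^ e) s' \<in> iter e S"
    unfolding iter_def by (rule lspan_incl[OF _ _ fr_pow_sub[OF S]]) (use s' in auto)
  then have "a \<odot>\<^bsub>A\<^esub> s \<in> iter (Suc e) S" using lspan_step S s' by (simp add: fr_iter iter_smult)
  then show ?case using lspan_step add[of "a \<odot>\<^bsub>A\<^esub> s" y] fr[OF _ i, of a] s' by (simp add: iter_def)
qed

text \<open>Level \<open>e + 1\<close> consists of sums of \<open>r fr(c)\<close> with
  \<open>c\<close> on level \<open>e\<close>, and coordinates undo this step. Arguments can thus
  descend from any level to the generators.\<close>

lemma fq_iter:
  assumes S: "S \<subseteq> carrier A" and j: "j \<in> fidx" and x: "x \<in> iter (Suc e) S"
  shows "fq j x \<in> iter e S"
  using S x
proof (induction rule: iter_Suc_induct)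
  case (fr r c)
  then have "c \<in> carrier A" using iter_closed[OF S, of e] by blast
  then show ?case using fr j by (simp add: fq_fr fcoord_closed iter_smult[OF S])
next
  case (add x y)
  then have "x \<in> carrier A" "y \<in> carrier A" using iter_closed[OF S, of "Suc e"] by blast+
  then show ?case using add j by (simp add: fq_add iter_add[OF S])
qed

text \<open>The generated graded submodule \<open>M\<close> satisfies
  \<open>M \<subseteq> F(M)\<close> inside \<open>A\<close>, so the iterates form an ascending
  chain; together with \<open>exhausts\<close> this is a root of the F-module.\<close>

definition root :: "'b set \<Rightarrow> bool" where
  "root S \<longleftrightarrow> finite S \<and> (\<forall>s\<in>S. \<exists>d. s \<in> hcomp A d) \<and> S \<subseteq> iter 1 S"

lemma root_carrier: "root S \<Longrightarrow> S \<subseteq> carrier A"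
  unfolding root_def using hcomp_carrier by blast

lemma iter_mono: "root S \<Longrightarrow> e \<le> e' \<Longrightarrow> iter e S \<subseteq> iter e' S"
proof (rule lift_Suc_mono_le[of "\<lambda>e. iter e S"])
  fix e assume r: "root S"
  note S = root_carrier[OF r]
  have "(fr ^^ e) ` S \<subseteq> iter (Suc e) S"
  proof (induction e)
    case 0
    then show ?case using r by (simp add: root_def)
  next
    case (Suc e)
    then show ?case using fr_iter[OF S, of _ "Suc e"] by auto
  qed
  then show "iter e S \<subseteq> iter (Suc e) S"
    using lspan_subset[OF fr_pow_sub[OF S, of "Suc e"], of "(fr ^^ e) ` S"] by (simp add: iter_def)
qed auto

lemma iter_hpart: "root S \<Longrightarrow> x \<in> iter e S \<Longrightarrow> hpart d x \<in> iter e S"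
  unfolding iter_def
  by (rule lspan_hpart[OF graded_module_axioms]) (auto simp: root_def intro: fr_pow_degree)

lemma graded_module_iter: "root S \<Longrightarrow> graded_module R (subgmodule A (iter e S))"
  unfolding iter_def
  by (rule graded_module_lspan[OF graded_module_axioms]) (auto simp: root_def intro: fr_pow_degree)

definition exhausts :: "'b set \<Rightarrow> bool" where
  "exhausts S \<longleftrightarrow> (\<forall>y\<in>carrier A. \<exists>e. y \<in> iter e S)"

text \<open>The map \<open>\<beta>\<close> may have a kernel, so the root is taken to be the image
  in \<open>A\<close> of homogeneous generators of \<open>N 0\<close>. Each level \<open>N e\<close>
  then maps into \<open>iter e S\<close>, and these images cover the limit.\<close>

theorem F_finite_root:
  assumes fin: "graded_F_finite p R A"
  shows "\<exists>S. root S \<and> exhausts S"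
proof -
  obtain N :: "nat \<Rightarrow> ('k mpol, (nat \<Rightarrow> 'k mpol) set) graded_module" and b j \<iota>
    where fg: "finitely_generated R (N 0)" and tow: "frob_tower p R N b j"
      and lim: "direct_limit R N (\<lambda>e x. j e (b e x)) A \<iota>"
      and str: "\<And>e x. x \<in> carrier (N e) \<Longrightarrow> struct A (\<iota> e x) = frob_map p R A (\<iota> e) (b e x)"
    using fin unfolding graded_F_finite_def by (elim conjE exE) blast
  have gN: "graded_module R (N e)" and b: "b e \<in> gmod_hom R (N e) (frob p R (N e))"
    and j: "j e \<in> gmod_iso R (frob p R (N e)) (N (Suc e))"
    and bj: "\<And>y. y \<in> carrier (frob p R (N e)) \<Longrightarrow> b (Suc e) (j e y) =
          frob_map p R (N (Suc e)) (j e) (frob_map p R (frob p R (N e)) (b e) y)" for e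
    using tow by (auto simp: frob_tower_def)
  have i: "\<iota> e \<in> gmod_hom R (N e) A" and ib: "\<And>x. x \<in> carrier (N e) \<Longrightarrow> \<iota> (Suc e) (j e (b e x)) = \<iota> e x" for e
    using lim by (auto simp: direct_limit_def)
  have cA: "carrier A = (\<Union>e. \<iota> e ` carrier (N e))" using lim by (simp add: direct_limit_def)
  have mN: "Module.module R (N e)" for e using gN by (simp add: graded_module_def)
  have tN: "tensor R (N e)" for e using mN by (simp add: tensor_def)
  have jm: "j e \<in> mod_hom R (frob p R (N e)) (N (Suc e))" and bm: "b e \<in> mod_hom R (N e) (frob p R (N e))"
    and im: "\<iota> e \<in> mod_hom R (N e) A" for e
    using j b i by (auto simp: gmod_iso_def gmod_hom_def)
  have jc: "j e y \<in> carrier (N (Suc e))" if "y \<in> carrier (frob p R (N e))" for e y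
    using jm[of e] that by (auto simp: mod_hom_def)
  have bc: "b e y \<in> carrier (frob p R (N e))" if "y \<in> carrier (N e)" for e y
    using bm[of e] that by (auto simp: mod_hom_def)
  have ic: "\<iota> e y \<in> carrier A" if "y \<in> carrier (N e)" for e y
    using im[of e] that by (auto simp: mod_hom_def)
  \<comment> \<open>After applying the injective structure map both sides are computed in
    \<open>F(A)\<close>: the tower condition turns the left side into
    \<open>r \<otimes> \<iota> (j (b m))\<close>, and the cocone condition turns this into
    \<open>r \<otimes> \<iota> m\<close>.\<close>
  have step: "\<iota> (Suc e) (j e (frob_tensor p R (N e) r m)) = r \<odot>\<^bsub>A\<^esub> fr (\<iota> e m)"
    if r: "r \<in> carrier R" and m: "m \<in> carrier (N e)" for e r m
  proof -
    let ?t = "frob_tensor p R (N e) r m"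
    have t: "?t \<in> carrier (frob p R (N e))" using tensor.tensor_closed[OF tN r m] .
    have "struct A (\<iota> (Suc e) (j e ?t)) = frob_map p R A (\<iota> (Suc e))
        (frob_map p R (N (Suc e)) (j e) (frob_map p R (frob p R (N e)) (b e) ?t))"
      using str[OF jc[OF t]] bj[OF t] by simp
    also have "frob_map p R (frob p R (N e)) (b e) ?t = frob_tensor p R (frob p R (N e)) r (b e m)"
      by (rule tensor.frob_map_tensor[OF tN tensor.tensor_frob[OF tN] bm r m])
    also have "frob_map p R (N (Suc e)) (j e) \<dots> = frob_tensor p R (N (Suc e)) r (j e (b e m))"
      by (rule tensor.frob_map_tensor[OF tensor.tensor_frob[OF tN] tN jm r bc[OF m]])
    also have "frob_map p R A (\<iota> (Suc e)) \<dots> = frob_tensor p R A r (\<iota> e m)"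
      using tensor.frob_map_tensor[OF tN T.tensor im r jc[OF bc[OF m]]] ib[OF m] by simp
    also have "\<dots> = struct A (r \<odot>\<^bsub>A\<^esub> fr (\<iota> e m))" using struct_smult_fr[OF r ic[OF m]] by simp
    finally show ?thesis
      using r ic[OF m] ic[OF jc[OF t]] by (intro struct_inj) (auto simp: fr_closed)
  qed
  interpret N0: graded_module R "N 0" by (rule gN)
  obtain S0 where S0': "finite S0 \<and> S0 \<subseteq> carrier (N 0) \<and>
      (\<forall>H. submodule H R (N 0) \<and> S0 \<subseteq> H \<longrightarrow> carrier (N 0) \<subseteq> H)"
    using fg unfolding finitely_generated_def by (elim exE)
  then have S0: "finite S0" "S0 \<subseteq> carrier (N 0)"
    "\<And>H. submodule H R (N 0) \<Longrightarrow> S0 \<subseteq> H \<Longrightarrow> carrier (N 0) \<subseteq> H"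
    by simp_all
  \<comment> \<open>The given generators need not be homogeneous; their finitely many nonzero
    homogeneous parts generate as well.\<close>
  define S1 where "S1 = (\<Union>s\<in>S0. (\<lambda>d. N0.hpart d s) ` {d. N0.hpart d s \<noteq> \<zero>\<^bsub>N 0\<^esub>})"
  have S1: "finite S1" unfolding S1_def
    by (intro finite_UN_I finite_imageI N0.hpart_props(2)) (use S0(1,2) in auto)
  have S1h: "\<exists>d. s \<in> hcomp (N 0) d" if "s \<in> S1" for s
    using that S0(2) N0.hpart_props(1) by (auto simp: S1_def)
  have S1c: "S1 \<subseteq> carrier (N 0)" using S1h N0.hcomp_carrier by blast
  have "s \<in> lspan (carrier R) (N 0) S1" if s: "s \<in> S0" for s
  proof -
    have sc: "s \<in> carrier (N 0)" using s S0(2) by auto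
    have "finsum (N 0) (\<lambda>d. N0.hpart d s) D \<in> lspan (carrier R) (N 0) S1"
      if "finite D" "D \<subseteq> {d. N0.hpart d s \<noteq> \<zero>\<^bsub>N 0\<^esub>}" for D
      using that
    proof (induction D rule: finite_induct)
      case (insert d D)
      have "N0.hpart d s \<in> S1" using insert.prems s by (auto simp: S1_def)
      then have "N0.hpart d s \<in> lspan (carrier R) (N 0) S1"
        by (intro N0.lspan_incl[OF _ _ S1c]) auto
      then show ?case using insert sc by (auto intro!: N0.lspan_add[OF _ S1c])
    qed (simp add: lspan_zero)
    from this[OF N0.hpart_props(2)[OF sc]] show ?thesis using N0.hpart_props(3)[OF sc] by simp
  qed
  then have N0: "carrier (N 0) \<subseteq> lspan (carrier R) (N 0) S1"
    using S0(3)[OF N0.lspan_submodule[OF S1c]] by blast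
  define S where "S = \<iota> 0 ` S1"
  have Sc: "S \<subseteq> carrier A" using S1c ic by (auto simp: S_def)
  have lev: "\<iota> e ` carrier (N e) \<subseteq> iter e S" for e
  proof (induction e)
    case 0
    show ?case
    proof
      fix x assume "x \<in> \<iota> 0 ` carrier (N 0)"
      then obtain z where "z \<in> lspan (carrier R) (N 0) S1" "x = \<iota> 0 z" using N0 by blast
      then show "x \<in> iter 0 S"
        using mod_hom_lspan[OF mN module_axioms im S1c, of z] by (simp add: iter_def S_def)
    qed
  next
    case (Suc e)
    have "\<iota> (Suc e) (j e z) \<in> iter (Suc e) S" if "z \<in> carrier (frob p R (N e))" for z
      using that
    proof (rule tensor.tensor_induct[OF tN], goal_cases)
      case tensor: (1 r m)
      then have "\<iota> e m \<in> iter e S" using Suc by blast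
      then show ?case using tensor Sc by (simp add: step iter_smult fr_iter)
    next
      case add: (2 x y)
      have "\<iota> (Suc e) (j e (x \<oplus>\<^bsub>frob p R (N e)\<^esub> y)) = \<iota> (Suc e) (j e x) \<oplus>\<^bsub>A\<^esub> \<iota> (Suc e) (j e y)"
        using add(1,2) jc jm[of e] im[of "Suc e"] by (simp add: mod_hom_def)
      then show ?case using add by (simp add: iter_add[OF Sc])
    qed
    moreover have "carrier (N (Suc e)) = j e ` carrier (frob p R (N e))"
      using j[of e] by (simp add: gmod_iso_def bij_betw_def)
    ultimately show ?case by auto
  qed
  have "s \<in> iter 1 S" if "s \<in> S" for s
  proof -
    obtain z where "z \<in> S1" "s = \<iota> 0 z" using \<open>s \<in> S\<close> by (auto simp: S_def)
    then have "z \<in> carrier (N 0)" "s = \<iota> (Suc 0) (j 0 (b 0 z))" using S1c ib[of z 0] by auto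
    then have "s \<in> \<iota> (Suc 0) ` carrier (N (Suc 0))" using jc bc by blast
    then show ?thesis using lev[of "Suc 0"] by auto
  qed
  moreover have "\<exists>d. s \<in> hcomp A d" if s: "s \<in> S" for s
  proof -
    obtain z where "z \<in> S1" "s = \<iota> 0 z" using s by (auto simp: S_def)
    then show ?thesis using S1h[of z] i[of 0] by (auto simp: gmod_hom_def)
  qed
  ultimately have "root S" using S1 by (auto simp: root_def S_def)
  moreover have "exhausts S" using lev unfolding exhausts_def cA by blast
  ultimately show ?thesis by blast
qed

text \<open>The defining sequence is the chain of the \<open>iter e S\<close>, whose transition maps
  are inclusions. Restricting \<open>fr\<close> and its coordinates to consecutive levels makes
  level \<open>e + 1\<close> a copy of \<open>F\<close> of level \<open>e\<close>.\<close>

theorem root_F_finite: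
  assumes S: "root S" and ex: "exhausts S"
  shows "graded_F_finite p R A"
proof -
  note Sc = root_carrier[OF S]
  have ic: "x \<in> carrier A" if "x \<in> iter e S" for x e using iter_closed[OF Sc, of e] that by auto
  have "\<exists>\<sigma> :: 'b \<Rightarrow> nat \<Rightarrow> 'k mpol. inj_on \<sigma> (iter e S)" for e
    unfolding iter_def using S by (intro lspan_encode fr_pow_sub[OF Sc]) (simp add: root_def)
  then obtain \<sigma>0 :: "nat \<Rightarrow> 'b \<Rightarrow> nat \<Rightarrow> 'k mpol" where \<sigma>0: "\<And>e. inj_on (\<sigma>0 e) (iter e S)" by metis
  \<comment> \<open>The codes are wrapped in singletons because the prescribed elements are sets of
    sequences.\<close>
  define \<sigma> where "\<sigma> e x = {\<sigma>0 e x}" for e x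
  define \<iota> where "\<iota> e = inv_into (iter e S) (\<sigma> e)" for e
  have i\<sigma> [simp]: "\<iota> e (\<sigma> e x) = x" if "x \<in> iter e S" for e x
    unfolding \<iota>_def using that \<sigma>0[of e] by (intro inv_into_f_f) (auto simp: \<sigma>_def inj_on_def)
  define N :: "nat \<Rightarrow> ('k mpol, (nat \<Rightarrow> 'k mpol) set) graded_module" where
    "N e = \<lparr> carrier = \<sigma> e ` iter e S, monoid.mult = undefined, monoid.one = undefined,
      ring.zero = \<sigma> e \<zero>\<^bsub>A\<^esub>, ring.add = (\<lambda>X Y. \<sigma> e (\<iota> e X \<oplus>\<^bsub>A\<^esub> \<iota> e Y)),
      module.smult = (\<lambda>a X. \<sigma> e (a \<odot>\<^bsub>A\<^esub> \<iota> e X)), hcomp = (\<lambda>d. \<sigma> e ` (hcomp A d \<inter> iter e S)) \<rparr>" for e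
  have N: "carrier (N e) = \<sigma> e ` iter e S" "\<zero>\<^bsub>N e\<^esub> = \<sigma> e \<zero>\<^bsub>A\<^esub>"
    "\<And>X Y. X \<oplus>\<^bsub>N e\<^esub> Y = \<sigma> e (\<iota> e X \<oplus>\<^bsub>A\<^esub> \<iota> e Y)" "\<And>a X. a \<odot>\<^bsub>N e\<^esub> X = \<sigma> e (a \<odot>\<^bsub>A\<^esub> \<iota> e X)"
    "\<And>d. hcomp (N e) d = \<sigma> e ` (hcomp A d \<inter> iter e S)" for e
    by (simp_all add: N_def)
  note iter_cl = iter_zero iter_add[OF Sc] iter_smult[OF Sc]
  have gN: "graded_module R (N e)" for e
  proof (rule graded_module_transport[OF graded_module_iter[OF S, of e], where h = "\<iota> e"])
    show "bij_betw (\<iota> e) (carrier (N e)) (carrier (subgmodule A (iter e S)))"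
      by (rule bij_betw_byWitness[where f' = "\<sigma> e"]) (auto simp: N)
  qed (auto simp: N iter_cl rcomp_carrier)
  have mN: "Module.module R (N e)" for e using gN by (simp add: graded_module_def)
  have tN: "tensor R (N e)" for e using mN by (simp add: tensor_def)
  have suc: "x \<in> iter (Suc e) S" if "x \<in> iter e S" for x e
    using iter_mono[OF S, of e "Suc e"] that by auto
  define f where "f e X = \<sigma> (Suc e) (fr (\<iota> e X))" for e X
  have fe: "frob_ext p n (N e) (N (Suc e)) (f e) (\<lambda>j X. \<sigma> e (fq j (\<iota> (Suc e) X)))" for e
  proof -
    interpret C: graded_module R "N e" by (rule gN)
    interpret D: graded_module R "N (Suc e)" by (rule gN)
    show ?thesis
    proof unfold_locales
      fix c assume "c \<in> carrier (N e)"
      then show "f e c \<in> carrier (N (Suc e))" by (auto simp: N f_def fr_iter[OF Sc])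
    next
      fix c c' assume "c \<in> carrier (N e)" "c' \<in> carrier (N e)"
      then show "f e (c \<oplus>\<^bsub>N e\<^esub> c') = f e c \<oplus>\<^bsub>N (Suc e)\<^esub> f e c'"
        by (auto simp: N f_def fr_iter[OF Sc] iter_cl fr_add ic)
    next
      fix s c assume "s \<in> carrier R" "c \<in> carrier (N e)"
      then show "f e (s \<odot>\<^bsub>N e\<^esub> c) = s ^ p \<odot>\<^bsub>N (Suc e)\<^esub> f e c"
        by (auto simp: N f_def fr_iter[OF Sc] iter_cl fr_smult ic)
    next
      fix j x assume "j \<in> fidx" "x \<in> carrier (N (Suc e))"
      then show "\<sigma> e (fq j (\<iota> (Suc e) x)) \<in> carrier (N e)"
        by (auto simp: N intro!: imageI fq_iter[OF Sc])
    next
      fix j x y assume j: "j \<in> fidx" and "x \<in> carrier (N (Suc e))" and "y \<in> carrier (N (Suc e))"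
      then show "\<sigma> e (fq j (\<iota> (Suc e) (x \<oplus>\<^bsub>N (Suc e)\<^esub> y))) =
          \<sigma> e (fq j (\<iota> (Suc e) x)) \<oplus>\<^bsub>N e\<^esub> \<sigma> e (fq j (\<iota> (Suc e) y))"
        by (auto simp: N iter_cl fq_add[OF j] ic fq_iter[OF Sc j])
    next
      fix j r c assume "j \<in> fidx" "r \<in> carrier R" "c \<in> carrier (N e)"
      then show "\<sigma> e (fq j (\<iota> (Suc e) (r \<odot>\<^bsub>N (Suc e)\<^esub> f e c))) = fcoord j r \<odot>\<^bsub>N e\<^esub> c"
        by (auto simp: N f_def fr_iter[OF Sc] iter_cl fq_fr ic)
    next
      fix x and P :: "(nat \<Rightarrow> 'k mpol) set \<Rightarrow> bool"
      assume x: "x \<in> carrier (N (Suc e))"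
        and Pf: "\<And>r c. r \<in> carrier R \<Longrightarrow> c \<in> carrier (N e) \<Longrightarrow> P (r \<odot>\<^bsub>N (Suc e)\<^esub> f e c)"
        and Pa: "\<And>x y. x \<in> carrier (N (Suc e)) \<Longrightarrow> y \<in> carrier (N (Suc e)) \<Longrightarrow> P x \<Longrightarrow> P y \<Longrightarrow>
          P (x \<oplus>\<^bsub>N (Suc e)\<^esub> y)"
      have "P (\<sigma> (Suc e) y)" if "y \<in> iter (Suc e) S" for y
        using Sc that
      proof (induction rule: iter_Suc_induct)
        case (fr r c)
        then show ?case using Pf[of r "\<sigma> e c"] by (simp add: N f_def fr_iter[OF Sc])
      next
        case (add x y)
        then show ?case using Pa[of "\<sigma> (Suc e) x" "\<sigma> (Suc e) y"] by (simp add: N)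
      qed
      then show "P x" using x by (auto simp: N)
    next
      fix c d assume "c \<in> hcomp (N e) d"
      then show "f e c \<in> hcomp (N (Suc e)) (int p * d)"
        by (auto simp: N f_def intro!: imageI fr_degree fr_iter[OF Sc])
    qed
  qed
  have "\<exists>\<psi>. \<psi> \<in> gmod_iso R (frob p R (N e)) (N (Suc e)) \<and>
      (\<forall>r\<in>carrier R. \<forall>c\<in>carrier (N e). \<psi> (frob_tensor p R (N e) r c) = r \<odot>\<^bsub>N (Suc e)\<^esub> f e c) \<and>
      (\<forall>d. \<forall>x\<in>hcomp (N (Suc e)) d. \<exists>z\<in>hcomp (frob p R (N e)) d. \<psi> z = x)" for e
  proof -
    interpret fe: frob_ext p n ty "N e" "N (Suc e)" "f e" "\<lambda>j X. \<sigma> e (fq j (\<iota> (Suc e) X))" by (rule fe)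
    show ?thesis using fe.frob_iso by metis
  qed
  then obtain j where j: "\<And>e. j e \<in> gmod_iso R (frob p R (N e)) (N (Suc e))"
    and jt: "\<And>e r c. r \<in> carrier R \<Longrightarrow> c \<in> carrier (N e) \<Longrightarrow> j e (frob_tensor p R (N e) r c) = r \<odot>\<^bsub>N (Suc e)\<^esub> f e c"
    and jd: "\<And>e x d. x \<in> hcomp (N (Suc e)) d \<Longrightarrow> \<exists>z\<in>hcomp (frob p R (N e)) d. j e z = x"
    by metis
  define k where "k e = inv_into (carrier (frob p R (N e))) (j e)" for e
  have k: "k e \<in> gmod_iso R (N (Suc e)) (frob p R (N e))" for e
    unfolding k_def by (rule gmod_iso_inv[OF gN gN j jd])
  have jb: "bij_betw (j e) (carrier (frob p R (N e))) (carrier (N (Suc e)))" for e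
    using j[of e] by (simp add: gmod_iso_def)
  have kj: "k e (j e z) = z" if "z \<in> carrier (frob p R (N e))" for e z
    using that jb[of e] by (simp add: k_def bij_betw_def)
  have jk: "j e (k e z) = z" if "z \<in> carrier (N (Suc e))" for e z
    using that jb[of e] by (simp add: k_def bij_betw_def f_inv_into_f)
  \<comment> \<open>\<open>t\<close> is the inclusion of level \<open>e\<close> into level
    \<open>e + 1\<close>; following it by the inverse \<open>k\<close> of \<open>j\<close> gives the
    required \<open>b = F^e(\<beta>)\<close>.\<close>
  define t where "t e X = \<sigma> (Suc e) (\<iota> e X)" for e X
  define b where "b e X = k e (t e X)" for e X
  have tg: "t e \<in> gmod_hom R (N e) (N (Suc e))" for e
    by (auto simp: gmod_hom_def mod_hom_def N t_def suc iter_cl)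
  have bg: "b e \<in> gmod_hom R (N e) (frob p R (N e))" for e
    using tg[of e] k[of e] by (auto simp: gmod_iso_def gmod_hom_def mod_hom_def b_def image_subset_iff Pi_def)
  have tc: "t e X \<in> carrier (N (Suc e))" if "X \<in> carrier (N e)" for e X
    using that by (auto simp: N t_def suc)
  have bm: "b e \<in> mod_hom R (N e) (frob p R (N e))" and jm: "j e \<in> mod_hom R (frob p R (N e)) (N (Suc e))"
    and tm: "t e \<in> mod_hom R (N e) (N (Suc e))" for e
    using bg tg j by (auto simp: gmod_hom_def gmod_iso_def)
  have jc: "j e z \<in> carrier (N (Suc e))" if "z \<in> carrier (frob p R (N e))" for e z
    using jm[of e] that by (auto simp: mod_hom_def)
  have bc: "b e z \<in> carrier (frob p R (N e))" if "z \<in> carrier (N e)" for e z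
    using bm[of e] that by (auto simp: mod_hom_def)
  have jb_t: "j e (b e X) = t e X" if "X \<in> carrier (N e)" for e X
    using jk[OF tc[OF that]] by (simp add: b_def)
  have ig: "\<iota> e \<in> gmod_hom R (N e) A" for e
    by (auto simp: gmod_hom_def mod_hom_def N iter_cl ic)
  have im: "\<iota> e \<in> mod_hom R (N e) A" for e using ig by (simp add: gmod_hom_def)
  have tower: "b (Suc e) (j e y) = frob_map p R (N (Suc e)) (j e) (frob_map p R (frob p R (N e)) (b e) y)"
    if y: "y \<in> carrier (frob p R (N e))" for e y
    using y
  proof (rule tensor.tensor_induct[OF tN], goal_cases)
    case tensor: (1 r m)
    note r = tensor(1) and m = tensor(2)
    have "frob_map p R (N (Suc e)) (j e) (frob_map p R (frob p R (N e)) (b e) (frob_tensor p R (N e) r m)) =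
        frob_tensor p R (N (Suc e)) r (t e m)"
      using tensor.frob_map_tensor[OF tN tensor.tensor_frob[OF tN] bm r m]
        tensor.frob_map_tensor[OF tensor.tensor_frob[OF tN] tN jm r bc[OF m]] jb_t[OF m] by simp
    moreover have "b (Suc e) (j e (frob_tensor p R (N e) r m)) = frob_tensor p R (N (Suc e)) r (t e m)"
    proof -
      have "t (Suc e) (r \<odot>\<^bsub>N (Suc e)\<^esub> f e m) = r \<odot>\<^bsub>N (Suc (Suc e))\<^esub> f (Suc e) (t e m)"
        using m r by (auto simp: N t_def f_def suc iter_cl fr_iter[OF Sc])
      also have "\<dots> = j (Suc e) (frob_tensor p R (N (Suc e)) r (t e m))" using jt[OF r tc[OF m]] by simp
      finally show ?thesis
        using kj[OF tensor.tensor_closed[OF tN r tc[OF m]]] by (simp add: b_def jt[OF r m])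
    qed
    ultimately show ?case by simp
  next
    case add: (2 x y)
    have "b (Suc e) (j e (x \<oplus>\<^bsub>frob p R (N e)\<^esub> y)) = b (Suc e) (j e x) \<oplus>\<^bsub>frob p R (N (Suc e))\<^esub> b (Suc e) (j e y)"
      using add(1,2) jc jm[of e] bm[of "Suc e"] by (simp add: mod_hom_def)
    then show ?case
      using add tensor.frob_map_add[OF tN tensor.tensor_frob[OF tN] bm add(1,2)]
        tensor.frob_map_add[OF tensor.tensor_frob[OF tN] tN jm
          tensor.frob_map_closed[OF tN tensor.tensor_frob[OF tN] bm add(1)]
          tensor.frob_map_closed[OF tN tensor.tensor_frob[OF tN] bm add(2)]] by simp
  qed
  have "frob_tower p R N b j"
    using gN bg j tower by (simp add: frob_tower_def)
  moreover have "finitely_generated R (N 0)"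
    unfolding finitely_generated_def
  proof (intro exI conjI allI impI)
    show "finite (\<sigma> 0 ` S)" using S by (simp add: root_def)
    have S0: "s \<in> iter 0 S" if "s \<in> S" for s
      unfolding iter_def using that Sc by (intro lspan_incl) auto
    then show "\<sigma> 0 ` S \<subseteq> carrier (N 0)" by (auto simp: N)
    fix H assume H: "submodule H R (N 0) \<and> \<sigma> 0 ` S \<subseteq> H"
    note HE = module.submoduleE[OF mN conjunct1[OF H]]
    have z: "\<sigma> 0 \<zero>\<^bsub>A\<^esub> \<in> H" using H subgroup.one_closed[OF submodule.axioms(1)] by (fastforce simp: N)
    have "lspan (carrier R) A S \<subseteq> {x \<in> iter 0 S. \<sigma> 0 x \<in> H}"
    proof (rule lspan_least)
      fix x y assume "x \<in> {x \<in> iter 0 S. \<sigma> 0 x \<in> H}" "y \<in> {x \<in> iter 0 S. \<sigma> 0 x \<in> H}"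
      then show "x \<oplus>\<^bsub>A\<^esub> y \<in> {x \<in> iter 0 S. \<sigma> 0 x \<in> H}"
        using HE(5)[of "\<sigma> 0 x" "\<sigma> 0 y"] by (simp add: N iter_cl)
    next
      fix a x assume "a \<in> carrier R" "x \<in> S"
      then show "a \<odot>\<^bsub>A\<^esub> x \<in> {x \<in> iter 0 S. \<sigma> 0 x \<in> H}"
        using HE(4)[of a "\<sigma> 0 x"] H S0[of x] by (auto simp: N iter_cl)
    qed (simp add: z iter_cl)
    then show "carrier (N 0) \<subseteq> H" by (auto simp: N iter_def)
  qed
  moreover have "direct_limit R N (\<lambda>e x. j e (b e x)) A \<iota>"
    unfolding direct_limit_def
  proof (intro conjI allI ballI impI)
    show "\<iota> e \<in> gmod_hom R (N e) A" for e by (rule ig)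
    show "\<iota> (Suc e) (j e (b e x)) = \<iota> e x" if "x \<in> carrier (N e)" for e x
      using jb_t[OF that] that by (auto simp: t_def N suc)
    have "\<iota> e ` carrier (N e) = iter e S" for e by (force simp: N)
    then show "carrier A = (\<Union>e. \<iota> e ` carrier (N e))" using ex ic by (auto simp: exhausts_def)
    have tr: "transition (\<lambda>e x. j e (b e x)) e k x = \<sigma> (e + k) (\<iota> e x)" if x: "x \<in> carrier (N e)" for e k x
    proof (induction k)
      case 0
      then show ?case using x by (auto simp: N)
    next
      case (Suc k)
      have i: "\<iota> e x \<in> iter (e + k) S" using x iter_mono[OF S, of e "e + k"] by (auto simp: N)
      then have "\<sigma> (e + k) (\<iota> e x) \<in> carrier (N (e + k))" by (auto simp: N)
      then show ?case using Suc i by (simp add: jb_t t_def)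
    qed
    fix e f x y assume "x \<in> carrier (N e)" "y \<in> carrier (N f)" "\<iota> e x = \<iota> f y"
    \<comment> \<open>Transitions are inclusions, so two elements with the same image in
      \<open>A\<close> coincide on the common level \<open>e + f\<close>.\<close>
    then show "\<exists>k l. e + k = f + l \<and>
        transition (\<lambda>e x. j e (b e x)) e k x = transition (\<lambda>e x. j e (b e x)) f l y"
      by (intro exI[of _ f] exI[of _ e]) (simp add: tr add.commute)
  qed
  moreover have "struct A (\<iota> e x) = frob_map p R A (\<iota> e) (b e x)" if x: "x \<in> carrier (N e)" for e x
  proof -
    have "struct A (\<iota> (Suc e) (j e z)) = frob_map p R A (\<iota> e) z" if "z \<in> carrier (frob p R (N e))" for z
      using that
    proof (rule tensor.tensor_induct[OF tN], goal_cases)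
      case tensor: (1 r m)
      have i: "\<iota> e m \<in> iter e S" using tensor by (auto simp: N)
      have "\<iota> (Suc e) (r \<odot>\<^bsub>N (Suc e)\<^esub> f e m) = r \<odot>\<^bsub>A\<^esub> fr (\<iota> e m)"
        using tensor i by (simp add: N f_def fr_iter[OF Sc] iter_cl)
      then show ?case using tensor i
        by (simp add: jt tensor.frob_map_tensor[OF tN T.tensor im] struct_smult_fr ic)
    next
      case add: (2 x y)
      have "\<iota> (Suc e) (j e (x \<oplus>\<^bsub>frob p R (N e)\<^esub> y)) = \<iota> (Suc e) (j e x) \<oplus>\<^bsub>A\<^esub> \<iota> (Suc e) (j e y)"
        using add(1,2) jc jm[of e] im[of "Suc e"] by (simp add: mod_hom_def)
      moreover have "\<iota> (Suc e) (j e x) \<in> carrier A" "\<iota> (Suc e) (j e y) \<in> carrier A"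
        using jc[OF add(1)] jc[OF add(2)] im[of "Suc e"] by (auto simp: mod_hom_def)
      ultimately show ?case
        using add by (simp add: struct_add tensor.frob_map_add[OF tN T.tensor im])
    qed
    note * = this[OF bc[OF x]]
    have "\<iota> e x \<in> iter e S" using x by (auto simp: N)
    then have "\<iota> (Suc e) (j e (b e x)) = \<iota> e x" using suc by (simp only: jb_t[OF x] t_def i\<sigma>)
    then show ?thesis using * by (simp only:)
  qed
  ultimately show ?thesis
    unfolding graded_F_finite_def
    by (intro conjI exI[of _ N] exI[of _ b] exI[of _ j] exI[of _ \<iota>] fmod) auto
qed

end


section \<open>The inverse system\<close>

text \<open>The inverse system: a polynomial \<open>\<Sum> c\<^sub>q x\<^sup>q\<close> stands for the class \<open>\<Sum> c\<^sub>q x\<^sup>-\<^sup>1\<^sup>-\<^sup>q\<close> in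
  \<open>H\<^sup>n\<^sub>\<mm>(R)\<close>, and \<open>R\<close> acts by contraction.\<close>

definition contract :: "'k::field mpol \<Rightarrow> 'k mpol \<Rightarrow> 'k mpol" where
  "contract a g = Abs_poly_mapping
    (\<lambda>m. \<Sum>s\<in>Poly_Mapping.keys a. Poly_Mapping.lookup a s * Poly_Mapping.lookup g (m + s))"

lemma lookup_contract: "Poly_Mapping.lookup (contract a g) m =
    (\<Sum>s\<in>Poly_Mapping.keys a. Poly_Mapping.lookup a s * Poly_Mapping.lookup g (m + s))"
proof -
  let ?F = "\<lambda>m. \<Sum>s\<in>Poly_Mapping.keys a. Poly_Mapping.lookup a s * Poly_Mapping.lookup g (m + s)"
  have "{m. ?F m \<noteq> 0} \<subseteq> (\<Union>s\<in>Poly_Mapping.keys a. (\<lambda>m. m + s) -` Poly_Mapping.keys g)"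
  proof
    fix m assume "m \<in> {m. ?F m \<noteq> 0}"
    then obtain s where "s \<in> Poly_Mapping.keys a" "Poly_Mapping.lookup a s * Poly_Mapping.lookup g (m + s) \<noteq> 0"
      by (auto elim: sum.not_neutral_contains_not_neutral)
    then show "m \<in> (\<Union>s\<in>Poly_Mapping.keys a. (\<lambda>m. m + s) -` Poly_Mapping.keys g)"
      by (auto simp: in_keys_iff)
  qed
  moreover have "finite \<dots>" by (intro finite_UN_I finite_vimageI) (auto intro: injI)
  ultimately have "finite {m. ?F m \<noteq> 0}" by (rule finite_subset)
  then show ?thesis by (simp add: contract_def)
qed

lemma lookup_contract_superset:
  assumes "finite K" "Poly_Mapping.keys a \<subseteq> K"
  shows "Poly_Mapping.lookup (contract a g) m =
    (\<Sum>s\<in>K. Poly_Mapping.lookup a s * Poly_Mapping.lookup g (m + s))"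
  unfolding lookup_contract by (rule sum.mono_neutral_left) (use assms in \<open>auto simp: in_keys_iff\<close>)

lemma lookup_contract_single [simp]:
  "Poly_Mapping.lookup (contract (Poly_Mapping.single u c) g) m = c * Poly_Mapping.lookup g (m + u)"
  by (subst lookup_contract_superset[of "{u}"]) auto

lemma contract_add_left: "contract (a + b) g = contract a g + contract b g"
proof (rule poly_mapping_eqI)
  fix m
  let ?K = "Poly_Mapping.keys a \<union> Poly_Mapping.keys b"
  have K: "finite ?K" "Poly_Mapping.keys a \<subseteq> ?K" "Poly_Mapping.keys b \<subseteq> ?K" "Poly_Mapping.keys (a + b) \<subseteq> ?K"
    using keys_add[of a b] by auto
  show "Poly_Mapping.lookup (contract (a + b) g) m = Poly_Mapping.lookup (contract a g + contract b g) m"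
    unfolding lookup_add lookup_contract_superset[OF K(1,2)] lookup_contract_superset[OF K(1,3)]
      lookup_contract_superset[OF K(1,4)]
    by (simp add: distrib_right sum.distrib)
qed

lemma contract_add_right: "contract a (g + h) = contract a g + contract a h"
  by (rule poly_mapping_eqI) (simp add: lookup_contract lookup_add distrib_left sum.distrib)

lemma contract_zero [simp]: "contract 0 g = 0" "contract a 0 = 0"
  by (rule poly_mapping_eqI; simp add: lookup_contract)+

lemma contract_closed: "g \<in> carrier (poly_ring n) \<Longrightarrow> contract a g \<in> carrier (poly_ring n)"
proof -
  assume g: "g \<in> carrier (poly_ring n)"
  have "Poly_Mapping.keys m \<subseteq> {..<n}" if "m \<in> Poly_Mapping.keys (contract a g)" for m
  proof -
    have "(\<Sum>s\<in>Poly_Mapping.keys a. Poly_Mapping.lookup a s * Poly_Mapping.lookup g (m + s)) \<noteq> 0"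
      using that by (simp add: in_keys_iff lookup_contract)
    then obtain s where "Poly_Mapping.lookup a s * Poly_Mapping.lookup g (m + s) \<noteq> 0"
      by (auto elim: sum.not_neutral_contains_not_neutral)
    then have "m + s \<in> Poly_Mapping.keys g" by (auto simp: in_keys_iff)
    then show ?thesis using g unfolding in_poly_ring by (metis keys_plus_nat le_sup_iff)
  qed
  then show ?thesis by (simp add: in_poly_ring)
qed

lemma contract_one [simp]: "contract 1 g = g"
  using lookup_contract_single[of 0 1 g] by (intro poly_mapping_eqI) (simp add: single_one[symmetric] del: single_one)

lemma contract_mult:
  assumes a: "a \<in> carrier (poly_ring n)" and b: "b \<in> carrier (poly_ring n)"
  shows "contract (a * b) g = contract a (contract b g)"
  using a
proof (induction a rule: poly_ring_induct)
  case (single u c)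
  show ?case using b
  proof (induction b rule: poly_ring_induct)
    case (single v d)
    show ?case by (rule poly_mapping_eqI) (simp add: mult_single ac_simps)
  next
    case (add f h)
    then show ?case by (simp add: distrib_left contract_add_left contract_add_right)
  qed
next
  case (add f h)
  then show ?case by (simp add: distrib_right contract_add_left)
qed

text \<open>The degree of \<open>x^m\<close> is that of the class \<open>x^(-1-m)\<close> it stands
  for, with \<open>-1\<close> in each of the \<open>n\<close> variables.\<close>

definition inv_system :: "nat \<Rightarrow> ('k::field mpol, 'k mpol) graded_module" where
  "inv_system n = \<lparr> carrier = carrier (poly_ring n), monoid.mult = undefined, monoid.one = undefined,
     ring.zero = 0, ring.add = (+), module.smult = contract,
     hcomp = (\<lambda>d. {g \<in> carrier (poly_ring n). \<forall>m\<in>Poly_Mapping.keys g. - int n - int (mdeg m) = d}) \<rparr>"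

lemma inv_system_simps [simp]:
  "carrier (inv_system n) = carrier (poly_ring n)" "\<zero>\<^bsub>inv_system n\<^esub> = 0"
  "x \<oplus>\<^bsub>inv_system n\<^esub> y = x + y" "a \<odot>\<^bsub>inv_system n\<^esub> x = contract a x"
  by (simp_all add: inv_system_def)

lemma in_hcomp_inv_system: "g \<in> hcomp (inv_system n) d \<longleftrightarrow> g \<in> carrier (poly_ring n) \<and>
    (\<forall>m\<in>Poly_Mapping.keys g. - int n - int (mdeg m) = d)"
  by (simp add: inv_system_def)

lemma abelian_group_inv_system: "abelian_group (inv_system n :: ('k::field mpol, 'k mpol) graded_module)"
proof (rule abelian_groupI)
  fix x :: "'k mpol" assume "x \<in> carrier (inv_system n)"
  then show "\<exists>y\<in>carrier (inv_system n). y \<oplus>\<^bsub>inv_system n\<^esub> x = \<zero>\<^bsub>inv_system n\<^esub>"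
    by (intro bexI[of _ "- x"]) auto
qed auto

lemma finsum_inv_system:
  fixes c :: "'i \<Rightarrow> 'k::field mpol"
  assumes "finite D" "\<And>d. d \<in> D \<Longrightarrow> c d \<in> carrier (poly_ring n)"
  shows "finsum (inv_system n) c D = sum c D"
proof -
  interpret abelian_group "inv_system n :: ('k mpol, 'k mpol) graded_module" by (rule abelian_group_inv_system)
  show ?thesis using assms by (induction D rule: finite_induct) (auto simp: Pi_def)
qed

lemma contract_degree:
  assumes "a \<in> rcomp (poly_ring n) i" "x \<in> hcomp (inv_system n) j"
  shows "contract a x \<in> hcomp (inv_system n) (i + j)"
proof -
  have x: "x \<in> carrier (poly_ring n)" using assms(2) by (simp add: in_hcomp_inv_system)
  have "- int n - int (mdeg m) = i + j" if "m \<in> Poly_Mapping.keys (contract a x)" for m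
  proof -
    have "(\<Sum>s\<in>Poly_Mapping.keys a. Poly_Mapping.lookup a s * Poly_Mapping.lookup x (m + s)) \<noteq> 0"
      using that by (simp add: in_keys_iff lookup_contract)
    then obtain s where s: "s \<in> Poly_Mapping.keys a" "Poly_Mapping.lookup a s * Poly_Mapping.lookup x (m + s) \<noteq> 0"
      by (auto elim: sum.not_neutral_contains_not_neutral)
    then have "m + s \<in> Poly_Mapping.keys x" by (auto simp: in_keys_iff)
    then have "- int n - int (mdeg (m + s)) = j" "int (mdeg s) = i"
      using assms s by (auto simp: in_hcomp_inv_system in_rcomp)
    then show ?thesis by (simp add: mdeg_add)
  qed
  then show ?thesis using contract_closed[OF x] by (simp add: in_hcomp_inv_system)
qed

lemma graded_module_inv_system:
  "graded_module (poly_ring n) (inv_system n :: ('k::field mpol, 'k mpol) graded_module)"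
proof -
  let ?E = "inv_system n :: ('k mpol, 'k mpol) graded_module"
  interpret E: abelian_group ?E by (rule abelian_group_inv_system)
  have mod: "Module.module (poly_ring n) ?E"
    by (rule moduleI[OF cring_poly_ring abelian_group_inv_system])
       (auto simp: contract_closed contract_add_left contract_add_right contract_mult)
  show ?thesis
  proof (rule graded_module.intro[OF mod graded_module_axioms.intro])
    fix d
    have neg: "\<ominus>\<^bsub>?E\<^esub> x = - x" if "x \<in> carrier (poly_ring n)" for x
      using that by (intro E.minus_equality) auto
    show "subgroup (hcomp ?E d) (add_monoid ?E)"
    proof (rule subgroup.intro)
      fix x y assume "x \<in> hcomp ?E d" "y \<in> hcomp ?E d"
      then show "x \<otimes>\<^bsub>add_monoid ?E\<^esub> y \<in> hcomp ?E d"
        using keys_add[of x y] by (auto simp: in_hcomp_inv_system)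
    next
      fix x assume x: "x \<in> hcomp ?E d"
      then have "\<ominus>\<^bsub>?E\<^esub> x \<in> hcomp ?E d" using neg[of x] by (auto simp: in_hcomp_inv_system)
      then show "inv\<^bsub>add_monoid ?E\<^esub> x \<in> hcomp ?E d" by (simp add: a_inv_def)
    qed (auto simp: in_hcomp_inv_system)
  next
    fix a x :: "'k mpol" and i j assume "a \<in> rcomp (poly_ring n) i" "x \<in> hcomp ?E j"
    then show "a \<odot>\<^bsub>?E\<^esub> x \<in> hcomp ?E (i + j)" by (simp add: contract_degree)
  next
    fix x assume "x \<in> carrier ?E"
    then have x: "x \<in> carrier (poly_ring n)" by simp
    define dg where "dg m = - int n - int (mdeg m)" for m
    define c where "c d = (\<Sum>m | m \<in> Poly_Mapping.keys x \<and> dg m = d. Poly_Mapping.single m (Poly_Mapping.lookup x m))" for d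
    have lc: "Poly_Mapping.lookup (c d) m = (if dg m = d then Poly_Mapping.lookup x m else 0)" for d m
      by (auto simp: c_def lookup_sum lookup_single when_def sum.delta in_keys_iff)
    have cc: "c d \<in> hcomp ?E d" for d
    proof -
      have "m \<in> Poly_Mapping.keys x \<and> dg m = d" if "m \<in> Poly_Mapping.keys (c d)" for m
        using that by (simp add: in_keys_iff lc split: if_splits)
      then show ?thesis using x unfolding in_hcomp_inv_system in_poly_ring by (metis dg_def)
    qed
    have fin: "{d. c d \<noteq> 0} \<subseteq> dg ` Poly_Mapping.keys x"
    proof
      fix d assume "d \<in> {d. c d \<noteq> 0}"
      then have "Poly_Mapping.keys (c d) \<noteq> {}" by simp
      then obtain m where "m \<in> Poly_Mapping.keys (c d)" by blast
      then have "Poly_Mapping.lookup (c d) m \<noteq> 0" by (simp add: in_keys_iff)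
      then show "d \<in> dg ` Poly_Mapping.keys x" by (auto simp: lc in_keys_iff split: if_splits)
    qed
    then have fin': "finite {d. c d \<noteq> 0}" by (rule finite_subset) auto
    have ccl: "c d \<in> carrier (poly_ring n)" for d using cc[of d] by (simp add: in_hcomp_inv_system)
    show "\<exists>!c. (\<forall>d. c d \<in> hcomp ?E d) \<and> finite {d. c d \<noteq> \<zero>\<^bsub>?E\<^esub>} \<and> x = finsum ?E c {d. c d \<noteq> \<zero>\<^bsub>?E\<^esub>}"
    proof (rule ex1I[of _ c])
      have "x = sum c {d. c d \<noteq> 0}"
      proof (rule poly_mapping_eqI)
        fix m
        show "Poly_Mapping.lookup x m = Poly_Mapping.lookup (sum c {d. c d \<noteq> 0}) m"
        proof (cases "c (dg m) = 0")
          case True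
          then have "Poly_Mapping.lookup x m = 0" using lc[of "dg m" m] by simp
          then show ?thesis unfolding lookup_sum lc by (simp add: sum.neutral)
        next
          case False
          have "(\<Sum>d | c d \<noteq> 0. Poly_Mapping.lookup (c d) m) = (\<Sum>d\<in>{dg m}. Poly_Mapping.lookup (c d) m)"
            by (rule sum.mono_neutral_right) (use fin' False lc in auto)
          then show ?thesis by (simp add: lookup_sum lc)
        qed
      qed
      then show "(\<forall>d. c d \<in> hcomp ?E d) \<and> finite {d. c d \<noteq> \<zero>\<^bsub>?E\<^esub>} \<and> x = finsum ?E c {d. c d \<noteq> \<zero>\<^bsub>?E\<^esub>}"
        using cc fin' ccl by (simp add: finsum_inv_system)
    next
      fix c' assume c': "(\<forall>d. c' d \<in> hcomp ?E d) \<and> finite {d. c' d \<noteq> \<zero>\<^bsub>?E\<^esub>} \<and> x = finsum ?E c' {d. c' d \<noteq> \<zero>\<^bsub>?E\<^esub>}"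
      have c'c: "c' d \<in> carrier (poly_ring n)" for d using c' by (simp add: in_hcomp_inv_system)
      have x': "x = sum c' {d. c' d \<noteq> 0}" using c' c'c by (simp add: finsum_inv_system)
      have c'0: "Poly_Mapping.lookup (c' d) m = 0" if "dg m \<noteq> d" for d m
      proof -
        have "m \<notin> Poly_Mapping.keys (c' d)" using c' that by (auto simp: in_hcomp_inv_system dg_def)
        then show ?thesis by (simp add: in_keys_iff)
      qed
      show "c' = c"
      proof (intro ext poly_mapping_eqI)
        fix d m
        have "Poly_Mapping.lookup x (m::nat \<Rightarrow>\<^sub>0 nat) = Poly_Mapping.lookup (c' (dg m)) m"
        proof (cases "c' (dg m) = 0")
          case True
          then have "Poly_Mapping.lookup (c' d) m = 0" for d using c'0[of m d] by (cases "dg m = d") auto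
          then show ?thesis by (subst x') (simp add: lookup_sum)
        next
          case False
          have "(\<Sum>d | c' d \<noteq> 0. Poly_Mapping.lookup (c' d) m) = (\<Sum>d\<in>{dg m}. Poly_Mapping.lookup (c' d) m)"
            by (rule sum.mono_neutral_right) (use c' False c'0 in auto)
          then show ?thesis by (subst x') (simp add: lookup_sum)
        qed
        then show "Poly_Mapping.lookup (c' d) m = Poly_Mapping.lookup (c d) m" using c'0[of m d] by (simp add: lc)
      qed
    qed
  qed
qed

section \<open>The Frobenius action on the inverse system\<close>

context char_p
begin

text \<open>The largest exponent vector of the box \<open>mbox n p\<close>, so that
  \<open>r \<mapsto> mtop - r\<close> permutes the box.\<close>

definition mtop :: "nat \<Rightarrow>\<^sub>0 nat" where "mtop = (\<Sum>i<n. Poly_Mapping.single i (p - 1))"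

lemma lookup_mtop: "Poly_Mapping.lookup mtop i = (if i < n then p - 1 else 0)"
  by (auto simp: mtop_def lookup_sum lookup_single when_def sum.delta)

lemma keys_mtop: "Poly_Mapping.keys mtop \<subseteq> {..<n}"
  by (auto simp: in_keys_iff lookup_mtop split: if_splits)

lemma mdeg_mtop: "mdeg mtop = n * (p - 1)"
proof -
  have "mdeg mtop = (\<Sum>i<n. Poly_Mapping.lookup mtop i)"
    unfolding mdeg_def by (rule sum.mono_neutral_left) (use keys_mtop in \<open>auto simp: in_keys_iff\<close>)
  then show ?thesis by (simp add: lookup_mtop)
qed

text \<open>The \<open>p\<close>-th power of \<open>x\<^sup>-\<^sup>1\<^sup>-\<^sup>q\<close> is \<open>x\<^sup>-\<^sup>1\<^sup>-\<^sup>r\<close> with \<open>r = p q + (p - 1)\<close>.\<close>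

definition efrob :: "'k mpol \<Rightarrow> 'k mpol" where
  "efrob g = (\<Sum>q\<in>Poly_Mapping.keys g. Poly_Mapping.single (mscale p q + mtop) (Poly_Mapping.lookup g q ^ p))"

lemma lookup_efrob: "Poly_Mapping.lookup (efrob g) (mscale p q + mtop) = Poly_Mapping.lookup g q ^ p"
proof -
  have "Poly_Mapping.lookup (efrob g) (mscale p q + mtop) =
      (\<Sum>q'\<in>Poly_Mapping.keys g. if q' = q then Poly_Mapping.lookup g q ^ p else 0)"
    unfolding efrob_def lookup_sum
    by (rule sum.cong) (auto simp: lookup_single when_def dest: mscale_inj[OF p_pos])
  then show ?thesis using p_pos by (auto simp: sum.delta in_keys_iff)
qed

lemma lookup_efrob_zero: "(\<And>q. m \<noteq> mscale p q + mtop) \<Longrightarrow> Poly_Mapping.lookup (efrob g) m = 0"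
  unfolding efrob_def lookup_sum by (rule sum.neutral) (auto simp: lookup_single when_def)

lemma efrob_add: "efrob (g + h) = efrob g + efrob h"
proof (rule poly_mapping_eqI)
  fix m
  show "Poly_Mapping.lookup (efrob (g + h)) m = Poly_Mapping.lookup (efrob g + efrob h) m"
    by (cases "\<exists>q. m = mscale p q + mtop")
       (auto simp: lookup_add lookup_efrob lookup_efrob_zero frob_add_field)
qed

lemma efrob_closed: "g \<in> carrier R \<Longrightarrow> efrob g \<in> carrier R"
  unfolding efrob_def using keys_mtop p_pos
  by (intro poly_ring_sum_closed) (auto simp: in_poly_ring keys_plus_nat)

lemma efrob_degree:
  assumes "g \<in> hcomp (inv_system n) d"
  shows "efrob g \<in> hcomp (inv_system n) (int p * d)"
proof -
  have g: "g \<in> carrier R" using assms by (simp add: in_hcomp_inv_system)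
  have "- int n - int (mdeg m) = int p * d" if "m \<in> Poly_Mapping.keys (efrob g)" for m
  proof -
    have nz: "Poly_Mapping.lookup (efrob g) m \<noteq> 0" using that by (simp add: in_keys_iff)
    then obtain q where q: "m = mscale p q + mtop" using lookup_efrob_zero by blast
    then have "q \<in> Poly_Mapping.keys g" using nz p_pos by (auto simp: lookup_efrob in_keys_iff zero_power)
    then have d: "d = - int n - int (mdeg q)" using assms by (auto simp: in_hcomp_inv_system)
    have "int (mdeg m) = int p * int (mdeg q) + int n * (int p - 1)"
      using p_pos by (simp add: q mdeg_add mdeg_mscale mdeg_mtop of_nat_diff)
    then show ?thesis by (simp add: d algebra_simps)
  qed
  then show ?thesis using efrob_closed[OF g] by (simp add: in_hcomp_inv_system)
qed

text \<open>On monomials both sides are supported at exponents \<open>p q + mtop\<close>. If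
  \<open>m + p u = p q + mtop\<close>, then \<open>u \<le> q\<close> in each coordinate because the
  entries of \<open>mtop\<close> are below \<open>p\<close>, and so \<open>m\<close> has the same
  form.\<close>

lemma efrob_contract:
  assumes s: "s \<in> carrier R"
  shows "efrob (contract s g) = contract (s ^ p) (efrob g)"
  using s
proof (induction s rule: poly_ring_induct)
  case (single u c)
  show ?case
  proof (rule poly_mapping_eqI)
    fix m
    show "Poly_Mapping.lookup (efrob (contract (Poly_Mapping.single u c) g)) m =
        Poly_Mapping.lookup (contract (Poly_Mapping.single u c ^ p) (efrob g)) m"
    proof (cases "\<exists>q. m = mscale p q + mtop")
      case True
      then obtain q where m: "m = mscale p q + mtop" by auto
      have "m + mscale p u = mscale p (q + u) + mtop" by (simp add: m mscale_add ac_simps)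
      then show ?thesis
        by (simp only: single_power lookup_contract_single lookup_efrob m power_mult_distrib)
    next
      case False
      have "m + mscale p u \<noteq> mscale p q + mtop" for q
      proof
        assume a: "m + mscale p u = mscale p q + mtop"
        have eq: "Poly_Mapping.lookup m i + p * Poly_Mapping.lookup u i =
            p * Poly_Mapping.lookup q i + Poly_Mapping.lookup mtop i" for i
          using a[THEN arg_cong, of "\<lambda>m. Poly_Mapping.lookup m i"] by (simp add: lookup_add)
        have le: "Poly_Mapping.lookup u i \<le> Poly_Mapping.lookup q i" for i
        proof (rule ccontr)
          assume "\<not> ?thesis"
          then have "Suc (Poly_Mapping.lookup q i) \<le> Poly_Mapping.lookup u i" by simp
          from mult_le_mono2[OF this, of p]
          have "p + p * Poly_Mapping.lookup q i \<le> p * Poly_Mapping.lookup u i" by simp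
          moreover have "Poly_Mapping.lookup mtop i < p" using p_pos by (simp add: lookup_mtop)
          ultimately show False using eq[of i] by linarith
        qed
        have "m = mscale p (q - u) + mtop"
        proof (rule poly_mapping_eqI)
          fix i
          have "p * Poly_Mapping.lookup u i \<le> p * Poly_Mapping.lookup q i" using le[of i] by (rule mult_le_mono2)
          then show "Poly_Mapping.lookup m i = Poly_Mapping.lookup (mscale p (q - u) + mtop) i"
            using eq[of i] by (simp add: lookup_add lookup_minus diff_mult_distrib2)
        qed
        then show False using False by blast
      qed
      then have "Poly_Mapping.lookup (efrob g) (m + mscale p u) = 0" by (intro lookup_efrob_zero) auto
      then show ?thesis using False by (simp add: single_power lookup_efrob_zero)
    qed
  qed
next
  case (add s t)
  then show ?case by (simp add: contract_add_left efrob_add frob_add_mpol)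
qed

text \<open>Contracting \<open>x^(p q + mtop)\<close> by \<open>x^r\<close> leaves the remainder
  \<open>mtop - r\<close> modulo \<open>p\<close>. The coordinate belonging to \<open>r\<close> is
  therefore found at the complementary remainder.\<close>

definition ecoord :: "'k \<times> (nat \<Rightarrow>\<^sub>0 nat) \<Rightarrow> 'k mpol \<Rightarrow> 'k mpol" where
  "ecoord j = fcoord (fst j, mtop - snd j)"

lemma mtop_minus: "r \<in> mbox n p \<Longrightarrow> mtop - r + r = mtop"
proof (rule poly_mapping_eqI)
  fix i assume r: "r \<in> mbox n p"
  have "Poly_Mapping.lookup r i \<le> Poly_Mapping.lookup mtop i"
  proof (cases "i < n")
    case True
    have "Poly_Mapping.lookup r i < p" using r by (simp add: mbox_def)
    then show ?thesis using True by (simp add: lookup_mtop)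
  next
    case False
    then have "i \<notin> Poly_Mapping.keys r" using r by (auto simp: mbox_def)
    then show ?thesis by (simp add: in_keys_iff)
  qed
  then show "Poly_Mapping.lookup (mtop - r + r) i = Poly_Mapping.lookup mtop i"
    by (simp add: lookup_add lookup_minus)
qed

text \<open>Everything rests on \<open>p m + (mtop - rj) + s = p q + mtop\<close> being equivalent
  to \<open>p m + s = p q + rj\<close>. As \<open>rj\<close> lies in the box, this forces
  \<open>s = p (q - m) + rj\<close>.\<close>

lemma ecoord_efrob:
  assumes j: "j \<in> fidx" and r: "r \<in> carrier R"
  shows "ecoord j (contract r (efrob c)) = contract (fcoord j r) c"
  using r
proof (induction r rule: poly_ring_induct)
  case (single s k)
  obtain b rj where br: "j = (b, rj)" by (cases j)
  have rj: "rj \<in> mbox n p" using j by (auto simp: fidx_def br)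
  show ?case
  proof (rule poly_mapping_eqI)
    fix m
    have L: "Poly_Mapping.lookup (ecoord j (contract (Poly_Mapping.single s k) (efrob c))) m =
        frep b (k * Poly_Mapping.lookup (efrob c) (mscale p m + (mtop - rj) + s))"
      by (simp add: ecoord_def br lookup_fcoord)
    show "Poly_Mapping.lookup (ecoord j (contract (Poly_Mapping.single s k) (efrob c))) m =
        Poly_Mapping.lookup (contract (fcoord j (Poly_Mapping.single s k)) c) m"
    proof (cases "\<exists>s1. s = mscale p s1 + rj")
      case True
      then obtain s1 where s1: "s = mscale p s1 + rj" by auto
      have "fcoord j (Poly_Mapping.single s k) = Poly_Mapping.single s1 (frep b k)"
      proof (rule poly_mapping_eqI)
        fix t
        have "s = mscale p t + rj \<longleftrightarrow> s1 = t" using s1 mscale_inj[OF p_pos] by auto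
        then show "Poly_Mapping.lookup (fcoord j (Poly_Mapping.single s k)) t =
            Poly_Mapping.lookup (Poly_Mapping.single s1 (frep b k)) t"
          by (auto simp: lookup_fcoord br lookup_single when_def)
      qed
      moreover have "mscale p m + (mtop - rj) + s = mscale p (m + s1) + (mtop - rj + rj)"
        by (simp add: s1 mscale_add ac_simps)
      then have "mscale p m + (mtop - rj) + s = mscale p (m + s1) + mtop"
        by (simp only: mtop_minus[OF rj])
      ultimately show ?thesis
        by (simp only: L lookup_efrob lookup_contract_single mult.commute[of k] frep_scale)
           (simp add: mult.commute)
    next
      case False
      then have z: "fcoord j (Poly_Mapping.single s k) = 0"
        by (intro poly_mapping_eqI) (auto simp: lookup_fcoord br lookup_single when_def)
      have "mscale p m + (mtop - rj) + s \<noteq> mscale p q + mtop" for q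
      proof
        assume "mscale p m + (mtop - rj) + s = mscale p q + mtop"
        then have "(mscale p m + (mtop - rj) + s) + rj = mscale p q + mtop + rj" by (simp only:)
        then have "mscale p m + (mtop - rj + rj) + s = mscale p q + mtop + rj" by (simp only: ac_simps)
        then have "mscale p m + mtop + s = mscale p q + mtop + rj" by (simp only: mtop_minus[OF rj])
        then have "mscale p m + s + mtop = mscale p q + rj + mtop" by (simp only: ac_simps)
        then have a: "mscale p m + s = mscale p q + rj" by simp
        have eq: "p * Poly_Mapping.lookup m i + Poly_Mapping.lookup s i =
            p * Poly_Mapping.lookup q i + Poly_Mapping.lookup rj i" for i
          using a[THEN arg_cong, of "\<lambda>m. Poly_Mapping.lookup m i"] by (simp add: lookup_add)
        have "s = mscale p (q - m) + rj"
        proof (rule poly_mapping_eqI)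
          fix i
          have "Poly_Mapping.lookup m i \<le> Poly_Mapping.lookup q i"
          proof (rule ccontr)
            assume "\<not> ?thesis"
            then have "Suc (Poly_Mapping.lookup q i) \<le> Poly_Mapping.lookup m i" by simp
            from mult_le_mono2[OF this, of p]
            have "p + p * Poly_Mapping.lookup q i \<le> p * Poly_Mapping.lookup m i" by simp
            moreover have "Poly_Mapping.lookup rj i < p" using rj by (simp add: mbox_def)
            ultimately show False using eq[of i] by linarith
          qed
          then have "p * Poly_Mapping.lookup m i \<le> p * Poly_Mapping.lookup q i" by (rule mult_le_mono2)
          then show "Poly_Mapping.lookup s i = Poly_Mapping.lookup (mscale p (q - m) + rj) i"
            using eq[of i] by (simp add: lookup_add lookup_minus diff_mult_distrib2)
        qed
        then show False using False by blast
      qed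
      then have "Poly_Mapping.lookup (efrob c) (mscale p m + (mtop - rj) + s) = 0" by (intro lookup_efrob_zero) auto
      then show ?thesis by (simp add: L z)
    qed
  qed
next
  case (add f g)
  then show ?case by (simp add: contract_add_left fcoord_add ecoord_def)
qed

lemma inv_system_induct:
  assumes x: "x \<in> carrier R"
    and f: "\<And>r c. r \<in> carrier R \<Longrightarrow> c \<in> carrier R \<Longrightarrow> P (contract r (efrob c))"
    and add: "\<And>x y. x \<in> carrier R \<Longrightarrow> y \<in> carrier R \<Longrightarrow> P x \<Longrightarrow> P y \<Longrightarrow> P (x + y)"
  shows "P x"
  using x
proof (induction x rule: poly_ring_induct)
  case (single m c)
  let ?q = "mquot p m" and ?r = "mrem p m"
  \<comment> \<open>With \<open>m = p q + r\<close>, contracting the Frobenius image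
    \<open>x^(p q + mtop)\<close> of \<open>x^q\<close> by \<open>x^(mtop - r)\<close> leaves
    exactly \<open>x^m\<close>.\<close>
  let ?a = "Poly_Mapping.single (mtop - ?r) c" and ?X = "Poly_Mapping.single ?q (1::'k)"
  have r: "?r \<in> mbox n p" using single p_pos by (intro mrem_mbox)
  have eq: "contract ?a (efrob ?X) = Poly_Mapping.single m c"
  proof (rule poly_mapping_eqI)
    fix t
    have iff: "mscale p ?q + mtop = t + (mtop - ?r) \<longleftrightarrow> m = t"
    proof -
      have "mscale p ?q + mtop = mscale p ?q + (mtop - ?r + ?r)" by (simp only: mtop_minus[OF r])
      also have "\<dots> = m + (mtop - ?r)" using mquot_mrem[of p m] by (metis add.assoc add.commute)
      finally show ?thesis by simp
    qed
    have "efrob ?X = Poly_Mapping.single (mscale p ?q + mtop) 1" by (simp add: efrob_def)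
    then show "Poly_Mapping.lookup (contract ?a (efrob ?X)) t = Poly_Mapping.lookup (Poly_Mapping.single m c) t"
      using iff by (simp add: lookup_single when_def)
  qed
  have "Poly_Mapping.keys (mtop - ?r) \<subseteq> {..<n}"
    using keys_mtop by (auto simp: in_keys_iff lookup_minus lookup_mtop split: if_splits)
  moreover have "Poly_Mapping.keys ?q \<subseteq> {..<n}" using single mquot_keys[of p m] by blast
  ultimately have "P (contract ?a (efrob ?X))" by (intro f) auto
  then show ?case by (simp add: eq)
next
  case (add f g)
  then show ?case by (rule assms(3))
qed

lemma frob_ext_inv_system: "frob_ext p n (inv_system n :: ('k mpol, 'k mpol) graded_module) (inv_system n) efrob ecoord"
proof -
  interpret E: graded_module R "inv_system n :: ('k mpol, 'k mpol) graded_module"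
    by (rule graded_module_inv_system)
  show ?thesis
  proof unfold_locales
    fix x :: "'k mpol" and P
    assume "x \<in> carrier (inv_system n)"
      "\<And>r c. r \<in> carrier R \<Longrightarrow> c \<in> carrier (inv_system n) \<Longrightarrow> P (r \<odot>\<^bsub>inv_system n\<^esub> efrob c)"
      "\<And>x y. x \<in> carrier (inv_system n) \<Longrightarrow> y \<in> carrier (inv_system n) \<Longrightarrow> P x \<Longrightarrow> P y \<Longrightarrow>
        P (x \<oplus>\<^bsub>inv_system n\<^esub> y)"
    then show "P x" by (intro inv_system_induct[of x P]) auto
  qed (auto simp: efrob_closed efrob_add efrob_contract efrob_degree ecoord_def fcoord_closed fcoord_add
      ecoord_efrob[unfolded ecoord_def])
qed

end


section \<open>Top local cohomology as the inverse system\<close>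

text \<open>The exponent of the \<open>k\<close>-th power of the product of all \<open>n\<close>
  variables, the denominators of the top localization.\<close>

definition mones :: "nat \<Rightarrow> nat \<Rightarrow> (nat \<Rightarrow>\<^sub>0 nat)" where
  "mones n k = (\<Sum>i<n. Poly_Mapping.single i k)"

lemma lookup_mones: "Poly_Mapping.lookup (mones n k) i = (if i < n then k else 0)"
  by (auto simp: mones_def lookup_sum lookup_single when_def sum.delta)

lemma mones_add: "mones n (k + l) = mones n k + mones n l"
  by (rule poly_mapping_eqI) (simp add: lookup_mones lookup_add)

lemma mones_zero [simp]: "mones n 0 = 0"
  by (simp add: mones_def)

lemma keys_mones: "Poly_Mapping.keys (mones n k) \<subseteq> {..<n}"
  by (auto simp: in_keys_iff lookup_mones split: if_splits)

lemma mdeg_mones: "mdeg (mones n k) = n * k"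
proof -
  have "mdeg (mones n k) = (\<Sum>i<n. Poly_Mapping.lookup (mones n k) i)"
    unfolding mdeg_def by (rule sum.mono_neutral_left) (use keys_mones[of n k] in \<open>auto simp: in_keys_iff\<close>)
  then show ?thesis by (simp add: lookup_mones)
qed

lemma prod_mvar: "finite S \<Longrightarrow> (\<Prod>i\<in>S. mvar i :: 'k::field mpol) = Poly_Mapping.single (\<Sum>i\<in>S. Poly_Mapping.single i 1) 1"
  by (induction S rule: finite_induct) (simp_all add: mvar_def mult_single)

lemma prod_mvar_power: "(\<Prod>i\<in>{..<n}. mvar i :: 'k::field mpol) ^ k = Poly_Mapping.single (mones n k) 1"
proof -
  have "mscale k (\<Sum>i<n. Poly_Mapping.single i 1) = mones n k"
    by (rule poly_mapping_eqI) (simp add: lookup_mones lookup_sum lookup_single when_def sum.delta)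
  then show ?thesis by (simp add: prod_mvar single_power)
qed

text \<open>The principal part of \<open>a / (x\<^sub>0 \<cdots> x\<^sub>n\<^sub>-\<^sub>1)\<^sup>k\<close>: the coefficient of \<open>x\<^sup>-\<^sup>1\<^sup>-\<^sup>q\<close> is the
  coefficient of \<open>x\<^sup>e\<close> in \<open>a\<close>, where \<open>e + q + 1 = k\<close>.\<close>

definition ppart :: "nat \<Rightarrow> 'k::field mpol \<Rightarrow> nat \<Rightarrow> 'k mpol" where
  "ppart n a k = Abs_poly_mapping (\<lambda>q. if \<exists>e. e + q + mones n 1 = mones n k
     then Poly_Mapping.lookup a (mones n k - (q + mones n 1)) else 0)"

lemma lookup_ppart_aux: "Poly_Mapping.lookup (ppart n a k) q = (if \<exists>e. e + q + mones n 1 = mones n k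
     then Poly_Mapping.lookup a (mones n k - (q + mones n 1)) else 0)"
proof -
  let ?F = "\<lambda>q. if \<exists>e. e + q + mones n 1 = mones n k
     then Poly_Mapping.lookup a (mones n k - (q + mones n 1)) else 0"
  have "{q. ?F q \<noteq> 0} \<subseteq> (\<lambda>e. mones n k - (e + mones n 1)) ` Poly_Mapping.keys a"
  proof
    fix q assume "q \<in> {q. ?F q \<noteq> 0}"
    then obtain e where e: "e + q + mones n 1 = mones n k"
      and nz: "Poly_Mapping.lookup a (mones n k - (q + mones n 1)) \<noteq> 0" by (auto split: if_splits)
    have "mones n k - (q + mones n 1) = e" "mones n k - (e + mones n 1) = q"
      using e by (auto intro!: poly_mapping_eqI simp: e[symmetric] lookup_add lookup_minus)
    then show "q \<in> (\<lambda>e. mones n k - (e + mones n 1)) ` Poly_Mapping.keys a"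
      using nz by (auto simp: in_keys_iff intro!: image_eqI[of _ _ e])
  qed
  then have "finite {q. ?F q \<noteq> 0}" by (rule finite_subset) auto
  then show ?thesis by (simp add: ppart_def)
qed

lemma lookup_ppart: "e + q + mones n 1 = mones n k \<Longrightarrow> Poly_Mapping.lookup (ppart n a k) q = Poly_Mapping.lookup a e"
proof -
  assume e: "e + q + mones n 1 = mones n k"
  have "mones n k - (q + mones n 1) = e"
    by (auto intro!: poly_mapping_eqI simp: e[symmetric] lookup_add lookup_minus)
  then show ?thesis using e by (auto simp: lookup_ppart_aux)
qed

lemma lookup_ppart_zero: "(\<And>e. e + q + mones n 1 \<noteq> mones n k) \<Longrightarrow> Poly_Mapping.lookup (ppart n a k) q = 0"
  by (simp add: lookup_ppart_aux)

lemma ppart_add: "ppart n (a + b) k = ppart n a k + ppart n b k"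
  by (rule poly_mapping_eqI) (simp add: lookup_ppart_aux lookup_add)

lemma ppart_zero [simp]: "ppart n 0 k = 0"
  by (rule poly_mapping_eqI) (simp add: lookup_ppart_aux)

lemma ppart_closed: "ppart n a k \<in> carrier (poly_ring n)"
proof -
  have "Poly_Mapping.keys q \<subseteq> {..<n}" if "q \<in> Poly_Mapping.keys (ppart n a k)" for q
  proof -
    have nz: "Poly_Mapping.lookup (ppart n a k) q \<noteq> 0" using that by (simp only: in_keys_iff not_False_eq_True)
    obtain e where "e + q + mones n 1 = mones n k"
      using nz lookup_ppart_zero[of q n k a] by blast
    then show ?thesis using keys_mones[of n k] by (metis keys_plus_nat le_sup_iff)
  qed
  then show ?thesis by (simp add: in_poly_ring)
qed

text \<open>Expanding a fraction by a power of the denominator shifts both exponents alike, so the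
  coefficients of the negative monomials stay the same. This makes the principal part a function of
  the fraction in \<open>ppart_cong\<close>.\<close>

lemma ppart_shift: "ppart n (Poly_Mapping.single (mones n l) 1 * a) (k + l) = ppart n a k"
proof (rule poly_mapping_eqI)
  fix q
  show "Poly_Mapping.lookup (ppart n (Poly_Mapping.single (mones n l) 1 * a) (k + l)) q = Poly_Mapping.lookup (ppart n a k) q"
  proof (cases "\<exists>e. e + q + mones n 1 = mones n k")
    case True
    then obtain e where e: "e + q + mones n 1 = mones n k" by auto
    then have "(mones n l + e) + q + mones n 1 = mones n (k + l)"
      by (simp only: mones_add e[symmetric] ac_simps)
    note e2 = this
    show ?thesis by (simp only: lookup_ppart[OF e2] lookup_single_mult lookup_ppart[OF e] mult_1)
  next
    case False
    show ?thesis
    proof (cases "\<exists>e'. e' + q + mones n 1 = mones n (k + l)")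
      case True
      then obtain e' where e': "e' + q + mones n 1 = mones n (k + l)" by auto
      have "e' \<noteq> mones n l + e" for e
      proof
        assume "e' = mones n l + e"
        then have "mones n l + (e + q + mones n 1) = mones n l + mones n k"
          using e' by (simp only: mones_add ac_simps)
        then show False using False by simp
      qed
      then have "Poly_Mapping.lookup (Poly_Mapping.single (mones n l) 1 * a) e' = 0"
        by (rule lookup_single_mult_zero)
      then show ?thesis using False by (simp add: lookup_ppart[OF e'] lookup_ppart_zero)
    qed (use False in \<open>simp add: lookup_ppart_zero\<close>)
  qed
qed

lemma ppart_mult:
  assumes "r \<in> carrier (poly_ring n)"
  shows "ppart n (r * a) k = contract r (ppart n a k)"
  using assms
proof (induction r rule: poly_ring_induct)
  case (single s c)
  show ?case
  proof (rule poly_mapping_eqI)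
    fix q
    show "Poly_Mapping.lookup (ppart n (Poly_Mapping.single s c * a) k) q =
      Poly_Mapping.lookup (contract (Poly_Mapping.single s c) (ppart n a k)) q"
    proof (cases "\<exists>e. e + (q + s) + mones n 1 = mones n k")
      case True
      then obtain e where e: "e + (q + s) + mones n 1 = mones n k" by auto
      then have "(s + e) + q + mones n 1 = mones n k" by (simp only: ac_simps)
      note e2 = this
      show ?thesis by (simp only: lookup_ppart[OF e2] lookup_single_mult lookup_ppart[OF e] lookup_contract_single)
    next
      case False
      show ?thesis
      proof (cases "\<exists>e'. e' + q + mones n 1 = mones n k")
        case True
        then obtain e' where e': "e' + q + mones n 1 = mones n k" by auto
        have "e' \<noteq> s + e" for e using False e' by (metis add.assoc add.commute)
        then have "Poly_Mapping.lookup (Poly_Mapping.single s c * a) e' = 0"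
          by (rule lookup_single_mult_zero)
        then show ?thesis using False by (simp add: lookup_ppart[OF e'] lookup_ppart_zero)
      qed (use False in \<open>simp add: lookup_ppart_zero\<close>)
    qed
  qed
next
  case (add f g)
  then show ?case by (simp add: distrib_right ppart_add contract_add_left)
qed

abbreviation xpow :: "nat \<Rightarrow> nat \<Rightarrow> 'k::field mpol" where
  "xpow n k \<equiv> Poly_Mapping.single (mones n k) 1"

lemma xpow_nz [simp]: "xpow n k \<noteq> (0 :: 'k::field mpol)"
  by (metis lookup_single_eq lookup_zero zero_neq_one)

lemma xpow_add: "xpow n (k + l) = (xpow n k * xpow n l :: 'k::field mpol)"
  by (simp add: mult_single mones_add)

lemma xpow_closed [simp]: "xpow n k \<in> carrier (poly_ring n)"
  using keys_mones by simp

section \<open>Principal parts of fractions\<close>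

lemma cech_loc_top: "cech_loc n {..<n} = {Fract a (xpow n k) | a k. a \<in> carrier (poly_ring n)}"
  unfolding cech_loc_def prod_mvar_power ..

lemma ppart_cong:
  fixes a b :: "'k::field mpol"
  assumes "Fract a (xpow n k) = Fract b (xpow n l)"
  shows "ppart n a k = ppart n b l"
proof -
  have "xpow n l * a = xpow n k * b"
    using assms by (simp add: eq_fract mult.commute)
  then have "ppart n (xpow n l * a) (k + l) = ppart n (xpow n k * b) (l + k)" by (simp add: add.commute)
  then show ?thesis by (simp only: ppart_shift)
qed

definition prho :: "nat \<Rightarrow> 'k::field mpol fract \<Rightarrow> 'k mpol" where
  "prho n u = (SOME g. \<exists>a k. a \<in> carrier (poly_ring n) \<and> u = Fract a (xpow n k) \<and> g = ppart n a k)"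

lemma prho_Fract: "a \<in> carrier (poly_ring n) \<Longrightarrow> prho n (Fract a (xpow n k)) = ppart n a k"
proof -
  assume a: "a \<in> carrier (poly_ring n)"
  have "\<exists>g a' k'. a' \<in> carrier (poly_ring n) \<and> Fract a (xpow n k) = Fract a' (xpow n k') \<and> g = ppart n a' k'"
    using a by blast
  from someI_ex[OF this] obtain a' k' where "Fract a (xpow n k) = Fract a' (xpow n k')"
    "prho n (Fract a (xpow n k)) = ppart n a' k'"
    unfolding prho_def[symmetric] by (elim exE conjE)
  then show ?thesis using ppart_cong by metis
qed

lemma cech_loc_cases:
  assumes "u \<in> cech_loc n {..<n}"
  obtains a k where "a \<in> carrier (poly_ring n)" "u = Fract a (xpow n k)"
  using assms unfolding cech_loc_top by blast

lemma prho_closed: "u \<in> cech_loc n {..<n} \<Longrightarrow> prho n u \<in> carrier (poly_ring n)"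
  by (erule cech_loc_cases) (simp add: prho_Fract ppart_closed)

lemma prod_mvar_nz: "(\<Prod>i\<in>S. mvar i) ^ k \<noteq> (0 :: 'k::field mpol)"
proof -
  have m: "mvar i \<noteq> (0 :: 'k mpol)" for i
  proof
    assume "mvar i = (0 :: 'k mpol)"
    then have "Poly_Mapping.lookup (mvar i :: 'k mpol) (Poly_Mapping.single i 1) = 0" by simp
    then show False by (simp add: mvar_def)
  qed
  have "(\<Prod>i\<in>S. mvar i) \<noteq> (0 :: 'k mpol)"
    by (induction S rule: infinite_finite_induct) (auto simp: m)
  then show ?thesis by simp
qed

lemma prod_mvar_closed: "S \<subseteq> {..<n} \<Longrightarrow> (\<Prod>i\<in>S. mvar i) ^ k \<in> carrier (poly_ring n)"
proof -
  assume S: "S \<subseteq> {..<n}"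
  then have "finite S" by (rule finite_subset) simp
  then have "(\<Prod>i\<in>S. mvar i :: 'a mpol) \<in> carrier (poly_ring n)" using S
    by (induction S rule: finite_induct) (auto simp: mvar_def)
  then show ?thesis by simp
qed

lemma cech_loc_add:
  assumes S: "S \<subseteq> {..<n}" and u: "u \<in> cech_loc n S" and v: "v \<in> cech_loc n S"
  shows "u + v \<in> cech_loc n S"
proof -
  let ?x = "\<Prod>i\<in>S. mvar i"
  obtain a k where a: "a \<in> carrier (poly_ring n)" "u = Fract a (?x ^ k)" using u by (auto simp: cech_loc_def)
  obtain b l where b: "b \<in> carrier (poly_ring n)" "v = Fract b (?x ^ l)" using v by (auto simp: cech_loc_def)
  have "u + v = Fract (a * ?x ^ l + b * ?x ^ k) (?x ^ (k + l))"
    unfolding a b by (subst add_fract[OF prod_mvar_nz prod_mvar_nz]) (simp add: power_add)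
  moreover have "a * ?x ^ l + b * ?x ^ k \<in> carrier (poly_ring n)"
    by (intro poly_ring_add_closed poly_ring_mult_closed a(1) b(1) prod_mvar_closed[OF S])
  ultimately show ?thesis unfolding cech_loc_def by blast
qed

lemma cech_loc_mult:
  assumes u: "u \<in> cech_loc n S" and r: "r \<in> carrier (poly_ring n)"
  shows "Fract r 1 * u \<in> cech_loc n S"
proof -
  obtain a k where a: "a \<in> carrier (poly_ring n)" "u = Fract a ((\<Prod>i\<in>S. mvar i) ^ k)"
    using u by (auto simp: cech_loc_def)
  have "Fract r 1 * u = Fract (r * a) ((\<Prod>i\<in>S. mvar i) ^ k)" by (simp add: a)
  then show ?thesis using a(1) r unfolding cech_loc_def by (auto intro!: exI[of _ "r * a"])
qed

lemma cech_loc_zero: "0 \<in> cech_loc n S"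
  unfolding cech_loc_def by (auto intro!: exI[of _ 0] simp: rat_number_collapse Zero_fract_def eq_fract prod_mvar_nz[of S 0, simplified])

lemma cech_loc_sum:
  assumes S: "S \<subseteq> {..<n}" and u: "\<And>i. i \<in> I \<Longrightarrow> u i \<in> cech_loc n S"
  shows "sum u I \<in> cech_loc n S"
  using u by (induction I rule: infinite_finite_induct) (auto simp: cech_loc_zero intro!: cech_loc_add[OF S])

lemma cech_loc_uminus: "u \<in> cech_loc n S \<Longrightarrow> - u \<in> cech_loc n S"
  using cech_loc_mult[of u n S "- 1"] by (simp add: One_fract_def[symmetric] flip: minus_fract)

lemma prho_add:
  assumes u: "u \<in> cech_loc n {..<n}" and v: "v \<in> cech_loc n {..<n}"
  shows "prho n (u + v) = prho n u + prho n v"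
proof -
  obtain a k where a: "a \<in> carrier (poly_ring n)" "u = Fract a (xpow n k)" using u by (rule cech_loc_cases)
  obtain b l where b: "b \<in> carrier (poly_ring n)" "v = Fract b (xpow n l)" using v by (rule cech_loc_cases)
  have "u + v = Fract (xpow n l * a + xpow n k * b) (xpow n (k + l))"
    unfolding a b by (subst add_fract) (simp_all add: xpow_add mult.commute)
  then have "prho n (u + v) = ppart n (xpow n l * a + xpow n k * b) (k + l)"
    using a(1) b(1) by (simp only: prho_Fract poly_ring_add_closed poly_ring_mult_closed xpow_closed)
  also have "\<dots> = ppart n (xpow n l * a) (k + l) + ppart n (xpow n k * b) (l + k)"
    by (simp only: ppart_add add.commute[of l k])
  finally show ?thesis using a b by (simp only: ppart_shift prho_Fract)
qed

lemma prho_zero [simp]: "prho n 0 = 0"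
  using prho_Fract[of 0 n 0] by (simp add: Zero_fract_def eq_fract)

lemma prho_mult:
  assumes u: "u \<in> cech_loc n {..<n}" and r: "r \<in> carrier (poly_ring n)"
  shows "prho n (Fract r 1 * u) = contract r (prho n u)"
proof -
  obtain a k where a: "a \<in> carrier (poly_ring n)" "u = Fract a (xpow n k)" using u by (rule cech_loc_cases)
  show ?thesis using a(1) r by (simp add: a(2) prho_Fract ppart_mult)
qed

lemma prho_sum_zero:
  assumes "\<And>i. i \<in> I \<Longrightarrow> u i \<in> cech_loc n {..<n}" "\<And>i. i \<in> I \<Longrightarrow> prho n (u i) = 0"
  shows "prho n (sum u I) = 0"
  using assms by (induction I rule: infinite_finite_induct) (auto simp: prho_add cech_loc_sum)

text \<open>Subtraction of exponents is truncated at zero; the bound on \<open>q\<close> makes it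
  exact.\<close>

lemma exponent_bound:
  assumes q: "Poly_Mapping.keys q \<subseteq> {..<n}" and k: "\<And>i. i < n \<Longrightarrow> Poly_Mapping.lookup q i < k"
  shows "(mones n k - (q + mones n 1)) + q + mones n 1 = mones n k"
proof (rule poly_mapping_eqI)
  fix i
  show "Poly_Mapping.lookup ((mones n k - (q + mones n 1)) + q + mones n 1) i = Poly_Mapping.lookup (mones n k) i"
  proof (cases "i < n")
    case True
    then show ?thesis using k[of i] by (simp add: lookup_add lookup_minus lookup_mones)
  next
    case False
    then have "Poly_Mapping.lookup q i = 0" using q by (auto simp: in_keys_iff)
    then show ?thesis using False by (simp add: lookup_add lookup_minus lookup_mones)
  qed
qed

lemma lookup_le_mdeg: "Poly_Mapping.lookup q i \<le> mdeg q"
proof (cases "i \<in> Poly_Mapping.keys q")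
  case True
  then show ?thesis unfolding mdeg_def by (intro member_le_sum) auto
qed (simp add: in_keys_iff)

lemma cech_loc_comp_top: "cech_loc_comp n {..<n} d =
    {Fract a (xpow n k) | a k. a \<in> rcomp (poly_ring n) (d + int (k * n))}"
  unfolding cech_loc_comp_def prod_mvar_power by simp

lemma cech_loc_comp_sub: "cech_loc_comp n S d \<subseteq> cech_loc n S"
  unfolding cech_loc_comp_def cech_loc_def using rcomp_carrier by blast

lemma cech_loc_comp_add:
  assumes "u \<in> cech_loc_comp n {..<n} d" "v \<in> cech_loc_comp n {..<n} d"
  shows "u + v \<in> cech_loc_comp n {..<n} d"
proof -
  obtain a k where a: "a \<in> rcomp (poly_ring n) (d + int (k * n))" "u = Fract a (xpow n k)"
    using assms(1) by (auto simp: cech_loc_comp_top)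
  obtain b l where b: "b \<in> rcomp (poly_ring n) (d + int (l * n))" "v = Fract b (xpow n l)"
    using assms(2) by (auto simp: cech_loc_comp_top)
  have x: "xpow n j \<in> rcomp (poly_ring n) (int (j * n))" for j
    by (rule single_in_rcomp[OF keys_mones]) (simp add: mdeg_mones)
  have "u + v = Fract (xpow n l * a + xpow n k * b) (xpow n (k + l))"
    unfolding a b by (subst add_fract) (simp_all add: xpow_add mult.commute)
  moreover have "xpow n l * a + xpow n k * b \<in> rcomp (poly_ring n) (d + int ((k + l) * n))"
    using rcomp_closed(4)[OF x[of l] a(1)] rcomp_closed(4)[OF x[of k] b(1)]
    by (intro rcomp_closed(3)) (simp_all add: algebra_simps)
  ultimately show ?thesis unfolding cech_loc_comp_top by blast
qed

lemma prho_degree: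
  assumes "u \<in> cech_loc_comp n {..<n} d"
  shows "prho n u \<in> hcomp (inv_system n) d"
proof -
  obtain a k where a: "a \<in> rcomp (poly_ring n) (d + int (k * n))" "u = Fract a (xpow n k)"
    using assms by (auto simp: cech_loc_comp_top)
  have "- int n - int (mdeg q) = d" if "q \<in> Poly_Mapping.keys (ppart n a k)" for q
  proof -
    have nz: "Poly_Mapping.lookup (ppart n a k) q \<noteq> 0" using that by (simp only: in_keys_iff not_False_eq_True)
    obtain e where e: "e + q + mones n 1 = mones n k"
      using nz lookup_ppart_zero[of q n k a] by blast
    then have "e \<in> Poly_Mapping.keys a" using that by (simp add: in_keys_iff lookup_ppart[OF e])
    then have "int (mdeg e) = d + int (k * n)" using a by (auto simp: in_rcomp)
    moreover have "mdeg e + mdeg q + n = n * k"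
      using arg_cong[OF e, of mdeg] by (simp add: mdeg_add mdeg_mones)
    then have "int (mdeg e) + int (mdeg q) + int n = int (k * n)"
      by (metis mult.commute of_nat_add)
    ultimately show ?thesis by linarith
  qed
  then show ?thesis using a rcomp_carrier[OF a(1)] by (simp add: in_hcomp_inv_system prho_Fract ppart_closed)
qed

lemma prho_surj_comp:
  fixes g :: "'k::field mpol"
  assumes g: "g \<in> hcomp (inv_system n) d"
  shows "\<exists>u\<in>cech_loc_comp n {..<n} d. prho n u = g"
proof -
  have single: "\<exists>u\<in>cech_loc_comp n {..<n} d. prho n u = Poly_Mapping.single q c"
    if q: "Poly_Mapping.keys q \<subseteq> {..<n}" "- int n - int (mdeg q) = d" for q and c :: 'k
  proof -
    \<comment> \<open>Any \<open>k\<close> larger than all exponents of \<open>q\<close> would do,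
      and the total degree bounds them.\<close>
    define k where "k = Suc (mdeg q)"
    define e where "e = mones n k - (q + mones n 1)"
    have e: "e + q + mones n 1 = mones n k"
      unfolding e_def k_def by (rule exponent_bound[OF q(1)]) (simp add: le_imp_less_Suc lookup_le_mdeg)
    have ek: "Poly_Mapping.keys e \<subseteq> {..<n}" using keys_mones[of n k] e by (metis keys_plus_nat le_sup_iff)
    have "mdeg e + mdeg q + n = n * k"
      using arg_cong[OF e, of mdeg] by (simp add: mdeg_add mdeg_mones)
    then have "int (mdeg e) + int (mdeg q) + int n = int (k * n)"
      by (metis mult.commute of_nat_add)
    then have s: "Poly_Mapping.single e c \<in> rcomp (poly_ring n) (d + int (k * n))"
      using ek q(2) by (intro single_in_rcomp) auto
    have "ppart n (Poly_Mapping.single e c) k = Poly_Mapping.single q c"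
    proof (rule poly_mapping_eqI)
      fix q'
      show "Poly_Mapping.lookup (ppart n (Poly_Mapping.single e c) k) q' = Poly_Mapping.lookup (Poly_Mapping.single q c) q'"
      proof (cases "\<exists>e'. e' + q' + mones n 1 = mones n k")
        case True
        then obtain e' where e': "e' + q' + mones n 1 = mones n k" by auto
        have "e' + q' = e + q" using e e' by (metis add_right_cancel)
        then have "e = e' \<longleftrightarrow> q = q'" by (metis add_left_cancel add_right_cancel)
        then show ?thesis by (simp only: lookup_ppart[OF e'] lookup_single when_def)
      next
        case False
        then have "q \<noteq> q'" using e by blast
        then show ?thesis using False by (simp add: lookup_ppart_zero lookup_single when_def)
      qed
    qed
    then have "prho n (Fract (Poly_Mapping.single e c) (xpow n k)) = Poly_Mapping.single q c"
      using rcomp_carrier[OF s] by (simp add: prho_Fract)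
    then show ?thesis using s unfolding cech_loc_comp_top by blast
  qed
  have "\<exists>u\<in>cech_loc_comp n {..<n} d. prho n u = (\<Sum>q\<in>K. Poly_Mapping.single q (Poly_Mapping.lookup g q))"
    if "finite K" "K \<subseteq> Poly_Mapping.keys g" for K
    using that
  proof (induction K rule: finite_induct)
    case empty
    have "0 \<in> cech_loc_comp n {..<n} d"
      unfolding cech_loc_comp_top by (auto intro!: exI[of _ 0] simp: Zero_fract_def eq_fract rcomp_closed)
    then show ?case by (intro bexI[of _ 0]) auto
  next
    case (insert q K)
    then obtain u where u: "u \<in> cech_loc_comp n {..<n} d"
      "prho n u = (\<Sum>q\<in>K. Poly_Mapping.single q (Poly_Mapping.lookup g q))" by auto
    have q: "Poly_Mapping.keys q \<subseteq> {..<n}" "- int n - int (mdeg q) = d"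
      using insert.prems g unfolding in_hcomp_inv_system in_poly_ring by blast+
    obtain v where v: "v \<in> cech_loc_comp n {..<n} d" "prho n v = Poly_Mapping.single q (Poly_Mapping.lookup g q)"
      using single[OF q] by blast
    have "prho n (v + u) = prho n v + prho n u"
      using u v cech_loc_comp_sub by (intro prho_add) blast+
    then show ?case using insert.hyps u v cech_loc_comp_add[OF v(1) u(1)]
      by (intro bexI[of _ "v + u"]) simp_all
  qed
  from this[of "Poly_Mapping.keys g"] show ?thesis using poly_mapping_sum_single[of g] by simp
qed

lemma prho_surj:
  fixes g :: "'k::field mpol"
  assumes g: "g \<in> carrier (poly_ring n)"
  shows "\<exists>u\<in>cech_loc n {..<n}. prho n u = g"
  using g
proof (induction g rule: poly_ring_induct)
  case (single m c)
  have "Poly_Mapping.single m c \<in> hcomp (inv_system n) (- int n - int (mdeg m))"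
    using single by (simp add: in_hcomp_inv_system)
  from prho_surj_comp[OF this] show ?case using cech_loc_comp_sub by blast
next
  case (add f g)
  then obtain u v where "u \<in> cech_loc n {..<n}" "prho n u = f" "v \<in> cech_loc n {..<n}" "prho n v = g" by auto
  then show ?case by (intro bexI[of _ "u + v"]) (auto simp: prho_add cech_loc_add)
qed

section \<open>Top cocycles and coboundaries\<close>

lemma top_subset: "S \<subseteq> {..<n} \<and> card S = n \<longleftrightarrow> S = {..<n::nat}"
  by (metis card_lessThan card_subset_eq finite_lessThan order_refl)

text \<open>A subset of \<open>{..<n}\<close> with one point removed is never all of
  \<open>{..<n}\<close>, so every top cochain is a cocycle.\<close>

lemma cech_diff_top_zero:
  assumes "\<And>S. S \<noteq> {..<n} \<Longrightarrow> c S = 0"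
  shows "cech_diff n c = (\<lambda>_. 0)"
proof
  fix T
  have "c (T - {j}) = 0" if "T \<subseteq> {..<n}" "j \<in> T" for j
    using assms[of "T - {j}"] that by auto
  then show "cech_diff n c T = 0" by (simp add: cech_diff_def)
qed

lemma in_cocycles_top: "c \<in> carrier (cech_cocycles n n) \<longleftrightarrow>
    c {..<n} \<in> cech_loc n {..<n} \<and> (\<forall>S. S \<noteq> {..<n} \<longrightarrow> c S = 0)"
proof -
  have "c \<in> cech_cochains n n \<longleftrightarrow> c {..<n} \<in> cech_loc n {..<n} \<and> (\<forall>S. S \<noteq> {..<n} \<longrightarrow> c S = 0)"
    unfolding cech_cochains_def top_subset by auto
  then show ?thesis using cech_diff_top_zero[of n c] by (auto simp: cech_cocycles_def Let_def)
qed

lemma cocycles_simps [simp]: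
  "\<zero>\<^bsub>cech_cocycles n i\<^esub> = (\<lambda>_. 0)" "c \<oplus>\<^bsub>cech_cocycles n i\<^esub> c' = (\<lambda>S. c S + c' S)"
  "a \<odot>\<^bsub>cech_cocycles n i\<^esub> c = (\<lambda>S. Fract a 1 * c S)"
  by (simp_all add: cech_cocycles_def Let_def)

lemma hcomp_cocycles_top: "c \<in> hcomp (cech_cocycles n n) d \<longleftrightarrow>
    c \<in> carrier (cech_cocycles n n) \<and> c {..<n} \<in> cech_loc_comp n {..<n} d"
  by (auto simp: cech_cocycles_def Let_def) (metis top_subset)

lemma abelian_group_cocycles_top:
  "abelian_group (cech_cocycles n n :: ('k::field mpol, nat set \<Rightarrow> 'k mpol fract) graded_module)"
proof (rule abelian_groupI)
  fix x :: "nat set \<Rightarrow> 'k mpol fract" assume x: "x \<in> carrier (cech_cocycles n n)"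
  then have "(\<lambda>S. - x S) \<in> carrier (cech_cocycles n n)"
    by (simp add: in_cocycles_top cech_loc_uminus)
  then show "\<exists>y\<in>carrier (cech_cocycles n n). y \<oplus>\<^bsub>cech_cocycles n n\<^esub> x = \<zero>\<^bsub>cech_cocycles n n\<^esub>"
    by (intro bexI[of _ "\<lambda>S. - x S"]) auto
qed (auto simp: in_cocycles_top cech_loc_add cech_loc_zero add_ac)

lemma prho_sign:
  assumes "u \<in> cech_loc n {..<n}" "prho n u = 0"
  shows "(- 1) ^ s * u \<in> cech_loc n {..<n}" "prho n ((- 1) ^ s * u) = 0"
proof -
  have "prho n (- u) = 0"
    using prho_mult[OF assms(1), of "- 1"] assms(2)
    by (simp add: One_fract_def[symmetric] flip: minus_fract)
  then show "(- 1) ^ s * u \<in> cech_loc n {..<n}" "prho n ((- 1) ^ s * u) = 0"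
    using assms cech_loc_uminus[OF assms(1)] by (cases "even s"; simp)+
qed

lemma prod_mvar_remove:
  "i < n \<Longrightarrow> (\<Prod>i\<in>{..<n}. mvar i :: 'k::field mpol) ^ k =
    Poly_Mapping.single (Poly_Mapping.single i k) 1 * (\<Prod>i\<in>{..<n} - {i}. mvar i) ^ k"
proof -
  assume i: "i < n"
  have "(\<Prod>i\<in>{..<n}. mvar i :: 'k mpol) = mvar i * (\<Prod>i\<in>{..<n} - {i}. mvar i)"
    using i by (intro prod.remove) auto
  moreover have "(mvar i :: 'k mpol) ^ k = Poly_Mapping.single (Poly_Mapping.single i k) 1"
  proof -
    have "mscale k (Poly_Mapping.single i 1) = Poly_Mapping.single i k"
      by (rule poly_mapping_eqI) (simp add: lookup_single when_def)
    then show ?thesis by (simp add: mvar_def single_power)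
  qed
  ultimately show ?thesis by (simp add: power_mult_distrib)
qed

lemma single_one_nz: "Poly_Mapping.single m 1 \<noteq> (0 :: 'a \<Rightarrow>\<^sub>0 'k::field)"
  by (metis lookup_single_eq lookup_zero zero_neq_one)

lemma face_Fract:
  fixes a :: "'k::field mpol"
  assumes "i < n"
  shows "Fract a ((\<Prod>i\<in>{..<n} - {i}. mvar i) ^ k) =
    Fract (Poly_Mapping.single (Poly_Mapping.single i k) 1 * a) (xpow n k)"
  unfolding prod_mvar_power[symmetric]
  by (subst eq_fract) (simp_all add: prod_mvar_nz prod_mvar_remove[OF assms] single_one_nz del: power_eq_0_iff)

text \<open>Over the full denominator the numerator becomes divisible by \<open>x_i^k\<close>, so
  the \<open>i\<close>-th exponent of every term is nonnegative and nothing remains in the principal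
  part.\<close>

lemma face_prho:
  fixes u :: "'k::field mpol fract"
  assumes i: "i < n" and u: "u \<in> cech_loc n ({..<n} - {i})"
  shows "u \<in> cech_loc n {..<n}" "prho n u = 0"
proof -
  obtain a k where a: "a \<in> carrier (poly_ring n)" "u = Fract a ((\<Prod>i\<in>{..<n} - {i}. mvar i) ^ k)"
    using u by (auto simp: cech_loc_def)
  let ?b = "Poly_Mapping.single (Poly_Mapping.single i k) 1 * a"
  have b: "?b \<in> carrier (poly_ring n)" using a(1) i by (intro poly_ring_mult_closed) auto
  have u': "u = Fract ?b (xpow n k)" unfolding a(2) by (rule face_Fract[OF i])
  then show "u \<in> cech_loc n {..<n}" unfolding cech_loc_top using b by blast
  have "ppart n ?b k = 0"
  proof (rule poly_mapping_eqI)
    fix q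
    show "Poly_Mapping.lookup (ppart n ?b k) q = Poly_Mapping.lookup 0 q"
    proof (cases "\<exists>e. e + q + mones n 1 = mones n k")
      case True
      then obtain e where e: "e + q + mones n 1 = mones n k" by auto
      have "e \<noteq> Poly_Mapping.single i k + m" for m
      proof
        assume "e = Poly_Mapping.single i k + m"
        then have "Poly_Mapping.lookup (Poly_Mapping.single i k + m + q + mones n 1) i = Poly_Mapping.lookup (mones n k) i"
          using e by simp
        then show False using i by (simp add: lookup_add lookup_mones)
      qed
      then have "Poly_Mapping.lookup ?b e = 0" by (rule lookup_single_mult_zero)
      then show ?thesis by (simp add: lookup_ppart[OF e])
    qed (simp add: lookup_ppart_zero)
  qed
  then show "prho n u = 0" unfolding u' by (simp only: prho_Fract[OF b])
qed

definition emb_top :: "nat \<Rightarrow> 'k::field mpol fract \<Rightarrow> nat set \<Rightarrow> 'k mpol fract" where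
  "emb_top n u S = (if S = {..<n} then u else 0)"

lemma emb_top: "c \<in> carrier (cech_cocycles n n) \<Longrightarrow> c = emb_top n (c {..<n})"
  by (auto simp: in_cocycles_top emb_top_def fun_eq_iff)

lemma emb_top_in: "u \<in> cech_loc n {..<n} \<Longrightarrow> emb_top n u \<in> carrier (cech_cocycles n n)"
  by (simp add: in_cocycles_top emb_top_def)

lemma coboundaries_add:
  assumes "emb_top n u \<in> cech_coboundaries n n" "emb_top n v \<in> cech_coboundaries n n"
  shows "emb_top n (u + v) \<in> cech_coboundaries n n"
proof -
  have e: "emb_top n (u + v) = (\<lambda>S. emb_top n u S + emb_top n v S)" by (auto simp: emb_top_def)
  have main: "(\<lambda>S. x S + y S) \<in> cech_coboundaries n n"
    if x: "x \<in> cech_coboundaries n n" and y: "y \<in> cech_coboundaries n n" for x y :: "nat set \<Rightarrow> 'a mpol fract"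
  proof (cases "x = (\<lambda>_. 0) \<or> y = (\<lambda>_. 0)")
    case True
    then show ?thesis using x y by auto
  next
    case False
    then obtain c j c' j' where c: "x = cech_diff n c" "c \<in> cech_cochains n j" "Suc j = n"
      "y = cech_diff n c'" "c' \<in> cech_cochains n j'" "Suc j' = n"
      using x y by (auto simp: cech_coboundaries_def)
    have "(\<lambda>S. c S + c' S) \<in> cech_cochains n j"
      unfolding cech_cochains_def
    proof (intro CollectI allI)
      fix S
      have j: "j' = j" using c(3,6) by simp
      have "c S \<in> (if S \<subseteq> {..<n} \<and> card S = j then cech_loc n S else {0})"
        using c(2) unfolding cech_cochains_def by blast
      moreover have "c' S \<in> (if S \<subseteq> {..<n} \<and> card S = j then cech_loc n S else {0})"
        using c(5) unfolding cech_cochains_def j by blast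
      ultimately show "c S + c' S \<in> (if S \<subseteq> {..<n} \<and> card S = j then cech_loc n S else {0})"
        by (cases "S \<subseteq> {..<n} \<and> card S = j") (simp_all add: cech_loc_add cech_loc_zero)
    qed
    moreover have "(\<lambda>S. x S + y S) = cech_diff n (\<lambda>S. c S + c' S)"
      by (auto simp: c cech_diff_def fun_eq_iff distrib_left sum.distrib)
    ultimately show ?thesis using c(3) unfolding cech_coboundaries_def by blast
  qed
  show ?thesis unfolding e by (rule main[OF assms])
qed

text \<open>If \<open>e_i \<ge> k\<close>, the variable \<open>x_i\<close> cancels from the
  denominator and the fraction already lives on the face without \<open>i\<close>.\<close>

lemma single_coboundary:
  fixes c :: "'k::field"
  assumes i: "i < n" and e: "Poly_Mapping.keys e \<subseteq> {..<n}" "k \<le> Poly_Mapping.lookup e i"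
  shows "emb_top n (Fract (Poly_Mapping.single e c) (xpow n k)) \<in> cech_coboundaries n n"
proof -
  let ?N = "{..<n}" and ?s = "card {l \<in> {..<n}. l < i}"
  define v where "v = Fract (Poly_Mapping.single (e - Poly_Mapping.single i k) c) ((\<Prod>i\<in>?N - {i}. mvar i) ^ k)"
  have ei: "Poly_Mapping.single i k + (e - Poly_Mapping.single i k) = e"
    using e(2) by (intro poly_mapping_eqI) (auto simp: lookup_add lookup_minus lookup_single when_def)
  have v: "v = Fract (Poly_Mapping.single e c) (xpow n k)"
    unfolding v_def face_Fract[OF i] by (simp add: mult_single ei)
  have "Poly_Mapping.keys (e - Poly_Mapping.single i k) \<subseteq> {..<n}"
    using e(1) ei by (metis keys_plus_nat le_sup_iff)
  then have vl: "v \<in> cech_loc n (?N - {i})"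
    unfolding v_def cech_loc_def by auto
  have sv: "(- 1) ^ ?s * v \<in> cech_loc n (?N - {i})"
    using vl cech_loc_uminus[OF vl] by (cases "even ?s") auto
  \<comment> \<open>The sign is the one with which this face enters the differential, so the two
    cancel.\<close>
  define w where "w S = (if S = ?N - {i} then (- 1) ^ ?s * v else 0)" for S
  have cN: "card (?N - {i}) = n - 1" using i by simp
  have "w \<in> cech_cochains n (n - 1)"
    using sv cN by (auto simp: cech_cochains_def w_def cech_loc_zero)
  moreover have "cech_diff n w = emb_top n v"
  proof
    fix T
    show "cech_diff n w T = emb_top n v T"
    proof (cases "T = ?N")
      case True
      have "(\<Sum>j\<in>?N. (- 1) ^ card {l \<in> ?N. l < j} * w (?N - {j})) =
          (\<Sum>j\<in>{i}. (- 1) ^ card {l \<in> ?N. l < j} * w (?N - {j}))"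
        by (rule sum.mono_neutral_right) (use i in \<open>auto simp: w_def\<close>)
      also have "\<dots> = ((- 1) ^ ?s * (- 1) ^ ?s) * v" by (simp add: w_def)
      also have "((- 1) ^ ?s * (- 1) ^ ?s :: 'k mpol fract) = 1" by (simp add: power_add[symmetric])
      finally show ?thesis using True by (simp add: cech_diff_def emb_top_def)
    next
      case False
      have "w (T - {j}) = 0" if "T \<subseteq> ?N" "j \<in> T" for j
      proof -
        have "T - {j} \<noteq> ?N - {i}"
        proof
          assume a: "T - {j} = ?N - {i}"
          have "finite T" using that finite_subset by blast
          then have "card T = Suc (card (T - {j}))" using that card_Suc_Diff1[of T j] by simp
          then have "card T = n" using a cN i by simp
          then show False using top_subset[of T n] that False by blast
        qed
        then show ?thesis by (simp add: w_def)
      qed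
      then show ?thesis using False by (simp add: cech_diff_def emb_top_def)
    qed
  qed
  moreover have "Suc (n - 1) = n" using i by simp
  ultimately have "emb_top n v \<in> cech_coboundaries n n"
    unfolding cech_coboundaries_def by (metis (mono_tags, lifting) UnI2 mem_Collect_eq)
  then show ?thesis by (simp only: v)
qed

text \<open>This identifies top cohomology with inverse polynomials. Faces have no principal part;
  conversely, with zero principal part every term of the numerator has an exponent of at least
  \<open>k\<close>, so each term is a coboundary by itself.\<close>

lemma coboundaries_top:
  "cech_coboundaries n n = {c \<in> carrier (cech_cocycles n n). prho n (c {..<n} :: 'k::field mpol fract) = 0}"
proof (intro equalityI subsetI)
  fix c :: "nat set \<Rightarrow> 'k mpol fract" assume "c \<in> cech_coboundaries n n"
  then consider "c = (\<lambda>_. 0)" | c' j where "c = cech_diff n c'" "c' \<in> cech_cochains n j" "Suc j = n"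
    by (auto simp: cech_coboundaries_def)
  then show "c \<in> {c \<in> carrier (cech_cocycles n n). prho n (c {..<n}) = 0}"
  proof cases
    case 1
    then show ?thesis by (simp add: in_cocycles_top cech_loc_zero)
  next
    case 2
    have c': "c' S \<in> (if S \<subseteq> {..<n} \<and> card S = j then cech_loc n S else {0})" for S
      using 2 by (auto simp: cech_cochains_def)
    have face: "c' ({..<n} - {i}) \<in> cech_loc n {..<n}" "prho n (c' ({..<n} - {i})) = 0" if "i < n" for i
    proof -
      have "card ({..<n} - {i}) = j" using that 2(3) by simp
      then have "c' ({..<n} - {i}) \<in> cech_loc n ({..<n} - {i})" using c'[of "{..<n} - {i}"] by auto
      from face_prho[OF that this] show "c' ({..<n} - {i}) \<in> cech_loc n {..<n}" "prho n (c' ({..<n} - {i})) = 0"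
        by auto
    qed
    have cN: "c {..<n} = (\<Sum>j\<in>{..<n}. (- 1) ^ card {l \<in> {..<n}. l < j} * c' ({..<n} - {j}))"
      by (simp add: 2(1) cech_diff_def)
    have "c {..<n} \<in> cech_loc n {..<n}"
      unfolding cN by (rule cech_loc_sum) (auto intro!: prho_sign(1) face)
    moreover have "prho n (c {..<n}) = 0"
      unfolding cN by (rule prho_sum_zero) (auto intro!: prho_sign face)
    moreover have "c T = 0" if "T \<noteq> {..<n}" for T
    proof (cases "T \<subseteq> {..<n}")
      case True
      have "c' (T - {i}) = 0" if i: "i \<in> T" for i
      proof -
        have "finite T" using True finite_subset by blast
        then have "card T = Suc (card (T - {i}))" using i card_Suc_Diff1[of T i] by simp
        then have "card (T - {i}) \<noteq> j" using top_subset[of T n] True \<open>T \<noteq> {..<n}\<close> 2(3) by auto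
        then show ?thesis using c'[of "T - {i}"] by auto
      qed
      then show ?thesis by (simp add: 2(1) cech_diff_def)
    qed (simp add: 2(1) cech_diff_def)
    ultimately show ?thesis by (simp add: in_cocycles_top)
  qed
next
  fix c :: "nat set \<Rightarrow> 'k mpol fract"
  assume c: "c \<in> {c \<in> carrier (cech_cocycles n n). prho n (c {..<n}) = 0}"
  then have "c {..<n} \<in> cech_loc n {..<n}" by (simp add: in_cocycles_top)
  then obtain a k where a: "a \<in> carrier (poly_ring n)" "c {..<n} = Fract a (xpow n k)" by (rule cech_loc_cases)
  have zero: "ppart n a k = 0" using c a by (simp add: prho_Fract)
  \<comment> \<open>If all exponents of \<open>e\<close> were below \<open>k\<close>, the term would
    show up in the principal part at \<open>k - 1 - e\<close>.\<close>
  have big: "\<exists>i<n. k \<le> Poly_Mapping.lookup e i" if e: "e \<in> Poly_Mapping.keys a" for e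
  proof (rule ccontr)
    assume "\<not> (\<exists>i<n. k \<le> Poly_Mapping.lookup e i)"
    then have "(mones n k - (e + mones n 1)) + e + mones n 1 = mones n k"
      using a(1) e by (intro exponent_bound) (auto simp: in_poly_ring not_le)
    then have "e + (mones n k - (e + mones n 1)) + mones n 1 = mones n k" by (simp only: ac_simps)
    from lookup_ppart[OF this, of a] show False using zero e by (simp add: in_keys_iff)
  qed
  have "emb_top n (Fract (\<Sum>e\<in>K. Poly_Mapping.single e (Poly_Mapping.lookup a e)) (xpow n k)) \<in> cech_coboundaries n n"
    if "finite K" "K \<subseteq> Poly_Mapping.keys a" for K
    using that
  proof (induction K rule: finite_induct)
    case empty
    have "emb_top n (Fract (0 :: 'k mpol) (xpow n k)) = (\<lambda>_. 0)"
      by (auto simp: emb_top_def Zero_fract_def eq_fract)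
    then show ?case by (simp add: cech_coboundaries_def)
  next
    case (insert e K)
    have "e \<in> Poly_Mapping.keys a" using insert.prems by simp
    then obtain i where i: "i < n" "k \<le> Poly_Mapping.lookup e i" and ek: "Poly_Mapping.keys e \<subseteq> {..<n}"
      using big[of e] a(1) unfolding in_poly_ring by blast
    have "Fract (\<Sum>e\<in>insert e K. Poly_Mapping.single e (Poly_Mapping.lookup a e)) (xpow n k) =
        Fract (Poly_Mapping.single e (Poly_Mapping.lookup a e)) (xpow n k) +
        Fract (\<Sum>e\<in>K. Poly_Mapping.single e (Poly_Mapping.lookup a e)) (xpow n k)"
      using insert.hyps by (simp add: eq_fract algebra_simps)
    moreover have "emb_top n (Fract (\<Sum>e\<in>K. Poly_Mapping.single e (Poly_Mapping.lookup a e)) (xpow n k))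
        \<in> cech_coboundaries n n"
      using insert.IH insert.prems by simp
    ultimately show ?case
      by (simp only: coboundaries_add[OF single_coboundary[OF i(1) ek i(2)]])
  qed
  from this[of "Poly_Mapping.keys a"] have "emb_top n (c {..<n}) \<in> cech_coboundaries n n"
    using poly_mapping_sum_single[of a] a(2) by simp
  then show "c \<in> cech_coboundaries n n" using emb_top[of c n] c by auto
qed

lemma abelian_subgroup_coboundaries_top:
  "abelian_subgroup (cech_coboundaries n n) (cech_cocycles n n :: ('k::field mpol, nat set \<Rightarrow> 'k mpol fract) graded_module)"
proof -
  let ?Z = "cech_cocycles n n :: ('k mpol, nat set \<Rightarrow> 'k mpol fract) graded_module"
  interpret Z: abelian_group ?Z by (rule abelian_group_cocycles_top)
  show ?thesis
  proof (rule abelian_subgroupI3[OF additive_subgroupI abelian_group_cocycles_top])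
    show "subgroup (cech_coboundaries n n) (add_monoid ?Z)"
    proof (rule subgroup.intro)
      fix c c' :: "nat set \<Rightarrow> 'k mpol fract" assume "c \<in> cech_coboundaries n n" "c' \<in> (cech_coboundaries n n :: (nat set \<Rightarrow> 'k mpol fract) set)"
      then show "c \<otimes>\<^bsub>add_monoid ?Z\<^esub> c' \<in> cech_coboundaries n n"
        by (auto simp: coboundaries_top in_cocycles_top cech_loc_add prho_add)
    next
      fix c assume "c \<in> (cech_coboundaries n n :: (nat set \<Rightarrow> 'k mpol fract) set)"
      then have c: "c \<in> carrier ?Z" "prho n (c {..<n}) = 0" by (auto simp: coboundaries_top)
      then have cl: "c {..<n} \<in> cech_loc n {..<n}" by (simp add: in_cocycles_top)
      have "(\<lambda>S. - c S) \<in> carrier ?Z" using c by (simp add: in_cocycles_top cech_loc_uminus)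
      then have "\<ominus>\<^bsub>?Z\<^esub> c = (\<lambda>S. - c S)" using c by (intro Z.minus_equality) auto
      moreover have "(\<lambda>S. - c S) \<in> cech_coboundaries n n"
        using prho_sign[OF cl c(2), of 1] c by (auto simp: coboundaries_top in_cocycles_top)
      ultimately show "inv\<^bsub>add_monoid ?Z\<^esub> c \<in> cech_coboundaries n n" by (simp add: a_inv_def)
    qed (auto simp: coboundaries_top in_cocycles_top cech_loc_zero)
  qed
qed

text \<open>The isomorphism with the inverse system evaluates the principal part at an arbitrary
  representative; coboundaries have none, so the choice is harmless.\<close>

definition chi :: "nat \<Rightarrow> (nat set \<Rightarrow> 'k::field mpol fract) set \<Rightarrow> 'k mpol" where
  "chi n X = prho n ((SOME c. c \<in> X) {..<n})"

abbreviation top_class :: "nat \<Rightarrow> (nat set \<Rightarrow> 'k::field mpol fract) \<Rightarrow> (nat set \<Rightarrow> 'k mpol fract) set" where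
  "top_class n c \<equiv> cech_coboundaries n n +>\<^bsub>cech_cocycles n n\<^esub> c"

lemma chi_class:
  assumes c: "c \<in> carrier (cech_cocycles n n)"
  shows "chi n (top_class n c) = prho n (c {..<n})"
proof -
  have "c \<in> top_class n c" using abelian_subgroup.a_rcos_self[OF abelian_subgroup_coboundaries_top c] .
  then have "(SOME d. d \<in> top_class n c) \<in> top_class n c" by (rule someI[of "\<lambda>d. d \<in> top_class n c"])
  then obtain k where "k \<in> cech_coboundaries n n" "(SOME d. d \<in> top_class n c) = (\<lambda>S. k S + c S)"
    by (auto simp: a_r_coset_def')
  then show ?thesis using c by (simp add: chi_def coboundaries_top in_cocycles_top prho_add)
qed

lemma class_eq_iff:
  assumes c: "c \<in> carrier (cech_cocycles n n)" and d: "d \<in> carrier (cech_cocycles n n)"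
  shows "top_class n c = top_class n d \<longleftrightarrow> prho n (c {..<n}) = prho n (d {..<n})"
proof
  assume "prho n (c {..<n}) = prho n (d {..<n})"
  moreover have nd: "(\<lambda>S. - d S) \<in> carrier (cech_cocycles n n)" using d by (simp add: in_cocycles_top cech_loc_uminus)
  interpret Z: abelian_group "cech_cocycles n n :: ('a mpol, nat set \<Rightarrow> 'a mpol fract) graded_module"
    by (rule abelian_group_cocycles_top)
  have m: "\<ominus>\<^bsub>cech_cocycles n n\<^esub> d = (\<lambda>S. - d S)" using d nd by (intro Z.minus_equality) auto
  have "prho n (d {..<n}) + prho n (- d {..<n}) = 0"
    using prho_add[of "d {..<n}" n "- d {..<n}"] d nd by (simp add: in_cocycles_top)
  moreover have "prho n (c {..<n} + - d {..<n}) = prho n (c {..<n}) + prho n (- d {..<n})"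
    using c nd by (intro prho_add) (auto simp: in_cocycles_top)
  ultimately have "(\<lambda>S. c S + - d S) \<in> cech_coboundaries n n"
    using c nd cech_loc_add[of "{..<n}" n "c {..<n}" "- d {..<n}"] by (auto simp: coboundaries_top in_cocycles_top)
  then show "top_class n c = top_class n d"
    using coset_eq_iff[OF abelian_subgroup_coboundaries_top c d] m by simp
qed (use chi_class[OF c] chi_class[OF d] in auto)

section \<open>Top local cohomology is isomorphic to the inverse system\<close>

lemma carrier_lc: "carrier (local_cohomology n n) = top_class n ` carrier (cech_cocycles n n)"
  by (simp add: local_cohomology_def carrier_quot_gmodule)

lemma lc_add:
  assumes "c \<in> carrier (cech_cocycles n n)" "d \<in> carrier (cech_cocycles n n)"
  shows "top_class n c \<oplus>\<^bsub>local_cohomology n n\<^esub> top_class n d = top_class n (\<lambda>S. c S + d S)"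
  using quot_gmodule_add[OF abelian_subgroup_coboundaries_top assms] by (simp add: local_cohomology_def)

lemma lc_smult:
  fixes c :: "nat set \<Rightarrow> 'k::field mpol fract"
  assumes a: "a \<in> carrier (poly_ring n)" and c: "c \<in> carrier (cech_cocycles n n)"
  shows "a \<odot>\<^bsub>local_cohomology n n\<^esub> top_class n c = top_class n (\<lambda>S. Fract a 1 * c S)"
proof -
  let ?h = "\<lambda>c S. Fract a 1 * c S :: 'k mpol fract"
  have "cech_coboundaries n n <+>\<^bsub>cech_cocycles n n\<^esub> ?h ` top_class n c = top_class n (?h c)"
  proof (rule coset_image[OF abelian_subgroup_coboundaries_top abelian_subgroup_coboundaries_top _ _ _ c])
    show "?h ` cech_coboundaries n n \<subseteq> cech_coboundaries n n"
      using a by (auto simp: coboundaries_top in_cocycles_top cech_loc_mult prho_mult)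
  qed (use a in \<open>auto simp: in_cocycles_top cech_loc_mult distrib_left\<close>)
  then show ?thesis by (simp add: local_cohomology_def quot_gmodule_def)
qed

lemma lc_zero: "\<zero>\<^bsub>local_cohomology n n\<^esub> = top_class n (\<lambda>_. 0 :: 'k::field mpol fract)"
proof -
  interpret abelian_subgroup "cech_coboundaries n n" "cech_cocycles n n :: ('k mpol, nat set \<Rightarrow> 'k mpol fract) graded_module"
    by (rule abelian_subgroup_coboundaries_top)
  show ?thesis using a_coset_add_zero[OF a_subset] by (simp add: local_cohomology_def quot_gmodule_def)
qed

lemma hcomp_lc: "hcomp (local_cohomology n n) d = top_class n ` hcomp (cech_cocycles n n) d"
  by (simp add: local_cohomology_def quot_gmodule_def)

lemma chi_bij: "bij_betw (chi n :: (nat set \<Rightarrow> 'k::field mpol fract) set \<Rightarrow> _) (carrier (local_cohomology n n)) (carrier (inv_system n))"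
  unfolding bij_betw_def
proof
  show "inj_on (chi n :: (nat set \<Rightarrow> 'k mpol fract) set \<Rightarrow> _) (carrier (local_cohomology n n))"
  proof (rule inj_onI)
    fix X Y :: "(nat set \<Rightarrow> 'k mpol fract) set"
    assume "X \<in> carrier (local_cohomology n n)" "Y \<in> carrier (local_cohomology n n)" and eq: "chi n X = chi n Y"
    then obtain c d where c: "c \<in> carrier (cech_cocycles n n)" "X = top_class n c"
      and d: "d \<in> carrier (cech_cocycles n n)" "Y = top_class n d" by (auto simp: carrier_lc)
    have "prho n (c {..<n}) = prho n (d {..<n})" using eq by (simp add: c(2) d(2) chi_class[OF c(1)] chi_class[OF d(1)])
    then show "X = Y" using class_eq_iff[OF c(1) d(1)] by (simp only: c(2) d(2))
  qed
  show "(chi n :: (nat set \<Rightarrow> 'k mpol fract) set \<Rightarrow> _) ` carrier (local_cohomology n n) = carrier (inv_system n)"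
  proof (intro equalityI subsetI)
    fix g :: "'k mpol" assume "g \<in> carrier (inv_system n)"
    then obtain u where u: "u \<in> cech_loc n {..<n}" "prho n u = g" using prho_surj[of g n] by auto
    then have "chi n (top_class n (emb_top n u)) = g" using chi_class[OF emb_top_in[OF u(1)]] by (simp add: emb_top_def)
    then show "g \<in> chi n ` carrier (local_cohomology n n)" using emb_top_in[OF u(1)] by (auto simp: carrier_lc)
  qed (auto simp: carrier_lc chi_class in_cocycles_top prho_closed)
qed

lemma chi_hom:
  assumes "X \<in> carrier (local_cohomology n n)"
  shows "Y \<in> carrier (local_cohomology n n) \<Longrightarrow> X \<oplus>\<^bsub>local_cohomology n n\<^esub> Y \<in> carrier (local_cohomology n n) \<and>
      chi n (X \<oplus>\<^bsub>local_cohomology n n\<^esub> Y) = chi n X + chi n Y"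
    and "a \<in> carrier (poly_ring n) \<Longrightarrow> a \<odot>\<^bsub>local_cohomology n n\<^esub> X \<in> carrier (local_cohomology n n) \<and>
      chi n (a \<odot>\<^bsub>local_cohomology n n\<^esub> X) = contract a (chi n X)"
proof -
  obtain c where c: "c \<in> carrier (cech_cocycles n n)" "X = top_class n c" using assms by (auto simp: carrier_lc)
  {
    assume "Y \<in> carrier (local_cohomology n n)"
    then obtain d where d: "d \<in> carrier (cech_cocycles n n)" "Y = top_class n d" by (auto simp: carrier_lc)
    have "(\<lambda>S. c S + d S) \<in> carrier (cech_cocycles n n)"
      using c(1) d(1) by (auto simp: in_cocycles_top cech_loc_add)
    then show "X \<oplus>\<^bsub>local_cohomology n n\<^esub> Y \<in> carrier (local_cohomology n n) \<and>
      chi n (X \<oplus>\<^bsub>local_cohomology n n\<^esub> Y) = chi n X + chi n Y"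
      using c d by (auto simp: lc_add carrier_lc chi_class) (auto simp: in_cocycles_top prho_add)
  }
  assume a: "a \<in> carrier (poly_ring n)"
  have "(\<lambda>S. Fract a 1 * c S) \<in> carrier (cech_cocycles n n)"
    using c(1) a by (auto simp: in_cocycles_top cech_loc_mult)
  then show "a \<odot>\<^bsub>local_cohomology n n\<^esub> X \<in> carrier (local_cohomology n n) \<and>
      chi n (a \<odot>\<^bsub>local_cohomology n n\<^esub> X) = contract a (chi n X)"
    using c a by (auto simp: lc_smult carrier_lc chi_class) (auto simp: in_cocycles_top prho_mult)
qed

lemma chi_zero: "\<zero>\<^bsub>local_cohomology n n\<^esub> \<in> carrier (local_cohomology n n)" "chi n \<zero>\<^bsub>local_cohomology n n\<^esub> = 0"
proof -
  have z: "(\<lambda>_. 0) \<in> carrier (cech_cocycles n n)" by (simp add: in_cocycles_top cech_loc_zero)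
  show "\<zero>\<^bsub>local_cohomology n n\<^esub> \<in> carrier (local_cohomology n n)" "chi n \<zero>\<^bsub>local_cohomology n n\<^esub> = 0"
    unfolding lc_zero using z chi_class[OF z] by (auto simp: carrier_lc)
qed

text \<open>Degree \<open>d\<close> of the quotient consists of classes of homogeneous cocycles, so
  one inclusion requires a homogeneous lift of a homogeneous principal part, which
  \<open>prho_surj_comp\<close> supplies.\<close>

lemma chi_hcomp: "hcomp (local_cohomology n n) d =
    {X \<in> carrier (local_cohomology n n). chi n X \<in> hcomp (inv_system n) d}"
proof (intro equalityI subsetI)
  fix X assume "X \<in> hcomp (local_cohomology n n) d"
  then show "X \<in> {X \<in> carrier (local_cohomology n n). chi n X \<in> hcomp (inv_system n) d}"
    by (auto simp: hcomp_lc hcomp_cocycles_top carrier_lc chi_class prho_degree)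
next
  fix X assume X: "X \<in> {X \<in> carrier (local_cohomology n n). chi n X \<in> hcomp (inv_system n) d}"
  then obtain u where u: "u \<in> cech_loc_comp n {..<n} d" "prho n u = chi n X"
    using prho_surj_comp[of "chi n X" n d] by auto
  then have ul: "u \<in> cech_loc n {..<n}" using cech_loc_comp_sub by blast
  obtain c where c: "c \<in> carrier (cech_cocycles n n)" "X = top_class n c" using X by (auto simp: carrier_lc)
  have Xu: "X = top_class n (emb_top n u)"
    using u c class_eq_iff[OF c(1) emb_top_in[OF ul]] by (simp add: chi_class) (simp add: emb_top_def)
  show "X \<in> hcomp (local_cohomology n n) d"
  proof -
    have "emb_top n u \<in> hcomp (cech_cocycles n n) d"
      using u emb_top_in[OF ul] by (simp add: hcomp_cocycles_top) (simp add: emb_top_def)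
    then show ?thesis using Xu by (simp only: hcomp_lc imageI)
  qed
qed

lemma graded_module_lc:
  "graded_module (poly_ring n) (local_cohomology n n :: ('k::field mpol, (nat set \<Rightarrow> 'k mpol fract) set) graded_module)"
  by (rule graded_module_transport[OF graded_module_inv_system, where h = "chi n"])
     (auto simp: chi_bij[simplified] chi_hom chi_zero chi_hcomp rcomp_carrier)

section \<open>The Frobenius action and the F-module structure on local cohomology\<close>

context char_p
begin

lemma CHAR_fract: "CHAR('k mpol fract) = p"
proof (rule CHAR_eqI)
  have *: "(of_nat m :: 'k mpol fract) = Fract (of_nat m) 1" for m
    by (induction m) (simp_all add: Zero_fract_def One_fract_def)
  have c: "(of_nat m :: 'k mpol) = 0 \<longleftrightarrow> p dvd m" for m
    by (simp add: of_nat_eq_0_iff_char_dvd CHAR_mpol)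
  show "(of_nat p :: 'k mpol fract) = 0"
    unfolding * using c[of p] by (simp add: Zero_fract_def)
  show "p dvd m" if "(of_nat m :: 'k mpol fract) = 0" for m
    using that unfolding * by (simp add: Zero_fract_def eq_fract c)
qed

lemma frob_add_fract: "(x + y :: 'k mpol fract) ^ p = x ^ p + y ^ p"
  by (rule freshmans_dream) (simp_all add: CHAR_fract prime_p)

lemma lookup_power_p:
  assumes "a \<in> carrier R"
  shows "Poly_Mapping.lookup (a ^ p) (mscale p e) = Poly_Mapping.lookup a e ^ p"
    and "(\<And>e. m \<noteq> mscale p e) \<Longrightarrow> Poly_Mapping.lookup (a ^ p) m = 0"
proof -
  have "(\<forall>e. Poly_Mapping.lookup (a ^ p) (mscale p e) = Poly_Mapping.lookup a e ^ p) \<and>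
      (\<forall>m. (\<forall>e. m \<noteq> mscale p e) \<longrightarrow> Poly_Mapping.lookup (a ^ p) m = 0)"
    using assms
  proof (induction a rule: poly_ring_induct)
    case (single m c)
    have "mscale p m = mscale p e \<longleftrightarrow> m = e" for e using mscale_inj[OF p_pos] by auto
    then show ?case using p_pos by (auto simp: single_power lookup_single when_def zero_power)
  next
    case (add f g)
    then show ?case by (simp add: frob_add_mpol lookup_add frob_add_field)
  qed
  then show "Poly_Mapping.lookup (a ^ p) (mscale p e) = Poly_Mapping.lookup a e ^ p"
    "(\<And>e. m \<noteq> mscale p e) \<Longrightarrow> Poly_Mapping.lookup (a ^ p) m = 0" by blast+
qed

lemma mtop_mones: "mtop + mones n 1 = mones n p"
  by (rule poly_mapping_eqI) (use p_pos in \<open>simp add: lookup_mtop lookup_mones lookup_add\<close>)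

lemma mscale_mones: "mscale k (mones n l) = mones n (k * l)"
  by (rule poly_mapping_eqI) (simp add: lookup_mones)

text \<open>The \<open>p\<close>-th power has numerator \<open>a^p\<close> and denominator exponent
  \<open>p k\<close>. Multiplying \<open>e + q + 1 = k\<close> by \<open>p\<close> gives
  \<open>p e + (p q + p - 1) + 1 = p k\<close>, which is the exponent shift in
  \<open>efrob\<close>.\<close>

lemma ppart_power:
  assumes a: "a \<in> carrier R"
  shows "ppart n (a ^ p) (p * k) = efrob (ppart n a k)"
proof (rule poly_mapping_eqI)
  fix q
  show "Poly_Mapping.lookup (ppart n (a ^ p) (p * k)) q = Poly_Mapping.lookup (efrob (ppart n a k)) q"
  proof (cases "\<exists>e q0. q = mscale p q0 + mtop \<and> e + q0 + mones n 1 = mones n k")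
    case True
    then obtain e q0 where q: "q = mscale p q0 + mtop" and e: "e + q0 + mones n 1 = mones n k" by auto
    have "mscale p e + mscale p q0 + (mtop + mones n 1) = mscale p (e + q0 + mones n 1)"
      by (simp only: mtop_mones mscale_add mscale_mones mult_1_right)
    then have *: "mscale p e + q + mones n 1 = mones n (p * k)"
      unfolding q e mscale_mones by (simp only: ac_simps)
    show ?thesis unfolding lookup_ppart[OF *] lookup_power_p(1)[OF a]
      by (simp only: q lookup_efrob lookup_ppart[OF e])
  next
    case False
    have r: "Poly_Mapping.lookup (efrob (ppart n a k)) q = 0"
    proof (cases "\<exists>q0. q = mscale p q0 + mtop")
      case True
      then obtain q0 where q: "q = mscale p q0 + mtop" by auto
      then have "Poly_Mapping.lookup (ppart n a k) q0 = 0" using False by (intro lookup_ppart_zero) blast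
      then show ?thesis using p_pos by (simp add: q lookup_efrob zero_power)
    next
      case False
      then show ?thesis by (intro lookup_efrob_zero) blast
    qed
    show ?thesis
    proof (cases "\<exists>e'. e' + q + mones n 1 = mones n (p * k)")
      case True
      then obtain e' where e': "e' + q + mones n 1 = mones n (p * k)" by auto
      have "e' \<noteq> mscale p e" for e
      proof
        assume eq: "e' = mscale p e"
        have i: "p * Poly_Mapping.lookup e i + Poly_Mapping.lookup q i + (if i < n then 1 else 0) =
            (if i < n then p * k else 0)" for i
          using e'[THEN arg_cong, of "\<lambda>m. Poly_Mapping.lookup m i"]
          by (simp only: eq lookup_add lookup_mones lookup_mscale)
        \<comment> \<open>From \<open>p e + q + 1 = p k\<close> each \<open>e_i\<close> is below
          \<open>k\<close>, so \<open>q0 = k - 1 - e\<close> is an honest exponent, and then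
          \<open>q = p q0 + mtop\<close> contradicts the case assumption.\<close>
        define q0 where "q0 = mones n k - (e + mones n 1)"
        have lt: "Poly_Mapping.lookup e i < k" if "i < n" for i
        proof (rule ccontr)
          assume "\<not> ?thesis"
          then have "k \<le> Poly_Mapping.lookup e i" by simp
          then have "p * k \<le> p * Poly_Mapping.lookup e i" by (rule mult_le_mono2)
          moreover have "p * Poly_Mapping.lookup e i + Poly_Mapping.lookup q i + 1 = p * k"
            using i[of i] that by (simp only: if_True)
          ultimately show False by linarith
        qed
        have ek: "Poly_Mapping.keys e \<subseteq> {..<n}"
        proof
          fix i assume "i \<in> Poly_Mapping.keys e"
          then show "i \<in> {..<n}" using i[of i] p_pos by (auto simp: in_keys_iff split: if_splits)
        qed
        have "q0 + e + mones n 1 = mones n k" unfolding q0_def by (rule exponent_bound[OF ek lt])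
        then have e0: "e + q0 + mones n 1 = mones n k" by (simp only: ac_simps)
        have "mscale p e + mscale p q0 + (mtop + mones n 1) = mscale p (e + q0 + mones n 1)"
          by (simp only: mtop_mones mscale_add mscale_mones mult_1_right)
        then have "mscale p e + (mscale p q0 + mtop) + mones n 1 = mones n (p * k)"
          unfolding e0 mscale_mones by (simp only: ac_simps)
        then have "q = mscale p q0 + mtop" using e' eq by (metis add_left_cancel add_right_cancel)
        then show False using False e0 by blast
      qed
      then have "Poly_Mapping.lookup (a ^ p) e' = 0" by (rule lookup_power_p(2)[OF a])
      then show ?thesis by (simp only: lookup_ppart[OF e'] r)
    next
      case False
      then show ?thesis using r lookup_ppart_zero[of q n "p * k" "a ^ p"] by metis
    qed
  qed
qed

lemma fract_power: "(Fract a b) ^ m = Fract (a ^ m) (b ^ m :: 'k mpol)"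
  by (induction m) (simp_all add: One_fract_def)

lemma cech_loc_power: "u \<in> cech_loc n S \<Longrightarrow> u ^ p \<in> cech_loc n (S :: nat set)" for u :: "'k mpol fract"
proof -
  assume "u \<in> cech_loc n S"
  then obtain a k where a: "a \<in> carrier R" "u = Fract a ((\<Prod>i\<in>S. mvar i) ^ k)" by (auto simp: cech_loc_def)
  have "u ^ p = Fract (a ^ p) ((\<Prod>i\<in>S. mvar i) ^ (k * p))" by (simp add: a fract_power power_mult)
  then show ?thesis using a(1) unfolding cech_loc_def by (auto intro!: exI[of _ "a ^ p"])
qed

lemma prho_power:
  fixes u :: "'k mpol fract"
  assumes "u \<in> cech_loc n {..<n}"
  shows "prho n (u ^ p) = efrob (prho n u)"
proof -
  obtain a k where a: "a \<in> carrier R" "u = Fract a (xpow n k)" using assms by (rule cech_loc_cases)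
  have "u ^ p = Fract (a ^ p) (xpow n (p * k))"
    by (simp add: a fract_power single_power mscale_mones)
  then show ?thesis using a by (simp add: prho_Fract ppart_power)
qed

abbreviation H :: "('k mpol, (nat set \<Rightarrow> 'k mpol fract) set) graded_module" where
  "H \<equiv> local_cohomology n n"

lemma frob_action_class:
  fixes c :: "nat set \<Rightarrow> 'k mpol fract"
  assumes c: "c \<in> carrier (cech_cocycles n n)"
  shows "frob_action p n n (top_class n c) = top_class n (\<lambda>S. c S ^ p)"
  unfolding frob_action_def
proof (rule coset_image[OF abelian_subgroup_coboundaries_top abelian_subgroup_coboundaries_top _ _ _ c])
  show "(\<lambda>c S. c S ^ p) ` cech_coboundaries n n \<subseteq> (cech_coboundaries n n :: (nat set \<Rightarrow> 'k mpol fract) set)"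
    using p_pos by (auto simp: coboundaries_top in_cocycles_top cech_loc_power prho_power efrob_def)
qed (use p_pos in \<open>auto simp: in_cocycles_top cech_loc_power frob_add_fract\<close>)

lemma chi_frob_action:
  assumes "X \<in> carrier H"
  shows "frob_action p n n X \<in> carrier H \<and> chi n (frob_action p n n X) = efrob (chi n X)"
proof -
  obtain c where c: "c \<in> carrier (cech_cocycles n n)" "X = top_class n c" using assms by (auto simp: carrier_lc)
  have cp: "(\<lambda>S. c S ^ p) \<in> carrier (cech_cocycles n n)"
    using c(1) p_pos by (auto simp: in_cocycles_top cech_loc_power)
  have "c {..<n} \<in> cech_loc n {..<n}" using c(1) by (simp add: in_cocycles_top)
  then show ?thesis using c cp chi_class[OF cp] chi_class[OF c(1)]
    by (simp add: frob_action_class carrier_lc prho_power)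
qed

text \<open>The coordinate maps are conjugated by \<open>h\<close>, and every law is checked after
  applying \<open>h\<close>.\<close>

lemma frob_ext_transport:
  fixes M :: "('k mpol, 'b, 'y) graded_module_scheme" and N :: "('k mpol, 'c, 'z) graded_module_scheme"
  assumes fe: "frob_ext p n M M f q" and gN: "graded_module R N"
    and bij: "bij_betw h (carrier N) (carrier M)"
    and add: "\<And>x y. x \<in> carrier N \<Longrightarrow> y \<in> carrier N \<Longrightarrow> h (x \<oplus>\<^bsub>N\<^esub> y) = h x \<oplus>\<^bsub>M\<^esub> h y"
    and smult: "\<And>a x. a \<in> carrier R \<Longrightarrow> x \<in> carrier N \<Longrightarrow> h (a \<odot>\<^bsub>N\<^esub> x) = a \<odot>\<^bsub>M\<^esub> h x"
    and hc: "\<And>d. hcomp N d = {x \<in> carrier N. h x \<in> hcomp M d}"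
    and f': "\<And>x. x \<in> carrier N \<Longrightarrow> f' x \<in> carrier N \<and> h (f' x) = f (h x)"
  shows "frob_ext p n N N f' (\<lambda>j x. inv_into (carrier N) h (q j (h x)))"
proof -
  interpret M: frob_ext p n ty M M f q by (rule fe)
  interpret N: graded_module R N by (rule gN)
  let ?g = "inv_into (carrier N) h"
  have hM: "h x \<in> carrier M" if "x \<in> carrier N" for x using bij that by (auto simp: bij_betw_def)
  have inj: "x = y" if "x \<in> carrier N" "y \<in> carrier N" "h x = h y" for x y
    using bij that by (auto simp: bij_betw_def inj_on_def)
  have g: "?g y \<in> carrier N" "h (?g y) = y" if "y \<in> carrier M" for y
    using bij that by (auto simp: bij_betw_def intro: inv_into_into f_inv_into_f)
  have gh: "?g (h x) = x" if "x \<in> carrier N" for x using bij that by (auto simp: bij_betw_def)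
  show ?thesis
  proof unfold_locales
    fix c c' assume "c \<in> carrier N" "c' \<in> carrier N"
    then show "f' (c \<oplus>\<^bsub>N\<^esub> c') = f' c \<oplus>\<^bsub>N\<^esub> f' c'"
      by (intro inj) (simp_all add: add f' hM M.f_add)
  next
    fix s c assume "s \<in> carrier R" "c \<in> carrier N"
    then show "f' (s \<odot>\<^bsub>N\<^esub> c) = s ^ p \<odot>\<^bsub>N\<^esub> f' c"
      by (intro inj) (simp_all add: smult f' hM M.f_smult)
  next
    fix j x assume "j \<in> fidx" "x \<in> carrier N"
    then show "?g (q j (h x)) \<in> carrier N" by (simp add: g hM M.q_closed)
  next
    fix j x y assume "j \<in> fidx" "x \<in> carrier N" "y \<in> carrier N"
    then show "?g (q j (h (x \<oplus>\<^bsub>N\<^esub> y))) = ?g (q j (h x)) \<oplus>\<^bsub>N\<^esub> ?g (q j (h y))"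
      by (intro inj) (simp_all add: add g hM M.q_closed M.q_add)
  next
    fix j r c assume "j \<in> fidx" "r \<in> carrier R" "c \<in> carrier N"
    then show "?g (q j (h (r \<odot>\<^bsub>N\<^esub> f' c))) = fcoord j r \<odot>\<^bsub>N\<^esub> c"
      by (intro inj) (simp_all add: smult f' g hM M.q_f fcoord_closed)
  next
    fix x P assume x: "x \<in> carrier N"
      and Pf: "\<And>r c. r \<in> carrier R \<Longrightarrow> c \<in> carrier N \<Longrightarrow> P (r \<odot>\<^bsub>N\<^esub> f' c)"
      and Pa: "\<And>x y. x \<in> carrier N \<Longrightarrow> y \<in> carrier N \<Longrightarrow> P x \<Longrightarrow> P y \<Longrightarrow> P (x \<oplus>\<^bsub>N\<^esub> y)"
    have "P (?g y)" if "y \<in> carrier M" for y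
      using that
    proof (rule M.D_induct)
      fix r c assume rc: "r \<in> carrier R" "c \<in> carrier M"
      have "?g (r \<odot>\<^bsub>M\<^esub> f c) = r \<odot>\<^bsub>N\<^esub> f' (?g c)"
        using rc by (intro inj) (simp_all add: smult f' g M.f_closed)
      then show "P (?g (r \<odot>\<^bsub>M\<^esub> f c))" using Pf rc g by simp
    next
      fix y z assume yz: "y \<in> carrier M" "z \<in> carrier M" "P (?g y)" "P (?g z)"
      have "?g (y \<oplus>\<^bsub>M\<^esub> z) = ?g y \<oplus>\<^bsub>N\<^esub> ?g z"
        using yz(1,2) by (intro inj) (simp_all add: add g)
      then show "P (?g (y \<oplus>\<^bsub>M\<^esub> z))" using Pa yz g by simp
    qed
    from this[OF hM[OF x]] show "P x" by (simp add: gh x)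
  next
    fix c d assume "c \<in> hcomp N d"
    then show "f' c \<in> hcomp N (int p * d)" using f' M.f_degree by (auto simp: hc)
  qed (use f' in auto)
qed

lemma frob_ext_lc: "\<exists>q. frob_ext p n H H (frob_action p n n) q"
  by (rule exI, rule frob_ext_transport[OF frob_ext_inv_system graded_module_lc chi_bij])
     (auto simp: chi_hom chi_hcomp chi_frob_action)

text \<open>Recognises both local cohomology and the subobjects of \<open>sub_F_module\<close> as
  F-modules, and identifies the abstract action \<open>froact\<close> with the concrete
  \<open>f\<close>.\<close>

lemma F_module_of:
  fixes M :: "('k mpol, 'b, 'z) graded_module_scheme" and A :: "('k mpol, 'b) F_module"
  assumes fe: "frob_ext p n M M f q"
    and eq: "carrier A = carrier M" "ring.zero A = ring.zero M" "ring.add A = ring.add M"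
      "module.smult A = module.smult M" "hcomp A = hcomp M"
    and \<theta>: "struct A \<in> gmod_iso R M (frob p R M)"
    and \<theta>t: "\<And>r c. r \<in> carrier R \<Longrightarrow> c \<in> carrier M \<Longrightarrow> struct A (r \<odot>\<^bsub>M\<^esub> f c) = frob_tensor p R M r c"
  shows "graded_F_module p R A" and "y \<in> carrier A \<Longrightarrow> froact p R A y = f y"
proof -
  interpret M: frob_ext p n ty M M f q by (rule fe)
  have gA: "graded_module R A"
    by (rule graded_module_transport[OF M.C.graded_module_axioms, where h = id])
       (auto simp: eq rcomp_carrier M.C.hcomp_carrier)
  have fr: "frob p R A = frob p R M" "frob_tensor p R A = frob_tensor p R M"
    by (rule frob_cong; simp add: eq)+
  have "struct A \<in> gmod_iso R A (frob p R A)"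
    using \<theta> by (simp add: fr gmod_iso_def gmod_hom_def mod_hom_def eq)
  then show gF: "graded_F_module p R A" using gA by (simp add: graded_F_module_def)
  assume y: "y \<in> carrier A"
  have inj: "inj_on (struct A) (carrier A)" using \<theta> by (simp add: gmod_iso_def bij_betw_def eq)
  have "struct A (\<one>\<^bsub>R\<^esub> \<odot>\<^bsub>M\<^esub> f y) = frob_tensor p R M \<one>\<^bsub>R\<^esub> y" using y by (intro \<theta>t) (auto simp: eq)
  then have "frob_tensor p R A \<one>\<^bsub>R\<^esub> y = struct A (f y)"
    using y M.C.smult_one[OF M.f_closed, of y] by (simp add: eq fr)
  then show "froact p R A y = f y"
    unfolding froact_def using inv_into_f_f[OF inj, of "f y"] y M.f_closed by (simp add: eq)
qed

abbreviation E :: "('k mpol, (nat set \<Rightarrow> 'k mpol fract) set) F_module" where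
  "E \<equiv> top_local_cohomology p n"

lemma top_simps [simp]: "carrier E = carrier H" "ring.zero E = ring.zero H" "ring.add E = ring.add H"
  "module.smult E = module.smult H" "hcomp E = hcomp H" "struct E = top_structure p n"
  by (simp_all add: top_local_cohomology_def graded_module.extend_def F_module.fields_def)

text \<open>The definite description in \<open>top_structure\<close> has to be justified: existence
  comes from the coordinates, uniqueness from the fact that the elements \<open>r f(\<eta>)\<close>
  generate \<open>H\<close> additively.\<close>

lemma top_structure_props:
  "top_structure p n \<in> gmod_iso R H (frob p R H)"
  "r \<in> carrier R \<Longrightarrow> X \<in> carrier H \<Longrightarrow>
    top_structure p n (r \<odot>\<^bsub>H\<^esub> frob_action p n n X) = frob_tensor p R H r X"
proof -
  obtain q where fe: "frob_ext p n H H (frob_action p n n) q" using frob_ext_lc by blast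
  interpret fe: frob_ext p n ty H H "frob_action p n n" q by (rule fe)
  obtain \<theta>0 where \<theta>0: "\<theta>0 \<in> gmod_iso R H (frob p R H)"
    "\<And>r c. r \<in> carrier R \<Longrightarrow> c \<in> carrier H \<Longrightarrow> \<theta>0 (r \<odot>\<^bsub>H\<^esub> frob_action p n n c) = frob_tensor p R H r c"
    using frob_ext_struct[OF fe] by blast
  \<comment> \<open>Restricting makes the map extensional, without which values off the carrier
    would spoil uniqueness.\<close>
  define \<theta> where "\<theta> = restrict \<theta>0 (carrier H)"
  have \<theta>iso: "\<theta> \<in> gmod_iso R H (frob p R H)"
  proof -
    have "bij_betw \<theta> (carrier H) (carrier (frob p R H))"
      using \<theta>0(1) by (simp add: \<theta>_def gmod_iso_def cong: bij_betw_cong)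
    moreover have "\<theta> ` hcomp H d \<subseteq> hcomp (frob p R H) d" for d
      using \<theta>0(1) fe.C.hcomp_carrier by (auto simp: \<theta>_def gmod_iso_def gmod_hom_def)
    ultimately show ?thesis using \<theta>0(1)
      by (auto simp: \<theta>_def gmod_iso_def gmod_hom_def mod_hom_def)
  qed
  have \<theta>t: "\<theta> (r \<odot>\<^bsub>H\<^esub> frob_action p n n c) = frob_tensor p R H r c" if "r \<in> carrier R" "c \<in> carrier H" for r c
    using \<theta>0(2)[OF that] that by (simp add: \<theta>_def fe.f_closed)
  let ?P = "\<lambda>\<theta>. \<theta> \<in> mod_hom R H (frob p R H) \<and> \<theta> \<in> extensional (carrier H) \<and>
       (\<forall>r\<in>carrier R. \<forall>\<eta>\<in>carrier H. \<theta> (r \<odot>\<^bsub>H\<^esub> frob_action p n n \<eta>) = frob_tensor p R H r \<eta>)"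
  have "(THE \<theta>. ?P \<theta>) = \<theta>"
  proof (rule the_equality)
    show "?P \<theta>" using \<theta>iso \<theta>t by (auto simp: gmod_iso_def gmod_hom_def \<theta>_def)
    fix \<theta>' assume \<theta>': "?P \<theta>'"
    show "\<theta>' = \<theta>"
    proof (rule extensionalityI[of _ "carrier H"])
      fix x assume "x \<in> carrier H"
      then show "\<theta>' x = \<theta> x"
      proof (rule fe.D_induct)
        fix x y assume "x \<in> carrier H" "y \<in> carrier H" "\<theta>' x = \<theta> x" "\<theta>' y = \<theta> y"
        then show "\<theta>' (x \<oplus>\<^bsub>H\<^esub> y) = \<theta> (x \<oplus>\<^bsub>H\<^esub> y)"
          using \<theta>' \<theta>iso by (simp add: gmod_iso_def gmod_hom_def mod_hom_def)
      qed (use \<theta>' \<theta>t in auto)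
    qed (use \<theta>' in \<open>auto simp: \<theta>_def\<close>)
  qed
  then have "top_structure p n = \<theta>" unfolding top_structure_def Let_def .
  then show "top_structure p n \<in> gmod_iso R H (frob p R H)"
    "r \<in> carrier R \<Longrightarrow> X \<in> carrier H \<Longrightarrow>
      top_structure p n (r \<odot>\<^bsub>H\<^esub> frob_action p n n X) = frob_tensor p R H r X"
    using \<theta>iso \<theta>t by auto
qed

lemma top_F_module: "graded_F_module p R E"
  and froact_top: "X \<in> carrier H \<Longrightarrow> froact p R E X = frob_action p n n X"
proof -
  obtain q where fe: "frob_ext p n H H (frob_action p n n) q" using frob_ext_lc by blast
  have "struct E \<in> gmod_iso R H (frob p R H)" using top_structure_props(1) by simp
  note * = F_module_of[OF fe top_simps(1-5) this]
  show "graded_F_module p R E" by (rule *(1)) (use top_structure_props(2) in simp)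
  show "X \<in> carrier H \<Longrightarrow> froact p R E X = frob_action p n n X"
    by (rule *(2)) (use top_structure_props(2) in simp_all)
qed

lemma chi_froact: "X \<in> carrier H \<Longrightarrow> chi n (froact p R E X) = efrob (chi n X)"
  using chi_frob_action by (simp add: froact_top)

text \<open>The polynomial \<open>1\<close> stands for the class \<open>x^(-1)\<close>, whose
  \<open>p^e\<close>-th power \<open>x^(-p^e)\<close> is written with exponent
  \<open>p^e - 1\<close>.\<close>

lemma efrob_pow_one: "(efrob ^^ e) 1 = Poly_Mapping.single (mones n (p ^ e - 1)) 1"
proof (induction e)
  case (Suc e)
  have "mscale p (mones n (p ^ e - 1)) + mtop = mones n (p ^ Suc e - 1)"
  proof (rule poly_mapping_eqI)
    fix i
    have "p * (p ^ e - 1) + (p - 1) = p ^ Suc e - 1"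
      using p_pos by (simp add: algebra_simps diff_mult_distrib2)
    then show "Poly_Mapping.lookup (mscale p (mones n (p ^ e - 1)) + mtop) i =
        Poly_Mapping.lookup (mones n (p ^ Suc e - 1)) i"
      by (simp add: lookup_add lookup_mones lookup_mtop)
  qed
  then show ?case using Suc by (simp add: efrob_def)
qed simp

lemma p_pow_gt: "m < p ^ m"
  using prime_gt_1_nat[OF prime_p] by (simp add: power_gt_expt)

text \<open>The class of \<open>x^(-1)\<close> alone is a root. Contracting its \<open>e\<close>-th
  Frobenius image reaches every monomial with exponents below \<open>p^e\<close>, and these bounds
  grow without limit.\<close>

theorem top_F_finite: "graded_F_finite p R E"
proof -
  interpret E: fmod p n ty E by unfold_locales (rule top_F_module)
  define g where "g = inv_into (carrier H) (chi n)"
  have cb: "bij_betw (chi n) (carrier H) (carrier R)" using chi_bij[where ?'k = 'k] by simp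
  have g: "g y \<in> carrier H" "chi n (g y) = y" if "y \<in> carrier R" for y
    using cb that by (auto simp: g_def bij_betw_def intro: inv_into_into f_inv_into_f)
  have gc: "g (chi n X) = X" if "X \<in> carrier H" for X using cb that by (auto simp: g_def bij_betw_def)
  have inj: "X = Y" if "X \<in> carrier H" "Y \<in> carrier H" "chi n X = chi n Y" for X Y
    using gc that by metis
  let ?S = "{g 1}"
  have S: "?S \<subseteq> carrier E" using g[of 1] by simp
  have deg: "g 1 \<in> hcomp E (- int n)"
    using g[of 1] by (simp add: chi_hcomp in_hcomp_inv_system)
  have frc: "(froact p R E ^^ e) (g 1) \<in> carrier H \<and> chi n ((froact p R E ^^ e) (g 1)) = (efrob ^^ e) 1" for e
    using g[of 1] by (induction e) (auto simp: chi_froact E.fr_closed[simplified])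
  have mono: "g (Poly_Mapping.single q c) \<in> E.iter e ?S"
    if q: "Poly_Mapping.keys q \<subseteq> {..<n}" and e: "\<And>i. i < n \<Longrightarrow> Poly_Mapping.lookup q i < p ^ e" for q c e
  proof -
    let ?a = "Poly_Mapping.single (mones n (p ^ e - 1) - q) c"
    have le: "mones n (p ^ e - 1) - q + q = mones n (p ^ e - 1)"
    proof (rule poly_mapping_eqI)
      fix i
      show "Poly_Mapping.lookup (mones n (p ^ e - 1) - q + q) i = Poly_Mapping.lookup (mones n (p ^ e - 1)) i"
      proof (cases "i < n")
        case True
        then show ?thesis using e[of i] by (simp add: lookup_add lookup_minus lookup_mones)
      next
        case False
        then have "Poly_Mapping.lookup q i = 0" using q by (auto simp: in_keys_iff)
        then show ?thesis using False by (simp add: lookup_add lookup_minus lookup_mones)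
      qed
    qed
    then have "Poly_Mapping.keys (mones n (p ^ e - 1) - q) \<subseteq> {..<n}"
      using keys_mones[of n "p ^ e - 1"] by (metis keys_plus_nat le_sup_iff)
    then have a: "?a \<in> carrier R" by simp
    have "contract ?a (Poly_Mapping.single (mones n (p ^ e - 1)) 1) = Poly_Mapping.single q c"
    proof (rule poly_mapping_eqI)
      fix m
      have "mones n (p ^ e - 1) = m + (mones n (p ^ e - 1) - q) \<longleftrightarrow> q = m"
        using le by (metis add.commute add_left_cancel)
      then show "Poly_Mapping.lookup (contract ?a (Poly_Mapping.single (mones n (p ^ e - 1)) 1)) m =
          Poly_Mapping.lookup (Poly_Mapping.single q c) m"
        by (simp add: lookup_single when_def)
    qed
    then have "g (Poly_Mapping.single q c) = ?a \<odot>\<^bsub>E\<^esub> (froact p R E ^^ e) (g 1)"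
      using frc[of e] q g[of "Poly_Mapping.single q c"] a by (intro inj) (auto simp: chi_hom efrob_pow_one)
    moreover have "(froact p R E ^^ e) (g 1) \<in> E.iter e ?S"
      unfolding E.iter_def by (rule E.lspan_incl[OF _ _ E.fr_pow_sub[OF S]]) auto
    ultimately show ?thesis using E.iter_smult[OF S a] by simp
  qed
  have "g 1 \<in> E.iter 1 ?S"
    using mono[of 0 1 1] p_pos by simp
  then have root: "E.root ?S" using deg by (auto simp: E.root_def)
  have "E.exhausts ?S"
    unfolding E.exhausts_def
  proof
    fix X assume X: "X \<in> carrier E"
    have "\<exists>e. g y \<in> E.iter e ?S" if "y \<in> carrier R" for y
      using that
    proof (induction y rule: poly_ring_induct)
      case (single m c)
      \<comment> \<open>The degree of \<open>m\<close> serves as the level, since \<open>p\<close>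
        to that power exceeds the degree and hence all exponents.\<close>
      have "Poly_Mapping.lookup m i < p ^ mdeg m" for i
        using lookup_le_mdeg[of m i] p_pow_gt[of "mdeg m"] by linarith
      then show ?case using mono[OF single] by blast
    next
      case (add f h)
      then obtain e1 e2 where e: "g f \<in> E.iter e1 ?S" "g h \<in> E.iter e2 ?S" by auto
      have "g f \<in> E.iter (max e1 e2) ?S" "g h \<in> E.iter (max e1 e2) ?S"
        using e E.iter_mono[OF root, of e1 "max e1 e2"] E.iter_mono[OF root, of e2 "max e1 e2"] by auto
      then have "g f \<oplus>\<^bsub>E\<^esub> g h \<in> E.iter (max e1 e2) ?S" by (rule E.iter_add[OF S])
      moreover have "g (f + h) = g f \<oplus>\<^bsub>E\<^esub> g h"
        using add(1,2) g by (intro inj) (auto simp: chi_hom)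
      ultimately show ?case by auto
    qed
    from this[of "chi n X"] show "\<exists>e. X \<in> E.iter e ?S"
      using X gc bij_betwE[OF cb] by simp
  qed
  with root show ?thesis by (rule E.root_F_finite)
qed

end


section \<open>Kernels of monomorphisms\<close>

lemma lspan_cong:
  assumes "\<zero>\<^bsub>M\<^esub> = \<zero>\<^bsub>N\<^esub>" "\<And>x y. x \<oplus>\<^bsub>M\<^esub> y = x \<oplus>\<^bsub>N\<^esub> y" "\<And>a x. a \<odot>\<^bsub>M\<^esub> x = a \<odot>\<^bsub>N\<^esub> x"
  shows "lspan Q M S = lspan Q N S"
proof (intro equalityI subsetI)
  fix x
  show "x \<in> lspan Q N S" if "x \<in> lspan Q M S"
    using that by induction (auto simp: assms intro: lspan.intros)
  show "x \<in> lspan Q M S" if "x \<in> lspan Q N S"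
    using that by induction (auto simp: assms[symmetric] intro: lspan.intros)
qed

lemma gmod_hom_simps:
  assumes "h \<in> gmod_hom R M N"
  shows "x \<in> carrier M \<Longrightarrow> h x \<in> carrier N"
    and "x \<in> carrier M \<Longrightarrow> y \<in> carrier M \<Longrightarrow> h (x \<oplus>\<^bsub>M\<^esub> y) = h x \<oplus>\<^bsub>N\<^esub> h y"
    and "a \<in> carrier R \<Longrightarrow> x \<in> carrier M \<Longrightarrow> h (a \<odot>\<^bsub>M\<^esub> x) = a \<odot>\<^bsub>N\<^esub> h x"
    and "x \<in> hcomp M d \<Longrightarrow> h x \<in> hcomp N d"
  using assms by (auto simp: gmod_hom_def mod_hom_def image_subset_iff)

lemma finite_monomials: "finite {m :: nat \<Rightarrow>\<^sub>0 nat. Poly_Mapping.keys m \<subseteq> {..<n} \<and> mdeg m = N}"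
proof -
  let ?F = "{f. \<forall>x. (x \<in> {..<n} \<longrightarrow> f x \<in> {..N}) \<and> (x \<notin> {..<n} \<longrightarrow> f x = (0::nat))}"
  have "finite ?F" by (rule finite_set_of_finite_funs) auto
  moreover have "Poly_Mapping.lookup ` {m :: nat \<Rightarrow>\<^sub>0 nat. Poly_Mapping.keys m \<subseteq> {..<n} \<and> mdeg m = N} \<subseteq> ?F"
    using lookup_le_mdeg by (auto simp: in_keys_iff)
  ultimately have "finite (Poly_Mapping.lookup ` {m :: nat \<Rightarrow>\<^sub>0 nat. Poly_Mapping.keys m \<subseteq> {..<n} \<and> mdeg m = N})"
    by (rule finite_subset[rotated])
  then show ?thesis by (rule finite_imageD) (rule inj_onI, simp only: poly_mapping.lookup_inject)
qed

text \<open>The coefficient field as a subset of \<open>R\<close>, in the form to which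
  \<open>lspan_subspace_finite\<close> applies.\<close>

definition scalars :: "'k::field mpol set" where "scalars = range (Poly_Mapping.single 0)"

lemma scalars_closed: "scalars \<subseteq> carrier (poly_ring n)" "0 \<in> scalars" "1 \<in> scalars"
  "a \<in> scalars \<Longrightarrow> b \<in> scalars \<Longrightarrow> a + b \<in> scalars" "a \<in> scalars \<Longrightarrow> b \<in> scalars \<Longrightarrow> a * b \<in> scalars"
  "a \<in> scalars \<Longrightarrow> - a \<in> scalars" "a \<in> scalars \<Longrightarrow> a \<noteq> 0 \<Longrightarrow> \<exists>b\<in>scalars. b * a = 1"
proof -
  show "0 \<in> scalars" using single_zero[of 0] by (auto simp: scalars_def simp del: single_zero)
  show "1 \<in> scalars" using single_one by (metis scalars_def rangeI)
  show "a \<in> scalars \<Longrightarrow> b \<in> scalars \<Longrightarrow> a + b \<in> scalars"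
    by (auto simp: scalars_def single_add[symmetric])
  show "a \<in> scalars \<Longrightarrow> b \<in> scalars \<Longrightarrow> a * b \<in> scalars"
    by (auto simp: scalars_def mult_single)
  show "a \<in> scalars \<Longrightarrow> - a \<in> scalars"
    by (auto simp: scalars_def single_uminus[symmetric])
  show "\<exists>b\<in>scalars. b * a = 1" if a: "a \<in> scalars" "a \<noteq> 0"
  proof -
    obtain c where c: "a = Poly_Mapping.single 0 c" using a by (auto simp: scalars_def)
    then have "c \<noteq> 0" using a by auto
    then have "Poly_Mapping.single 0 (inverse c) * a = 1" by (simp add: c mult_single)
    then show ?thesis by (auto simp: scalars_def)
  qed
qed (auto simp: scalars_def)

section \<open>F-submodules generated by roots\<close>

context fmod
begin

text \<open>An element is a finite sum of the terms \<open>fbasis j fr(fq j x)\<close>, so a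
  property closed under sums can be tested on these terms.\<close>

lemma fq_finsum_closed:
  assumes x: "x \<in> carrier A" and P0: "P \<zero>\<^bsub>A\<^esub>"
    and add: "\<And>y z. y \<in> carrier A \<Longrightarrow> z \<in> carrier A \<Longrightarrow> P y \<Longrightarrow> P z \<Longrightarrow> P (y \<oplus>\<^bsub>A\<^esub> z)"
    and q: "\<And>j. j \<in> fidx \<Longrightarrow> P (fbasis j \<odot>\<^bsub>A\<^esub> fr (fq j x))"
  shows "P x"
proof -
  obtain J where J: "J \<subseteq> fidx" "finite J" "x = finsum A (\<lambda>j. fbasis j \<odot>\<^bsub>A\<^esub> fr (fq j x)) J"
    using E0.q_expandE[OF x] .
  have cl: "fbasis j \<odot>\<^bsub>A\<^esub> fr (fq j x) \<in> carrier A" if "j \<in> fidx" for j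
    using that x by (intro smult_closed fbasis_carrier fr_closed fq_closed)
  have "finsum A (\<lambda>j. fbasis j \<odot>\<^bsub>A\<^esub> fr (fq j x)) L \<in> carrier A \<and> P (finsum A (\<lambda>j. fbasis j \<odot>\<^bsub>A\<^esub> fr (fq j x)) L)"
    if "finite L" "L \<subseteq> fidx" for L
    using that
  proof (induction L rule: finite_induct)
    case (insert j L)
    then have j: "j \<in> fidx" and L: "L \<subseteq> fidx" by auto
    have "finsum A (\<lambda>j. fbasis j \<odot>\<^bsub>A\<^esub> fr (fq j x)) (insert j L) =
        fbasis j \<odot>\<^bsub>A\<^esub> fr (fq j x) \<oplus>\<^bsub>A\<^esub> finsum A (\<lambda>j. fbasis j \<odot>\<^bsub>A\<^esub> fr (fq j x)) L"
      using insert.hyps cl j L by (intro M.finsum_insert) auto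
    then show ?case using insert.IH[OF L] cl[OF j] q[OF j] add by simp
  qed (simp add: P0)
  from this[OF J(2,1)] show ?thesis using J(3) by simp
qed

text \<open>Stability of the union under \<open>fr\<close> would give only a Frobenius action.
  Stability under the coordinate maps makes its linear extension bijective again, so the union is an
  F-module with root \<open>U\<close>.\<close>

lemma sub_F_module:
  assumes U: "root U"
  obtains C :: "('k mpol, 'b) F_module" where "carrier C = (\<Union>e. iter e U)" "graded_F_finite p R C"
    "(\<lambda>x. x) \<in> F_hom p R C A" "(\<lambda>_. \<zero>\<^bsub>A\<^esub>) \<in> F_hom p R C A"
proof -
  define K where "K = (\<Union>e. iter e U)"
  note Uc = root_carrier[OF U]
  have Kc: "K \<subseteq> carrier A" unfolding K_def using iter_closed[OF Uc] by blast
  have Kadd: "x \<oplus>\<^bsub>A\<^esub> y \<in> K" if xy: "x \<in> K" "y \<in> K" for x y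
  proof -
    obtain e1 e2 where e: "x \<in> iter e1 U" "y \<in> iter e2 U" using xy by (auto simp: K_def)
    have "x \<in> iter (max e1 e2) U" "y \<in> iter (max e1 e2) U"
      using e iter_mono[OF U, of e1 "max e1 e2"] iter_mono[OF U, of e2 "max e1 e2"] by auto
    then have "x \<oplus>\<^bsub>A\<^esub> y \<in> iter (max e1 e2) U" by (rule iter_add[OF Uc])
    then show ?thesis by (auto simp: K_def)
  qed
  have Ksm: "a \<odot>\<^bsub>A\<^esub> x \<in> K" if "a \<in> carrier R" "x \<in> K" for a x
    using that iter_smult[OF Uc] by (auto simp: K_def)
  have Khp: "hpart d x \<in> K" if "x \<in> K" for d x using that iter_hpart[OF U] by (auto simp: K_def)
  have Kz: "\<zero>\<^bsub>A\<^esub> \<in> K" using iter_zero by (auto simp: K_def)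
  have Kfr: "fr x \<in> K" if "x \<in> K" for x using that fr_iter[OF Uc] unfolding K_def by blast
  have Kfq: "fq j x \<in> K" if j: "j \<in> fidx" and "x \<in> K" for j x
  proof -
    obtain e where "x \<in> iter e U" using \<open>x \<in> K\<close> by (auto simp: K_def)
    then have "x \<in> iter (Suc e) U" using iter_mono[OF U, of e "Suc e"] by auto
    from fq_iter[OF Uc j this] show ?thesis by (auto simp: K_def)
  qed
  define C0 where "C0 = subgmodule A K"
  have C0: "carrier C0 = K" "\<And>x y. x \<oplus>\<^bsub>C0\<^esub> y = x \<oplus>\<^bsub>A\<^esub> y" "\<zero>\<^bsub>C0\<^esub> = \<zero>\<^bsub>A\<^esub>"
    "\<And>a x. a \<odot>\<^bsub>C0\<^esub> x = a \<odot>\<^bsub>A\<^esub> x" "\<And>d. hcomp C0 d = hcomp A d \<inter> K"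
    by (simp_all add: C0_def)
  have gC0: "graded_module R C0" unfolding C0_def
    by (rule graded_module_subgmodule[OF rcomp_carrier Kc Kz Kadd Ksm Khp])
  interpret C0: graded_module R C0 by (rule gC0)
  have fe: "frob_ext p n C0 C0 fr fq"
  proof unfold_locales
    fix x P assume x: "x \<in> carrier C0"
      and Pf: "\<And>r c. r \<in> carrier R \<Longrightarrow> c \<in> carrier C0 \<Longrightarrow> P (r \<odot>\<^bsub>C0\<^esub> fr c)"
      and Pa: "\<And>x y. x \<in> carrier C0 \<Longrightarrow> y \<in> carrier C0 \<Longrightarrow> P x \<Longrightarrow> P y \<Longrightarrow> P (x \<oplus>\<^bsub>C0\<^esub> y)"
    obtain e where "x \<in> iter e U" using x by (auto simp: C0 K_def)
    then have xe: "x \<in> iter (Suc e) U" using iter_mono[OF U, of e "Suc e"] by auto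
    have ie: "y \<in> K" if "y \<in> iter e' U" for y e' using that by (auto simp: K_def)
    show "P x" using Uc xe
      by (induction rule: iter_Suc_induct) (use Pf Pa ie in \<open>auto simp: C0\<close>)
  qed (use Kc in \<open>auto simp: C0 fr_add fr_smult fq_add fq_fr subset_iff Kfr Kfq intro: fr_degree\<close>)
  obtain \<theta> where \<theta>: "\<theta> \<in> gmod_iso R C0 (frob p R C0)"
    "\<And>r c. r \<in> carrier R \<Longrightarrow> c \<in> carrier C0 \<Longrightarrow> \<theta> (r \<odot>\<^bsub>C0\<^esub> fr c) = frob_tensor p R C0 r c"
    using frob_ext_struct[OF fe] by blast
  define C where "C = C0\<lparr>struct := \<theta>\<rparr>"
  have C: "carrier C = carrier C0" "ring.zero C = ring.zero C0" "ring.add C = ring.add C0"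
    "module.smult C = module.smult C0" "hcomp C = hcomp C0" "struct C = \<theta>"
    by (simp_all add: C_def)
  have s: "struct C \<in> gmod_iso R C0 (frob p R C0)" using \<theta>(1) C(6) by simp
  have gF: "graded_F_module p R C"
    by (rule F_module_of(1)[OF fe C(1-5) s]) (simp add: C(6) \<theta>(2))
  have fC: "froact p R C y = fr y" if "y \<in> K" for y
    by (rule F_module_of(2)[OF fe C(1-5) s]) (use that in \<open>simp_all add: C(6) C(1) C0(1) \<theta>(2)\<close>)
  interpret C: fmod p n ty C by unfold_locales (rule gF)
  have UK: "U \<subseteq> K"
  proof -
    have "U \<subseteq> iter 0 U" using lspan_incl[OF _ _ Uc, of "carrier R"] by (auto simp: iter_def)
    then show ?thesis by (auto simp: K_def)
  qed
  have pow: "(froact p R C ^^ e) y = (fr ^^ e) y \<and> (fr ^^ e) y \<in> K" if "y \<in> K" for e y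
    using that by (induction e) (auto simp: fC Kfr)
  have it: "C.iter e U = iter e U" for e
  proof -
    have "(froact p R C ^^ e) ` U = (fr ^^ e) ` U"
    proof (rule image_cong[OF refl])
      fix x assume "x \<in> U"
      then have "x \<in> K" using UK by blast
      then show "(froact p R C ^^ e) x = (fr ^^ e) x" using pow[of x e] by blast
    qed
    moreover have "lspan (carrier R) C ((fr ^^ e) ` U) = lspan (carrier R) A ((fr ^^ e) ` U)"
      by (rule lspan_cong) (simp_all only: C C0)
    ultimately show ?thesis by (simp only: C.iter_def iter_def)
  qed
  have hU: "\<exists>d. s \<in> hcomp C d" if s: "s \<in> U" for s
  proof -
    obtain d where "s \<in> hcomp A d" using U s unfolding root_def by blast
    then have "s \<in> hcomp C d" using s UK by (auto simp: C C0)
    then show ?thesis ..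
  qed
  have "C.root U" unfolding C.root_def it using U hU by (simp add: root_def)
  moreover have "C.exhausts U" unfolding C.exhausts_def it C(1) C0(1) K_def by blast
  ultimately have fin: "graded_F_finite p R C" by (rule C.root_F_finite)
  have "(\<lambda>x. x) \<in> F_hom p R C A"
    unfolding F_hom_iff[OF gF fmod] using Kc by (auto simp: gmod_hom_def mod_hom_def C C0 fC)
  moreover have "(\<lambda>_. \<zero>\<^bsub>A\<^esub>) \<in> F_hom p R C A"
    unfolding F_hom_iff[OF gF fmod] using Kc by (auto simp: gmod_hom_def mod_hom_def C C0 fr_zero)
  ultimately show thesis using that[of C] fin by (simp add: C C0 K_def)
qed

text \<open>Homogeneous generators reach degree \<open>d\<close> only through monomials of one fixed
  degree each, and there are finitely many of those.\<close>

lemma component_finite: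
  assumes S: "root S"
  shows "\<exists>T. finite T \<and> T \<subseteq> carrier A \<and> iter 0 S \<inter> hcomp A d \<subseteq> lspan scalars A T"
proof -
  note Sc = root_carrier[OF S]
  have "\<forall>s\<in>S. \<exists>d. s \<in> hcomp A d" using S by (simp add: root_def)
  then obtain dg where dg: "\<And>s. s \<in> S \<Longrightarrow> s \<in> hcomp A (dg s)" by metis
  \<comment> \<open>If \<open>d\<close> is below the degree of \<open>s\<close>, truncation gives
    degree \<open>0\<close> and merely adds \<open>s\<close> itself to \<open>T\<close>.\<close>
  define T where "T = (\<Union>s\<in>S. (\<lambda>m. Poly_Mapping.single m 1 \<odot>\<^bsub>A\<^esub> s) `
    {m. Poly_Mapping.keys m \<subseteq> {..<n} \<and> mdeg m = nat (d - dg s)})"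
  have "finite T" unfolding T_def using S finite_monomials by (auto simp: root_def)
  moreover have Tc: "T \<subseteq> carrier A" using Sc by (auto simp: T_def)
  have hom: "hpart d (a \<odot>\<^bsub>A\<^esub> s) \<in> lspan scalars A T" if a: "a \<in> carrier R" and s: "s \<in> S" for a s
    using a
  proof (induction a rule: poly_ring_induct)
    case (single m c)
    have sc: "s \<in> carrier A" using s Sc by auto
    have "Poly_Mapping.single m c \<odot>\<^bsub>A\<^esub> s \<in> hcomp A (int (mdeg m) + dg s)"
      using single dg[OF s] by (intro hcomp_smult single_in_rcomp) auto
    moreover have "Poly_Mapping.single m c \<odot>\<^bsub>A\<^esub> s \<in> lspan scalars A T" if "int (mdeg m) + dg s = d"
    proof -
      have "mdeg m = nat (d - dg s)" using that by simp
      then have m: "Poly_Mapping.single m 1 \<odot>\<^bsub>A\<^esub> s \<in> T" using s single by (auto simp: T_def)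
      have "Poly_Mapping.single m c \<odot>\<^bsub>A\<^esub> s = Poly_Mapping.single 0 c \<odot>\<^bsub>A\<^esub> (Poly_Mapping.single m 1 \<odot>\<^bsub>A\<^esub> s)"
        using smult_assoc1[of "Poly_Mapping.single 0 c" "Poly_Mapping.single m 1" s] single sc
        by (simp add: mult_single)
      moreover have "Poly_Mapping.single 0 c \<odot>\<^bsub>A\<^esub> (Poly_Mapping.single m 1 \<odot>\<^bsub>A\<^esub> s) \<oplus>\<^bsub>A\<^esub> \<zero>\<^bsub>A\<^esub> \<in> lspan scalars A T"
        by (rule lspan_step[OF _ m lspan_zero]) (simp add: scalars_def)
      ultimately show ?thesis using single sc by simp
    qed
    ultimately show ?case by (simp add: hpart_homog lspan_zero)
  next
    case (add f g)
    then show ?case using smult_l_distr[of f g s] s Sc lspan_add[OF scalars_closed(1) Tc]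
      by (auto simp: hpart_add subset_iff)
  qed
  have "hpart d x \<in> lspan scalars A T" if "x \<in> iter 0 S" for x
    using that unfolding iter_def funpow_0 image_ident
  proof induction
    case lspan_zero
    then show ?case by (simp add: lspan.lspan_zero)
  next
    case (lspan_step a s y)
    have "y \<in> carrier A" using lspan_closed[OF _ Sc, of "carrier R"] lspan_step by auto
    then have "hpart d (a \<odot>\<^bsub>A\<^esub> s \<oplus>\<^bsub>A\<^esub> y) = hpart d (a \<odot>\<^bsub>A\<^esub> s) \<oplus>\<^bsub>A\<^esub> hpart d y"
      using lspan_step Sc by (intro hpart_add) auto
    then show ?case using lspan_step hom lspan_add[OF scalars_closed(1) Tc] by simp
  qed
  then have "iter 0 S \<inter> hcomp A d \<subseteq> lspan scalars A T" by (auto simp: hpart_homog) (metis hpart_homog)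
  ultimately show ?thesis using Tc by blast
qed

end

lemma hpart_inv_system:
  fixes g :: "'k::field mpol"
  assumes "g \<in> carrier (poly_ring n)"
  shows "Poly_Mapping.lookup (graded_module.hpart (inv_system n) d g) m =
    (if - int n - int (mdeg m) = d then Poly_Mapping.lookup g m else 0)"
proof -
  interpret E: graded_module "poly_ring n :: 'k mpol graded_ring" "inv_system n" by (rule graded_module_inv_system)
  have "g \<in> carrier (inv_system n)" using assms by simp
  then show ?thesis
  proof (induction g rule: E.homog_induct)
    case (homog x e)
    then have "e = - int n - int (mdeg m)" if "Poly_Mapping.lookup x m \<noteq> 0"
      using that by (auto simp: in_hcomp_inv_system in_keys_iff)
    then show ?case using homog by (auto simp: E.hpart_homog)
  next
    case (add x y)
    then show ?case using E.hpart_add[of x y d] by (simp add: lookup_add)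
  qed
qed

context char_p
begin

text \<open>A categorical monomorphism need not be injective a priori, but otherwise its kernel, in the
  degrees \<open>-n, \<dots>, 0\<close> that \<open>\<phi>\<close> can see, would generate a nonzero F-finite submodule.\<close>

lemma mono_kernel:
  fixes A :: "('k mpol, 'b) F_module" and B :: "('k mpol, 'c) F_module"
  assumes A: "graded_F_finite p R A" and B: "graded_F_finite p R B"
    and i: "i \<in> F_finite_mono p R A B"
    and \<phi>: "\<phi> \<in> gmod_hom R A (inv_system n)"
    and \<phi>f: "\<And>y. y \<in> carrier A \<Longrightarrow> \<phi> (froact p R A y) = efrob (\<phi> y)"
    and x: "x \<in> carrier A" "i x = \<zero>\<^bsub>B\<^esub>"
  shows "\<phi> x = 0"
proof -
  have gA: "graded_F_module p R A" and gB: "graded_F_module p R B"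
    using A B by (auto simp: graded_F_finite_def)
  interpret A: fmod p n ty A by unfold_locales (rule gA)
  interpret B: fmod p n ty B by unfold_locales (rule gB)
  have iF: "i \<in> F_hom p R A B" using i by (simp add: F_finite_mono_def)
  have ig: "i \<in> gmod_hom R A B" and ifr: "\<And>y. y \<in> carrier A \<Longrightarrow> i (A.fr y) = B.fr (i y)"
    using iF by (auto simp: F_hom_iff[OF gA gB])
  note ih = gmod_hom_simps[OF ig] and \<phi>s = gmod_hom_simps[OF \<phi>, simplified]
  have \<phi>0: "\<phi> \<zero>\<^bsub>A\<^esub> = 0" using \<phi>s(3)[of 0 "\<zero>\<^bsub>A\<^esub>"] A.smult_l_null[of "\<zero>\<^bsub>A\<^esub>"] by simp
  have i0: "i \<zero>\<^bsub>A\<^esub> = \<zero>\<^bsub>B\<^esub>" using ih(2)[of "\<zero>\<^bsub>A\<^esub>" "\<zero>\<^bsub>A\<^esub>"] ih(1)[of "\<zero>\<^bsub>A\<^esub>"] by simp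
  obtain S where S: "A.root S" "A.exhausts S" using A.F_finite_root[OF A] by auto
  note Sc = A.root_carrier[OF S(1)]
  define K where "K = {x \<in> carrier A. i x = \<zero>\<^bsub>B\<^esub>}"
  have Kadd: "x \<oplus>\<^bsub>A\<^esub> y \<in> K" if "x \<in> K" "y \<in> K" for x y using that by (auto simp: K_def ih)
  have Ksm: "a \<odot>\<^bsub>A\<^esub> x \<in> K" if "a \<in> carrier R" "x \<in> K" for a x using that by (auto simp: K_def ih)
  have Kfr: "A.fr x \<in> K" if "x \<in> K" for x using that by (auto simp: K_def ifr A.fr_closed B.fr_zero)
  have iq: "i (A.fq j y) = B.fq j (i y)" if j: "j \<in> fidx" and y: "y \<in> carrier A" for j y
    using y
  proof (induction y rule: A.fr_induct)
    case (fr r c)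
    then show ?case using j by (simp add: A.fq_fr B.fq_fr ih ifr A.fr_closed fcoord_closed)
  next
    case (add y z)
    then show ?case using j by (simp add: A.fq_add B.fq_add A.fq_closed ih)
  qed
  have Kq: "A.fq j y \<in> K" if "j \<in> fidx" "y \<in> K" for j y
    using that by (auto simp: K_def iq A.fq_closed B.fq_zero)
  \<comment> \<open>The part of the kernel that lies in the root and in degree \<open>d\<close>, a
    finite-dimensional space over the field.\<close>
  define V where "V d = K \<inter> (A.iter 0 S \<inter> hcomp A d)" for d
  have Vq: "A.fq j u \<in> V e \<or> A.fq j u = \<zero>\<^bsub>A\<^esub>"
    if j: "j \<in> fidx" and u: "u \<in> V d" and e: "int p * e + int (mdeg (snd j)) = d" for j u d e
  proof -
    have "u \<in> A.iter (Suc 0) S" using u A.iter_mono[OF S(1), of 0 "Suc 0"] by (auto simp: V_def)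
    then show ?thesis using A.fq_iter[OF Sc j, of u 0] A.fq_degree[OF j _ e, of u] Kq[OF j] u by (auto simp: V_def)
  qed
  \<comment> \<open>The window is stable under coordinates: \<open>0 \<le> mdeg (snd j)\<close>
    gives the upper bound, and \<open>mdeg (snd j) \<le> n (p - 1)\<close> the lower one.\<close>
  have range: "- int n \<le> e \<and> e \<le> 0"
    if j: "j \<in> fidx" and d: "- int n \<le> d" "d \<le> 0" and e: "int p * e + int (mdeg (snd j)) = d" for j d e
  proof
    have "mdeg (snd j) \<le> n * (p - 1)" using j mdeg_mbox[of "snd j" n p] by (auto simp: fidx_def)
    then have "int (mdeg (snd j)) \<le> int n * (int p - 1)" using p_pos
      by (metis One_nat_def Suc_leI of_nat_1 of_nat_diff of_nat_le_iff of_nat_mult)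
    then have "int p * (- int n) \<le> int p * e" using e d(1) by (simp add: algebra_simps)
    then show "- int n \<le> e" by (rule mult_left_le_imp_le) (use p_pos in simp)
    have "int p * e \<le> 0" using e d(2) by linarith
    then show "e \<le> 0" using p_pos by (simp add: mult_le_0_iff)
  qed
  have "\<exists>T\<subseteq>V d. finite T \<and> V d \<subseteq> lspan scalars A T" for d
  proof -
    obtain T where T: "finite T" "T \<subseteq> carrier A" "A.iter 0 S \<inter> hcomp A d \<subseteq> lspan scalars A T"
      using A.component_finite[OF S(1)] by blast
    show ?thesis
    proof (rule A.lspan_subspace_finite[OF _ _ _ _ _ _ _ T(1,2)])
      show "V d \<subseteq> lspan scalars A T" using T(3) by (auto simp: V_def)
      show "x \<oplus>\<^bsub>A\<^esub> y \<in> V d" if "x \<in> V d" "y \<in> V d" for x y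
        using that Kadd A.iter_add[OF Sc] A.hcomp_add by (auto simp: V_def)
      show "a \<odot>\<^bsub>A\<^esub> x \<in> V d" if a: "a \<in> scalars" and x: "x \<in> V d" for a x
      proof -
        have ac: "a \<in> carrier R" "a \<in> rcomp R 0" using a by (auto simp: scalars_def in_rcomp split: if_splits)
        have "a \<odot>\<^bsub>A\<^esub> x \<in> hcomp A (0 + d)" using x ac by (intro A.hcomp_smult) (auto simp: V_def)
        then show ?thesis using x ac Ksm A.iter_smult[OF Sc] by (auto simp: V_def)
      qed
      show "\<ominus>\<^bsub>R\<^esub> a \<in> scalars" if "a \<in> scalars" for a
        using scalars_closed(6)[OF that] subsetD[OF scalars_closed(1) that] by simp
    qed (use scalars_closed in auto)
  qed
  then obtain T where T: "\<And>d. T d \<subseteq> V d" "\<And>d. finite (T d)" "\<And>d. V d \<subseteq> lspan scalars A (T d)" by metis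
  \<comment> \<open>Bounding the degrees on both sides keeps \<open>U\<close> finite, and the bounds
    are those that coordinates respect.\<close>
  define U where "U = (\<Union>d\<in>{- int n..0}. T d)"
  have UV: "\<exists>d. - int n \<le> d \<and> d \<le> 0 \<and> u \<in> V d" if u: "u \<in> U" for u
  proof -
    obtain d where "- int n \<le> d" "d \<le> 0" "u \<in> T d" using u by (auto simp: U_def)
    then show ?thesis using T(1)[of d] by blast
  qed
  have Uc: "U \<subseteq> carrier A" using UV by (auto simp: V_def K_def)
  have VU: "V d \<subseteq> A.iter 0 U" if "- int n \<le> d" "d \<le> 0" for d
  proof -
    have TU: "T d \<subseteq> U" using that by (auto simp: U_def)
    have "lspan scalars A (T d) \<subseteq> lspan (carrier R) A U"
    proof (rule lspan_least)
      fix a :: "'k mpol" and x assume a: "a \<in> scalars" and x: "x \<in> T d"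
      have "x \<in> lspan (carrier R) A U" using x TU by (intro A.lspan_incl[OF _ _ Uc]) auto
      then show "a \<odot>\<^bsub>A\<^esub> x \<in> lspan (carrier R) A U"
        using subsetD[OF scalars_closed(1) a] by (intro A.lspan_smult[OF _ Uc]) auto
    qed (auto intro: lspan_zero A.lspan_add[OF _ Uc])
    then show ?thesis using T(3) by (auto simp: A.iter_def)
  qed
  \<comment> \<open>Each coordinate of \<open>u\<close> is zero or lies in some \<open>V e\<close>
    of the window, hence in the span of \<open>U\<close>; expanding \<open>u\<close> in the basis
    then puts it on level \<open>1\<close>. This is the root condition.\<close>
  have "u \<in> A.iter 1 U" if u: "u \<in> U" for u
  proof (rule A.fq_finsum_closed)
    obtain d where d: "- int n \<le> d" "d \<le> 0" "u \<in> V d" using UV[OF u] by auto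
    show "u \<in> carrier A" using u Uc by auto
    fix j assume j: "j \<in> fidx"
    have "A.fq j u \<in> A.iter 0 U"
    proof (cases "\<exists>e. int p * e + int (mdeg (snd j)) = d")
      case True
      then obtain e where e: "int p * e + int (mdeg (snd j)) = d" by auto
      then show ?thesis using Vq[OF j d(3) e] VU range[OF j d(1,2) e] A.iter_zero by auto
    next
      case False
      then have "A.fq j u = \<zero>\<^bsub>A\<^esub>" using d(3) by (intro A.fq_degree_zero[OF j]) (auto simp: V_def)
      then show ?thesis using A.iter_zero by simp
    qed
    then show "fbasis j \<odot>\<^bsub>A\<^esub> A.fr (A.fq j u) \<in> A.iter 1 U"
      using A.fr_iter[OF Uc, of _ 0] A.iter_smult[OF Uc fbasis_carrier[OF j], of _ 1] by simp
  qed (use A.iter_zero A.iter_add[OF Uc] in auto)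
  moreover have "finite U" using T(2) by (auto simp: U_def)
  moreover have "\<forall>u\<in>U. \<exists>d. u \<in> hcomp A d" using UV by (auto simp: V_def)
  ultimately have rU: "A.root U" by (auto simp: A.root_def)
  obtain C :: "('k mpol, 'b) F_module" where C: "carrier C = (\<Union>e. A.iter e U)" "graded_F_finite p R C"
    "(\<lambda>x. x) \<in> F_hom p R C A" "(\<lambda>_. \<zero>\<^bsub>A\<^esub>) \<in> F_hom p R C A"
    using A.sub_F_module[OF rU] by blast
  have UK: "U \<subseteq> K" using UV by (auto simp: V_def)
  have Kz: "\<zero>\<^bsub>A\<^esub> \<in> K" by (simp add: K_def i0)
  have "(A.fr ^^ e) u \<in> K" if "u \<in> U" for e u using that UK by (induction e) (auto simp: Kfr)
  then have "A.iter e U \<subseteq> K" for e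
    unfolding A.iter_def using Kz Kadd Ksm by (intro lspan_least) blast+
  then have "\<forall>y\<in>carrier C. i y = i \<zero>\<^bsub>A\<^esub>" using C(1) by (auto simp: K_def i0)
  \<comment> \<open>On \<open>C\<close> the map \<open>i\<close> agrees after the inclusion and
    after the zero map, so a monomorphism makes these two equal.\<close>
  then have C0: "\<forall>y\<in>carrier C. y = \<zero>\<^bsub>A\<^esub>"
    using i C(2,3,4) unfolding F_finite_mono_def by blast
  have V0: "V d \<subseteq> {\<zero>\<^bsub>A\<^esub>}" if "- int n \<le> d" "d \<le> 0" for d
    using VU[OF that] C0 C(1) by blast
  \<comment> \<open>Coordinates lower the level by one and stay in the kernel and the window, so the
    vanishing on level \<open>0\<close> spreads upwards; the passage back uses that
    \<open>\<phi>\<close> commutes with the Frobenius actions.\<close>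
  have van: "\<phi> y = 0" if "y \<in> K \<inter> (A.iter e S \<inter> hcomp A d)" "- int n \<le> d" "d \<le> 0" for e y d
    using that
  proof (induction e arbitrary: y d)
    case 0
    then have "y = \<zero>\<^bsub>A\<^esub>" using V0[of d] by (auto simp: V_def)
    then show ?case by (simp add: \<phi>0)
  next
    case (Suc e)
    show ?case
    proof (rule A.fq_finsum_closed[of y "\<lambda>y. \<phi> y = 0"])
      show yc: "y \<in> carrier A" using Suc.prems by (auto simp: K_def)
      fix j assume j: "j \<in> fidx"
      have "\<phi> (A.fq j y) = 0"
      proof (cases "\<exists>e'. int p * e' + int (mdeg (snd j)) = d")
        case True
        then obtain e' where e': "int p * e' + int (mdeg (snd j)) = d" by auto
        have "A.fq j y \<in> K \<inter> (A.iter e S \<inter> hcomp A e')"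
          using Suc.prems(1) Kq[OF j] A.fq_iter[OF Sc j] A.fq_degree[OF j _ e'] by auto
        then show ?thesis using Suc.IH range[OF j Suc.prems(2,3) e'] by blast
      next
        case False
        then have "A.fq j y = \<zero>\<^bsub>A\<^esub>" using Suc.prems(1) by (intro A.fq_degree_zero[OF j]) auto
        then show ?thesis by (simp add: \<phi>0)
      qed
      then show "\<phi> (fbasis j \<odot>\<^bsub>A\<^esub> A.fr (A.fq j y)) = 0"
        using j yc by (simp add: \<phi>s fbasis_carrier A.fr_closed A.fq_closed \<phi>f efrob_def)
    qed (auto simp: \<phi>0 \<phi>s)
  qed
  show "\<phi> x = 0"
  proof (rule poly_mapping_eqI)
    fix m
    have \<phi>x: "\<phi> x \<in> carrier R" using x \<phi>s(1) by simp
    show "Poly_Mapping.lookup (\<phi> x) m = Poly_Mapping.lookup 0 m"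
    proof (cases "Poly_Mapping.keys m \<subseteq> {..<n}")
      case False
      then have "m \<notin> Poly_Mapping.keys (\<phi> x)" using \<phi>x by (auto simp: in_poly_ring)
      then show ?thesis by (simp add: in_keys_iff)
    next
      case True
      \<comment> \<open>The coefficient of \<open>\<phi> x\<close> at \<open>m\<close> is the
        constant coefficient of \<open>\<phi> (x^m x)\<close>, and that depends only on the part of
        degree \<open>-n\<close>.\<close>
      let ?y = "Poly_Mapping.single m 1 \<odot>\<^bsub>A\<^esub> x"
      have m: "Poly_Mapping.single m 1 \<in> carrier R" using True by simp
      have yc: "?y \<in> carrier A" using m x by simp
      have yK: "?y \<in> K" using Ksm[OF m, of x] x by (simp add: K_def)
      let ?z = "A.hpart (- int n) ?y"
      have "i ?z = B.hpart (- int n) (i ?y)"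
        using gmod_hom_hpart[OF A.graded_module_axioms B.graded_module_axioms ig yc] by simp
      then have zK: "?z \<in> K" using yK yc by (auto simp: K_def)
      obtain e where "?y \<in> A.iter e S" using S(2) yc by (auto simp: A.exhausts_def)
      then have "\<phi> ?z = 0"
        using van[of ?z e "- int n"] zK A.iter_hpart[OF S(1)] A.hpart_props(1)[OF yc] by auto
      then have "graded_module.hpart (inv_system n) (- int n) (\<phi> ?y) = 0"
        using gmod_hom_hpart[OF A.graded_module_axioms graded_module_inv_system \<phi> yc] by simp
      then have "Poly_Mapping.lookup (\<phi> ?y) 0 = 0"
        using hpart_inv_system[of "\<phi> ?y" n "- int n" 0] \<phi>s(1)[OF yc] by simp
      then show ?thesis using \<phi>s(3)[OF m x(1)] by simp
    qed
  qed
qed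

end


section \<open>Injectivity among graded modules\<close>

lemma scalar_smult:
  fixes M :: "('k::field mpol, 'b, 'z) graded_module_scheme"
  assumes "graded_module (poly_ring n) M" "x \<in> carrier M"
  shows "Poly_Mapping.single 0 a \<odot>\<^bsub>M\<^esub> (Poly_Mapping.single 0 b \<odot>\<^bsub>M\<^esub> x) = Poly_Mapping.single 0 (a * b) \<odot>\<^bsub>M\<^esub> x"
    and "Poly_Mapping.single 0 a \<odot>\<^bsub>M\<^esub> x \<oplus>\<^bsub>M\<^esub> Poly_Mapping.single 0 b \<odot>\<^bsub>M\<^esub> x = Poly_Mapping.single 0 (a + b) \<odot>\<^bsub>M\<^esub> x"
    and "Poly_Mapping.single 0 1 \<odot>\<^bsub>M\<^esub> x = x" and "Poly_Mapping.single 0 0 \<odot>\<^bsub>M\<^esub> x = \<zero>\<^bsub>M\<^esub>"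
    and "Poly_Mapping.single 0 (a :: 'k) \<odot>\<^bsub>M\<^esub> x \<in> carrier M"
proof -
  interpret graded_module "poly_ring n :: 'k mpol graded_ring" M by fact
  show "Poly_Mapping.single 0 a \<odot>\<^bsub>M\<^esub> (Poly_Mapping.single 0 b \<odot>\<^bsub>M\<^esub> x) = Poly_Mapping.single 0 (a * b) \<odot>\<^bsub>M\<^esub> x"
    using smult_assoc1[of "Poly_Mapping.single 0 a" "Poly_Mapping.single 0 b" x] assms by (simp add: mult_single)
  show "Poly_Mapping.single 0 a \<odot>\<^bsub>M\<^esub> x \<oplus>\<^bsub>M\<^esub> Poly_Mapping.single 0 b \<odot>\<^bsub>M\<^esub> x = Poly_Mapping.single 0 (a + b) \<odot>\<^bsub>M\<^esub> x"
    using smult_l_distr[of "Poly_Mapping.single 0 a" "Poly_Mapping.single 0 b" x] assms by (simp add: single_add)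
  show "Poly_Mapping.single 0 1 \<odot>\<^bsub>M\<^esub> x = x" "Poly_Mapping.single 0 0 \<odot>\<^bsub>M\<^esub> x = \<zero>\<^bsub>M\<^esub>"
    using smult_one[of x] smult_l_null[of x] assms by auto
  show "Poly_Mapping.single 0 a \<odot>\<^bsub>M\<^esub> x \<in> carrier M" using assms by simp
qed

text \<open>Extension of linear functionals by Zorn's lemma, the field acting through the constants
  of \<open>R\<close>. Partial functionals are handled as graphs, so that a chain has its union as
  upper bound.\<close>

lemma extend_functional:
  fixes B :: "('k::field mpol, 'b, 'z) graded_module_scheme" and \<mu> :: "'b \<Rightarrow> 'k"
  assumes B: "graded_module (poly_ring n) B" and D: "D \<subseteq> carrier B" "\<zero>\<^bsub>B\<^esub> \<in> D"
    and Dadd: "\<And>x y. x \<in> D \<Longrightarrow> y \<in> D \<Longrightarrow> x \<oplus>\<^bsub>B\<^esub> y \<in> D"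
    and Dsm: "\<And>c x. x \<in> D \<Longrightarrow> Poly_Mapping.single 0 c \<odot>\<^bsub>B\<^esub> x \<in> D"
    and \<mu>add: "\<And>x y. x \<in> D \<Longrightarrow> y \<in> D \<Longrightarrow> \<mu> (x \<oplus>\<^bsub>B\<^esub> y) = \<mu> x + \<mu> y"
    and \<mu>sm: "\<And>c x. x \<in> D \<Longrightarrow> \<mu> (Poly_Mapping.single 0 c \<odot>\<^bsub>B\<^esub> x) = c * \<mu> x"
  obtains \<Lambda> where "\<And>x y. x \<in> carrier B \<Longrightarrow> y \<in> carrier B \<Longrightarrow> \<Lambda> (x \<oplus>\<^bsub>B\<^esub> y) = \<Lambda> x + \<Lambda> y"
    "\<And>c x. x \<in> carrier B \<Longrightarrow> \<Lambda> (Poly_Mapping.single 0 c \<odot>\<^bsub>B\<^esub> x) = c * \<Lambda> x"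
    "\<And>x. x \<in> D \<Longrightarrow> \<Lambda> x = \<mu> x"
proof -
  interpret graded_module "poly_ring n :: 'k mpol graded_ring" B by (rule B)
  note sc = scalar_smult[OF B]
  let ?s = "\<lambda>c x. Poly_Mapping.single 0 (c :: 'k) \<odot>\<^bsub>B\<^esub> x"
  have sadd: "?s c (x \<oplus>\<^bsub>B\<^esub> y) = ?s c x \<oplus>\<^bsub>B\<^esub> ?s c y" if "x \<in> carrier B" "y \<in> carrier B" for c x y
    using that by (simp add: smult_r_distr)
  define G0 where "G0 = (\<lambda>x. (x, \<mu> x)) ` D"
  \<comment> \<open>Single-valuedness is imposed only at zero; for a graph closed under sums and
    scalars this suffices.\<close>
  define \<G> where "\<G> = {G. G0 \<subseteq> G \<and> G \<subseteq> carrier B \<times> UNIV \<and>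
     (\<forall>x a y b. (x, a) \<in> G \<and> (y, b) \<in> G \<longrightarrow> (x \<oplus>\<^bsub>B\<^esub> y, a + b) \<in> G) \<and>
     (\<forall>c x a. (x, a) \<in> G \<longrightarrow> (?s c x, c * a) \<in> G) \<and> (\<forall>a. (\<zero>\<^bsub>B\<^esub>, a) \<in> G \<longrightarrow> a = 0)}"
  have \<mu>0: "\<mu> \<zero>\<^bsub>B\<^esub> = 0" using \<mu>sm[OF D(2), of 0] by simp
  have "G0 \<in> \<G>"
    using D \<mu>0 by (auto simp: \<G>_def G0_def Dadd Dsm \<mu>add \<mu>sm)
  then have ne: "\<G> \<noteq> {}" by auto
  have "\<exists>G\<in>\<G>. \<forall>X\<in>\<G>. G \<subseteq> X \<longrightarrow> X = G"
  proof (rule subset_Zorn_nonempty[OF ne])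
    fix C assume C: "C \<noteq> {}" "subset.chain \<G> C"
    then have CG: "G \<in> \<G>" if "G \<in> C" for G using that by (auto simp: subset.chain_def)
    have two: "\<exists>G\<in>C. u \<in> G \<and> v \<in> G" if uv: "u \<in> \<Union>C" "v \<in> \<Union>C" for u v
    proof -
      obtain G1 G2 where G: "G1 \<in> C" "G2 \<in> C" "u \<in> G1" "v \<in> G2" using uv by blast
      then have "G1 \<subseteq> G2 \<or> G2 \<subseteq> G1" using C(2) by (auto simp: subset_chain_def)
      then show ?thesis using G by blast
    qed
    show "\<Union>C \<in> \<G>"
      unfolding \<G>_def
    proof (intro CollectI conjI allI impI)
      have sub: "G0 \<subseteq> G" "G \<subseteq> carrier B \<times> UNIV" if "G \<in> C" for G
        using CG[OF that] unfolding \<G>_def by blast+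
      show "G0 \<subseteq> \<Union>C" using C(1) sub(1) by blast
      show "\<Union>C \<subseteq> carrier B \<times> UNIV" by (rule Union_least) (rule sub(2))
      show "(x \<oplus>\<^bsub>B\<^esub> y, a + b) \<in> \<Union>C" if xy: "(x, a) \<in> \<Union>C \<and> (y, b) \<in> \<Union>C" for x a y b
      proof -
        obtain G where G: "G \<in> C" "(x, a) \<in> G" "(y, b) \<in> G" using two xy by blast
        then have "(x \<oplus>\<^bsub>B\<^esub> y, a + b) \<in> G" using CG[OF G(1)] unfolding \<G>_def by blast
        then show ?thesis using G(1) by blast
      qed
      show "(?s c x, c * a) \<in> \<Union>C" if xa: "(x, a) \<in> \<Union>C" for c x a
      proof -
        obtain G where G: "G \<in> C" "(x, a) \<in> G" using xa by blast
        then have "(?s c x, c * a) \<in> G" using CG[OF G(1)] unfolding \<G>_def by blast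
        then show ?thesis using G(1) by blast
      qed
      show "a = 0" if xa: "(\<zero>\<^bsub>B\<^esub>, a) \<in> \<Union>C" for a
      proof -
        obtain G where G: "G \<in> C" "(\<zero>\<^bsub>B\<^esub>, a) \<in> G" using xa by blast
        then show ?thesis using CG[OF G(1)] unfolding \<G>_def by blast
      qed
    qed
  qed
  then obtain G where G: "G \<in> \<G>" and max: "\<And>X. X \<in> \<G> \<Longrightarrow> G \<subseteq> X \<Longrightarrow> X = G" by blast
  have G0: "G0 \<subseteq> G" and Gc: "\<And>x a. (x, a) \<in> G \<Longrightarrow> x \<in> carrier B"
    and Gadd: "\<And>x a y b. (x, a) \<in> G \<Longrightarrow> (y, b) \<in> G \<Longrightarrow> (x \<oplus>\<^bsub>B\<^esub> y, a + b) \<in> G"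
    and Gsm: "\<And>c x a. (x, a) \<in> G \<Longrightarrow> (?s c x, c * a) \<in> G"
    and Gsv: "\<And>a. (\<zero>\<^bsub>B\<^esub>, a) \<in> G \<Longrightarrow> a = 0"
    using G unfolding \<G>_def by blast+
  have Gz: "(\<zero>\<^bsub>B\<^esub>, 0) \<in> G" using G0 D(2) \<mu>0 by (force simp: G0_def)
  have neg: "x \<oplus>\<^bsub>B\<^esub> ?s (- 1) x = \<zero>\<^bsub>B\<^esub>" if "x \<in> carrier B" for x
    using sc(2)[OF that, of 1 "- 1"] sc(3,4)[OF that] by simp
  have uniq: "a = b" if "(x, a) \<in> G" "(x, b) \<in> G" for x a b
  proof -
    have "(x \<oplus>\<^bsub>B\<^esub> ?s (- 1) x, a + (- 1) * b) \<in> G" using Gadd Gsm that by blast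
    then show ?thesis using Gsv[of "a + (- 1) * b"] neg[OF Gc[OF that(1)]] by simp
  qed
  have total: "\<exists>a. (y, a) \<in> G" if y: "y \<in> carrier B" for y
  proof (rule ccontr)
    assume no: "\<nexists>a. (y, a) \<in> G"
    \<comment> \<open>The new vector \<open>y\<close> is adjoined with value \<open>0\<close>; any
      value would give an extension.\<close>
    define G' where "G' = {(x \<oplus>\<^bsub>B\<^esub> ?s c y, a) | x c a. (x, a) \<in> G}"
    have GG': "G \<subseteq> G'"
    proof
      fix u assume u: "u \<in> G"
      obtain x a where xa: "u = (x, a)" by (cases u)
      have "x \<oplus>\<^bsub>B\<^esub> ?s 0 y = x" using sc(4)[OF y] Gc[of x a] u by (simp add: xa)
      then show "u \<in> G'" using u unfolding G'_def xa by (metis (mono_tags, lifting) mem_Collect_eq)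
    qed
    have "G' \<in> \<G>"
      unfolding \<G>_def
    proof (intro CollectI conjI allI impI)
      show "G0 \<subseteq> G'" using G0 GG' by blast
      show "G' \<subseteq> carrier B \<times> UNIV" using Gc sc(5)[OF y] by (auto simp: G'_def)
    next
      fix x a x' a' assume "(x, a) \<in> G' \<and> (x', a') \<in> G'"
      then obtain z c z' c' where z: "(z, a) \<in> G" "x = z \<oplus>\<^bsub>B\<^esub> ?s c y" "(z', a') \<in> G" "x' = z' \<oplus>\<^bsub>B\<^esub> ?s c' y"
        unfolding G'_def by blast
      have zc: "z \<in> carrier B" "z' \<in> carrier B" using Gc z by auto
      have "x \<oplus>\<^bsub>B\<^esub> x' = (z \<oplus>\<^bsub>B\<^esub> z') \<oplus>\<^bsub>B\<^esub> (?s c y \<oplus>\<^bsub>B\<^esub> ?s c' y)"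
        unfolding z using zc sc(5)[OF y] by (simp only: M.add.m_ac M.a_closed)
      then have "x \<oplus>\<^bsub>B\<^esub> x' = (z \<oplus>\<^bsub>B\<^esub> z') \<oplus>\<^bsub>B\<^esub> ?s (c + c') y" by (simp only: sc(2)[OF y])
      moreover have "(z \<oplus>\<^bsub>B\<^esub> z', a + a') \<in> G" by (rule Gadd[OF z(1,3)])
      ultimately show "(x \<oplus>\<^bsub>B\<^esub> x', a + a') \<in> G'" unfolding G'_def by blast
    next
      fix c x a assume "(x, a) \<in> G'"
      then obtain z c' where z: "(z, a) \<in> G" "x = z \<oplus>\<^bsub>B\<^esub> ?s c' y" unfolding G'_def by blast
      have "?s c x = ?s c z \<oplus>\<^bsub>B\<^esub> ?s (c * c') y"
        unfolding z by (simp only: sadd[OF Gc[OF z(1)] sc(5)[OF y]] sc(1)[OF y])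
      moreover have "(?s c z, c * a) \<in> G" by (rule Gsm[OF z(1)])
      ultimately show "(?s c x, c * a) \<in> G'" unfolding G'_def by blast
    next
      fix a assume "(\<zero>\<^bsub>B\<^esub>, a) \<in> G'"
      then obtain z c where z: "(z, a) \<in> G" "\<zero>\<^bsub>B\<^esub> = z \<oplus>\<^bsub>B\<^esub> ?s c y" unfolding G'_def by blast
      have zc: "z \<in> carrier B" using Gc z by auto
      \<comment> \<open>With \<open>c\<close> invertible, \<open>y\<close> would be a multiple of
        \<open>z\<close> and already belong to the domain of \<open>G\<close>.\<close>
      have "c = 0"
      proof (rule ccontr)
        assume c: "c \<noteq> 0"
        have "?s (- 1) z = ?s (- 1) z \<oplus>\<^bsub>B\<^esub> (z \<oplus>\<^bsub>B\<^esub> ?s c y)" using sc(5)[OF zc] by (simp add: z(2)[symmetric])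
        also have "\<dots> = (z \<oplus>\<^bsub>B\<^esub> ?s (- 1) z) \<oplus>\<^bsub>B\<^esub> ?s c y"
          using zc sc(5)[OF zc] sc(5)[OF y] by (simp only: M.add.m_ac M.a_closed)
        also have "\<dots> = ?s c y" using neg[OF zc] sc(5)[OF y] by simp
        finally have "?s (inverse c) (?s (- 1) z) = ?s (inverse c) (?s c y)" by simp
        then have "y = ?s (inverse c * (- 1)) z" using sc(1)[OF y] sc(1)[OF zc] sc(3)[OF y] c by simp
        then have "(y, inverse c * (- 1) * a) \<in> G" using Gsm[OF z(1), of "inverse c * (- 1)"] by simp
        then show False using no by blast
      qed
      then have "?s c y = \<zero>\<^bsub>B\<^esub>" by (simp only: sc(4)[OF y])
      then have "z = \<zero>\<^bsub>B\<^esub>" using z(2) M.r_zero[OF zc] by metis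
      then show "a = 0" using z(1) Gsv by simp
    qed
    then have "G' = G" using max GG' by blast
    moreover have "(\<zero>\<^bsub>B\<^esub> \<oplus>\<^bsub>B\<^esub> ?s 1 y, 0) \<in> G'" unfolding G'_def using Gz by blast
    then have "(y, 0) \<in> G'" using sc(3)[OF y] y by simp
    ultimately show False using no by blast
  qed
  define \<Lambda> where "\<Lambda> y = (THE a. (y, a) \<in> G)" for y
  have \<Lambda>: "\<Lambda> y = a" if "(y, a) \<in> G" for y a
    unfolding \<Lambda>_def using that uniq by blast
  show thesis
  proof (rule that[of \<Lambda>])
    fix x y assume "x \<in> carrier B" "y \<in> carrier B"
    then obtain a b where "(x, a) \<in> G" "(y, b) \<in> G" using total by blast
    then show "\<Lambda> (x \<oplus>\<^bsub>B\<^esub> y) = \<Lambda> x + \<Lambda> y" using \<Lambda> Gadd by metis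
  next
    fix c x assume "x \<in> carrier B"
    then obtain a where "(x, a) \<in> G" using total by blast
    then show "\<Lambda> (?s c x) = c * \<Lambda> x" using \<Lambda> Gsm by metis
  next
    fix x assume "x \<in> D"
    then have "(x, \<mu> x) \<in> G" using G0 by (auto simp: G0_def)
    then show "\<Lambda> x = \<mu> x" by (rule \<Lambda>)
  qed
qed

text \<open>Graded homomorphisms to the inverse system are the \<open>k\<close>-linear functionals on the component of
  degree \<open>-n\<close>; extending functionals extends homomorphisms.\<close>

lemma extend_hom:
  fixes B :: "('k::field mpol, 'b, 'z) graded_module_scheme"
  assumes B: "graded_module (poly_ring n) B" and D: "D \<subseteq> carrier B" "\<zero>\<^bsub>B\<^esub> \<in> D"
    and Dadd: "\<And>x y. x \<in> D \<Longrightarrow> y \<in> D \<Longrightarrow> x \<oplus>\<^bsub>B\<^esub> y \<in> D"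
    and Dsm: "\<And>a x. a \<in> carrier (poly_ring n) \<Longrightarrow> x \<in> D \<Longrightarrow> a \<odot>\<^bsub>B\<^esub> x \<in> D"
    and Dhp: "\<And>x d. x \<in> D \<Longrightarrow> graded_module.hpart B d x \<in> D"
    and g: "g \<in> gmod_hom (poly_ring n) (subgmodule B D) (inv_system n)"
  shows "\<exists>\<mu>\<in>gmod_hom (poly_ring n) B (inv_system n). \<forall>x\<in>D. \<mu> x = g x"
proof -
  interpret graded_module "poly_ring n :: 'k mpol graded_ring" B by (rule B)
  have gD: "graded_module (poly_ring n) (subgmodule B D)"
    by (rule graded_module_subgmodule[OF rcomp_carrier D Dadd Dsm Dhp])
  interpret D: graded_module "poly_ring n :: 'k mpol graded_ring" "subgmodule B D" by (rule gD)
  have gc: "g x \<in> carrier (poly_ring n)" if "x \<in> D" for x using gmod_hom_simps(1)[OF g, of x] that by simp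
  have ga: "g (x \<oplus>\<^bsub>B\<^esub> y) = g x + g y" if "x \<in> D" "y \<in> D" for x y
    using gmod_hom_simps(2)[OF g, of x y] that by simp
  have gs: "g (a \<odot>\<^bsub>B\<^esub> x) = contract a (g x)" if "a \<in> carrier (poly_ring n)" "x \<in> D" for a x
    using gmod_hom_simps(3)[OF g, of a x] that by simp
  obtain \<Lambda> where \<Lambda>a: "\<And>x y. x \<in> carrier B \<Longrightarrow> y \<in> carrier B \<Longrightarrow> \<Lambda> (x \<oplus>\<^bsub>B\<^esub> y) = \<Lambda> x + \<Lambda> y"
    and \<Lambda>s: "\<And>c x. x \<in> carrier B \<Longrightarrow> \<Lambda> (Poly_Mapping.single 0 c \<odot>\<^bsub>B\<^esub> x) = c * \<Lambda> x"
    and \<Lambda>g: "\<And>x. x \<in> D \<Longrightarrow> \<Lambda> x = Poly_Mapping.lookup (g x) 0"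
    by (rule extend_functional[OF B D Dadd, of "\<lambda>x. Poly_Mapping.lookup (g x) 0"])
       (auto simp: Dsm ga gs lookup_add)
  have \<Lambda>0: "\<Lambda> \<zero>\<^bsub>B\<^esub> = 0" using \<Lambda>s[of "\<zero>\<^bsub>B\<^esub>" 0] smult_l_null[of "\<zero>\<^bsub>B\<^esub>"] by simp
  let ?X = "\<lambda>m. Poly_Mapping.single m (1 :: 'k)"
  \<comment> \<open>Contraction by \<open>x^m\<close> moves the coefficient at \<open>m\<close> to
    the constant term, so linearity forces the coefficient of \<open>\<mu> y\<close> at
    \<open>m\<close> to be the functional applied to the part of \<open>x^m y\<close> in degree
    \<open>-n\<close>.\<close>
  define F where "F y m = (if Poly_Mapping.keys m \<subseteq> {..<n} then \<Lambda> (hpart (- int n) (?X m \<odot>\<^bsub>B\<^esub> y)) else 0)" for y m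
  have shift: "hpart (- int n) (?X m \<odot>\<^bsub>B\<^esub> y) = ?X m \<odot>\<^bsub>B\<^esub> hpart (- int n - int (mdeg m)) y"
    if m: "Poly_Mapping.keys m \<subseteq> {..<n}" and y: "y \<in> carrier B" for m y
    using hpart_smult[OF single_in_rcomp[OF m refl, of 1] _ y, of "- int n - int (mdeg m)"] m by simp
  \<comment> \<open>Only monomials \<open>m\<close> for which \<open>y\<close> has a part in degree
    \<open>-n - mdeg m\<close> contribute, and \<open>y\<close> has finitely many parts.\<close>
  have fin: "finite {m. F y m \<noteq> 0}" if y: "y \<in> carrier B" for y
  proof -
    let ?I = "{d. hpart d y \<noteq> \<zero>\<^bsub>B\<^esub>}"
    have "{m. F y m \<noteq> 0} \<subseteq> (\<Union>d\<in>?I. {m. Poly_Mapping.keys m \<subseteq> {..<n} \<and> mdeg m = nat (- int n - d)})"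
    proof
      fix m assume "m \<in> {m. F y m \<noteq> 0}"
      then have m: "Poly_Mapping.keys m \<subseteq> {..<n}" and nz: "\<Lambda> (hpart (- int n) (?X m \<odot>\<^bsub>B\<^esub> y)) \<noteq> 0"
        by (auto simp: F_def split: if_splits)
      have "hpart (- int n - int (mdeg m)) y \<noteq> \<zero>\<^bsub>B\<^esub>"
        using nz m by (auto simp: shift[OF m y] \<Lambda>0)
      then show "m \<in> (\<Union>d\<in>?I. {m. Poly_Mapping.keys m \<subseteq> {..<n} \<and> mdeg m = nat (- int n - d)})"
        using m by (intro UN_I[of "- int n - int (mdeg m)"]) auto
    qed
    moreover have "finite \<dots>" using hpart_props(2)[OF y] finite_monomials by blast
    ultimately show ?thesis by (rule finite_subset)
  qed
  define \<mu> where "\<mu> y = Abs_poly_mapping (F y)" for y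
  have lm: "Poly_Mapping.lookup (\<mu> y) m = F y m" if "y \<in> carrier B" for y m
    using fin[OF that] by (simp add: \<mu>_def)
  have \<mu>c: "\<mu> y \<in> carrier (poly_ring n)" if y: "y \<in> carrier B" for y
    unfolding in_poly_ring
  proof
    fix m assume "m \<in> Poly_Mapping.keys (\<mu> y)"
    then have "F y m \<noteq> 0" by (simp add: in_keys_iff lm[OF y])
    then show "Poly_Mapping.keys m \<subseteq> {..<n}" unfolding F_def by presburger
  qed
  have \<mu>a: "\<mu> (x \<oplus>\<^bsub>B\<^esub> y) = \<mu> x + \<mu> y" if "x \<in> carrier B" "y \<in> carrier B" for x y
  proof (rule poly_mapping_eqI)
    fix m
    show "Poly_Mapping.lookup (\<mu> (x \<oplus>\<^bsub>B\<^esub> y)) m = Poly_Mapping.lookup (\<mu> x + \<mu> y) m"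
      using that by (cases "Poly_Mapping.keys m \<subseteq> {..<n}") (simp_all add: lookup_add lm F_def smult_r_distr hpart_add \<Lambda>a)
  qed
  have \<mu>s: "\<mu> (a \<odot>\<^bsub>B\<^esub> y) = contract a (\<mu> y)" if a: "a \<in> carrier (poly_ring n)" and y: "y \<in> carrier B" for a y
    using a
  proof (induction a rule: poly_ring_induct)
    case (single s c)
    have s: "Poly_Mapping.single s c \<in> carrier (poly_ring n)" using single by simp
    show ?case
    proof (rule poly_mapping_eqI)
      fix m
      show "Poly_Mapping.lookup (\<mu> (Poly_Mapping.single s c \<odot>\<^bsub>B\<^esub> y)) m =
          Poly_Mapping.lookup (contract (Poly_Mapping.single s c) (\<mu> y)) m"
      proof (cases "Poly_Mapping.keys m \<subseteq> {..<n}")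
        case True
        have k: "Poly_Mapping.keys (m + s) \<subseteq> {..<n}" using True single by (simp add: keys_plus_nat)
        have "?X m \<odot>\<^bsub>B\<^esub> (Poly_Mapping.single s c \<odot>\<^bsub>B\<^esub> y) = Poly_Mapping.single 0 c \<odot>\<^bsub>B\<^esub> (?X (m + s) \<odot>\<^bsub>B\<^esub> y)"
          using smult_assoc1[of "?X m" "Poly_Mapping.single s c" y]
            smult_assoc1[of "Poly_Mapping.single 0 c" "?X (m + s)" y] True k s y by (simp add: mult_single)
        moreover have "hpart (0 + - int n) (Poly_Mapping.single 0 c \<odot>\<^bsub>B\<^esub> (?X (m + s) \<odot>\<^bsub>B\<^esub> y)) =
            Poly_Mapping.single 0 c \<odot>\<^bsub>B\<^esub> hpart (- int n) (?X (m + s) \<odot>\<^bsub>B\<^esub> y)"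
          using k y by (intro hpart_smult single_in_rcomp) auto
        ultimately show ?thesis using True k y s by (simp add: lm F_def \<Lambda>s)
      next
        case False
        then have "\<not> Poly_Mapping.keys (m + s) \<subseteq> {..<n}" by (simp add: keys_plus_nat)
        then show ?thesis using False y s by (simp add: lm F_def)
      qed
    qed
  next
    case (add f h)
    then show ?case using smult_l_distr[of f h y] y by (simp add: contract_add_left \<mu>a)
  qed
  have \<mu>d: "\<mu> y \<in> hcomp (inv_system n) d" if y: "y \<in> hcomp B d" for y d
  proof -
    have yc: "y \<in> carrier B" using y by (rule hcomp_carrier)
    have "- int n - int (mdeg m) = d" if "m \<in> Poly_Mapping.keys (\<mu> y)" for m
    proof (rule ccontr)
      assume ne: "- int n - int (mdeg m) \<noteq> d"
      have "F y m = 0"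
        using ne by (cases "Poly_Mapping.keys m \<subseteq> {..<n}") (simp_all add: F_def shift yc hpart_homog[OF y] \<Lambda>0)
      then show False using that by (simp add: in_keys_iff lm[OF yc])
    qed
    then show ?thesis using \<mu>c[OF yc] by (simp add: in_hcomp_inv_system)
  qed
  have "\<mu> x = g x" if x: "x \<in> D" for x
  proof (rule poly_mapping_eqI)
    fix m
    have xc: "x \<in> carrier B" using x D by auto
    show "Poly_Mapping.lookup (\<mu> x) m = Poly_Mapping.lookup (g x) m"
    proof (cases "Poly_Mapping.keys m \<subseteq> {..<n}")
      case True
      have m: "?X m \<in> carrier (poly_ring n)" using True by simp
      have xD: "?X m \<odot>\<^bsub>B\<^esub> x \<in> D" by (rule Dsm[OF m x])
      let ?z = "?X m \<odot>\<^bsub>B\<^esub> x"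
      have "D.hpart (- int n) ?z = hpart (- int n) ?z"
      proof -
        have "(\<lambda>x. x) \<in> gmod_hom (poly_ring n) (subgmodule B D) B"
          using D by (auto simp: gmod_hom_def mod_hom_def)
        from gmod_hom_hpart[OF gD B this, of ?z] show ?thesis using xD by simp
      qed
      then have "g (hpart (- int n) ?z) = graded_module.hpart (inv_system n) (- int n) (g ?z)"
        using gmod_hom_hpart[OF gD graded_module_inv_system g, of ?z] xD by simp
      then have "Poly_Mapping.lookup (g (hpart (- int n) ?z)) 0 = Poly_Mapping.lookup (g ?z) 0"
        using hpart_inv_system[OF gc[OF xD], of "- int n" 0] by simp
      also have "\<dots> = Poly_Mapping.lookup (g x) m" by (simp add: gs[OF m x])
      finally show ?thesis using True by (simp add: lm[OF xc] F_def \<Lambda>g[OF Dhp[OF xD]])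
    next
      case False
      then have "m \<notin> Poly_Mapping.keys (g x)" using gc[OF x] by (auto simp: in_poly_ring)
      then show ?thesis using False by (simp add: lm[OF xc] F_def in_keys_iff)
    qed
  qed
  moreover have "\<mu> \<in> gmod_hom (poly_ring n) B (inv_system n)"
    using \<mu>c \<mu>a \<mu>s \<mu>d by (auto simp: gmod_hom_def mod_hom_def)
  ultimately show ?thesis by blast
qed


section \<open>Fixed points of the Frobenius pullback\<close>

text \<open>The values on \<open>X\<close> are vectors in a finite-dimensional space, so some vector
  of the sequence depends on its predecessors. The coordinates are eliminated one at a time.\<close>

lemma eventually_dependent:
  fixes \<nu> :: "nat \<Rightarrow> 'x \<Rightarrow> 'k::field"
  assumes "finite X"
  shows "\<exists>d a. \<forall>x\<in>X. \<nu> d x = (\<Sum>i<d. a i * \<nu> i x)"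
  using assms
proof (induction X arbitrary: \<nu> rule: finite_induct)
  case (insert y X)
  show ?case
  proof (cases "\<forall>i. \<nu> i y = 0")
    case True
    then show ?thesis using insert.IH[of \<nu>] by auto
  next
    case False
    then obtain k where k: "\<nu> k y \<noteq> 0" by auto
    \<comment> \<open>Subtracting \<open>r i\<close> times \<open>\<nu> k\<close> from the later
      vectors makes them vanish at \<open>y\<close>, and the induction hypothesis gives a relation
      among them on \<open>X\<close>.\<close>
    define r where "r i = \<nu> (Suc k + i) y / \<nu> k y" for i
    obtain d a where da: "\<And>x. x \<in> X \<Longrightarrow> \<nu> (Suc k + d) x - r d * \<nu> k x =
        (\<Sum>i<d. a i * (\<nu> (Suc k + i) x - r i * \<nu> k x))"
      using insert.IH[of "\<lambda>i x. \<nu> (Suc k + i) x - r i * \<nu> k x"] by blast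
    \<comment> \<open>Substituting the differences back collects all multiples of
      \<open>\<nu> k\<close> into this coefficient.\<close>
    define c where "c = r d - (\<Sum>i<d. a i * r i)"
    define b where "b j = (if j < k then 0 else if j = k then c else a (j - Suc k))" for j
    have split: "(\<Sum>j<Suc k + d. f j) = (\<Sum>j<k. f j) + f k + (\<Sum>i<d. f (Suc k + i))" for f :: "nat \<Rightarrow> 'k"
      by (induction d) (simp_all add: add.assoc)
    have sum: "(\<Sum>j<Suc k + d. b j * \<nu> j x) = c * \<nu> k x + (\<Sum>i<d. a i * \<nu> (Suc k + i) x)" for x
      unfolding split by (simp add: b_def)
    have "\<nu> (Suc k + d) x = (\<Sum>j<Suc k + d. b j * \<nu> j x)" if x: "x \<in> insert y X" for x
    proof -
      have "\<nu> (Suc k + d) x - r d * \<nu> k x = (\<Sum>i<d. a i * (\<nu> (Suc k + i) x - r i * \<nu> k x))"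
      proof (cases "x = y")
        case True
        have "\<nu> (Suc k + i) y - r i * \<nu> k y = 0" for i using k by (simp add: r_def)
        then show ?thesis using True by (simp only: mult_zero_right sum.neutral_const)
      next
        case False
        then show ?thesis using da x by simp
      qed
      also have "\<dots> = (\<Sum>i<d. a i * \<nu> (Suc k + i) x) - (\<Sum>i<d. a i * r i) * \<nu> k x"
        by (simp add: algebra_simps sum_subtractf sum_distrib_left)
      finally show ?thesis unfolding sum c_def by (simp add: algebra_simps)
    qed
    then show ?thesis by blast
  qed
qed simp

text \<open>The unknowns \<open>t i\<close> can be eliminated successively in favour of the last one, which is
  then a root of a polynomial with derivative \<open>-1\<close>.\<close>

lemma separably_closed_solution:
  fixes a :: "nat \<Rightarrow> 'k::field"
  assumes p: "p = CHAR('k)" "p > 0" and sc: "separably_closed TYPE('k)"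
  shows "\<exists>t. \<forall>N. N d = (\<Sum>i<d. a i * N i) \<longrightarrow>
    N 0 + (\<Sum>i<d. t i ^ p * N (Suc i)) = (\<Sum>i<d. t i * N i)"
proof (cases d)
  case (Suc k)
  \<comment> \<open>Replacing \<open>N d\<close> by its expression, with \<open>d = k + 1\<close>,
    and comparing coefficients of \<open>N i\<close> gives \<open>t_0 = 1 + a_0 t_k^p\<close> and
    \<open>t_(i+1) = t_i^p + a_(i+1) t_k^p\<close>. \<open>T i\<close> is \<open>t_i\<close> as a
    polynomial in \<open>t_k\<close>, and the case \<open>i = k\<close> is the one remaining
    equation.\<close>
  define T :: "nat \<Rightarrow> 'k poly" where
    "T = rec_nat (1 + smult (a 0) (monom 1 p)) (\<lambda>i q. q ^ p + smult (a (Suc i)) (monom 1 p))"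
  have T: "T 0 = 1 + smult (a 0) (monom 1 p)" "\<And>i. T (Suc i) = T i ^ p + smult (a (Suc i)) (monom 1 p)"
    by (simp_all add: T_def)
  have p0: "(of_nat p :: 'k) = 0" by (simp add: p(1))
  have "pderiv (T i) = 0" for i
    by (cases i) (simp_all add: T pderiv_add pderiv_smult pderiv_monom pderiv_power p0)
  then have d: "pderiv (T k - [:0, 1:]) = - 1" by (simp add: pderiv_diff pderiv_pCons one_pCons)
  have "degree (T k - [:0, 1:]) > 0"
  proof (rule ccontr)
    assume "\<not> ?thesis"
    then obtain c where "T k - [:0, 1:] = [:c:]" by (auto elim: degree_eq_zeroE)
    then show False using d by (simp add: pderiv_pCons)
  qed
  moreover have "coprime (T k - [:0, 1:]) (pderiv (T k - [:0, 1:]))"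
    unfolding d by (rule is_unit_right_imp_coprime) simp
  ultimately obtain s where "poly (T k - [:0, 1:]) s = 0" using sc unfolding separably_closed_def by blast
  then have s: "poly (T k) s = s" by simp
  define t where "t i = poly (T i) s" for i
  \<comment> \<open>\<open>u i\<close> is the coefficient of \<open>N i\<close> on the left-hand
    side apart from the term \<open>t_k^p * N d\<close>.\<close>
  define u where "u i = (case i of 0 \<Rightarrow> 1 | Suc i \<Rightarrow> t i ^ p)" for i
  have t: "t i = u i + a i * t k ^ p" for i
    by (cases i) (simp_all add: t_def u_def T s poly_monom)
  show ?thesis
  proof (intro exI[of _ t] allI impI)
    fix N assume N: "N d = (\<Sum>i<d. a i * N i)"
    have "t i * N i = u i * N i + t k ^ p * (a i * N i)" for i
      by (subst t[of i]) (simp only: distrib_right distrib_left mult_ac)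
    then have "(\<Sum>i<d. t i * N i) = (\<Sum>i<d. u i * N i) + t k ^ p * N d"
      unfolding N by (simp only: sum_distrib_left sum.distrib)
    also have "(\<Sum>i<d. u i * N i) = N 0 + (\<Sum>i<k. t i ^ p * N (Suc i))"
      unfolding Suc sum.lessThan_Suc_shift by (simp add: u_def)
    finally show "N 0 + (\<Sum>i<d. t i ^ p * N (Suc i)) = (\<Sum>i<d. t i * N i)" by (simp add: Suc)
  qed
qed simp

lemma single_zero_power: "Poly_Mapping.single 0 c ^ k = (Poly_Mapping.single 0 (c ^ k) :: 'k::field mpol)"
  by (induction k) (simp_all add: mult_single)

lemma inv_system_hcomp_closed:
  fixes g h :: "'k::field mpol"
  shows "g \<in> hcomp (inv_system n) d \<Longrightarrow> h \<in> hcomp (inv_system n) d \<Longrightarrow> g + h \<in> hcomp (inv_system n) d"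
    and "0 \<in> hcomp (inv_system n :: ('k mpol, 'k mpol) graded_module) d"
proof -
  interpret E: graded_module "poly_ring n :: 'k mpol graded_ring" "inv_system n" by (rule graded_module_inv_system)
  show "g \<in> hcomp (inv_system n) d \<Longrightarrow> h \<in> hcomp (inv_system n) d \<Longrightarrow> g + h \<in> hcomp (inv_system n) d"
    using E.hcomp_add[of g d h] by simp
  show "0 \<in> hcomp (inv_system n :: ('k mpol, 'k mpol) graded_module) d" by (simp add: in_hcomp_inv_system)
qed

lemma gmod_hom_comb:
  fixes A :: "('k::field mpol, 'b, 'z) graded_module_scheme"
  assumes "\<phi> \<in> gmod_hom (poly_ring n) A (inv_system n)" "\<psi> \<in> gmod_hom (poly_ring n) A (inv_system n)"
  shows "(\<lambda>x. \<phi> x + contract (Poly_Mapping.single 0 c) (\<psi> x)) \<in> gmod_hom (poly_ring n) A (inv_system n)"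
proof -
  note s = gmod_hom_simps[OF assms(1), simplified] gmod_hom_simps[OF assms(2), simplified]
  have c: "Poly_Mapping.single 0 c \<in> carrier (poly_ring n)" "Poly_Mapping.single 0 c \<in> rcomp (poly_ring n) 0"
    by (simp_all add: in_rcomp)
  have "contract (Poly_Mapping.single 0 c) (contract a x) = contract a (contract (Poly_Mapping.single 0 c) x)"
    if "a \<in> carrier (poly_ring n)" for a x
    using contract_mult[OF that c(1)] contract_mult[OF c(1) that] by (simp add: mult.commute)
  moreover have "contract (Poly_Mapping.single 0 c) x \<in> hcomp (inv_system n) d" if "x \<in> hcomp (inv_system n) d" for x d
    using contract_degree[OF c(2) that] by simp
  ultimately show ?thesis using s
    by (auto simp: gmod_hom_def mod_hom_def contract_add_right contract_closed inv_system_hcomp_closed)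
qed

section \<open>The pullback operator on homomorphisms to the inverse system\<close>

context fmod
begin

abbreviation "homE \<equiv> gmod_hom R A (inv_system n)"

text \<open>Prescribing the values on \<open>r fr m\<close> is consistent because
  \<open>efrob\<close> is \<open>p\<close>-linear for contraction, so the assignment is balanced;
  \<open>fr_hcomp_induct\<close> controls the degrees.\<close>

lemma pull_exists:
  assumes "\<phi> \<in> homE"
  shows "\<exists>\<psi>\<in>homE. \<forall>r\<in>carrier R. \<forall>m\<in>carrier A. \<psi> (r \<odot>\<^bsub>A\<^esub> fr m) = contract r (efrob (\<phi> m))"
proof -
  note s = gmod_hom_simps[OF assms, simplified]
  obtain \<psi> where \<psi>: "\<And>x. x \<in> carrier A \<Longrightarrow> \<psi> x \<in> carrier (inv_system n)"
    "\<And>x y. x \<in> carrier A \<Longrightarrow> y \<in> carrier A \<Longrightarrow> \<psi> (x \<oplus>\<^bsub>A\<^esub> y) = \<psi> x \<oplus>\<^bsub>inv_system n\<^esub> \<psi> y"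
    "\<And>r m. r \<in> carrier R \<Longrightarrow> m \<in> carrier A \<Longrightarrow> \<psi> (r \<odot>\<^bsub>A\<^esub> fr m) = contract r (efrob (\<phi> m))"
  proof (rule fr_lift[OF abelian_group_inv_system, of "\<lambda>r m. contract r (efrob (\<phi> m))"])
    fix r s' m assume *: "r \<in> carrier R" "s' \<in> carrier R" "m \<in> carrier A"
    show "contract (s' ^ p * r) (efrob (\<phi> m)) = contract r (efrob (\<phi> (s' \<odot>\<^bsub>A\<^esub> m)))"
      using * contract_mult[of r n "s' ^ p" "efrob (\<phi> m)"] by (simp add: s efrob_contract mult.commute)
  qed (auto simp: s contract_closed efrob_closed contract_add_left contract_add_right efrob_add)
  have sm: "\<psi> (a \<odot>\<^bsub>A\<^esub> x) = contract a (\<psi> x)" if a: "a \<in> carrier R" and x: "x \<in> carrier A" for a x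
    using x
  proof (induction x rule: fr_induct)
    case (fr r c)
    have "a \<odot>\<^bsub>A\<^esub> (r \<odot>\<^bsub>A\<^esub> fr c) = (a * r) \<odot>\<^bsub>A\<^esub> fr c"
      using smult_assoc1[of a r "fr c"] a fr by (simp add: fr_closed)
    then show ?case using a fr \<psi>(3)[of "a * r" c] \<psi>(3)[of r c] by (simp add: contract_mult)
  next
    case (add x y)
    then show ?case using a \<psi>(2) by (simp add: smult_r_distr contract_add_right)
  qed
  have "\<psi> x \<in> hcomp (inv_system n) d" if "x \<in> hcomp A d" for x d
    using that
  proof (rule fr_hcomp_induct)
    fix r m i j assume *: "r \<in> rcomp R i" "m \<in> hcomp A j" "i + int p * j = d"
    have "contract r (efrob (\<phi> m)) \<in> hcomp (inv_system n) (i + int p * j)"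
      by (intro contract_degree[OF *(1)] efrob_degree s *(2))
    then show "\<psi> (r \<odot>\<^bsub>A\<^esub> fr m) \<in> hcomp (inv_system n) d"
      using * \<psi>(3)[OF rcomp_carrier[OF *(1)] hcomp_carrier[OF *(2)]] by simp
  next
    fix x y assume "x \<in> carrier A" "y \<in> carrier A" "\<psi> x \<in> hcomp (inv_system n) d" "\<psi> y \<in> hcomp (inv_system n) d"
    then show "\<psi> (x \<oplus>\<^bsub>A\<^esub> y) \<in> hcomp (inv_system n) d"
      using \<psi>(2)[of x y] by (simp add: inv_system_hcomp_closed)
  qed
  then have "\<psi> \<in> homE" using \<psi>(1,2) sm by (auto simp: gmod_hom_def mod_hom_def)
  then show ?thesis using \<psi>(3) by blast
qed

text \<open>The operator \<open>\<theta>\<^sub>E\<^sup>-\<^sup>1 \<circ> F(\<phi>) \<circ> \<theta>\<^sub>A\<close>, where \<open>E\<close> is the inverse system; its fixed points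
  are the morphisms of F-modules.\<close>

definition pull :: "('b \<Rightarrow> 'k mpol) \<Rightarrow> 'b \<Rightarrow> 'k mpol" where
  "pull \<phi> = (SOME \<psi>. \<psi> \<in> homE \<and> (\<forall>r\<in>carrier R. \<forall>m\<in>carrier A. \<psi> (r \<odot>\<^bsub>A\<^esub> fr m) = contract r (efrob (\<phi> m))))"

lemma pull_hom: "\<phi> \<in> homE \<Longrightarrow> pull \<phi> \<in> homE"
  and pull_smult_fr: "\<phi> \<in> homE \<Longrightarrow> r \<in> carrier R \<Longrightarrow> m \<in> carrier A \<Longrightarrow>
    pull \<phi> (r \<odot>\<^bsub>A\<^esub> fr m) = contract r (efrob (\<phi> m))"
proof -
  assume "\<phi> \<in> homE"
  then have "\<exists>\<psi>. \<psi> \<in> homE \<and> (\<forall>r\<in>carrier R. \<forall>m\<in>carrier A. \<psi> (r \<odot>\<^bsub>A\<^esub> fr m) = contract r (efrob (\<phi> m)))"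
    using pull_exists by blast
  from someI_ex[OF this, folded pull_def]
  show "pull \<phi> \<in> homE" "r \<in> carrier R \<Longrightarrow> m \<in> carrier A \<Longrightarrow> pull \<phi> (r \<odot>\<^bsub>A\<^esub> fr m) = contract r (efrob (\<phi> m))"
    by blast+
qed

lemma pull_fr:
  assumes "\<phi> \<in> homE" "m \<in> carrier A"
  shows "pull \<phi> (fr m) = efrob (\<phi> m)"
  using pull_smult_fr[OF assms(1) _ assms(2), of 1] smult_one[OF fr_closed[OF assms(2)]] by simp

text \<open>The operator is \<open>p\<close>-linear: a scalar passes through \<open>efrob\<close>
  and comes out as its \<open>p\<close>-th power.\<close>

lemma pull_comb:
  assumes "\<phi> \<in> homE" "\<psi> \<in> homE" "x \<in> carrier A"
  shows "pull (\<lambda>x. \<phi> x + contract (Poly_Mapping.single 0 c) (\<psi> x)) x =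
    pull \<phi> x + contract (Poly_Mapping.single 0 (c ^ p)) (pull \<psi> x)"
proof -
  let ?h = "\<lambda>x. \<phi> x + contract (Poly_Mapping.single 0 c) (\<psi> x)"
  have h: "?h \<in> homE" by (rule gmod_hom_comb[OF assms(1,2)])
  note s = gmod_hom_simps[OF pull_hom[OF assms(1)], simplified] gmod_hom_simps[OF pull_hom[OF assms(2)], simplified]
    gmod_hom_simps[OF pull_hom[OF h], simplified]
  show ?thesis
  proof (rule fr_fun_eqI[where pl = "(+)", OF _ _ _ assms(3)])
    fix x y assume "x \<in> carrier A" "y \<in> carrier A"
    then show "pull ?h (x \<oplus>\<^bsub>A\<^esub> y) = pull ?h x + pull ?h y" by (rule s)
    show "pull \<phi> (x \<oplus>\<^bsub>A\<^esub> y) + contract (Poly_Mapping.single 0 (c ^ p)) (pull \<psi> (x \<oplus>\<^bsub>A\<^esub> y)) =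
        (pull \<phi> x + contract (Poly_Mapping.single 0 (c ^ p)) (pull \<psi> x)) +
        (pull \<phi> y + contract (Poly_Mapping.single 0 (c ^ p)) (pull \<psi> y))"
      using \<open>x \<in> carrier A\<close> \<open>y \<in> carrier A\<close> by (simp add: s contract_add_right)
  next
    fix r m assume rm: "r \<in> carrier R" "m \<in> carrier A"
    have c: "Poly_Mapping.single 0 c \<in> carrier R" "Poly_Mapping.single 0 (c ^ p) \<in> carrier R" by simp_all
    have "contract r (contract (Poly_Mapping.single 0 (c ^ p)) g) = contract (Poly_Mapping.single 0 (c ^ p)) (contract r g)" for g
      using contract_mult[OF rm(1) c(2)] contract_mult[OF c(2) rm(1)] by (simp add: mult.commute)
    then show "pull ?h (r \<odot>\<^bsub>A\<^esub> fr m) =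
        pull \<phi> (r \<odot>\<^bsub>A\<^esub> fr m) + contract (Poly_Mapping.single 0 (c ^ p)) (pull \<psi> (r \<odot>\<^bsub>A\<^esub> fr m))"
      using rm pull_smult_fr[OF h rm] efrob_contract[OF c(1)]
      by (simp add: pull_smult_fr[OF assms(1)] pull_smult_fr[OF assms(2)] efrob_add contract_add_right single_zero_power)
  qed
qed

text \<open>On \<open>r fr c\<close> the pullback sees only the value at \<open>c\<close>, so one
  application gains one level of agreement.\<close>

lemma pull_iter:
  assumes S: "S \<subseteq> carrier A" and h: "\<phi> \<in> homE" "\<psi> \<in> homE"
    and eq: "\<And>x. x \<in> iter e S \<Longrightarrow> \<phi> x = \<psi> x" and x: "x \<in> iter (Suc e) S"
  shows "pull \<phi> x = pull \<psi> x"
  using S x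
proof (induction rule: iter_Suc_induct)
  case (fr r c)
  then show ?case using iter_closed[OF S, of e] eq by (auto simp: pull_smult_fr h)
next
  case (add x y)
  then have "x \<in> carrier A" "y \<in> carrier A" using iter_closed[OF S, of "Suc e"] by blast+
  then show ?case
    using gmod_hom_simps(2)[OF pull_hom[OF h(1)], of x y] gmod_hom_simps(2)[OF pull_hom[OF h(2)], of x y] add by simp
qed

lemma homE_iter_0:
  assumes S: "S \<subseteq> carrier A" and h: "\<phi> \<in> homE" "\<psi> \<in> homE"
    and eq: "\<And>x. x \<in> S \<Longrightarrow> \<phi> x = \<psi> x" and x: "x \<in> iter 0 S"
  shows "\<phi> x = \<psi> x"
proof -
  note s = gmod_hom_simps[OF h(1), simplified] gmod_hom_simps[OF h(2), simplified]
  have z: "\<phi> \<zero>\<^bsub>A\<^esub> = \<psi> \<zero>\<^bsub>A\<^esub>"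
    using s(3,7)[of 0 "\<zero>\<^bsub>A\<^esub>"] smult_l_null[of "\<zero>\<^bsub>A\<^esub>"] by simp
  have "lspan (carrier R) A S \<subseteq> {x \<in> carrier A. \<phi> x = \<psi> x}"
    using S eq by (intro lspan_least) (auto simp: s z subset_iff)
  then show ?thesis using x by (auto simp: iter_def)
qed

text \<open>By \<open>pull_iter\<close> the iterates of \<open>pull\<close> are constant on
  \<open>iter e S\<close> from the \<open>e\<close>-th on, so they have a pointwise limit on all of
  \<open>A\<close>. The last conclusion passes properties shared by all iterates on to the
  limit.\<close>

lemma fixed_point_limit:
  assumes S: "root S" "exhausts S" and h: "h \<in> homE" and fixed: "\<And>x. x \<in> iter 0 S \<Longrightarrow> pull h x = h x"
  obtains l where "l \<in> homE" "\<And>y. y \<in> carrier A \<Longrightarrow> l (fr y) = efrob (l y)"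
    "\<And>y. y \<in> carrier A \<Longrightarrow> \<exists>e. l y = (pull ^^ e) h y"
proof -
  note Sc = root_carrier[OF S(1)]
  define H where "H e = (pull ^^ e) h" for e
  have H: "H e \<in> homE" for e by (induction e) (simp_all add: H_def h pull_hom)
  note s = gmod_hom_simps[OF H, simplified]
  have step: "\<forall>x\<in>iter e S. H (Suc e) x = H e x" for e
  proof (induction e)
    case 0
    then show ?case using fixed by (simp add: H_def)
  next
    case (Suc e)
    then show ?case using pull_iter[OF Sc H[of "Suc e"] H[of e], of e] by (simp add: H_def)
  qed
  have ge: "H (e + k) x = H e x" if "x \<in> iter e S" for e k x
  proof (induction k)
    case (Suc k)
    have "x \<in> iter (e + k) S" using that iter_mono[OF S(1), of e "e + k"] by auto
    then show ?case using step[of "e + k"] Suc by simp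
  qed simp
  define l where "l y = H (LEAST e. y \<in> iter e S) y" for y
  have l: "l y = H e y" if "y \<in> iter e S" for y e
  proof -
    have "y \<in> iter (LEAST e. y \<in> iter e S) S" using that by (rule LeastI)
    moreover have "(LEAST e. y \<in> iter e S) \<le> e" using that by (rule Least_le)
    ultimately show ?thesis using ge[of y "LEAST e. y \<in> iter e S" "e - (LEAST e. y \<in> iter e S)"] by (simp add: l_def)
  qed
  have ex: "\<exists>e. y \<in> iter e S" if "y \<in> carrier A" for y using S(2) that by (simp add: exhausts_def)
  have "l (x \<oplus>\<^bsub>A\<^esub> y) = l x + l y" if xy: "x \<in> carrier A" "y \<in> carrier A" for x y
  proof -
    obtain e1 e2 where e: "x \<in> iter e1 S" "y \<in> iter e2 S" using ex xy by metis
    then have "x \<in> iter (max e1 e2) S" "y \<in> iter (max e1 e2) S"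
      using iter_mono[OF S(1), of e1 "max e1 e2"] iter_mono[OF S(1), of e2 "max e1 e2"] by auto
    with iter_add[OF Sc this] show ?thesis using s(2)[OF xy, of "max e1 e2"] by (simp only: l)
  qed
  moreover have "l (a \<odot>\<^bsub>A\<^esub> x) = contract a (l x)" if a: "a \<in> carrier R" and x: "x \<in> carrier A" for a x
  proof -
    obtain e where e: "x \<in> iter e S" using ex x by metis
    then show ?thesis using l[OF iter_smult[OF Sc a e]] l[OF e] s(3)[OF a x] by simp
  qed
  moreover have lH: "\<exists>e. l y = H e y" for y by (auto simp: l_def)
  ultimately have "l \<in> homE" using s(1,4) by (auto simp: gmod_hom_def mod_hom_def) (metis s(1), metis s(4))
  moreover have "l (fr y) = efrob (l y)" if y: "y \<in> carrier A" for y
  proof -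
    obtain e where e: "y \<in> iter e S" using ex y by metis
    then show ?thesis using l[OF fr_iter[OF Sc e]] l[OF e] pull_fr[OF H y, of e] by (simp add: H_def)
  qed
  ultimately show thesis using that[of l] lH by (simp add: H_def)
qed

end

section \<open>Extension of morphisms\<close>

context char_p
begin

text \<open>Pullback commutes with restriction along \<open>i\<close>, and \<open>g\<close> is its
  own pullback.\<close>

lemma pull_restrict:
  fixes A :: "('k mpol, 'b) F_module" and B :: "('k mpol, 'c) F_module"
  assumes A: "graded_F_module p R A" and B: "graded_F_module p R B" and i: "i \<in> F_hom p R A B"
    and g: "g \<in> gmod_hom R A (inv_system n)" "\<And>y. y \<in> carrier A \<Longrightarrow> g (froact p R A y) = efrob (g y)"
    and \<phi>: "\<phi> \<in> gmod_hom R B (inv_system n)" "\<And>x. x \<in> carrier A \<Longrightarrow> \<phi> (i x) = g x" and x: "x \<in> carrier A"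
  shows "fmod.pull p n B \<phi> (i x) = g x"
proof -
  interpret A: fmod p n ty A by unfold_locales (rule A)
  interpret B: fmod p n ty B by unfold_locales (rule B)
  have ig: "i \<in> gmod_hom R A B" and ifr: "\<And>y. y \<in> carrier A \<Longrightarrow> i (A.fr y) = B.fr (i y)"
    using i by (auto simp: F_hom_iff[OF A B])
  note s = gmod_hom_simps[OF ig] gmod_hom_simps[OF g(1), simplified]
    gmod_hom_simps[OF B.pull_hom[OF \<phi>(1)], simplified]
  show ?thesis
    by (rule A.fr_fun_eqI[where pl = "(+)", OF _ _ _ x])
       (simp_all add: s ifr A.fr_closed B.pull_smult_fr[OF \<phi>(1)] \<phi>(2) g(2))
qed

text \<open>The fixed point is sought as \<open>\<mu> + \<Sum> t_j \<nu>_j\<close>. Its equation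
  reads \<open>\<nu>_0 + \<Sum> t_j^p \<nu>_(j+1) = \<Sum> t_j \<nu>_j\<close>, and it has to hold
  at each generator and each coefficient with the same \<open>t\<close>; hence the uniform linear
  relation and the quantification over \<open>N\<close> in
  \<open>separably_closed_solution\<close>.\<close>

lemma extend_F_hom:
  fixes A :: "('k mpol, 'b) F_module" and B :: "('k mpol, 'c) F_module"
  assumes A: "graded_F_module p R A" and B: "graded_F_finite p R B" and i: "i \<in> F_hom p R A B"
    and g: "g \<in> gmod_hom R A (inv_system n)" "\<And>y. y \<in> carrier A \<Longrightarrow> g (froact p R A y) = efrob (g y)"
    and \<mu>: "\<mu> \<in> gmod_hom R B (inv_system n)" "\<And>x. x \<in> carrier A \<Longrightarrow> \<mu> (i x) = g x"
    and sc: "separably_closed TYPE('k)"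
  obtains l where "l \<in> gmod_hom R B (inv_system n)" "\<And>y. y \<in> carrier B \<Longrightarrow> l (froact p R B y) = efrob (l y)"
    "\<And>x. x \<in> carrier A \<Longrightarrow> l (i x) = g x"
proof -
  have gB: "graded_F_module p R B" using B by (simp add: graded_F_finite_def)
  interpret A: fmod p n ty A by unfold_locales (rule A)
  interpret B: fmod p n ty B by unfold_locales (rule gB)
  obtain S where S: "B.root S" "B.exhausts S" using B.F_finite_root[OF B] by auto
  note Sc = B.root_carrier[OF S(1)]
  have ic: "\<And>x. x \<in> carrier A \<Longrightarrow> i x \<in> carrier B" using i by (auto simp: F_hom_def gmod_hom_def mod_hom_def)
  let ?c = "\<lambda>c :: 'k. contract (Poly_Mapping.single 0 c)"
  \<comment> \<open>\<open>\<nu> 0\<close> is the defect \<open>pull \<mu> - \<mu>\<close>, with the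
    minus sign written as the scalar \<open>-1\<close> so that \<open>gmod_hom_comb\<close>
    applies.\<close>
  define \<nu> where "\<nu> k = (B.pull ^^ k) (\<lambda>x. B.pull \<mu> x + ?c (- 1) (\<mu> x))" for k
  have \<nu>h: "\<nu> k \<in> B.homE" for k
    by (induction k) (simp_all add: \<nu>_def B.pull_hom gmod_hom_comb \<mu>(1))
  have neg: "?c (- 1) f = - f" for f by (rule poly_mapping_eqI) simp
  have \<nu>i: "\<nu> k (i x) = 0" if "x \<in> carrier A" for k x
    using that
  proof (induction k arbitrary: x)
    case 0
    then show ?case using pull_restrict[OF A gB i g \<mu>] by (simp add: \<nu>_def neg \<mu>(2))
  next
    case (Suc k)
    have "(\<lambda>_. 0) \<in> A.homE" by (auto simp: gmod_hom_def mod_hom_def inv_system_hcomp_closed)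
    moreover have "efrob 0 = 0" by (simp add: efrob_def)
    ultimately show ?case using pull_restrict[OF A gB i _ _ \<nu>h[of k] Suc.IH Suc.prems] by (simp add: \<nu>_def)
  qed
  have "\<forall>s\<in>S. \<exists>d. s \<in> hcomp B d" using S by (simp add: B.root_def)
  then obtain dg where dg: "\<And>s. s \<in> S \<Longrightarrow> s \<in> hcomp B (dg s)" by metis
  \<comment> \<open>A generator \<open>s\<close> of degree \<open>dg s\<close> goes to polynomials
    whose monomials have degree \<open>-n - dg s\<close>, so these finitely many coefficients
    determine each \<open>\<nu> k\<close> on the root. If that number is negative, truncation only
    adds a coefficient that is always zero.\<close>
  define X where "X = (SIGMA s:S. {m. Poly_Mapping.keys m \<subseteq> {..<n} \<and> mdeg m = nat (- int n - dg s)})"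
  have "finite X" unfolding X_def using S finite_monomials by (auto simp: B.root_def)
  from eventually_dependent[OF this, of "\<lambda>k (s, m). Poly_Mapping.lookup (\<nu> k s) m"]
  obtain d a where da: "\<And>s m. (s, m) \<in> X \<Longrightarrow>
      Poly_Mapping.lookup (\<nu> d s) m = (\<Sum>k<d. a k * Poly_Mapping.lookup (\<nu> k s) m)" by fastforce
  have dep: "Poly_Mapping.lookup (\<nu> d s) m = (\<Sum>k<d. a k * Poly_Mapping.lookup (\<nu> k s) m)" if s: "s \<in> S" for s m
  proof (cases "(s, m) \<in> X")
    case False
    have "Poly_Mapping.lookup (\<nu> k s) m = 0" for k
    proof (rule ccontr)
      assume "Poly_Mapping.lookup (\<nu> k s) m \<noteq> 0"
      then have m: "m \<in> Poly_Mapping.keys (\<nu> k s)" by (simp add: in_keys_iff)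
      have "\<nu> k s \<in> hcomp (inv_system n) (dg s)" by (rule gmod_hom_simps(4)[OF \<nu>h dg[OF s]])
      then have "Poly_Mapping.keys m \<subseteq> {..<n}" "- int n - int (mdeg m) = dg s"
        using m by (auto simp: in_hcomp_inv_system in_poly_ring)
      then show False using False s by (auto simp: X_def)
    qed
    then show ?thesis by simp
  qed (rule da)
  obtain t where t: "\<And>N. N d = (\<Sum>k<d. a k * N k) \<Longrightarrow>
      N 0 + (\<Sum>k<d. t k ^ p * N (Suc k)) = (\<Sum>k<d. t k * N k)"
    using separably_closed_solution[OF p_CHAR p_pos sc, of d a] by blast
  define h where "h k x = \<mu> x + (\<Sum>j<k. ?c (t j) (\<nu> j x))" for k x
  have h0: "h 0 = \<mu>" and hS: "h (Suc k) = (\<lambda>x. h k x + ?c (t k) (\<nu> k x))" for k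
    by (auto simp: h_def add.assoc)
  have hh: "h k \<in> B.homE" for k
    by (induction k) (simp_all add: h0 hS \<mu>(1) gmod_hom_comb \<nu>h)
  \<comment> \<open>The pullback sends \<open>t_j \<nu>_j\<close> to
    \<open>t_j^p \<nu>_(j+1)\<close>, term by term.\<close>
  have ph: "B.pull (h k) x = B.pull \<mu> x + (\<Sum>j<k. ?c (t j ^ p) (\<nu> (Suc j) x))" if x: "x \<in> carrier B" for k x
  proof (induction k)
    case (Suc k)
    then show ?case using B.pull_comb[OF hh[of k] \<nu>h[of k] x, of "t k"] by (simp add: hS \<nu>_def add.assoc)
  qed (simp add: h0)
  have "B.pull (h d) x = h d x" if x: "x \<in> S" for x
  proof (rule poly_mapping_eqI)
    fix m
    have xc: "x \<in> carrier B" using x Sc by auto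
    have "Poly_Mapping.lookup (B.pull \<mu> x) m = Poly_Mapping.lookup (\<mu> x) m + Poly_Mapping.lookup (\<nu> 0 x) m"
      by (simp add: \<nu>_def lookup_add)
    then show "Poly_Mapping.lookup (B.pull (h d) x) m = Poly_Mapping.lookup (h d x) m"
      using t[of "\<lambda>k. Poly_Mapping.lookup (\<nu> k x) m", OF dep[OF x]]
      by (simp add: ph[OF xc] h_def lookup_add lookup_sum add.assoc)
  qed
  then have fixed: "B.pull (h d) x = h d x" if "x \<in> B.iter 0 S" for x
    using B.homE_iter_0[OF Sc B.pull_hom[OF hh] hh _ that] by blast
  obtain l where l: "l \<in> B.homE" "\<And>y. y \<in> carrier B \<Longrightarrow> l (B.fr y) = efrob (l y)"
    "\<And>y. y \<in> carrier B \<Longrightarrow> \<exists>e. l y = (B.pull ^^ e) (h d) y"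
    using B.fixed_point_limit[OF S hh fixed] by blast
  \<comment> \<open>At each point \<open>l\<close> is the value of one of these iterates, so it
    suffices that all of them restrict to \<open>g\<close>.\<close>
  have "(B.pull ^^ e) (h d) \<in> B.homE \<and> (\<forall>x\<in>carrier A. (B.pull ^^ e) (h d) (i x) = g x)" for e
  proof (induction e)
    case 0
    then show ?case by (simp add: hh) (simp add: h_def \<nu>i \<mu>(2))
  next
    case (Suc e)
    then show ?case using pull_restrict[OF A gB i g, of "(B.pull ^^ e) (h d)"] by (simp add: B.pull_hom)
  qed
  then have "l (i x) = g x" if "x \<in> carrier A" for x using l(3)[OF ic[OF that]] that by auto
  with l(1,2) show thesis by (rule that)
qed

text \<open>The problem is moved along \<open>chi\<close> to the inverse system, solved there in two
  stages (a graded extension, then a correction to a morphism), and the solution is moved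
  back.\<close>

lemma top_injective:
  fixes A :: "('k mpol, 'b) F_module" and B :: "('k mpol, 'c) F_module"
  assumes A: "graded_F_finite p R A" and B: "graded_F_finite p R B"
    and i: "i \<in> F_finite_mono p R A B" and g: "g \<in> F_hom p R A E"
    and sc: "separably_closed TYPE('k)"
  shows "\<exists>h\<in>F_hom p R B E. \<forall>x\<in>carrier A. h (i x) = g x"
proof -
  have gA: "graded_F_module p R A" and gB: "graded_F_module p R B"
    using A B by (auto simp: graded_F_finite_def)
  interpret A: fmod p n ty A by unfold_locales (rule gA)
  interpret B: fmod p n ty B by unfold_locales (rule gB)
  interpret E: fmod p n ty E by unfold_locales (rule top_F_module)
  have iF: "i \<in> F_hom p R A B" using i by (simp add: F_finite_mono_def)
  have ig: "i \<in> gmod_hom R A B" and ifr: "\<And>y. y \<in> carrier A \<Longrightarrow> i (A.fr y) = B.fr (i y)"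
    using iF by (auto simp: F_hom_iff[OF gA gB])
  have gg: "g \<in> gmod_hom R A E" and gfr: "\<And>y. y \<in> carrier A \<Longrightarrow> g (A.fr y) = E.fr (g y)"
    using g by (auto simp: F_hom_iff[OF gA top_F_module])
  note si = gmod_hom_simps[OF ig] and sg = gmod_hom_simps[OF gg, simplified]
  define \<phi> where "\<phi> x = chi n (g x)" for x
  have \<phi>: "\<phi> \<in> A.homE" using sg chi_bij[where 'k = 'k and n = n]
    by (auto simp: gmod_hom_def mod_hom_def \<phi>_def chi_hom bij_betw_def chi_hcomp)
  have \<phi>fr: "\<phi> (A.fr y) = efrob (\<phi> y)" if "y \<in> carrier A" for y
    using that sg(1) by (simp add: \<phi>_def gfr chi_froact)
  note s\<phi> = gmod_hom_simps[OF \<phi>, simplified]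
  \<comment> \<open>Although \<open>i\<close> may fail to be injective, \<open>\<phi>\<close>
    factors through its image: \<open>x - y\<close> lies in the kernel, where
    \<open>mono_kernel\<close> applies.\<close>
  have wd: "\<phi> x = \<phi> y" if xy: "x \<in> carrier A" "y \<in> carrier A" "i x = i y" for x y
  proof -
    let ?s = "Poly_Mapping.single 0 (- 1) :: 'k mpol"
    let ?z = "x \<oplus>\<^bsub>A\<^esub> ?s \<odot>\<^bsub>A\<^esub> y"
    have s: "?s \<in> carrier R" by simp
    note sB = scalar_smult[OF B.graded_module_axioms si(1)[OF xy(2)]]
    have "i ?z = i y \<oplus>\<^bsub>B\<^esub> ?s \<odot>\<^bsub>B\<^esub> i y" using xy s by (simp add: si)
    also have "\<dots> = \<zero>\<^bsub>B\<^esub>" using sB(2)[of 1 "- 1"] sB(3,4) by simp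
    finally have "\<phi> ?z = 0" using xy s by (intro mono_kernel[OF A B i \<phi> \<phi>fr]) auto
    then have "\<phi> x + contract ?s (\<phi> y) = 0" using xy s by (simp add: s\<phi>)
    moreover have "contract ?s (\<phi> y) = - \<phi> y" by (rule poly_mapping_eqI) simp
    ultimately show ?thesis by simp
  qed
  define D where "D = i ` carrier A"
  define g' where "g' y = \<phi> (SOME x. x \<in> carrier A \<and> i x = y)" for y
  have g': "g' (i x) = \<phi> x" if "x \<in> carrier A" for x
    using someI[of "\<lambda>x'. x' \<in> carrier A \<and> i x' = i x" x] that unfolding g'_def by (intro wd) auto
  have hp: "B.hpart d (i x) = i (A.hpart d x)" if "x \<in> carrier A" for x d
    using gmod_hom_hpart[OF A.graded_module_axioms B.graded_module_axioms ig that] by simp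
  have Dc: "D \<subseteq> carrier B" using si(1) by (auto simp: D_def)
  have Dz: "\<zero>\<^bsub>B\<^esub> \<in> D"
  proof -
    have "i (0 \<odot>\<^bsub>A\<^esub> \<zero>\<^bsub>A\<^esub>) = 0 \<odot>\<^bsub>B\<^esub> i \<zero>\<^bsub>A\<^esub>" by (rule si(3)) auto
    also have "\<dots> = \<zero>\<^bsub>B\<^esub>" using B.smult_l_null[OF si(1), of "\<zero>\<^bsub>A\<^esub>"] by simp
    finally show ?thesis unfolding D_def by (metis A.M.zero_closed A.smult_closed image_eqI poly_ring_closed(1))
  qed
  have Da: "x \<oplus>\<^bsub>B\<^esub> y \<in> D" if "x \<in> D" "y \<in> D" for x y
    using that si(2)[symmetric] by (auto simp: D_def)
  have Ds: "a \<odot>\<^bsub>B\<^esub> x \<in> D" if "a \<in> carrier R" "x \<in> D" for a x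
    using that si(3)[symmetric] by (auto simp: D_def)
  have Dh: "B.hpart d x \<in> D" if "x \<in> D" for x d
    using that A.hpart_props(1) by (auto simp: D_def hp)
  have g'd: "g' y \<in> hcomp (inv_system n) d" if y: "y \<in> hcomp B d" "y \<in> D" for y d
  proof -
    obtain x where x: "x \<in> carrier A" "y = i x" using y(2) by (auto simp: D_def)
    \<comment> \<open>A homogeneous element of the image has a homogeneous preimage, namely the part
      of any preimage in that degree.\<close>
    have "y = i (A.hpart d x)" using hp[OF x(1), of d] B.hpart_homog[OF y(1), of d] x(2) by simp
    then show ?thesis using g'[of "A.hpart d x"] s\<phi>(4) A.hpart_props(1)[OF x(1), of d] A.hcomp_carrier by metis
  qed
  have "g' \<in> gmod_hom R (subgmodule B D) (inv_system n)"
  proof -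
    have "g' (i x \<oplus>\<^bsub>B\<^esub> i y) = g' (i x) + g' (i y)" if "x \<in> carrier A" "y \<in> carrier A" for x y
      using g'[of "x \<oplus>\<^bsub>A\<^esub> y"] that by (simp add: si g' s\<phi>)
    moreover have "g' (a \<odot>\<^bsub>B\<^esub> i x) = contract a (g' (i x))" if "a \<in> carrier R" "x \<in> carrier A" for a x
      using g'[of "a \<odot>\<^bsub>A\<^esub> x"] that by (simp add: si g' s\<phi>)
    moreover have "g' ` hcomp (subgmodule B D) d \<subseteq> hcomp (inv_system n) d" for d
      using g'd by auto
    ultimately show ?thesis
      unfolding gmod_hom_def mod_hom_def by (auto simp: D_def g' s\<phi> simp del: subgmodule_simps(2))
  qed
  from extend_hom[OF B.graded_module_axioms Dc Dz Da Ds Dh this]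
  obtain \<mu> where \<mu>: "\<mu> \<in> B.homE" "\<And>x. x \<in> D \<Longrightarrow> \<mu> x = g' x" by blast
  have \<mu>i: "\<mu> (i x) = \<phi> x" if "x \<in> carrier A" for x
    using \<mu>(2)[of "i x"] that by (simp add: D_def g')
  obtain l where l: "l \<in> B.homE" "\<And>y. y \<in> carrier B \<Longrightarrow> l (B.fr y) = efrob (l y)"
    "\<And>x. x \<in> carrier A \<Longrightarrow> l (i x) = \<phi> x"
    using extend_F_hom[OF gA B iF \<phi> \<phi>fr \<mu>(1) \<mu>i sc] by blast
  note sl = gmod_hom_simps[OF l(1), simplified]
  define c where "c = inv_into (carrier H) (chi n :: _ \<Rightarrow> 'k mpol)"
  note bij = chi_bij[where 'k = 'k and n = n, simplified]
  have c: "c v \<in> carrier H" "chi n (c v) = v" if "v \<in> carrier R" for v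
    using bij that by (auto simp: c_def bij_betw_def intro: inv_into_into f_inv_into_f)
  have ceq: "c v = X" if "X \<in> carrier H" "chi n X = v" for v X
    using bij that by (auto simp: c_def bij_betw_def)
  define k where "k x = c (l x)" for x
  have "k \<in> gmod_hom R B E"
  proof -
    have "k (x \<oplus>\<^bsub>B\<^esub> y) = k x \<oplus>\<^bsub>H\<^esub> k y" if "x \<in> carrier B" "y \<in> carrier B" for x y
      unfolding k_def by (rule ceq) (use that in \<open>simp_all add: sl c chi_hom\<close>)
    moreover have "k (a \<odot>\<^bsub>B\<^esub> x) = a \<odot>\<^bsub>H\<^esub> k x" if "a \<in> carrier R" "x \<in> carrier B" for a x
      unfolding k_def by (rule ceq) (use that in \<open>simp_all add: sl c chi_hom\<close>)
    moreover have "k x \<in> hcomp H d" if "x \<in> hcomp B d" for x d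
      using that sl(4)[OF that] sl(1)[OF B.hcomp_carrier[OF that]] by (simp add: chi_hcomp k_def c)
    ultimately show ?thesis by (auto simp: gmod_hom_def mod_hom_def k_def c sl)
  qed
  moreover have "k (B.fr y) = E.fr (k y)" if "y \<in> carrier B" for y
  proof -
    have ky: "k y \<in> carrier H" using that by (simp add: k_def c sl)
    show ?thesis unfolding k_def[of "B.fr y"]
      by (rule ceq) (use that ky E.fr_closed[of "k y"] in \<open>simp_all add: l(2) chi_froact\<close>,
        simp add: k_def c sl)
  qed
  ultimately have "k \<in> F_hom p R B E" by (simp add: F_hom_iff[OF gB top_F_module])
  moreover have "k (i x) = g x" if "x \<in> carrier A" for x
    unfolding k_def by (rule ceq) (use that sg(1) in \<open>simp_all add: l(3) \<phi>_def\<close>)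
  ultimately show ?thesis by blast
qed

end

theorem corollary2p10:
  fixes n p :: nat
  assumes "p = CHAR('k::field)" and "p > 0"
    and "separably_closed TYPE('k)"
  shows "injective_graded_F_finite p (poly_ring n :: 'k mpol graded_ring) TYPE('a) TYPE('b)
           (top_local_cohomology p n)"
proof -
  interpret char_p p n "TYPE('k)" by unfold_locales (use assms in auto)
  show ?thesis
    unfolding injective_graded_F_finite_def using top_F_finite top_injective[OF _ _ _ _ assms(3)] by blast
qed

end
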